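(* Let $(G,H,\theta,B)<(G^{\mathbb C},U,\tau,B_{\mathbb C})$ be a real form of a complex reductive Lie group, defined by the antiholomorphic involution $\sigma$. Then: 1. The tuple $(U_\sigma,\theta,B)$ defines a reductive structure on $(G^{\mathbb C})_\sigma$. 2. One has $(G^{\mathbb C})_\sigma=N_{G^{\mathbb C}}(G)$ when $Z_{G^{\mathbb C}}(G)=Z(G^{\mathbb C})$. This is the case, for example, of semisimple groups. 3. The Lie algebra $\mathfrak g_\sigma\subset\mathfrak g^{\mathbb C}$ of $(G^{\mathbb C})_\sigma$ is a real form of $\mathfrak g^{\mathbb C}\oplus\mathfrak z(\mathfrak g^{\mathbb C})$.
   Context: A real reductive group is a tuple $(G,H,\theta,B)$: (1) $G$ is a real Lie group with reductive Lie algebra $\mathfrak g$; (2) $H<G$ is maximal compact; (3) $\theta$ is an involution of $\mathfrak g$ with $+1$-eigenspace $\mathfrak h=\mathrm{Lie}(H)$ and $-1$-eigenspace $\mathfrak m$; (4) $B$ is a $\theta$- and $\mathrm{Ad}(G)$-invariant non-degenerate bilinear form on $\mathfrak g$ with $\mathfrak h\perp_B\mathfrak m$, negative definite on $\mathfrak h$, positive definite on $\mathfrak m$; (5) multiplication $H\times\exp(\mathfrak m)\to G$ is a diffeomorphism. The triple $(H,\theta,B)$ is called Cartan data, and is said to define a reductive structure on $G$. A complex reductive group $(G^{\mathbb C},U,\tau,B_{\mathbb C})$ is a complex Lie group with such a structure on its underlying real group. A real form $(G,H,\theta,B)$ of it is a reductive subgroup (Cartan data obtained by intersection and restriction) such that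 $G=(G^{\mathbb C})^\sigma$ for an antiholomorphic involution $\sigma$ commuting with $\tau$; $\theta$ also denotes the holomorphic involution $\sigma\tau$. For an involution $\iota$ of a group $K$: $K_\iota=\{g\in K:g^{-1}g^\iota\in Z(K)\}$, $g^\iota=\iota(g)$. This defines $(G^{\mathbb C})_\sigma$ and $U_\sigma$. $N_{G^{\mathbb C}}(G)$ and $Z_{G^{\mathbb C}}(G)$ are the normalizer and centralizer of $G$ in $G^{\mathbb C}$. In item 3, a real form of a complex Lie algebra is a real Lie algebra whose complexification is isomorphic to it.
   Formalization: Item 3 is false for O(2,C): it is proved for connected G^C, and for all G^C with Lie(Z(G^C)) in place of z(g^C). In item 2 semisimple groups are taken connected (SL_2(C)×S_3 fails). In item 1 θ, B on g_σ are the restrictions of τ, B_C. *)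

theory Defs
  imports "HOL-Analysis.Analysis" "HOL-Algebra.Group_Action"
begin

section \<open>Smooth manifolds and smooth maps\<close>

text \<open>
  Manifolds are modelled on a linear subspace of a Euclidean type rather than on the whole type,
  so that dimension 0 (finite and countable discrete groups) is included. Derivatives are taken
  within the given set; smoothness is only ever used on sets that are relatively open in a subspace
  \<open>E\<close>, where the derivative is determined on \<open>E\<close>.
\<close>

primrec Ck_on :: "nat \<Rightarrow> 'a::euclidean_space set \<Rightarrow> ('a \<Rightarrow> 'b::euclidean_space) \<Rightarrow> bool" where
  "Ck_on 0 S f \<longleftrightarrow> continuous_on S f"
| "Ck_on (Suc k) S f \<longleftrightarrow>
     (\<exists>D. (\<forall>x\<in>S. (f has_derivative D x) (at x within S)) \<and> (\<forall>v. Ck_on k S (\<lambda>x. D x v)))"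

definition smooth_on :: "'a::euclidean_space set \<Rightarrow> ('a \<Rightarrow> 'b::euclidean_space) \<Rightarrow> bool" where
  "smooth_on S f \<longleftrightarrow> (\<forall>k. Ck_on k S f)"

record ('p, 'e) manifold =
  model :: "'e set"
  atlas :: "('p set \<times> ('p \<Rightarrow> 'e)) set"

definition points :: "('p, 'e) manifold \<Rightarrow> 'p set" where
  "points M = (\<Union>(U, \<phi>)\<in>atlas M. U)"

definition mtop :: "('p, 'e::euclidean_space) manifold \<Rightarrow> 'p topology" where
  "mtop M = topology (\<lambda>W. W \<subseteq> points M \<and>
     (\<forall>(U, \<phi>)\<in>atlas M. openin (top_of_set (model M)) (\<phi> ` (W \<inter> U))))"

definition smooth_atlas :: "'e::euclidean_space set \<Rightarrow> ('p set \<times> ('p \<Rightarrow> 'e)) set \<Rightarrow> bool" where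
  "smooth_atlas E A \<longleftrightarrow>
     (\<forall>(U, \<phi>)\<in>A. inj_on \<phi> U \<and> openin (top_of_set E) (\<phi> ` U)) \<and>
     (\<forall>(U, \<phi>)\<in>A. \<forall>(V, \<psi>)\<in>A. openin (top_of_set E) (\<phi> ` (U \<inter> V)) \<and>
        smooth_on (\<phi> ` (U \<inter> V)) (\<psi> \<circ> inv_into U \<phi>))"

lemma openin_mtop:
  assumes "smooth_atlas (model M) (atlas M)"
  shows "openin (mtop M) W \<longleftrightarrow> W \<subseteq> points M \<and>
     (\<forall>(U, \<phi>)\<in>atlas M. openin (top_of_set (model M)) (\<phi> ` (W \<inter> U)))"
proof -
  let ?P = "\<lambda>W. W \<subseteq> points M \<and>
     (\<forall>(U, \<phi>)\<in>atlas M. openin (top_of_set (model M)) (\<phi> ` (W \<inter> U)))"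
  have "istopology ?P"
    unfolding istopology_def
  proof (intro conjI allI impI)
    fix S T assume S: "?P S" and T: "?P T"
    show "S \<inter> T \<subseteq> points M" using S by blast
    show "\<forall>(U, \<phi>)\<in>atlas M. openin (top_of_set (model M)) (\<phi> ` (S \<inter> T \<inter> U))"
    proof clarify
      fix U \<phi> assume c: "(U, \<phi>) \<in> atlas M"
      then have "inj_on \<phi> U" using assms unfolding smooth_atlas_def by blast
      then have "\<phi> ` (S \<inter> T \<inter> U) = \<phi> ` (S \<inter> U) \<inter> \<phi> ` (T \<inter> U)"
        by (auto simp: inj_on_def)
      moreover have "openin (top_of_set (model M)) (\<phi> ` (S \<inter> U))"
        "openin (top_of_set (model M)) (\<phi> ` (T \<inter> U))"
        using S T c by blast+
      ultimately show "openin (top_of_set (model M)) (\<phi> ` (S \<inter> T \<inter> U))"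
        by (metis openin_Int)
    qed
  next
    fix K assume K: "\<forall>S\<in>K. ?P S"
    show "\<Union>K \<subseteq> points M" using K by blast
    show "\<forall>(U, \<phi>)\<in>atlas M. openin (top_of_set (model M)) (\<phi> ` (\<Union>K \<inter> U))"
    proof clarify
      fix U \<phi> assume c: "(U, \<phi>) \<in> atlas M"
      have "\<phi> ` (\<Union>K \<inter> U) = \<Union>((\<lambda>S. \<phi> ` (S \<inter> U)) ` K)" by blast
      moreover have "openin (top_of_set (model M)) (\<Union>((\<lambda>S. \<phi> ` (S \<inter> U)) ` K))"
        using K c by (intro openin_Union) blast
      ultimately show "openin (top_of_set (model M)) (\<phi> ` (\<Union>K \<inter> U))" by simp
    qed
  qed
  then show ?thesis unfolding mtop_def by (simp add: topology_inverse')
qed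

definition smooth_manifold :: "('p, 'e::euclidean_space) manifold \<Rightarrow> bool" where
  "smooth_manifold M \<longleftrightarrow> subspace (model M) \<and> smooth_atlas (model M) (atlas M) \<and>
     Hausdorff_space (mtop M) \<and> second_countable (mtop M)"

definition prod_mfd ::
  "('p, 'e) manifold \<Rightarrow> ('q, 'f) manifold \<Rightarrow> ('p \<times> 'q, 'e \<times> 'f) manifold" where
  "prod_mfd M N = \<lparr>model = model M \<times> model N,
     atlas = {(U \<times> V, map_prod \<phi> \<psi>) | U \<phi> V \<psi>. (U, \<phi>) \<in> atlas M \<and> (V, \<psi>) \<in> atlas N}\<rparr>"

definition vec_mfd :: "'e set \<Rightarrow> ('e, 'e) manifold" where
  "vec_mfd E = \<lparr>model = E, atlas = {(E, \<lambda>x. x)}\<rparr>"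

definition open_submfd :: "('p, 'e) manifold \<Rightarrow> 'p set \<Rightarrow> ('p, 'e) manifold" where
  "open_submfd M W = \<lparr>model = model M, atlas = {(U \<inter> W, \<phi>) | U \<phi>. (U, \<phi>) \<in> atlas M}\<rparr>"

definition smooth_map ::
  "('p, 'e::euclidean_space) manifold \<Rightarrow> ('q, 'f::euclidean_space) manifold \<Rightarrow> ('p \<Rightarrow> 'q) \<Rightarrow> bool" where
  "smooth_map M N f \<longleftrightarrow> f ` points M \<subseteq> points N \<and>
     (\<forall>(U, \<phi>)\<in>atlas M. \<forall>(V, \<psi>)\<in>atlas N.
        openin (top_of_set (model M)) (\<phi> ` (U \<inter> f -` V)) \<and>
        smooth_on (\<phi> ` (U \<inter> f -` V)) (\<psi> \<circ> f \<circ> inv_into U \<phi>))"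

text \<open>Smoothness on a subset (e.g. an embedded submanifold): local smooth extendability.\<close>

definition smooth_map_on ::
  "('p, 'e::euclidean_space) manifold \<Rightarrow> 'p set \<Rightarrow> ('q, 'f::euclidean_space) manifold
     \<Rightarrow> ('p \<Rightarrow> 'q) \<Rightarrow> bool" where
  "smooth_map_on M S N f \<longleftrightarrow> S \<subseteq> points M \<and>
     (\<forall>p\<in>S. \<exists>W g. openin (mtop M) W \<and> p \<in> W \<and> smooth_map (open_submfd M W) N g \<and>
        (\<forall>x\<in>S \<inter> W. g x = f x))"

text \<open>Slice charts; the charts are taken from the maximal atlas.\<close>

definition embedded_submanifold :: "('p, 'e::euclidean_space) manifold \<Rightarrow> 'p set \<Rightarrow> bool" where
  "embedded_submanifold M S \<longleftrightarrow> S \<subseteq> points M \<and>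
     (\<forall>p\<in>S. \<exists>W \<phi> V. p \<in> W \<and> W \<subseteq> points M \<and> smooth_atlas (model M) (insert (W, \<phi>) (atlas M)) \<and>
        subspace V \<and> V \<subseteq> model M \<and> \<phi> ` (W \<inter> S) = \<phi> ` W \<inter> V)"

text \<open>
  \<open>J\<close> and \<open>K\<close> are the complex structures (multiplication by the imaginary unit) on the model spaces
  of \<open>M\<close> and \<open>N\<close>. Replacing \<open>K\<close> by \<open>- K\<close> gives the antiholomorphic maps.
\<close>

definition holomorphic_map ::
  "('e \<Rightarrow> 'e) \<Rightarrow> ('f \<Rightarrow> 'f) \<Rightarrow> ('p, 'e::euclidean_space) manifold
     \<Rightarrow> ('q, 'f::euclidean_space) manifold \<Rightarrow> ('p \<Rightarrow> 'q) \<Rightarrow> bool" where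
  "holomorphic_map J K M N f \<longleftrightarrow> smooth_map M N f \<and>
     (\<forall>(U, \<phi>)\<in>atlas M. \<forall>(V, \<psi>)\<in>atlas N. \<forall>x\<in>\<phi> ` (U \<inter> f -` V). \<exists>D.
        ((\<psi> \<circ> f \<circ> inv_into U \<phi>) has_derivative D) (at x within \<phi> ` (U \<inter> f -` V)) \<and>
        (\<forall>v\<in>model M. D (J v) = K (D v)))"

section \<open>Lie algebras\<close>

record 'v lie_alg =
  lspace :: "'v set"
  lbracket :: "'v \<Rightarrow> 'v \<Rightarrow> 'v"

record 'v clie_alg = "'v lie_alg" +
  limul :: "'v \<Rightarrow> 'v"

definition lie_algebra :: "('v::euclidean_space, 'b) lie_alg_scheme \<Rightarrow> bool" where
  "lie_algebra A \<longleftrightarrow> subspace (lspace A) \<and>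
     (\<forall>x\<in>lspace A. \<forall>y\<in>lspace A. lbracket A x y \<in> lspace A) \<and>
     (\<forall>x\<in>lspace A. \<forall>y\<in>lspace A. \<forall>z\<in>lspace A.
        lbracket A (x + y) z = lbracket A x z + lbracket A y z \<and>
        lbracket A z (x + y) = lbracket A z x + lbracket A z y) \<and>
     (\<forall>x\<in>lspace A. \<forall>y\<in>lspace A. \<forall>c::real.
        lbracket A (c *\<^sub>R x) y = c *\<^sub>R lbracket A x y \<and>
        lbracket A x (c *\<^sub>R y) = c *\<^sub>R lbracket A x y) \<and>
     (\<forall>x\<in>lspace A. lbracket A x x = 0) \<and>
     (\<forall>x\<in>lspace A. \<forall>y\<in>lspace A. \<forall>z\<in>lspace A.
        lbracket A x (lbracket A y z) + lbracket A y (lbracket A z x)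
          + lbracket A z (lbracket A x y) = 0)"

definition lie_ideal :: "('v::euclidean_space, 'b) lie_alg_scheme \<Rightarrow> 'v set \<Rightarrow> bool" where
  "lie_ideal A I \<longleftrightarrow> subspace I \<and> I \<subseteq> lspace A \<and> (\<forall>x\<in>lspace A. \<forall>y\<in>I. lbracket A x y \<in> I)"

definition lie_center :: "('v::euclidean_space, 'b) lie_alg_scheme \<Rightarrow> 'v set" where
  "lie_center A = {x \<in> lspace A. \<forall>y\<in>lspace A. lbracket A x y = 0}"

text \<open>Reductive: every ideal has a complementary ideal.\<close>

definition reductive_lie_algebra :: "('v::euclidean_space, 'b) lie_alg_scheme \<Rightarrow> bool" where
  "reductive_lie_algebra A \<longleftrightarrow> lie_algebra A \<and>
     (\<forall>I. lie_ideal A I \<longrightarrow>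
        (\<exists>K. lie_ideal A K \<and> I \<inter> K = {0} \<and> {x + y | x y. x \<in> I \<and> y \<in> K} = lspace A))"

definition derived_subspace ::
  "('v::euclidean_space, 'b) lie_alg_scheme \<Rightarrow> 'v set \<Rightarrow> 'v set" where
  "derived_subspace A V = span {lbracket A x y | x y. x \<in> V \<and> y \<in> V}"

definition solvable_ideal :: "('v::euclidean_space, 'b) lie_alg_scheme \<Rightarrow> 'v set \<Rightarrow> bool" where
  "solvable_ideal A I \<longleftrightarrow> lie_ideal A I \<and> (\<exists>n. (derived_subspace A ^^ n) I = {0})"

definition semisimple_lie_algebra :: "('v::euclidean_space, 'b) lie_alg_scheme \<Rightarrow> bool" where
  "semisimple_lie_algebra A \<longleftrightarrow> lie_algebra A \<and> (\<forall>I. solvable_ideal A I \<longrightarrow> I = {0})"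

text \<open>The pair \<open>(x, y)\<close> stands for \<open>x + i y\<close>.\<close>

definition complexification :: "'v::euclidean_space lie_alg \<Rightarrow> ('v \<times> 'v) clie_alg" where
  "complexification A = \<lparr>lspace = lspace A \<times> lspace A,
     lbracket = (\<lambda>(x, y) (x', y'). (lbracket A x x' - lbracket A y y', lbracket A x y' + lbracket A y x')),
     limul = (\<lambda>(x, y). (- y, x))\<rparr>"

definition clie_dsum :: "'v clie_alg \<Rightarrow> 'w clie_alg \<Rightarrow> ('v \<times> 'w) clie_alg" where
  "clie_dsum A A' = \<lparr>lspace = lspace A \<times> lspace A',
     lbracket = (\<lambda>(x, y) (x', y'). (lbracket A x x', lbracket A' y y')),
     limul = map_prod (limul A) (limul A')\<rparr>"

definition clie_iso ::
  "('v::euclidean_space \<Rightarrow> 'w::euclidean_space) \<Rightarrow> 'v clie_alg \<Rightarrow> 'w clie_alg \<Rightarrow> bool" where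
  "clie_iso f A A' \<longleftrightarrow> bij_betw f (lspace A) (lspace A') \<and>
     (\<forall>x\<in>lspace A. \<forall>y\<in>lspace A. f (x + y) = f x + f y) \<and>
     (\<forall>x\<in>lspace A. \<forall>c::real. f (c *\<^sub>R x) = c *\<^sub>R f x) \<and>
     (\<forall>x\<in>lspace A. f (limul A x) = limul A' (f x)) \<and>
     (\<forall>x\<in>lspace A. \<forall>y\<in>lspace A. f (lbracket A x y) = lbracket A' (f x) (f y))"

definition real_form_lie_alg ::
  "'v::euclidean_space lie_alg \<Rightarrow> 'w::euclidean_space clie_alg \<Rightarrow> bool" where
  "real_form_lie_alg A C \<longleftrightarrow> lie_algebra A \<and> (\<exists>f. clie_iso f (complexification A) C)"

section \<open>Lie groups\<close>

record ('g, 'e) lie_group_data = "'g monoid" +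
  mfd :: "('g, 'e) manifold"

definition lie_group :: "('g, 'e::euclidean_space) lie_group_data \<Rightarrow> bool" where
  "lie_group L \<longleftrightarrow> group L \<and> smooth_manifold (mfd L) \<and> points (mfd L) = carrier L \<and>
     smooth_map (prod_mfd (mfd L) (mfd L)) (mfd L) (\<lambda>(g, h). g \<otimes>\<^bsub>L\<^esub> h) \<and>
     smooth_map (mfd L) (mfd L) (\<lambda>g. inv\<^bsub>L\<^esub> g)"

text \<open>
  The tangent space at the identity is identified with the model space by means of one fixed chart
  around the identity. A curve through the identity has its velocity read off in that chart.
\<close>

definition id_chart :: "('g, 'e) lie_group_data \<Rightarrow> 'g set \<times> ('g \<Rightarrow> 'e)" where
  "id_chart L = (SOME c. c \<in> atlas (mfd L) \<and> \<one>\<^bsub>L\<^esub> \<in> fst c)"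

definition velocity ::
  "('g, 'e::euclidean_space) lie_group_data \<Rightarrow> (real \<Rightarrow> 'g) \<Rightarrow> 'e" where
  "velocity L c = vector_derivative (\<lambda>t. snd (id_chart L) (c t)) (at 0)"

definition chart_line ::
  "('g, 'e::euclidean_space) lie_group_data \<Rightarrow> 'e \<Rightarrow> real \<Rightarrow> 'g" where
  "chart_line L X t = (let (U, \<phi>) = id_chart L in inv_into U \<phi> (\<phi> (\<one>\<^bsub>L\<^esub>) + t *\<^sub>R X))"

definition smooth_curve ::
  "('g, 'e::euclidean_space) lie_group_data \<Rightarrow> (real \<Rightarrow> 'g) \<Rightarrow> bool" where
  "smooth_curve L c \<longleftrightarrow> smooth_map (vec_mfd (UNIV::real set)) (mfd L) c"

text \<open>
  For a Lie subgroup \<open>S\<close> of \<open>L\<close> this is the tangent space of \<open>S\<close> at the identity,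
  as a subspace of the tangent space of \<open>L\<close>, which is \<open>model (mfd L)\<close>.
\<close>

definition Lie :: "('g, 'e::euclidean_space) lie_group_data \<Rightarrow> 'g set \<Rightarrow> 'e set" where
  "Lie L S = {velocity L c | c. smooth_curve L c \<and> c 0 = \<one>\<^bsub>L\<^esub> \<and> range c \<subseteq> S}"

text \<open>The differential at the identity of a map fixing the identity.\<close>

definition tangent_map ::
  "('g, 'e::euclidean_space) lie_group_data \<Rightarrow> ('g \<Rightarrow> 'g) \<Rightarrow> 'e \<Rightarrow> 'e" where
  "tangent_map L f X = velocity L (\<lambda>t. f (chart_line L X t))"

definition Ad :: "('g, 'e::euclidean_space) lie_group_data \<Rightarrow> 'g \<Rightarrow> 'e \<Rightarrow> 'e" where
  "Ad L g = tangent_map L (\<lambda>h. g \<otimes>\<^bsub>L\<^esub> h \<otimes>\<^bsub>L\<^esub> inv\<^bsub>L\<^esub> g)"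

text \<open>The bracket is the differential of the adjoint representation.\<close>

definition lie_bracket ::
  "('g, 'e::euclidean_space) lie_group_data \<Rightarrow> 'e \<Rightarrow> 'e \<Rightarrow> 'e" where
  "lie_bracket L X Y = vector_derivative (\<lambda>t. Ad L (chart_line L X t) Y) (at 0)"

definition lie_exp :: "('g, 'e::euclidean_space) lie_group_data \<Rightarrow> 'e \<Rightarrow> 'g" where
  "lie_exp L X = (THE c. smooth_curve L c \<and> (\<forall>s t. c (s + t) = c s \<otimes>\<^bsub>L\<^esub> c t) \<and> velocity L c = X) 1"

definition lie_alg_of ::
  "('g, 'e::euclidean_space) lie_group_data \<Rightarrow> 'g set \<Rightarrow> 'e lie_alg" where
  "lie_alg_of L S = \<lparr>lspace = Lie L S, lbracket = lie_bracket L\<rparr>"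

definition lie_subgroup :: "('g, 'e::euclidean_space) lie_group_data \<Rightarrow> 'g set \<Rightarrow> bool" where
  "lie_subgroup L G \<longleftrightarrow> subgroup G L \<and> embedded_submanifold (mfd L) G"

definition imag :: "complex ^ 'n \<Rightarrow> complex ^ 'n" where
  "imag v = \<i> *s v"

definition complex_lie_group :: "('g, complex ^ 'n) lie_group_data \<Rightarrow> bool" where
  "complex_lie_group L \<longleftrightarrow> lie_group L \<and> (\<forall>v\<in>model (mfd L). imag v \<in> model (mfd L)) \<and>
     \<comment> \<open>holomorphy of the identity map says that the transition maps are holomorphic\<close>
     holomorphic_map imag imag (mfd L) (mfd L) (\<lambda>g. g) \<and>
     holomorphic_map (map_prod imag imag) imag
       (prod_mfd (mfd L) (mfd L)) (mfd L) (\<lambda>(g, h). g \<otimes>\<^bsub>L\<^esub> h) \<and>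
     holomorphic_map imag imag (mfd L) (mfd L) (\<lambda>g. inv\<^bsub>L\<^esub> g)"

definition clie_alg_of :: "('g, complex ^ 'n) lie_group_data \<Rightarrow> 'g set \<Rightarrow> (complex ^ 'n) clie_alg" where
  "clie_alg_of L S = \<lparr>lspace = Lie L S, lbracket = lie_bracket L, limul = imag\<rparr>"

section \<open>Reductive groups\<close>

definition maximal_compact ::
  "('g, 'e::euclidean_space) lie_group_data \<Rightarrow> 'g set \<Rightarrow> 'g set \<Rightarrow> bool" where
  "maximal_compact L G H \<longleftrightarrow> subgroup H L \<and> H \<subseteq> G \<and> compactin (mtop (mfd L)) H \<and>
     (\<forall>K. subgroup K L \<and> K \<subseteq> G \<and> compactin (mtop (mfd L)) K \<and> H \<subseteq> K \<longrightarrow> K = H)"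

definition lie_involution :: "('v::euclidean_space, 'b) lie_alg_scheme \<Rightarrow> ('v \<Rightarrow> 'v) \<Rightarrow> bool" where
  "lie_involution A \<theta> \<longleftrightarrow>
     (\<forall>x\<in>lspace A. \<theta> x \<in> lspace A \<and> \<theta> (\<theta> x) = x) \<and>
     (\<forall>x\<in>lspace A. \<forall>y\<in>lspace A. \<theta> (x + y) = \<theta> x + \<theta> y) \<and>
     (\<forall>x\<in>lspace A. \<forall>c::real. \<theta> (c *\<^sub>R x) = c *\<^sub>R \<theta> x) \<and>
     (\<forall>x\<in>lspace A. \<forall>y\<in>lspace A. \<theta> (lbracket A x y) = lbracket A (\<theta> x) (\<theta> y))"

definition bilinear_form_on :: "'v::euclidean_space set \<Rightarrow> ('v \<Rightarrow> 'v \<Rightarrow> real) \<Rightarrow> bool" where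
  "bilinear_form_on V B \<longleftrightarrow>
     (\<forall>x\<in>V. \<forall>y\<in>V. \<forall>z\<in>V. B (x + y) z = B x z + B y z \<and> B z (x + y) = B z x + B z y) \<and>
     (\<forall>x\<in>V. \<forall>y\<in>V. \<forall>c::real. B (c *\<^sub>R x) y = c * B x y \<and> B x (c *\<^sub>R y) = c * B x y)"

definition nondegenerate_on :: "'v::euclidean_space set \<Rightarrow> ('v \<Rightarrow> 'v \<Rightarrow> real) \<Rightarrow> bool" where
  "nondegenerate_on V B \<longleftrightarrow>
     (\<forall>x\<in>V. (\<forall>y\<in>V. B x y = 0) \<longrightarrow> x = 0) \<and> (\<forall>y\<in>V. (\<forall>x\<in>V. B x y = 0) \<longrightarrow> y = 0)"

definition minus_part ::
  "('g, 'e::euclidean_space) lie_group_data \<Rightarrow> 'g set \<Rightarrow> ('e \<Rightarrow> 'e) \<Rightarrow> 'e set" where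
  "minus_part L G \<theta> = {X \<in> Lie L G. \<theta> X = - X}"

definition polar :: "('g, 'e::euclidean_space) lie_group_data \<Rightarrow> 'g \<times> 'e \<Rightarrow> 'g" where
  "polar L = (\<lambda>(h, X). h \<otimes>\<^bsub>L\<^esub> lie_exp L X)"

text \<open>
  The tuple \<open>(G, H, \<theta>, B)\<close> is a real reductive group, where \<open>G\<close> carries the structure of a Lie
  subgroup of the ambient Lie group \<open>L\<close>; taking \<open>G = carrier L\<close> gives the notion for an abstract Lie
  group. The maps \<open>\<theta>\<close> and \<open>B\<close> are total functions of which only the restrictions to
  the Lie algebra of \<open>G\<close> matter. In the last condition \<open>exp(\<mm>)\<close> has the manifold structure of
  \<open>\<mm>\<close>: the map \<open>(h, X) \<mapsto> h exp X\<close> from \<open>H \<times> \<mm>\<close> to \<open>G\<close> is a diffeomorphism.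
\<close>

definition real_reductive ::
  "('g, 'e::euclidean_space) lie_group_data \<Rightarrow> 'g set \<Rightarrow> 'g set \<Rightarrow> ('e \<Rightarrow> 'e) \<Rightarrow> ('e \<Rightarrow> 'e \<Rightarrow> real)
     \<Rightarrow> bool" where
  "real_reductive L G H \<theta> B \<longleftrightarrow>
     lie_group L \<and> lie_subgroup L G \<and> reductive_lie_algebra (lie_alg_of L G) \<and>
     maximal_compact L G H \<and>
     lie_involution (lie_alg_of L G) \<theta> \<and>
     Lie L H = {X \<in> Lie L G. \<theta> X = X} \<and>
     bilinear_form_on (Lie L G) B \<and> nondegenerate_on (Lie L G) B \<and>
     (\<forall>X\<in>Lie L G. \<forall>Y\<in>Lie L G. B (\<theta> X) (\<theta> Y) = B X Y) \<and>
     (\<forall>g\<in>G. \<forall>X\<in>Lie L G. \<forall>Y\<in>Lie L G. B (Ad L g X) (Ad L g Y) = B X Y) \<and>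
     (\<forall>X\<in>Lie L H. \<forall>Y\<in>minus_part L G \<theta>. B X Y = 0 \<and> B Y X = 0) \<and>
     (\<forall>X\<in>Lie L H. X \<noteq> 0 \<longrightarrow> B X X < 0) \<and>
     (\<forall>X\<in>minus_part L G \<theta>. X \<noteq> 0 \<longrightarrow> B X X > 0) \<and>
     bij_betw (polar L) (H \<times> minus_part L G \<theta>) G \<and>
     smooth_map_on (prod_mfd (mfd L) (vec_mfd (model (mfd L)))) (H \<times> minus_part L G \<theta>) (mfd L)
       (polar L) \<and>
     smooth_map_on (mfd L) G (prod_mfd (mfd L) (vec_mfd (model (mfd L))))
       (inv_into (H \<times> minus_part L G \<theta>) (polar L))"

text \<open>
  The involution \<open>\<tau>\<close> of a complex reductive group is conjugate linear. This is what makes the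
  composite of \<open>\<tau>\<close> with an antiholomorphic involution holomorphic.
\<close>

definition complex_reductive ::
  "('g, complex ^ 'n) lie_group_data \<Rightarrow> 'g set \<Rightarrow> (complex ^ 'n \<Rightarrow> complex ^ 'n)
     \<Rightarrow> (complex ^ 'n \<Rightarrow> complex ^ 'n \<Rightarrow> real) \<Rightarrow> bool" where
  "complex_reductive L U \<tau> BC \<longleftrightarrow> complex_lie_group L \<and>
     real_reductive L (carrier L) U \<tau> BC \<and>
     (\<forall>X\<in>Lie L (carrier L). \<tau> (imag X) = - imag (\<tau> X))"

text \<open>The lift \<open>u exp X \<mapsto> u exp (- X)\<close> of \<open>\<tau>\<close> to the group.\<close>

definition group_cartan_involution ::
  "('g, 'e::euclidean_space) lie_group_data \<Rightarrow> 'g set \<Rightarrow> ('e \<Rightarrow> 'e) \<Rightarrow> 'g \<Rightarrow> 'g" where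
  "group_cartan_involution L U \<tau> g =
     (let (u, X) = inv_into (U \<times> minus_part L (carrier L) \<tau>) (polar L) g in polar L (u, - X))"

definition antiholomorphic_involution ::
  "('g, complex ^ 'n) lie_group_data \<Rightarrow> ('g \<Rightarrow> 'g) \<Rightarrow> bool" where
  "antiholomorphic_involution L \<sigma> \<longleftrightarrow> \<sigma> \<in> hom L L \<and> (\<forall>g\<in>carrier L. \<sigma> (\<sigma> g) = g) \<and>
     holomorphic_map imag (\<lambda>v. - imag v) (mfd L) (mfd L) \<sigma>"

definition real_form_group ::
  "('g, complex ^ 'n) lie_group_data \<Rightarrow> 'g set \<Rightarrow> (complex ^ 'n \<Rightarrow> complex ^ 'n)
     \<Rightarrow> (complex ^ 'n \<Rightarrow> complex ^ 'n \<Rightarrow> real) \<Rightarrow> ('g \<Rightarrow> 'g)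
     \<Rightarrow> 'g set \<Rightarrow> 'g set \<Rightarrow> (complex ^ 'n \<Rightarrow> complex ^ 'n)
     \<Rightarrow> (complex ^ 'n \<Rightarrow> complex ^ 'n \<Rightarrow> real) \<Rightarrow> bool" where
  "real_form_group L U \<tau> BC \<sigma> G H \<theta> B \<longleftrightarrow>
     antiholomorphic_involution L \<sigma> \<and>
     (\<forall>g\<in>carrier L. \<sigma> (group_cartan_involution L U \<tau> g) = group_cartan_involution L U \<tau> (\<sigma> g)) \<and>
     G = {g \<in> carrier L. \<sigma> g = g} \<and>
     real_reductive L G H \<theta> B \<and>
     H = G \<inter> U \<and>
     (\<forall>X\<in>Lie L G. \<theta> X = \<tau> X) \<and>
     (\<forall>X\<in>Lie L G. \<forall>Y\<in>Lie L G. B X Y = BC X Y)"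

definition centralizer :: "('g, 'b) monoid_scheme \<Rightarrow> 'g set \<Rightarrow> 'g set" where
  "centralizer K S = {g \<in> carrier K. \<forall>h\<in>S. g \<otimes>\<^bsub>K\<^esub> h = h \<otimes>\<^bsub>K\<^esub> g}"

definition group_center :: "('g, 'b) monoid_scheme \<Rightarrow> 'g set" where
  "group_center K = centralizer K (carrier K)"

definition almost_fixed :: "('g, 'b) monoid_scheme \<Rightarrow> ('g \<Rightarrow> 'g) \<Rightarrow> 'g set" where
  "almost_fixed K \<iota> = {g \<in> carrier K. inv\<^bsub>K\<^esub> g \<otimes>\<^bsub>K\<^esub> \<iota> g \<in> group_center K}"

text \<open>A semisimple group is by convention connected.\<close>

definition semisimple_group :: "('g, 'e::euclidean_space) lie_group_data \<Rightarrow> bool" where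
  "semisimple_group L \<longleftrightarrow> lie_group L \<and> connected_space (mtop (mfd L)) \<and>
     semisimple_lie_algebra (lie_alg_of L (carrier L))"

end

theory Submission
  imports Defs
begin

text \<open>
  The exponential map is built without differential equations: in the identity chart the
  multiplication is \<open>x + y + O(\<bar>x\<bar> \<bar>y\<bar>)\<close>, hence the powers of \<open>X / k\<close> with exponent \<open>k\<close> converge, and
  coordinates of the second kind give the closed subgroup theorem.

  For the corollary, let \<open>\<zz>\<close> be the Lie algebra of the centre and \<open>S\<close> the differential of \<open>\<sigma>\<close>, so that
  the Lie algebra of \<open>G\<^sub>\<sigma>\<close> consists of the \<open>X\<close> with \<open>S X - X \<in> \<zz>\<close>. If \<open>u exp X \<in> G\<^sub>\<sigma>\<close> with \<open>u \<in> U\<close> and \<open>X\<close> in the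
  \<open>-1\<close>-eigenspace of \<open>\<tau>\<close>, then \<open>\<sigma> u exp (S X) = u exp X z\<close> with \<open>z = v exp Y\<close> central. Uniqueness of the
  polar decomposition makes \<open>v\<close> central and \<open>Ad (exp Y) = 1\<close>; since \<open>ad Y\<close> is symmetric, a convexity
  argument gives \<open>Y \<in> \<zz>\<close>. Hence the polar decomposition restricts to \<open>G\<^sub>\<sigma>\<close>. Any compact subgroup
  containing \<open>U\<^sub>\<sigma>\<close> properly would contain all powers of some \<open>exp X \<noteq> 1\<close>.

  An element centralizing \<open>G\<close> has trivial adjoint action on the fixed space of \<open>S\<close>, hence by
  complex linearity everywhere, hence is central if the group is connected. With \<open>P = (1 + S) / 2\<close> and
  \<open>Q = (1 - S) / 2\<close>, the map \<open>(x, y) \<mapsto> (P x + i P y, Q x + i Q y)\<close> is the isomorphism of item 3.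
\<close>

section \<open>Calculus of k times differentiable maps\<close>

text \<open>Three obstacles shape the development. An atlas is modelled on a subspace of a Euclidean
  type, and a derivative within that subspace is undetermined in transverse directions; chart
  inverses are therefore precomposed with the orthogonal projection, which puts the calculus on open
  sets of the full type, where derivatives are unique. Next, \<open>BC\<close> is not assumed
  symmetric, so orthogonality and positivity arguments run with a symmetrized form
  \<open>ip\<close>; the same form makes \<open>ad Y\<close> symmetric for \<open>Y\<close> in the
  -1 eigenspace and supplies complementary ideals. Last, several centres have to be reconciled:
  \<open>almost_fixed\<close> of \<open>U\<close> refers to the centre of \<open>U\<close>,
  \<open>almost_fixed\<close> of the whole group to the centre of that group, and item 3 can be read
  with the Lie algebra of the group centre or with the centre of the Lie algebra. The latter two
  agree for a connected group, so item 3 appears in both readings. Commutation of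
  \<open>\<sigma>\<close> with the Cartan involution is assumed on the group; its infinitesimal form
  is recovered from one-parameter subgroups.\<close>

lemma Ck_on_cong:
  assumes "\<And>x. x \<in> S \<Longrightarrow> f x = g x"
  shows "Ck_on k S f \<longleftrightarrow> Ck_on k S g"
proof (cases k)
  case 0
  then show ?thesis using assms by (simp cong: continuous_on_cong)
next
  case (Suc n)
  have "(f has_derivative D) (at x within S) \<longleftrightarrow> (g has_derivative D) (at x within S)"
    if "x \<in> S" for x D
    using has_derivative_transform[of x S f g D] has_derivative_transform[of x S g f D] that assms
    by metis
  with Suc show ?thesis by (auto cong: ball_cong)
qed

lemma Ck_on_SucI:
  assumes "\<And>x. x \<in> S \<Longrightarrow> (f has_derivative D x) (at x within S)" "\<And>v. Ck_on k S (\<lambda>x. D x v)"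
  shows "Ck_on (Suc k) S f"
  using assms by auto

lemma Ck_on_SucE:
  assumes "Ck_on (Suc k) S f"
  obtains D where "\<And>x. x \<in> S \<Longrightarrow> (f has_derivative D x) (at x within S)" "\<And>v. Ck_on k S (\<lambda>x. D x v)"
  using assms by auto

declare Ck_on.simps(2) [simp del]

lemma Ck_on_imp_continuous_on: "Ck_on k S f \<Longrightarrow> continuous_on S f"
proof (cases k)
  case (Suc n)
  assume "Ck_on k S f"
  with Suc obtain D where "\<And>x. x \<in> S \<Longrightarrow> (f has_derivative D x) (at x within S)"
    using Ck_on_SucE by blast
  then show ?thesis by (rule has_derivative_continuous_on)
qed auto

lemma Ck_on_SucD: "Ck_on (Suc k) S f \<Longrightarrow> Ck_on k S f"
proof (induction k arbitrary: f)
  case 0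
  show ?case by (simp only: Ck_on.simps(1)) (rule Ck_on_imp_continuous_on[OF 0])
next
  case (Suc k)
  from Suc.prems obtain D where D: "\<And>x. x \<in> S \<Longrightarrow> (f has_derivative D x) (at x within S)" "\<And>v. Ck_on (Suc k) S (\<lambda>x. D x v)"
    by (rule Ck_on_SucE) blast
  show ?case by (rule Ck_on_SucI[OF D(1) Suc.IH[OF D(2)]])
qed

lemma Ck_on_subset: "Ck_on k S f \<Longrightarrow> T \<subseteq> S \<Longrightarrow> Ck_on k T f"
proof (induction k arbitrary: f)
  case 0
  then show ?case by (auto intro: continuous_on_subset)
next
  case (Suc k)
  from Suc.prems(1) obtain D where D: "\<And>x. x \<in> S \<Longrightarrow> (f has_derivative D x) (at x within S)" "\<And>v. Ck_on k S (\<lambda>x. D x v)"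
    by (rule Ck_on_SucE) blast
  show ?case using Suc.prems(2) Suc.IH D
    by (intro Ck_on_SucI[of T f D]) (auto intro: has_derivative_subset)
qed

lemma Ck_on_const: "Ck_on k S (\<lambda>x. c)"
proof (induction k arbitrary: c)
  case (Suc k)
  then show ?case by (intro Ck_on_SucI[of _ _ "\<lambda>x v. 0"]) auto
qed auto

lemma Ck_on_bounded_linear: assumes "bounded_linear f" shows "Ck_on k S f"
proof (cases k)
  case 0
  then show ?thesis using assms by (auto intro: linear_continuous_on)
next
  case (Suc n)
  show ?thesis unfolding Suc using assms Ck_on_const
    by (intro Ck_on_SucI[of _ _ "\<lambda>x. f"] bounded_linear_imp_has_derivative)
qed

lemma Ck_on_add: "Ck_on k S f \<Longrightarrow> Ck_on k S g \<Longrightarrow> Ck_on k S (\<lambda>x. f x + g x)"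
proof (induction k arbitrary: f g)
  case 0
  then show ?case by (auto intro: continuous_on_add)
next
  case (Suc k)
  from Suc.prems(1) obtain D where D: "\<And>x. x \<in> S \<Longrightarrow> (f has_derivative D x) (at x within S)" "\<And>v. Ck_on k S (\<lambda>x. D x v)"
    by (rule Ck_on_SucE) blast
  from Suc.prems(2) obtain D' where D': "\<And>x. x \<in> S \<Longrightarrow> (g has_derivative D' x) (at x within S)" "\<And>v. Ck_on k S (\<lambda>x. D' x v)"
    by (rule Ck_on_SucE) blast
  show ?case by (intro Ck_on_SucI[of _ _ "\<lambda>x v. D x v + D' x v"] has_derivative_add Suc.IH D D')
qed

lemma Ck_on_sum:
  assumes "finite I" "\<And>i. i \<in> I \<Longrightarrow> Ck_on k S (f i)"
  shows "Ck_on k S (\<lambda>x. \<Sum>i\<in>I. f i x)"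
  using assms by (induction I rule: finite_induct) (auto intro: Ck_on_const Ck_on_add)

lemma Ck_on_linear:
  assumes "bounded_linear h"
  shows "Ck_on k S f \<Longrightarrow> Ck_on k S (\<lambda>x. h (f x))"
proof (induction k arbitrary: f)
  case 0
  then show ?case using assms by (auto intro: bounded_linear.continuous_on)
next
  case (Suc k)
  from Suc.prems(1) obtain D where D: "\<And>x. x \<in> S \<Longrightarrow> (f has_derivative D x) (at x within S)" "\<And>v. Ck_on k S (\<lambda>x. D x v)"
    by (rule Ck_on_SucE) blast
  show ?case
    by (intro Ck_on_SucI[of _ _ "\<lambda>x v. h (D x v)"] bounded_linear.has_derivative[OF assms] Suc.IH D)
qed

lemma Ck_on_bilinear:
  assumes "bounded_bilinear p"
  shows "Ck_on k S f \<Longrightarrow> Ck_on k S g \<Longrightarrow> Ck_on k S (\<lambda>x. p (f x) (g x))"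
proof (induction k arbitrary: f g)
  case 0
  then show ?case using assms by (auto intro: bounded_bilinear.continuous_on)
next
  case (Suc k)
  from Suc.prems(1) obtain D where D: "\<And>x. x \<in> S \<Longrightarrow> (f has_derivative D x) (at x within S)" "\<And>v. Ck_on k S (\<lambda>x. D x v)"
    by (rule Ck_on_SucE) blast
  from Suc.prems(2) obtain D' where D': "\<And>x. x \<in> S \<Longrightarrow> (g has_derivative D' x) (at x within S)" "\<And>v. Ck_on k S (\<lambda>x. D' x v)"
    by (rule Ck_on_SucE) blast
  \<comment> \<open>The product rule pairs a derivative with an undifferentiated factor, so
    \<open>f\<close> and \<open>g\<close> themselves must be lowered to order \<open>k\<close>
    before the induction hypothesis applies.\<close>
  have "Ck_on k S f" "Ck_on k S g" using Suc.prems Ck_on_SucD by auto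
  then show ?case
    by (intro Ck_on_SucI[of _ _ "\<lambda>x v. p (f x) (D' x v) + p (D x v) (g x)"] Ck_on_add Suc.IH D D'
        bounded_bilinear.FDERIV[OF assms])
qed

lemma Ck_on_Pair: 
  assumes "Ck_on k S f" "Ck_on k S g" shows "Ck_on k S (\<lambda>x. (f x, g x))"
proof -
  have "Ck_on k S (\<lambda>x. (f x, 0) + (0, g x))"
    by (rule Ck_on_add[OF Ck_on_linear[OF _ assms(1)] Ck_on_linear[OF _ assms(2)]])
      (rule bounded_linear_Pair bounded_linear_ident bounded_linear_zero)+
  then show ?thesis by simp
qed

lemma linear_euclidean_expand:
  fixes T :: "'a::euclidean_space \<Rightarrow> 'b::real_vector"
  assumes "linear T" shows "T w = (\<Sum>b\<in>Basis. (w \<bullet> b) *\<^sub>R T b)"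
  by (metis (no_types, lifting) assms euclidean_representation linear_scale linear_sum sum.cong)

text \<open>The chain rule yields \<open>D' (f x) (D x v)\<close>, whose direction moves with
  \<open>x\<close>, while the induction hypothesis covers only fixed directions. Expanding
  \<open>D x v\<close> in the basis leaves fixed directions \<open>b\<close> with scalar
  coefficients.\<close>

lemma Ck_on_compose:
  fixes g :: "'b::euclidean_space \<Rightarrow> 'c::euclidean_space" and f :: "'a::euclidean_space \<Rightarrow> 'b"
  assumes "f ` S \<subseteq> T"
  shows "Ck_on k S f \<Longrightarrow> Ck_on k T g \<Longrightarrow> Ck_on k S (\<lambda>x. g (f x))"
proof (induction k arbitrary: g)
  case 0
  then show ?case using assms by (auto intro: continuous_on_compose2)
next
  case (Suc k)
  from Suc.prems(1) obtain D where D: "\<And>x. x \<in> S \<Longrightarrow> (f has_derivative D x) (at x within S)" "\<And>v. Ck_on k S (\<lambda>x. D x v)"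
    by (rule Ck_on_SucE) blast
  from Suc.prems(2) obtain D' where D': "\<And>x. x \<in> T \<Longrightarrow> (g has_derivative D' x) (at x within T)" "\<And>v. Ck_on k T (\<lambda>x. D' x v)"
    by (rule Ck_on_SucE) blast
  have f: "Ck_on k S f" using Suc.prems Ck_on_SucD by auto
  have eq: "D' (f x) (D x v) = (\<Sum>b\<in>Basis. (D x v \<bullet> b) *\<^sub>R D' (f x) b)" if "x \<in> S" for x v
    using that assms D' by (intro linear_euclidean_expand has_derivative_linear) auto
  have "Ck_on k S (\<lambda>x. D' (f x) (D x v))" for v
  proof -
    have "Ck_on k S (\<lambda>x. \<Sum>b\<in>Basis. (D x v \<bullet> b) *\<^sub>R D' (f x) b)"
      by (intro Ck_on_sum Ck_on_bilinear[OF bounded_bilinear_scaleR] Ck_on_bilinear[OF bounded_bilinear_inner]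
         finite_Basis D Ck_on_const Suc.IH[OF f D'(2)])
    then show ?thesis by (rule Ck_on_cong[THEN iffD2, rotated]) (rule eq)
  qed
  moreover have "((\<lambda>x. g (f x)) has_derivative (\<lambda>v. D' (f x) (D x v))) (at x within S)" if "x \<in> S" for x
  proof (rule has_derivative_in_compose[OF D(1)[OF that]])
    show "(g has_derivative D' (f x)) (at (f x) within f ` S)"
      using that assms by (intro has_derivative_subset[OF D'(1)]) auto
  qed
  ultimately show ?case by (intro Ck_on_SucI[of _ _ "\<lambda>x v. D' (f x) (D x v)"])
qed

lemma has_derivative_unique_open:
  assumes "open S" "x \<in> S" "(f has_derivative D) (at x within S)" "(f has_derivative D') (at x within S)"
  shows "D = D'"
  using assms by (metis at_within_open has_derivative_unique)

lemma Ck_on_local_open: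
  fixes f :: "'a::euclidean_space \<Rightarrow> 'b::euclidean_space"
  assumes "\<And>x. x \<in> S \<Longrightarrow> \<exists>T. open T \<and> x \<in> T \<and> T \<subseteq> S \<and> Ck_on k T f"
  shows "Ck_on k S f"
  using assms
proof (induction k arbitrary: f)
  case 0
  then show ?case
    by (metis Ck_on.simps(1) at_within_open continuous_at_imp_continuous_on continuous_on_eq_continuous_at)
next
  case (Suc k)
  \<comment> \<open>The local derivatives have to be glued into one function; on an open piece the
    derivative is unique, so this canonical choice agrees with each of them.\<close>
  define D where "D x = frechet_derivative f (at x)" for x
  have *: "\<exists>T. open T \<and> x \<in> T \<and> T \<subseteq> S \<and> (\<forall>y\<in>T. (f has_derivative D y) (at y)) \<and> (\<forall>v. Ck_on k T (\<lambda>y. D y v))"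
    if x: "x \<in> S" for x
  proof -
    obtain T where T: "open T" "x \<in> T" "T \<subseteq> S" "Ck_on (Suc k) T f" using Suc.prems[OF x] by blast
    from T(4) obtain D' where D': "\<And>x. x \<in> T \<Longrightarrow> (f has_derivative D' x) (at x within T)" "\<And>v. Ck_on k T (\<lambda>x. D' x v)"
      by (rule Ck_on_SucE) blast
    have d: "(f has_derivative D' y) (at y)" if "y \<in> T" for y
      using D'(1)[OF that] T(1) that by (simp add: at_within_open[of _ T])
    then have eq: "D y = D' y" if "y \<in> T" for y
      unfolding D_def using frechet_derivative_at[OF d[OF that]] by simp
    have "Ck_on k T (\<lambda>x. D x v)" for v
      by (rule Ck_on_cong[THEN iffD2, OF _ D'(2)]) (simp add: eq)
    moreover have "(f has_derivative D y) (at y)" if "y \<in> T" for y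
      using D'(1)[OF that] T(1) that eq by (simp add: at_within_open[of _ T])
    ultimately show ?thesis using T by blast
  qed
  have "(f has_derivative D x) (at x within S)" if "x \<in> S" for x
    using *[OF that] by (elim exE conjE) (rule has_derivative_at_withinI, erule bspec)
  moreover have "Ck_on k S (\<lambda>x. D x v)" for v
  proof (rule Suc.IH)
    fix x assume "x \<in> S"
    from *[OF this] show "\<exists>T. open T \<and> x \<in> T \<and> T \<subseteq> S \<and> Ck_on k T (\<lambda>x. D x v)"
      by (elim exE conjE) (intro exI conjI; (assumption | erule spec))
  qed
  ultimately show ?case by (intro Ck_on_SucI[of _ _ D])
qed

text \<open>A product rule in which \<open>q\<close> is merely continuous: since \<open>p\<close>
  vanishes at the point, \<open>p y q y - p' (y - x) q x\<close> splits into the remainder of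
  \<open>p\<close> times \<open>q y\<close> and a bounded slope times \<open>q y - q x\<close>. It
  is needed because an inverse operator is at first known only to be continuous.\<close>

lemma has_derivative_vanishing_times_continuous:
  fixes p :: "'a::real_normed_vector \<Rightarrow> real" and q :: "'a \<Rightarrow> 'b::real_normed_vector"
  assumes p: "(p has_derivative p') (at x within S)" "p x = 0"
    and q: "continuous (at x within S) q"
  shows "((\<lambda>y. p y *\<^sub>R q y) has_derivative (\<lambda>w. p' w *\<^sub>R q x)) (at x within S)"
proof -
  have lin: "bounded_linear p'" using p(1) by (rule has_derivative_bounded_linear)
  obtain K where K: "\<And>w. \<bar>p' w\<bar> \<le> norm w * K" "K \<ge> 0" 
    using bounded_linear.nonneg_bounded[OF lin] by (auto simp: mult.commute)
  have e: "((\<lambda>y. (p y - p' (y - x)) / norm (y - x)) \<longlongrightarrow> 0) (at x within S)"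
    using p unfolding has_derivative_within
    by (auto simp: divide_inverse mult.commute algebra_simps linear_diff[OF bounded_linear.linear[OF lin]])
  have qx: "((\<lambda>y. q y - q x) \<longlongrightarrow> 0) (at x within S)"
    using q by (simp add: continuous_within LIM_zero_iff)
  have qy: "(q \<longlongrightarrow> q x) (at x within S)" using q by (simp add: continuous_within)
  have 1: "((\<lambda>y. ((p y - p' (y - x)) / norm (y - x)) *\<^sub>R q y) \<longlongrightarrow> 0 *\<^sub>R q x) (at x within S)"
    by (intro tendsto_scaleR e qy)
  have 2: "((\<lambda>y. (p' (y - x) / norm (y - x)) *\<^sub>R (q y - q x)) \<longlongrightarrow> 0) (at x within S)"
  proof (rule Lim_null_comparison)
    show "\<forall>\<^sub>F y in at x within S. norm ((p' (y - x) / norm (y - x)) *\<^sub>R (q y - q x)) \<le> K * norm (q y - q x)"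
    proof (rule always_eventually, rule allI)
      fix y
      have "\<bar>p' (y - x) / norm (y - x)\<bar> \<le> K"
        using K(1)[of "y - x"] K(2) by (auto simp: divide_simps mult.commute abs_mult)
      then show "norm ((p' (y - x) / norm (y - x)) *\<^sub>R (q y - q x)) \<le> K * norm (q y - q x)"
        unfolding norm_scaleR by (intro mult_right_mono) auto
    qed
    show "((\<lambda>y. K * norm (q y - q x)) \<longlongrightarrow> 0) (at x within S)"
      using tendsto_mult_right_zero[OF tendsto_norm_zero[OF qx]] .
  qed
  have "((\<lambda>y. ((p y - p' (y - x)) / norm (y - x)) *\<^sub>R q y + (p' (y - x) / norm (y - x)) *\<^sub>R (q y - q x)) \<longlongrightarrow> 0) (at x within S)"
    using tendsto_add[OF 1 2] by simp
  then have "((\<lambda>y. (1 / norm (y - x)) *\<^sub>R (p y *\<^sub>R q y - (p x *\<^sub>R q x + p' (y - x) *\<^sub>R q x))) \<longlongrightarrow> 0) (at x within S)"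
    by (rule Lim_transform_eventually)
      (simp add: p(2) algebra_simps diff_divide_distrib scaleR_diff_left)
  then show ?thesis unfolding has_derivative_within
    using bounded_linear_compose[OF bounded_linear_scaleR_left lin] by simp
qed

text \<open>The identity \<open>B y v = B x v - B y (A y u - A x u)\<close> with
  \<open>u = B x v\<close> exhibits the increment as a factor vanishing at \<open>y = x\<close>
  times the continuous \<open>B y\<close>. The resulting derivative, minus B (DA) B, is built from
  \<open>B\<close> and the derivative of \<open>A\<close>, so every order of smoothness of
  \<open>A\<close> passes to \<open>B\<close>.\<close>

lemma Ck_on_inverse_operator:
  fixes A B :: "'a::euclidean_space \<Rightarrow> 'b::euclidean_space \<Rightarrow> 'b"
  assumes "\<And>x. x \<in> S \<Longrightarrow> linear (A x)" and lB: "\<And>x. x \<in> S \<Longrightarrow> linear (B x)"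
    and AB: "\<And>x v. x \<in> S \<Longrightarrow> A x (B x v) = v" "\<And>x v. x \<in> S \<Longrightarrow> B x (A x v) = v"
    and cont: "\<And>v. continuous_on S (\<lambda>x. B x v)"
  shows "(\<And>v. Ck_on k S (\<lambda>x. A x v)) \<Longrightarrow> Ck_on k S (\<lambda>x. B x v)"
proof (induction k arbitrary: v)
  case 0
  then show ?case using cont by simp
next
  case (Suc k)
  have Bk: "Ck_on k S (\<lambda>x. B x v)" for v using Suc Ck_on_SucD by blast
  have "\<forall>b. \<exists>D. (\<forall>x\<in>S. ((\<lambda>x. A x b) has_derivative D x) (at x within S)) \<and> (\<forall>v. Ck_on k S (\<lambda>x. D x v))"
    using Suc.prems Ck_on.simps(2) by blast
  then obtain D where D: "\<And>b x. x \<in> S \<Longrightarrow> ((\<lambda>x. A x b) has_derivative D b x) (at x within S)"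
    "\<And>b v. Ck_on k S (\<lambda>x. D b x v)" by metis
  define DA where "DA x w u = (\<Sum>c\<in>Basis. (u \<bullet> c) *\<^sub>R D c x w)" for x w u
  have DA: "((\<lambda>x. A x u) has_derivative (\<lambda>w. DA x w u)) (at x within S)" if "x \<in> S" for x u
  proof -
    have "((\<lambda>x. \<Sum>c\<in>Basis. (u \<bullet> c) *\<^sub>R A x c) has_derivative (\<lambda>w. DA x w u)) (at x within S)"
      unfolding DA_def using D(1)[OF that] by (intro has_derivative_sum has_derivative_scaleR_right)
    then show ?thesis
      by (rule has_derivative_transform[OF that, rotated]) (use assms linear_euclidean_expand in metis)
  qed
  define E where "E x w = - (\<Sum>b\<in>Basis. (DA x w (B x v) \<bullet> b) *\<^sub>R B x b)" for x w
  have "((\<lambda>y. B y v) has_derivative E x) (at x within S)" if x: "x \<in> S" for x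
  proof -
    let ?u = "B x v"
    let ?p = "\<lambda>b y. (A y ?u - A x ?u) \<bullet> b"
    have p: "(?p b has_derivative (\<lambda>w. DA x w ?u \<bullet> b)) (at x within S)" for b
      using has_derivative_diff[OF DA[OF x, of ?u] has_derivative_const[of "A x ?u"]]
      by (intro has_derivative_inner_left) simp
    have "((\<lambda>y. ?p b y *\<^sub>R B y b) has_derivative (\<lambda>w. (DA x w ?u \<bullet> b) *\<^sub>R B x b)) (at x within S)" for b
      using cont x by (intro has_derivative_vanishing_times_continuous p)
        (auto simp: continuous_on_eq_continuous_within)
    then have "((\<lambda>y. B x v - (\<Sum>b\<in>Basis. ?p b y *\<^sub>R B y b)) has_derivative (\<lambda>w. 0 - (\<Sum>b\<in>Basis. (DA x w ?u \<bullet> b) *\<^sub>R B x b))) (at x within S)"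
      by (intro has_derivative_diff has_derivative_const has_derivative_sum)
    moreover have "B y v = B x v - (\<Sum>b\<in>Basis. ?p b y *\<^sub>R B y b)" if y: "y \<in> S" for y
    proof -
      have "(\<Sum>b\<in>Basis. ?p b y *\<^sub>R B y b) = B y (A y ?u - A x ?u)"
        using linear_euclidean_expand[OF lB[OF y]] by metis
      also have "\<dots> = ?u - B y v" using lB[OF y] AB x y by (simp add: linear_diff)
      finally show ?thesis by simp
    qed
    ultimately show ?thesis unfolding E_def
      by (intro has_derivative_transform[OF x, of "\<lambda>y. B y v"]) auto
  qed
  moreover have "Ck_on k S (\<lambda>x. E x w)" for w
  proof -
    have "Ck_on k S (\<lambda>x. DA x w (B x v))" unfolding DA_def
      by (intro Ck_on_sum Ck_on_bilinear[OF bounded_bilinear_scaleR] Ck_on_bilinear[OF bounded_bilinear_inner]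
          Bk Ck_on_const D) auto
    then have "Ck_on k S (\<lambda>x. \<Sum>b\<in>Basis. (DA x w (B x v) \<bullet> b) *\<^sub>R B x b)"
      by (intro Ck_on_sum Ck_on_bilinear[OF bounded_bilinear_scaleR] Ck_on_bilinear[OF bounded_bilinear_inner]
          Bk Ck_on_const finite_Basis)
    then show ?thesis unfolding E_def
      by (rule Ck_on_linear[OF bounded_linear_minus[OF bounded_linear_ident]])
  qed
  ultimately show ?case by (intro Ck_on_SucI[of _ _ E])
qed

text \<open>The classical theorem gives a differentiable inverse \<open>g\<close> whose derivative
  \<open>g' y\<close> inverts \<open>D (g y)\<close>. If \<open>g\<close> is of class
  \<open>k\<close>, so is \<open>y \<mapsto> D (g y)\<close>, hence so is its inverse operator
  \<open>g'\<close>, and \<open>g\<close> gains one order.\<close>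

lemma smooth_local_inverse:
  fixes f :: "'a::euclidean_space \<Rightarrow> 'a"
  assumes "open T" "x0 \<in> T" and f: "smooth_on T f"
    and D0: "(f has_derivative (\<lambda>v. v)) (at x0)"
  obtains U V g where "open U" "U \<subseteq> T" "x0 \<in> U" "open V" "homeomorphism U V f g"
    "smooth_on V g"
proof -
  have "Ck_on (Suc 0) T f" using f by (simp add: smooth_on_def)
  then obtain D where D1: "\<And>x. x \<in> T \<Longrightarrow> (f has_derivative D x) (at x within T)"
    and D2: "\<And>v. Ck_on 0 T (\<lambda>x. D x v)"
    by (rule Ck_on_SucE) blast
  have D: "\<And>x. x \<in> T \<Longrightarrow> (f has_derivative D x) (at x)" "\<And>v. continuous_on T (\<lambda>x. D x v)"
    using D1 D2 \<open>open T\<close> by (simp_all add: at_within_open[of _ T])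
  have bl: "bounded_linear (D x)" if "x \<in> T" for x using D that has_derivative_bounded_linear by blast
  define f' where "f' x = Blinfun (D x)" for x
  have f': "blinfun_apply (f' x) = D x" if "x \<in> T" for x
    using bl that by (simp add: f'_def bounded_linear_Blinfun_apply)
  have cf': "continuous_on T f'"
    by (rule continuous_on_blinfun_componentwise, rule continuous_on_eq[OF D(2)]) (simp add: f')
  have "D x0 = (\<lambda>v. v)" using D0 D \<open>x0 \<in> T\<close> has_derivative_unique by blast
  then have idc: "id_blinfun o\<^sub>L f' x0 = id_blinfun"
    using f'[OF \<open>x0 \<in> T\<close>] by (intro blinfun_eqI) simp
  have derf: "\<And>x. x \<in> T \<Longrightarrow> (f has_derivative blinfun_apply (f' x)) (at x)" using D(1) f' by simp
  obtain U V g g' where UV: "open U" "U \<subseteq> T" "x0 \<in> U" "open V" "homeomorphism U V f g"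
    and g': "\<And>y. y \<in> V \<Longrightarrow> (g has_derivative (g' y)) (at y)"
    "\<And>y. y \<in> V \<Longrightarrow> g' y = inv_into UNIV (blinfun_apply (f'(g y)))"
    "\<And>y. y \<in> V \<Longrightarrow> bij (blinfun_apply (f'(g y)))"
    by (rule inverse_function_theorem[OF \<open>open T\<close> derf cf' \<open>x0 \<in> T\<close> idc]; (assumption | rule that; (assumption | simp)))
  have gV: "g ` V \<subseteq> U" and cg: "continuous_on V g" using UV(5) by (auto simp: homeomorphism_def)
  have inv: "D (g y) (g' y v) = v" "g' y (D (g y) v) = v" if "y \<in> V" for y v
    using g'(2,3)[OF that] f'[of "g y"] gV UV(2) that
    by (auto simp: bij_is_surj surj_f_inv_f bij_is_inj inv_f_f subset_eq)
  have lg: "linear (g' y)" if "y \<in> V" for y using g'(1) that has_derivative_linear by blast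
  have lD: "linear (D (g y))" if "y \<in> V" for y 
    using bl gV UV(2) that by (auto intro!: bounded_linear.linear)
  have cD: "continuous_on V (\<lambda>y. f' (g y))"
    by (rule continuous_on_compose2[OF cf' cg]) (use gV UV(2) in auto)
  have cg': "continuous_on V (\<lambda>y. g' y v)" for v
  proof -
    have "((\<lambda>y. g' y v) \<longlongrightarrow> g' x v) (at x within V)" if x: "x \<in> V" for x
    proof -
      define K where "K = onorm (g' x)"
      have K: "norm (g' x w) \<le> K * norm w" for w
        unfolding K_def using lg[OF x] by (simp add: linear_conv_bounded_linear onorm)
      have K0: "K \<ge> 0" unfolding K_def using lg[OF x] by (simp add: linear_conv_bounded_linear onorm_pos_le)
      define F where "F y = norm (f' (g y) - f' (g x))" for y
      have Flim: "(F \<longlongrightarrow> 0) (at x within V)"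
        unfolding F_def using cD x
        by (intro tendsto_norm_zero) (simp add: continuous_on_def LIM_zero_iff)
      have est: "norm (g' y v - g' x v) \<le> K * F y * norm (g' y v)" if y: "y \<in> V" for y
      proof -
        have "g' y v - g' x v = g' x (D (g x) (g' y v) - D (g y) (g' y v))"
          using inv x y lg by (simp add: linear_diff)
        also have "norm \<dots> \<le> K * norm (D (g x) (g' y v) - D (g y) (g' y v))" by (rule K)
        also have "D (g x) (g' y v) - D (g y) (g' y v) = blinfun_apply (f' (g x) - f' (g y)) (g' y v)"
          using f' gV UV(2) x y by (auto simp: blinfun.diff_left subset_eq)
        also have "K * norm \<dots> \<le> K * (F y * norm (g' y v))"
          unfolding F_def using K0
          by (intro mult_left_mono) (metis norm_blinfun norm_minus_commute)
        finally show ?thesis by (simp add: mult.assoc)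
      qed
      \<comment> \<open>The estimate \<open>est\<close> still contains the unknown
        \<open>g' y v\<close> on its right side. Once the factor is below 1/2, that norm is at most
        twice the norm of \<open>g' x v\<close>, and the bound tends to 0 with
        \<open>F\<close>.\<close>
      have "\<forall>\<^sub>F y in at x within V. K * F y < 1 / 2"
      proof -
        have "((\<lambda>y. K * F y) \<longlongrightarrow> K * 0) (at x within V)" by (intro tendsto_mult_left Flim)
        then show ?thesis by (rule order_tendstoD) simp
      qed
      moreover have "\<forall>\<^sub>F y in at x within V. y \<in> V" by (simp add: eventually_at_filter)
      ultimately have "\<forall>\<^sub>F y in at x within V. norm (g' y v - g' x v) \<le> F y * (K * 2 * norm (g' x v))"
      proof eventually_elim
        case (elim y)
        have F0: "F y \<ge> 0" by (simp add: F_def)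
        have "norm (g' y v) \<le> norm (g' x v) + norm (g' y v - g' x v)" by norm
        also have "norm (g' y v - g' x v) \<le> 1 / 2 * norm (g' y v)"
          using est[OF elim(2)] elim(1) by (smt (verit) mult_right_mono norm_ge_zero)
        finally have "norm (g' y v) \<le> 2 * norm (g' x v)" by simp
        then have "K * F y * norm (g' y v) \<le> K * F y * (2 * norm (g' x v))"
          using K0 F0 by (intro mult_left_mono) auto
        then show ?case using est[OF elim(2)] by (simp add: algebra_simps)
      qed
      moreover have "((\<lambda>y. F y * (K * 2 * norm (g' x v))) \<longlongrightarrow> 0) (at x within V)"
        using tendsto_mult_left_zero[OF Flim] .
      ultimately have "((\<lambda>y. g' y v - g' x v) \<longlongrightarrow> 0) (at x within V)"
        by (rule Lim_null_comparison)
      then show ?thesis by (rule LIM_zero_cancel)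
    qed
    then show ?thesis by (simp add: continuous_on_def)
  qed
  have "Ck_on k V g" for k
  proof (induction k)
    case 0
    then show ?case using cg by simp
  next
    case (Suc k)
    have "Ck_on (Suc k) T f" using f by (simp add: smooth_on_def)
    then obtain D' where D': "\<And>x. x \<in> T \<Longrightarrow> (f has_derivative D' x) (at x within T)" "\<And>v. Ck_on k T (\<lambda>x. D' x v)"
      by (rule Ck_on_SucE) blast
    have "D' x = D x" if "x \<in> T" for x
      using D'(1)[OF that] D1[OF that] that \<open>open T\<close> by (intro has_derivative_unique_open)
    then have "Ck_on k T (\<lambda>x. D x v)" for v
      by (intro Ck_on_cong[THEN iffD2, OF _ D'(2)]) simp
    moreover have "g ` V \<subseteq> T" using gV UV(2) by blast
    ultimately have "Ck_on k V (\<lambda>y. D (g y) v)" for v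
      using Ck_on_compose[of g V T k "\<lambda>x. D x v"] Suc by blast
    then have g'k: "Ck_on k V (\<lambda>y. g' y v)" for v
      using Ck_on_inverse_operator[of V "\<lambda>y. D (g y)" g'] inv lg lD cg' by blast
    show ?case by (rule Ck_on_SucI[OF has_derivative_at_withinI[OF g'(1)] g'k])
  qed
  then have "smooth_on V g" by (simp add: smooth_on_def)
  then show thesis by (rule that[OF UV])
qed

lemma smooth_on_Ck: "smooth_on S f \<Longrightarrow> Ck_on k S f"
  by (simp add: smooth_on_def)

lemma smooth_on_cong: "(\<And>x. x \<in> S \<Longrightarrow> f x = g x) \<Longrightarrow> smooth_on S f \<longleftrightarrow> smooth_on S g"
  using Ck_on_cong unfolding smooth_on_def by blast

lemma smooth_on_subset: "smooth_on S f \<Longrightarrow> T \<subseteq> S \<Longrightarrow> smooth_on T f"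
  using Ck_on_subset unfolding smooth_on_def by blast

lemma smooth_on_imp_continuous_on: "smooth_on S f \<Longrightarrow> continuous_on S f"
  using Ck_on_imp_continuous_on unfolding smooth_on_def by blast

lemma smooth_on_compose: "smooth_on S f \<Longrightarrow> smooth_on T g \<Longrightarrow> f ` S \<subseteq> T \<Longrightarrow> smooth_on S (\<lambda>x. g (f x))"
  using Ck_on_compose unfolding smooth_on_def by blast

lemma smooth_on_Pair: "smooth_on S f \<Longrightarrow> smooth_on S g \<Longrightarrow> smooth_on S (\<lambda>x. (f x, g x))"
  using Ck_on_Pair unfolding smooth_on_def by blast

lemma smooth_on_add: "smooth_on S f \<Longrightarrow> smooth_on S g \<Longrightarrow> smooth_on S (\<lambda>x. f x + g x)"
  using Ck_on_add unfolding smooth_on_def by blast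

lemma smooth_on_const: "smooth_on S (\<lambda>x. c)"
  using Ck_on_const unfolding smooth_on_def by blast

lemma smooth_on_bounded_linear: "bounded_linear f \<Longrightarrow> smooth_on S f"
  using Ck_on_bounded_linear unfolding smooth_on_def by blast

lemma smooth_on_local_open:
  fixes f :: "'a::euclidean_space \<Rightarrow> 'b::euclidean_space"
  assumes "\<And>x. x \<in> S \<Longrightarrow> \<exists>T. open T \<and> x \<in> T \<and> T \<subseteq> S \<and> smooth_on T f"
  shows "smooth_on S f"
  unfolding smooth_on_def by (intro allI Ck_on_local_open) (meson assms smooth_on_Ck)

section \<open>Second order estimates for maps vanishing on the axes\<close>

lemma bounded_linear_basis_bound:
  fixes T :: "'a::euclidean_space \<Rightarrow> 'b::real_normed_vector"
  assumes "linear T" shows "norm (T v) \<le> (\<Sum>b\<in>Basis. norm (T b)) * norm v"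
proof -
  have "norm (T v) = norm (\<Sum>b\<in>Basis. (v \<bullet> b) *\<^sub>R T b)" using linear_euclidean_expand[OF assms] by metis
  also have "\<dots> \<le> (\<Sum>b\<in>Basis. norm ((v \<bullet> b) *\<^sub>R T b))" by (rule norm_sum)
  also have "\<dots> \<le> (\<Sum>b\<in>Basis. norm (T b) * norm v)"
    by (rule sum_mono) (simp add: Basis_le_norm mult.commute[of _ "norm v"] mult_right_mono)
  finally show ?thesis by (simp add: sum_distrib_right)
qed

lemma C1_Lipschitz_bound:
  fixes F :: "'a::euclidean_space \<Rightarrow> 'b::euclidean_space"
  assumes "Ck_on (Suc 0) \<Omega> F" "open \<Omega>" "compact K" "convex K" "K \<subseteq> \<Omega>"
  obtains M where "M \<ge> 0" "\<And>p q. p \<in> K \<Longrightarrow> q \<in> K \<Longrightarrow> norm (F p - F q) \<le> M * norm (p - q)"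
proof -
  from assms(1) obtain D where D1: "\<And>x. x \<in> \<Omega> \<Longrightarrow> (F has_derivative D x) (at x within \<Omega>)"
    and D2: "\<And>v. Ck_on 0 \<Omega> (\<lambda>x. D x v)"
    by (rule Ck_on_SucE) blast
  have cont: "continuous_on K (\<lambda>x. \<Sum>b\<in>Basis. norm (D x b))"
    using D2 assms(5) by (intro continuous_intros) (auto intro: continuous_on_subset)
  then have "bounded ((\<lambda>x. \<Sum>b\<in>Basis. norm (D x b)) ` K)"
    by (intro compact_imp_bounded compact_continuous_image assms)
  then obtain M where M: "M > 0" "\<And>x. x \<in> K \<Longrightarrow> (\<Sum>b\<in>Basis. norm (D x b)) \<le> M"
    unfolding bounded_pos by (metis abs_le_D1 imageI real_norm_def)
  have "norm (F p - F q) \<le> M * norm (p - q)" if "p \<in> K" "q \<in> K" for p q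
  proof (rule differentiable_bound[OF \<open>convex K\<close>])
    fix x assume x: "x \<in> K"
    then have xO: "x \<in> \<Omega>" using assms(5) by blast
    show "(F has_derivative D x) (at x within K)" using D1[OF xO] assms(5) by (rule has_derivative_subset)
    have "norm (D x v) \<le> M * norm v" for v
      using bounded_linear_basis_bound[OF has_derivative_linear[OF D1[OF xO]], of v] M(2)[OF x]
      by (smt (verit, best) mult_right_mono norm_ge_zero)
    then show "onorm (D x) \<le> M" by (rule onorm_le)
  qed (use that in auto)
  then show thesis using that[of M] M(1) by simp
qed

text \<open>On the axis \<open>x = 0\<close> the partial derivative in \<open>y\<close> equals
  \<open>P\<close>. As this partial derivative is Lipschitz, its distance from \<open>P\<close> is
  at most a multiple of the norm of \<open>x\<close>; the mean value inequality in \<open>y\<close>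
  then gives the product bound.\<close>

lemma bilinear_estimate_right:
  fixes \<mu> :: "'a::euclidean_space \<times> 'a \<Rightarrow> 'a"
  assumes O: "open \<Omega>" "(0,0) \<in> \<Omega>" and mu: "Ck_on 2 \<Omega> \<mu>" and P: "linear P"
    and m0: "\<And>y. (0,y) \<in> \<Omega> \<Longrightarrow> \<mu> (0,y) = P y"
  obtains r C where "r > 0" "C \<ge> 0" "cball 0 r \<times> cball 0 r \<subseteq> \<Omega>"
    "\<And>x y y'. norm x \<le> r \<Longrightarrow> norm y \<le> r \<Longrightarrow> norm y' \<le> r \<Longrightarrow>
       norm (\<mu> (x,y) - \<mu> (x,y') - P (y - y')) \<le> C * norm x * norm (y - y')"
proof -
  obtain A B where AB: "open A" "open B" "(0,0) \<in> A \<times> B" "A \<times> B \<subseteq> \<Omega>"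
    using open_prod_elim[OF O] by blast
  obtain r1 r2 where r12: "r1 > 0" "cball 0 r1 \<subseteq> A" "r2 > 0" "cball 0 r2 \<subseteq> B"
    using AB by (metis mem_Sigma_iff open_contains_cball)
  define r where "r = min r1 r2"
  have r: "r > 0" "cball 0 r \<times> cball 0 r \<subseteq> \<Omega>" using r12 AB by (auto simp: r_def subset_eq)
  from mu have "Ck_on (Suc (Suc 0)) \<Omega> \<mu>" by (simp add: numeral_2_eq_2)
  then obtain D where D1: "\<And>x. x \<in> \<Omega> \<Longrightarrow> (\<mu> has_derivative D x) (at x within \<Omega>)"
    and D2: "\<And>v. Ck_on (Suc 0) \<Omega> (\<lambda>x. D x v)"
    by (rule Ck_on_SucE) blast
  have D: "(\<mu> has_derivative D x) (at x)" if "x \<in> \<Omega>" for x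
    using D1[OF that] that O(1) by (simp add: at_within_open[of _ \<Omega>])
  have part: "((\<lambda>y. \<mu> (x,y)) has_derivative (\<lambda>v. D (x,y) (0,v))) (at y)" if "(x,y) \<in> \<Omega>" for x y
  proof -
    have "((\<lambda>y. (x,y)) has_derivative (\<lambda>v. (0,v))) (at y)" by (auto intro!: derivative_eq_intros)
    from has_derivative_compose[OF this, of \<mu> "D (x,y)"] D[OF that] show ?thesis by simp
  qed
  have D0: "D (0,y) (0,v) = P v" if y: "(0,y) \<in> \<Omega>" for y v
  proof -
    have "open ((\<lambda>y. (0,y)) -` \<Omega>)" by (intro continuous_open_vimage O continuous_intros)
    moreover have "(P has_derivative P) (at y)" 
      using P by (simp add: linear_conv_bounded_linear bounded_linear_imp_has_derivative)
    ultimately have "((\<lambda>y. \<mu> (0,y)) has_derivative P) (at y)"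
      using m0 y by (auto intro: has_derivative_transform_within_open)
    with part[OF y] have "(\<lambda>v. D (0,y) (0,v)) = P" by (rule has_derivative_unique)
    then show ?thesis by metis
  qed
  let ?K = "cball (0::'a) r \<times> cball (0::'a) r"
  \<comment> \<open>One Lipschitz constant for each of the finitely many basis directions; their sum
    bounds the operator norm and becomes \<open>C\<close>.\<close>
  have "\<exists>M\<ge>0. \<forall>p\<in>?K. \<forall>q\<in>?K. norm (D p (0,b) - D q (0,b)) \<le> M * norm (p - q)" for b
    by (rule C1_Lipschitz_bound[OF D2[of "(0,b)"] O(1), of ?K])
      (use r in \<open>auto intro: compact_Times convex_Times\<close>)
  then obtain M where M: "\<And>b. M b \<ge> 0"
     "\<And>b p q. p \<in> ?K \<Longrightarrow> q \<in> ?K \<Longrightarrow> norm (D p (0,b) - D q (0,b)) \<le> M b * norm (p - q)"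
    by metis
  define C where "C = (\<Sum>b\<in>Basis. M b)"
  have est: "norm (D (x,y) (0,v) - P v) \<le> C * norm x * norm v" if x: "norm x \<le> r" and y: "norm y \<le> r" for x y v
  proof -
    have xy: "(x,y) \<in> ?K" "(0,y) \<in> ?K" using x y r(1) by auto
    define T where "T v = D (x,y) (0,v) - P v" for v
    have lD: "linear (D (x,y))" using D xy r(2) has_derivative_linear by blast
    have "linear (\<lambda>v. D (x,y) (0,v))"
      using linear_compose[of "\<lambda>v. (0,v)" "D (x,y)"] lD
      by (simp add: o_def linear_iff)
    then have lT: "linear T" unfolding T_def by (intro linear_compose_sub P)
    have "norm (T b) \<le> M b * norm x" for b
    proof -
      have "(0,y) \<in> \<Omega>" using r(2) xy(2) by blast
      from D0[OF this, of b] show ?thesis using M(2)[OF xy, of b] by (simp add: T_def norm_Pair)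
    qed
    then have "(\<Sum>b\<in>Basis. norm (T b)) \<le> C * norm x" unfolding C_def sum_distrib_right by (rule sum_mono)
    then show ?thesis using bounded_linear_basis_bound[OF lT, of v]
      by (smt (verit, best) T_def mult_right_mono norm_ge_zero)
  qed
  have "norm (\<mu> (x,y) - \<mu> (x,y') - P (y - y')) \<le> C * norm x * norm (y - y')"
    if x: "norm x \<le> r" and y: "norm y \<le> r" "norm y' \<le> r" for x y y'
  proof -
    have "norm ((\<mu> (x,y) - P y) - (\<mu> (x,y') - P y')) \<le> C * norm x * norm (y - y')"
    proof (rule differentiable_bound[of "cball 0 r"])
      fix z :: 'a assume z: "z \<in> cball 0 r"
      then have "(x,z) \<in> \<Omega>" using x r(2) by auto
      then have "((\<lambda>y. \<mu> (x,y) - P y) has_derivative (\<lambda>v. D (x,z) (0,v) - P v)) (at z)"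
        using P by (intro has_derivative_diff part bounded_linear_imp_has_derivative) (simp_all add: linear_conv_bounded_linear)
      then show "((\<lambda>y. \<mu> (x,y) - P y) has_derivative (\<lambda>v. D (x,z) (0,v) - P v)) (at z within cball 0 r)"
        by (rule has_derivative_at_withinI)
      show "onorm (\<lambda>v. D (x,z) (0,v) - P v) \<le> C * norm x"
        by (rule onorm_le) (use est[OF x] z in auto)
    qed (use y in auto)
    then show ?thesis using P by (simp add: linear_diff algebra_simps)
  qed
  moreover have "C \<ge> 0" unfolding C_def using M(1) by (simp add: sum_nonneg)
  ultimately show thesis using that r by blast
qed

lemma bilinear_estimate:
  fixes \<mu> :: "'a::euclidean_space \<times> 'a \<Rightarrow> 'a"
  assumes O: "open \<Omega>" "(0,0) \<in> \<Omega>" and mu: "Ck_on 2 \<Omega> \<mu>" and P: "linear P"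
    and m0: "\<And>y. (0,y) \<in> \<Omega> \<Longrightarrow> \<mu> (0,y) = P y" "\<And>x. (x,0) \<in> \<Omega> \<Longrightarrow> \<mu> (x,0) = P x"
  obtains r C where "r > 0" "C > 0" "cball 0 r \<times> cball 0 r \<subseteq> \<Omega>"
    "\<And>x y y'. norm x \<le> r \<Longrightarrow> norm y \<le> r \<Longrightarrow> norm y' \<le> r \<Longrightarrow>
       norm (\<mu> (x,y) - \<mu> (x,y') - P (y - y')) \<le> C * norm x * norm (y - y')"
    "\<And>x x' y. norm x \<le> r \<Longrightarrow> norm x' \<le> r \<Longrightarrow> norm y \<le> r \<Longrightarrow>
       norm (\<mu> (x,y) - \<mu> (x',y) - P (x - x')) \<le> C * norm y * norm (x - x')"
proof -
  obtain r C where 1: "r > 0" "C \<ge> 0" "cball 0 r \<times> cball 0 r \<subseteq> \<Omega>"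
    "\<And>x y y'. norm x \<le> r \<Longrightarrow> norm y \<le> r \<Longrightarrow> norm y' \<le> r \<Longrightarrow>
       norm (\<mu> (x,y) - \<mu> (x,y') - P (y - y')) \<le> C * norm x * norm (y - y')"
    using bilinear_estimate_right[OF O mu P m0(1)] by blast
  have bl: "bounded_linear (prod.swap :: 'a \<times> 'a \<Rightarrow> _)"
    unfolding linear_conv_bounded_linear[symmetric] by (simp add: linear_iff)
  have c: "Ck_on 2 (prod.swap -` \<Omega>) (\<lambda>p. \<mu> (prod.swap p))"
    by (rule Ck_on_compose[OF _ Ck_on_bounded_linear[OF bl] mu]) auto
  have o: "open (prod.swap -` \<Omega>)"
    by (intro continuous_open_vimage O linear_continuous_at bl)
  obtain r' C' where 2: "r' > 0" "C' \<ge> 0" "cball 0 r' \<times> cball 0 r' \<subseteq> prod.swap -` \<Omega>"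
    "\<And>x y y'. norm x \<le> r' \<Longrightarrow> norm y \<le> r' \<Longrightarrow> norm y' \<le> r' \<Longrightarrow>
       norm (\<mu> (y,x) - \<mu> (y',x) - P (y - y')) \<le> C' * norm x * norm (y - y')"
    using bilinear_estimate_right[OF o _ c P] O(2) m0(2) by auto
  show thesis
  \<comment> \<open>The summand 1 makes the constant strictly positive, because a radius is later
    chosen with the help of \<open>1 / C\<close>.\<close>
  proof (rule that[of "min r r'" "C + C' + 1"])
    show "min r r' > 0" "C + C' + 1 > 0" using 1 2 by auto
    show "cball 0 (min r r') \<times> cball 0 (min r r') \<subseteq> \<Omega>" using 1(3) by auto
    show "norm (\<mu> (x,y) - \<mu> (x,y') - P (y - y')) \<le> (C + C' + 1) * norm x * norm (y - y')"
      if "norm x \<le> min r r'" "norm y \<le> min r r'" "norm y' \<le> min r r'" for x y y'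
    proof -
      have "C * (norm x * norm (y - y')) \<le> (C + C' + 1) * (norm x * norm (y - y'))"
        using 2(2) by (intro mult_right_mono) auto
      then show ?thesis using 1(4)[of x y y'] that by (simp add: mult.assoc)
    qed
    show "norm (\<mu> (x,y) - \<mu> (x',y) - P (x - x')) \<le> (C + C' + 1) * norm y * norm (x - x')"
      if "norm x \<le> min r r'" "norm x' \<le> min r r'" "norm y \<le> min r r'" for x x' y
    proof -
      have "C' * (norm y * norm (x - x')) \<le> (C + C' + 1) * (norm y * norm (x - x'))"
        using 1(2) by (intro mult_right_mono) auto
      then show ?thesis using 2(4)[of y x x'] that by (simp add: mult.assoc)
    qed
  qed
qed


section \<open>Orthogonal projection onto a subspace\<close>

definition onb :: "'a::euclidean_space set \<Rightarrow> 'a set" where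
  "onb S = (SOME B. finite B \<and> B \<subseteq> S \<and> pairwise orthogonal B \<and> (\<forall>x\<in>B. norm x = 1) \<and> span B = S)"

definition proj :: "'a::euclidean_space set \<Rightarrow> 'a \<Rightarrow> 'a" where
  "proj S x = (\<Sum>b\<in>onb S. (x \<bullet> b) *\<^sub>R b)"

lemma onb:
  assumes "subspace S"
  shows "finite (onb S)" "onb S \<subseteq> S" "pairwise orthogonal (onb S)" "\<And>x. x \<in> onb S \<Longrightarrow> norm x = 1"
    "span (onb S) = S"
proof -
  obtain B where "B \<subseteq> S" "pairwise orthogonal B" "\<And>x. x \<in> B \<Longrightarrow> norm x = 1" "independent B" "span B = S"
    using orthonormal_basis_subspace[OF assms] by metis
  then have "\<exists>B. finite B \<and> B \<subseteq> S \<and> pairwise orthogonal B \<and> (\<forall>x\<in>B. norm x = 1) \<and> span B = S"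
    using independent_bound by blast
  from someI_ex[OF this] show "finite (onb S)" "onb S \<subseteq> S" "pairwise orthogonal (onb S)"
    "\<And>x. x \<in> onb S \<Longrightarrow> norm x = 1" "span (onb S) = S"
    unfolding onb_def by blast+
qed

lemma linear_proj: "linear (proj S)"
  unfolding proj_def linear_iff
  by (auto simp: inner_add_left scaleR_add_left sum.distrib scaleR_sum_right)

lemma bounded_linear_proj: "bounded_linear (proj S)"
  using linear_proj linear_conv_bounded_linear by blast

lemma proj_in: "subspace S \<Longrightarrow> proj S x \<in> S"
  unfolding proj_def using onb[of S] by (auto intro!: subspace_sum subspace_scale)

lemma inner_proj_onb:
  assumes "subspace S" "c \<in> onb S" shows "proj S x \<bullet> c = x \<bullet> c"
proof -
  have "proj S x \<bullet> c = (\<Sum>b\<in>onb S. (x \<bullet> b) * (b \<bullet> c))" by (simp add: proj_def inner_sum_left)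
  also have "\<dots> = (\<Sum>b\<in>onb S. if b = c then x \<bullet> c else 0)"
  proof (rule sum.cong)
    fix b assume "b \<in> onb S"
    then show "(x \<bullet> b) * (b \<bullet> c) = (if b = c then x \<bullet> c else 0)"
      using onb(3)[OF assms(1)] onb(4)[OF assms] assms(2)
      by (auto simp: pairwise_def orthogonal_def dot_square_norm)
  qed simp
  also have "\<dots> = x \<bullet> c" using onb(1)[OF assms(1)] assms(2) by simp
  finally show ?thesis .
qed

lemma proj_orthogonal:
  assumes "subspace S" "y \<in> S" shows "(x - proj S x) \<bullet> y = 0"
proof -
  have "orthogonal (x - proj S x) y"
    by (rule orthogonal_to_span[of _ "onb S"])
      (use assms onb(5)[OF assms(1)] inner_proj_onb[OF assms(1)] in \<open>auto simp: orthogonal_def inner_diff_left\<close>)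
  then show ?thesis by (simp add: orthogonal_def)
qed

lemma proj_id: assumes "subspace S" "x \<in> S" shows "proj S x = x"
proof -
  have "x - proj S x \<in> S" using assms proj_in subspace_diff by blast
  then have "(x - proj S x) \<bullet> (x - proj S x) = 0" using proj_orthogonal[OF assms(1)] by blast
  then show ?thesis by simp
qed

lemma openin_subspace_vimage:
  assumes "openin (top_of_set E) S" "continuous_on UNIV Q" "range Q \<subseteq> E"
  shows "open (Q -` S)"
proof -
  obtain T where "open T" "S = E \<inter> T" using assms(1) openin_open by blast
  moreover then have "Q -` S = Q -` T" using assms(3) by auto
  ultimately show ?thesis using assms(2) by (simp add: open_vimage)
qed

lemma smooth_on_vimage:
  assumes "smooth_on S f" "bounded_linear Q"
  shows "smooth_on (Q -` S) (\<lambda>x. f (Q x))"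
  by (rule smooth_on_compose[OF smooth_on_bounded_linear[OF assms(2)] assms(1)]) auto

section \<open>Charts and the manifold topology\<close>

lemma smooth_mapD:
  assumes "smooth_map M N f" "c \<in> atlas M" "d \<in> atlas N"
  shows "openin (top_of_set (model M)) (snd c ` (fst c \<inter> f -` fst d))"
    "smooth_on (snd c ` (fst c \<inter> f -` fst d)) (snd d \<circ> f \<circ> inv_into (fst c) (snd c))"
  using assms unfolding smooth_map_def by (cases c; cases d; fastforce)+

lemma smooth_atlasD:
  assumes "smooth_atlas E A" "c \<in> A"
  shows "inj_on (snd c) (fst c)" "openin (top_of_set E) (snd c ` fst c)" "snd c ` fst c \<subseteq> E"
proof -
  show "inj_on (snd c) (fst c)" and o: "openin (top_of_set E) (snd c ` fst c)"
    using assms unfolding smooth_atlas_def by (cases c; fastforce)+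
  show "snd c ` fst c \<subseteq> E" using o openin_imp_subset by blast
qed

text \<open>The cylinder over the chart image in the directions orthogonal to the model space.
  Together with \<open>cinv\<close>, which is constant in those directions, it turns a chart of a
  manifold modelled on a subspace into data on an open set of the full type.\<close>

definition cdom :: "'e::euclidean_space set \<Rightarrow> 'p set \<times> ('p \<Rightarrow> 'e) \<Rightarrow> 'e set" where
  "cdom E c = {x. proj E x \<in> snd c ` fst c}"

definition cinv :: "'e::euclidean_space set \<Rightarrow> 'p set \<times> ('p \<Rightarrow> 'e) \<Rightarrow> 'e \<Rightarrow> 'p" where
  "cinv E c x = inv_into (fst c) (snd c) (proj E x)"

lemma cinv_in: "x \<in> cdom E c \<Longrightarrow> cinv E c x \<in> fst c"
  unfolding cdom_def cinv_def by (auto intro: inv_into_into)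

lemma chart_cinv: "x \<in> cdom E c \<Longrightarrow> snd c (cinv E c x) = proj E x"
  unfolding cdom_def cinv_def by (auto intro: f_inv_into_f)

lemma continuous_on_proj: "continuous_on S (proj E)"
  by (rule linear_continuous_on[OF bounded_linear_proj])

lemma range_proj: "subspace E \<Longrightarrow> range (proj E) \<subseteq> E"
  using proj_in by blast

lemma open_cdom: "subspace E \<Longrightarrow> smooth_atlas E A \<Longrightarrow> c \<in> A \<Longrightarrow> open (cdom E c)"
  using openin_subspace_vimage[OF smooth_atlasD(2) continuous_on_proj range_proj]
  by (simp add: cdom_def vimage_def)

lemma chart_in:
  assumes "smooth_atlas E A" "c \<in> A" "subspace E" "p \<in> fst c"
  shows "snd c p \<in> cdom E c" "cinv E c (snd c p) = p" "proj E (snd c p) = snd c p" "snd c p \<in> E"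
proof -
  show 1: "snd c p \<in> E" using smooth_atlasD(3)[OF assms(1,2)] assms(4) by blast
  show 2: "proj E (snd c p) = snd c p" using 1 assms(3) proj_id by blast
  show "snd c p \<in> cdom E c" "cinv E c (snd c p) = p"
    using 2 assms(4) smooth_atlasD(1)[OF assms(1,2)] by (auto simp: cdom_def cinv_def)
qed

lemma points_chart: "p \<in> points M \<longleftrightarrow> (\<exists>c\<in>atlas M. p \<in> fst c)"
  by (auto simp: points_def case_prod_beta)

lemma image_Int_vimage_inv_into:
  assumes "inj_on \<phi> U" shows "\<phi> ` (U \<inter> f -` V) = {x \<in> \<phi> ` U. f (inv_into U \<phi> x) \<in> V}"
proof (intro equalityI subsetI)
  fix x assume "x \<in> \<phi> ` (U \<inter> f -` V)"
  then show "x \<in> {x \<in> \<phi> ` U. f (inv_into U \<phi> x) \<in> V}" using inv_into_f_f[OF assms] by auto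
next
  fix x assume "x \<in> {x \<in> \<phi> ` U. f (inv_into U \<phi> x) \<in> V}"
  then have "inv_into U \<phi> x \<in> U \<inter> f -` V" "\<phi> (inv_into U \<phi> x) = x"
    by (auto intro: inv_into_into f_inv_into_f)
  then show "x \<in> \<phi> ` (U \<inter> f -` V)" by (metis imageI)
qed

lemma smooth_map_charts:
  assumes f: "smooth_map M N f" and "c \<in> atlas M" "d \<in> atlas N" 
    and M: "subspace (model M)" "smooth_atlas (model M) (atlas M)"
  defines "W \<equiv> {x \<in> cdom (model M) c. f (cinv (model M) c x) \<in> fst d}"
  shows "open W" "smooth_on W (\<lambda>x. snd d (f (cinv (model M) c x)))"
proof -
  let ?S = "snd c ` (fst c \<inter> f -` fst d)"
  have inj: "inj_on (snd c) (fst c)" using smooth_atlasD(1) assms by blast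
  have W: "W = proj (model M) -` ?S"
    unfolding W_def cdom_def cinv_def image_Int_vimage_inv_into[OF inj] by auto
  show "open W" unfolding W
    by (rule openin_subspace_vimage[OF smooth_mapD(1)[OF assms(1-3)] continuous_on_proj range_proj[OF M(1)]])
  show "smooth_on W (\<lambda>x. snd d (f (cinv (model M) c x)))"
    using smooth_on_vimage[OF smooth_mapD(2)[OF assms(1-3)] bounded_linear_proj, of "model M"]
    unfolding W by (simp add: cinv_def)
qed

lemma inv_into_map_prod:
  assumes "inj_on f A" "inj_on g B" "x \<in> f ` A" "y \<in> g ` B"
  shows "inv_into (A \<times> B) (map_prod f g) (x, y) = (inv_into A f x, inv_into B g y)"
proof -
  have "inj_on (map_prod f g) (A \<times> B)" using assms by (auto simp: inj_on_def)
  moreover have "(inv_into A f x, inv_into B g y) \<in> A \<times> B" using assms by (auto intro: inv_into_into)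
  moreover have "map_prod f g (inv_into A f x, inv_into B g y) = (x, y)" using assms by (auto simp: f_inv_into_f)
  ultimately show ?thesis by (metis inv_into_f_f)
qed

lemma smooth_map2_charts:
  assumes f: "smooth_map (prod_mfd M N) K f" and c: "c \<in> atlas M" "d \<in> atlas N" "k \<in> atlas K"
    and M: "subspace (model M)" "smooth_atlas (model M) (atlas M)"
    and N: "subspace (model N)" "smooth_atlas (model N) (atlas N)"
  defines "W \<equiv> {p. fst p \<in> cdom (model M) c \<and> snd p \<in> cdom (model N) d \<and>
      f (cinv (model M) c (fst p), cinv (model N) d (snd p)) \<in> fst k}"
  shows "open W" "smooth_on W (\<lambda>p. snd k (f (cinv (model M) c (fst p), cinv (model N) d (snd p))))"
proof -
  let ?cd = "(fst c \<times> fst d, map_prod (snd c) (snd d))"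
  let ?Q = "\<lambda>p. (proj (model M) (fst p), proj (model N) (snd p))"
  have cd: "?cd \<in> atlas (prod_mfd M N)" unfolding prod_mfd_def using c by (cases c; cases d) auto
  let ?S = "snd ?cd ` (fst ?cd \<inter> f -` fst k)"
  note inj = smooth_atlasD(1)[OF M(2) c(1)] smooth_atlasD(1)[OF N(2) c(2)]
  have injcd: "inj_on (snd ?cd) (fst ?cd)" using inj by (auto simp: inj_on_def)
  have im: "snd ?cd ` fst ?cd = snd c ` fst c \<times> snd d ` fst d" by auto
  have W: "W = ?Q -` ?S"
  proof (rule Set.set_eqI)
    fix p
    show "p \<in> W \<longleftrightarrow> p \<in> ?Q -` ?S"
      unfolding image_Int_vimage_inv_into[OF injcd] im W_def cdom_def cinv_def
      using inv_into_map_prod[OF inj, of "proj (model M) (fst p)" "proj (model N) (snd p)"] by auto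
  qed
  have bl: "bounded_linear ?Q"
    by (intro bounded_linear_Pair bounded_linear_compose[OF bounded_linear_proj] bounded_linear_fst bounded_linear_snd)
  have m: "model (prod_mfd M N) = model M \<times> model N" by (simp add: prod_mfd_def)
  show "open W" unfolding W
    by (rule openin_subspace_vimage[OF smooth_mapD(1)[OF f cd c(3), unfolded m]])
      (use M N linear_continuous_on[OF bl] in \<open>auto intro: proj_in\<close>)
  have s: "smooth_on W (\<lambda>x. (snd k \<circ> f \<circ> inv_into (fst ?cd) (snd ?cd)) (?Q x))"
    using smooth_on_vimage[OF smooth_mapD(2)[OF f cd c(3)] bl]
    unfolding W .
  show "smooth_on W (\<lambda>p. snd k (f (cinv (model M) c (fst p), cinv (model N) d (snd p))))"
  proof (rule smooth_on_cong[THEN iffD1, OF _ s])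
    fix p assume "p \<in> W"
    then show "(snd k \<circ> f \<circ> inv_into (fst ?cd) (snd ?cd)) (?Q p) = snd k (f (cinv (model M) c (fst p), cinv (model N) d (snd p)))"
      using inv_into_map_prod[OF inj, of "proj (model M) (fst p)" "proj (model N) (snd p)"]
      unfolding W_def cdom_def cinv_def by auto
  qed
qed

lemma openin_mtop_charts:
  assumes "smooth_atlas (model M) (atlas M)"
  shows "openin (mtop M) W \<longleftrightarrow> W \<subseteq> points M \<and>
     (\<forall>c\<in>atlas M. openin (top_of_set (model M)) (snd c ` (W \<inter> fst c)))"
  unfolding openin_mtop[OF assms] by fastforce

lemma topspace_mtop:
  assumes "smooth_atlas (model M) (atlas M)" shows "topspace (mtop M) = points M"
proof -
  have "openin (mtop M) (points M)" unfolding openin_mtop_charts[OF assms]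
  proof (intro conjI ballI)
    fix c assume c: "c \<in> atlas M"
    then have "points M \<inter> fst c = fst c" by (auto simp: points_def case_prod_beta)
    then show "openin (top_of_set (model M)) (snd c ` (points M \<inter> fst c))"
      using smooth_atlasD(2)[OF assms c] by simp
  qed simp
  moreover have "topspace (mtop M) \<subseteq> points M"
    using openin_mtop_charts[OF assms, of "topspace (mtop M)"] openin_topspace by blast
  ultimately show ?thesis by (metis openin_subset subset_antisym)
qed

text \<open>Transition maps are continuous, so openness in the model can be tested in a single chart.\<close>

lemma openin_mtop_chart_vimage:
  assumes M: "smooth_atlas (model M) (atlas M)" and c: "c \<in> atlas M"
    and S: "openin (top_of_set (model M)) S"
  shows "openin (mtop M) (fst c \<inter> snd c -` S)"
  unfolding openin_mtop_charts[OF M]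
proof (intro conjI ballI)
  show "fst c \<inter> snd c -` S \<subseteq> points M" using c by (auto simp: points_def case_prod_beta)
  fix d assume d: "d \<in> atlas M"
  have t: "openin (top_of_set (model M)) (snd d ` (fst d \<inter> fst c))"
    "smooth_on (snd d ` (fst d \<inter> fst c)) (snd c \<circ> inv_into (fst d) (snd d))"
    using M c d unfolding smooth_atlas_def case_prod_beta by blast+
  let ?A = "snd d ` (fst d \<inter> fst c)" and ?g = "snd c \<circ> inv_into (fst d) (snd d)"
  have inj: "inj_on (snd d) (fst d)" using smooth_atlasD(1)[OF M d] .
  have "?g ` ?A \<subseteq> model M" using inj smooth_atlasD(3)[OF M c] by fastforce
  then have "openin (top_of_set ?A) (?A \<inter> ?g -` S)"
    by (intro continuous_openin_preimage[OF smooth_on_imp_continuous_on[OF t(2)] _ S]) auto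
  then have "openin (top_of_set (model M)) (?A \<inter> ?g -` S)" using t(1) openin_trans by blast
  moreover have "?A \<inter> ?g -` S = snd d ` ((fst c \<inter> snd c -` S) \<inter> fst d)"
    using inj by (auto simp: image_iff)
  ultimately show "openin (top_of_set (model M)) (snd d ` ((fst c \<inter> snd c -` S) \<inter> fst d))" by simp
qed

lemma openin_mtop_chart: 
  assumes "smooth_atlas (model M) (atlas M)" "c \<in> atlas M" shows "openin (mtop M) (fst c)"
proof -
  have "fst c \<inter> snd c -` (snd c ` fst c) = fst c" by auto
  then show ?thesis using openin_mtop_chart_vimage[OF assms smooth_atlasD(2)[OF assms]] by simp
qed

text \<open>Stated for a pair of continuous maps into the two factors, so that the topology of
  \<open>prod_mfd\<close> never has to be compared with a product topology.\<close>

lemma smooth_map2_continuous: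
  assumes f: "smooth_map (prod_mfd M N) K f"
    and M: "smooth_atlas (model M) (atlas M)" and N: "smooth_atlas (model N) (atlas N)"
    and K: "smooth_atlas (model K) (atlas K)"
    and ab: "continuous_map X (mtop M) a" "continuous_map X (mtop N) b"
  shows "continuous_map X (mtop K) (\<lambda>x. f (a x, b x))"
  unfolding continuous_map_def
proof (intro conjI allI impI)
  have im: "(a x, b x) \<in> points (prod_mfd M N)" if "x \<in> topspace X" for x
  proof -
    have "a x \<in> points M" "b x \<in> points N" 
      using ab that topspace_mtop[OF M] topspace_mtop[OF N] by (auto simp: continuous_map_def)
    then obtain c d where "c \<in> atlas M" "a x \<in> fst c" "d \<in> atlas N" "b x \<in> fst d"
      unfolding points_chart by blast
    then have "(fst c \<times> fst d, map_prod (snd c) (snd d)) \<in> atlas (prod_mfd M N)" 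
      "(a x, b x) \<in> fst c \<times> fst d" unfolding prod_mfd_def by (cases c; cases d; auto)+
    then show ?thesis unfolding points_chart by (metis fst_conv)
  qed
  then show "(\<lambda>x. f (a x, b x)) \<in> topspace X \<rightarrow> topspace (mtop K)"
    using f topspace_mtop[OF K] unfolding smooth_map_def by blast
  fix W assume W: "openin (mtop K) W"
  show "openin X {x \<in> topspace X. f (a x, b x) \<in> W}"
  proof (subst openin_subopen, intro ballI)
    fix x assume "x \<in> {x \<in> topspace X. f (a x, b x) \<in> W}"
    then have x: "x \<in> topspace X" "f (a x, b x) \<in> W" by auto
    have "a x \<in> points M" "b x \<in> points N" "f (a x, b x) \<in> points K"
      using ab x W topspace_mtop[OF M] topspace_mtop[OF N] openin_mtop_charts[OF K] by (auto simp: continuous_map_def)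
    then obtain c d k where c: "c \<in> atlas M" "a x \<in> fst c" and d: "d \<in> atlas N" "b x \<in> fst d"
      and k: "k \<in> atlas K" "f (a x, b x) \<in> fst k"
      unfolding points_chart by blast
    define cd where "cd = (fst c \<times> fst d, map_prod (snd c) (snd d))"
    have fsc: "fst cd = fst c \<times> fst d" "snd cd = map_prod (snd c) (snd d)" by (simp_all add: cd_def)
    have cd: "cd \<in> atlas (prod_mfd M N)" unfolding prod_mfd_def cd_def using c d by (cases c; cases d; auto)
    have m: "model (prod_mfd M N) = model M \<times> model N" by (simp add: prod_mfd_def)
    let ?A = "snd cd ` (fst cd \<inter> f -` fst k)"
    define g where "g = snd k \<circ> f \<circ> inv_into (fst cd) (snd cd)"
    let ?S = "snd k ` (W \<inter> fst k)"
    note A = smooth_mapD[OF f cd k(1), unfolded m, folded g_def]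
    note ic = smooth_atlasD(1)[OF M c(1)] and id = smooth_atlasD(1)[OF N d(1)]
    have ik: "inj_on (snd k) (fst k)" using smooth_atlasD(1)[OF K k(1)] .
    have icd: "inj_on (snd cd) (fst cd)" using ic id by (auto simp: inj_on_def fsc)
    have S: "openin (top_of_set (model K)) ?S" using W k(1) openin_mtop_charts[OF K] by blast
    have gp: "g (snd cd p) = snd k (f p)" if "p \<in> fst cd" for p
      using inv_into_f_f[OF icd that] by (simp add: g_def)
    have "g ` ?A \<subseteq> model K"
    proof (rule image_subsetI, elim imageE IntE)
      fix z p assume z: "z = snd cd p" and p: "p \<in> fst cd" "p \<in> f -` fst k"
      show "g z \<in> model K" unfolding z gp[OF p(1)] using p(2) smooth_atlasD(3)[OF K k(1)] by blast
    qed
    then have "openin (top_of_set ?A) (?A \<inter> g -` ?S)"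
      using continuous_openin_preimage[OF smooth_on_imp_continuous_on[OF A(2)] _ S]
      unfolding image_subset_iff_funcset by blast
    then have oA: "openin (top_of_set (model M \<times> model N)) (?A \<inter> g -` ?S)" using A(1) openin_trans by blast
    have AS: "?A \<inter> g -` ?S = snd cd ` {p \<in> fst cd. f p \<in> W \<inter> fst k}"
    proof -
      have *: "g (snd cd p) \<in> ?S \<longleftrightarrow> f p \<in> W \<inter> fst k" if "p \<in> fst cd" "f p \<in> fst k" for p
        unfolding gp[OF that(1)] by (rule inj_on_image_mem_iff[OF ik that(2)]) simp
      show ?thesis
      proof (intro equalityI subsetI)
        fix z assume z: "z \<in> ?A \<inter> g -` ?S"
        then have "z \<in> ?A" by (rule IntD1)
        then obtain p where "z = snd cd p" "p \<in> fst cd \<inter> f -` fst k" by (rule imageE)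
        then have p: "z = snd cd p" "p \<in> fst cd" "f p \<in> fst k" by simp_all
        then have "f p \<in> W \<inter> fst k" using *[OF p(2,3)] z by simp
        then show "z \<in> snd cd ` {p \<in> fst cd. f p \<in> W \<inter> fst k}" using p by blast
      next
        fix z assume "z \<in> snd cd ` {p \<in> fst cd. f p \<in> W \<inter> fst k}"
        then obtain p where "z = snd cd p" "p \<in> {p \<in> fst cd. f p \<in> W \<inter> fst k}" by (rule imageE)
        then have p: "z = snd cd p" "p \<in> fst cd" "f p \<in> fst k" "f p \<in> W" by simp_all
        then have "g z \<in> ?S" using *[OF p(2,3)] by simp
        then show "z \<in> ?A \<inter> g -` ?S" using p by blast
      qed
    qed
    define Z where "Z = ?A \<inter> g -` ?S"
    note oA = oA[folded Z_def] and AS = AS[folded Z_def]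
    have mem: "(snd c (a x), snd d (b x)) \<in> Z"
    proof -
      have "(a x, b x) \<in> {p \<in> fst cd. f p \<in> W \<inter> fst k}" using c d k x by (simp add: fsc)
      then have "snd cd (a x, b x) \<in> snd cd ` {p \<in> fst cd. f p \<in> W \<inter> fst k}" by (rule imageI)
      then show ?thesis unfolding AS by (simp add: fsc)
    qed
    obtain T where T: "open T" "Z = (model M \<times> model N) \<inter> T" using oA openin_open by blast
    \<comment> \<open>A box inside the open set separates the two coordinates, so each can be
      controlled by the continuity of \<open>a\<close> or of \<open>b\<close> alone.\<close>
    then obtain C D where CD: "open C" "open D" "(snd c (a x), snd d (b x)) \<in> C \<times> D" "C \<times> D \<subseteq> T"
      using open_prod_elim[OF T(1)] mem by blast
    let ?Y = "{y \<in> topspace X. a y \<in> fst c \<inter> snd c -` (model M \<inter> C)} \<inter> {y \<in> topspace X. b y \<in> fst d \<inter> snd d -` (model N \<inter> D)}"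
    have "openin X ?Y"
      by (intro openin_Int openin_continuous_map_preimage[OF ab(1)] openin_continuous_map_preimage[OF ab(2)]
        openin_mtop_chart_vimage M N c d openin_open_Int CD)
    moreover have "x \<in> ?Y" using x c d CD smooth_atlasD(3)[OF M c(1)] smooth_atlasD(3)[OF N d(1)] by auto
    moreover have "?Y \<subseteq> {x \<in> topspace X. f (a x, b x) \<in> W}"
    proof clarify
      fix y assume y: "y \<in> topspace X" "a y \<in> fst c" "snd c (a y) \<in> model M" "snd c (a y) \<in> C"
        "b y \<in> fst d" "snd d (b y) \<in> model N" "snd d (b y) \<in> D"
      then have "snd cd (a y, b y) \<in> Z" using T(2) CD(4) by (auto simp: fsc)
      then obtain p where "snd cd (a y, b y) = snd cd p" "p \<in> {p \<in> fst cd. f p \<in> W \<inter> fst k}"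
        unfolding AS by (rule imageE)
      then have p: "p \<in> fst cd" "f p \<in> W" "snd cd p = snd cd (a y, b y)" by simp_all
      have "(a y, b y) \<in> fst cd" using y by (simp add: fsc)
      then have "p = (a y, b y)" using inj_onD[OF icd p(3) p(1)] by blast
      then show "f (a y, b y) \<in> W" using p by simp
    qed
    ultimately show "\<exists>T. openin X T \<and> x \<in> T \<and> T \<subseteq> {x \<in> topspace X. f (a x, b x) \<in> W}"
      by (intro exI[of _ ?Y] conjI)
  qed
qed

lemma smooth_map_continuous:
  assumes f: "smooth_map M N f"
    and M: "smooth_atlas (model M) (atlas M)" and N: "smooth_atlas (model N) (atlas N)"
  shows "continuous_map (mtop M) (mtop N) f"
  unfolding continuous_map_def
proof (intro conjI allI impI)
  show "f \<in> topspace (mtop M) \<rightarrow> topspace (mtop N)"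
    using f topspace_mtop[OF M] topspace_mtop[OF N] unfolding smooth_map_def by blast
  fix W assume W: "openin (mtop N) W"
  show "openin (mtop M) {x \<in> topspace (mtop M). f x \<in> W}"
  proof (subst openin_subopen, intro ballI)
    fix x assume "x \<in> {x \<in> topspace (mtop M). f x \<in> W}"
    then have x: "x \<in> points M" "f x \<in> W" using topspace_mtop[OF M] by auto
    have "f x \<in> points N" using x f unfolding smooth_map_def by blast
    then obtain c k where c: "c \<in> atlas M" "x \<in> fst c" and k: "k \<in> atlas N" "f x \<in> fst k"
      using x(1) unfolding points_chart by blast
    let ?A = "snd c ` (fst c \<inter> f -` fst k)"
    define g where "g = snd k \<circ> f \<circ> inv_into (fst c) (snd c)"
    let ?S = "snd k ` (W \<inter> fst k)"
    note A = smooth_mapD[OF f c(1) k(1), folded g_def]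
    note ic = smooth_atlasD(1)[OF M c(1)] and ik = smooth_atlasD(1)[OF N k(1)]
    have S: "openin (top_of_set (model N)) ?S" using W k(1) openin_mtop_charts[OF N] by blast
    have gp: "g (snd c p) = snd k (f p)" if "p \<in> fst c" for p
      using inv_into_f_f[OF ic that] by (simp add: g_def)
    have "g ` ?A \<subseteq> model N"
    proof (rule image_subsetI, elim imageE IntE)
      fix z p assume z: "z = snd c p" and p: "p \<in> fst c" "p \<in> f -` fst k"
      show "g z \<in> model N" unfolding z gp[OF p(1)] using p(2) smooth_atlasD(3)[OF N k(1)] by blast
    qed
    then have "openin (top_of_set ?A) (?A \<inter> g -` ?S)"
      using continuous_openin_preimage[OF smooth_on_imp_continuous_on[OF A(2)] _ S]
      unfolding image_subset_iff_funcset by blast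
    then have oA: "openin (top_of_set (model M)) (?A \<inter> g -` ?S)" using A(1) openin_trans by blast
    let ?Y = "fst c \<inter> snd c -` (?A \<inter> g -` ?S)"
    have "openin (mtop M) ?Y" by (rule openin_mtop_chart_vimage[OF M c(1) oA])
    moreover have "x \<in> ?Y" using c k x gp[OF c(2)] by simp
    moreover have "?Y \<subseteq> {x \<in> topspace (mtop M). f x \<in> W}"
    proof
      fix y assume y: "y \<in> ?Y"
      then have yc: "y \<in> fst c" by (rule IntD1)
      from y have "snd c y \<in> ?A" by simp
      then have fy: "f y \<in> fst k" using inj_on_image_mem_iff[OF ic yc] by simp
      from y have "g (snd c y) \<in> ?S" by simp
      then have "snd k (f y) \<in> ?S" unfolding gp[OF yc] .
      then have "f y \<in> W \<inter> fst k" using inj_on_image_mem_iff[OF ik fy, of "W \<inter> fst k"] by simp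
      moreover have "y \<in> points M" using yc c(1) points_chart by (simp add: points_chart) blast
      ultimately show "y \<in> {x \<in> topspace (mtop M). f x \<in> W}" using topspace_mtop[OF M] by simp
    qed
    ultimately show "\<exists>T. openin (mtop M) T \<and> x \<in> T \<and> T \<subseteq> {x \<in> topspace (mtop M). f x \<in> W}"
      by (intro exI[of _ ?Y] conjI)
  qed
qed

section \<open>Lie groups in the identity chart\<close>

locale lie_grp = group L for L :: "('g, 'e::euclidean_space) lie_group_data" (structure) +
  assumes lie: "lie_group L"
begin

abbreviation "E \<equiv> model (mfd L)"
abbreviation "c0 \<equiv> id_chart L"
abbreviation "U0 \<equiv> fst (id_chart L)"

lemma subE: "subspace E" and atl: "smooth_atlas E (atlas (mfd L))"
  and pts: "points (mfd L) = carrier L" and Hausdorff: "Hausdorff_space (mtop (mfd L))"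
  and mult_smooth: "smooth_map (prod_mfd (mfd L) (mfd L)) (mfd L) (\<lambda>(g, h). g \<otimes> h)"
  and inv_smooth: "smooth_map (mfd L) (mfd L) (\<lambda>g. inv g)"
  using lie unfolding lie_group_def smooth_manifold_def by auto

lemma topspace: "topspace (mtop (mfd L)) = carrier L"
  using topspace_mtop[OF atl] pts by simp

lemma chart_at: assumes "g \<in> carrier L" obtains c where "c \<in> atlas (mfd L)" "g \<in> fst c"
  using assms pts points_chart by metis

lemma chart_carrier: "c \<in> atlas (mfd L) \<Longrightarrow> g \<in> fst c \<Longrightarrow> g \<in> carrier L"
  unfolding pts[symmetric] points_chart by blast

lemma id_chart: "c0 \<in> atlas (mfd L)" "\<one> \<in> U0"
proof -
  obtain c where "c \<in> atlas (mfd L)" "\<one> \<in> fst c" using chart_at[OF one_closed] .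
  then have "\<exists>c. c \<in> atlas (mfd L) \<and> \<one> \<in> fst c" by blast
  from someI_ex[OF this] show "c0 \<in> atlas (mfd L)" "\<one> \<in> U0" unfolding id_chart_def by auto
qed

text \<open>The identity chart is translated so that the identity gets coordinate 0. Then 0 is the
  neutral element of the local group law and all estimates can be centred there.\<close>

definition a0 :: 'e where "a0 = snd c0 \<one>"
definition co :: "'g \<Rightarrow> 'e" where "co g = snd c0 g - a0"
definition pt :: "'e \<Rightarrow> 'g" where "pt x = cinv E c0 (a0 + x)"
definition O0 :: "'e set" where "O0 = {x. a0 + x \<in> cdom E c0}"

lemma a0E: "a0 \<in> E" and proj_a0: "proj E a0 = a0"
  unfolding a0_def using chart_in[OF atl id_chart(1) subE id_chart(2)] by auto

lemma U0_carrier: "g \<in> U0 \<Longrightarrow> g \<in> carrier L" using chart_carrier id_chart by blast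

lemma proj_add: "proj S (x + y) = proj S x + proj S y"
  by (rule linear_add[OF linear_proj])

lemma pt_in: "x \<in> O0 \<Longrightarrow> pt x \<in> U0" unfolding O0_def pt_def using cinv_in by blast

lemma co_pt: "x \<in> O0 \<Longrightarrow> co (pt x) = proj E x"
  unfolding O0_def pt_def co_def using chart_cinv[of "a0 + x" E c0] by (simp add: proj_add proj_a0)

lemma pt_co: assumes "g \<in> U0" shows "co g \<in> O0" "pt (co g) = g" "co g \<in> E"
  using chart_in[OF atl id_chart(1) subE assms] a0E subE
  by (auto simp: O0_def co_def pt_def intro: subspace_diff)

lemma co_one: "co \<one> = 0" by (simp add: co_def a0_def)

lemma O0: "open O0" "0 \<in> O0"
proof -
  have "O0 = (\<lambda>x. a0 + x) -` cdom E c0" by (auto simp: O0_def)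
  then show "open O0" using open_cdom[OF subE atl id_chart(1)]
    by (auto intro!: continuous_open_vimage continuous_intros)
  show "0 \<in> O0" using pt_co(1)[OF id_chart(2)] co_one by simp
qed

lemma pt_0: "pt 0 = \<one>" using pt_co(2)[OF id_chart(2)] co_one by simp

lemma pt_carrier: "x \<in> O0 \<Longrightarrow> pt x \<in> carrier L" using pt_in U0_carrier by blast

lemma proj_E: "x \<in> E \<Longrightarrow> proj E x = x" using proj_id subE by blast

text \<open>The domain on which the group law can be written in centred coordinates: both factors
  and their product stay in the identity chart.\<close>

definition Om :: "('e \<times> 'e) set" where
  "Om = {p. fst p \<in> O0 \<and> snd p \<in> O0 \<and> pt (fst p) \<otimes> pt (snd p) \<in> U0}"
definition mu :: "'e \<times> 'e \<Rightarrow> 'e" where "mu p = co (pt (fst p) \<otimes> pt (snd p))"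

lemma translate_smooth:
  fixes F :: "'a::euclidean_space \<Rightarrow> 'e" and b :: 'a
  assumes "open W" "smooth_on W F" "W' = (\<lambda>x. b + x) -` W"
  shows "open W'" "smooth_on W' (\<lambda>x. F (b + x) - a0)"
proof -
  show "open W'" unfolding assms(3) by (intro continuous_open_vimage assms continuous_intros)
  have "smooth_on W' (\<lambda>x. b + x)"
    by (intro smooth_on_add smooth_on_const smooth_on_bounded_linear bounded_linear_ident)
  then have "smooth_on W' (\<lambda>x. F (b + x))"
    by (rule smooth_on_compose[OF _ assms(2)]) (auto simp: assms(3))
  from smooth_on_add[OF this smooth_on_const[of W' "- a0"]]
  show "smooth_on W' (\<lambda>x. F (b + x) - a0)" by simp
qed

lemma Om: "open Om" "smooth_on Om mu"
proof -
  note * = smooth_map2_charts[OF mult_smooth id_chart(1) id_chart(1) id_chart(1) subE atl subE atl]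
  note ** = translate_smooth[OF *, of _ "(a0,a0)"]
  have eq: "Om = (\<lambda>x. (a0, a0) + x) -`
     {p. fst p \<in> cdom E c0 \<and> snd p \<in> cdom E c0 \<and>
        (case (cinv E c0 (fst p), cinv E c0 (snd p)) of (g, h) \<Rightarrow> g \<otimes> h) \<in> U0}"
    by (auto simp: Om_def O0_def pt_def)
  show "open Om" by (rule **(1)[OF eq])
  show "smooth_on Om mu"
    by (rule smooth_on_cong[THEN iffD1, OF _ **(2)[OF eq]]) (simp add: mu_def co_def pt_def)
qed

lemma map_smooth:
  assumes "smooth_map (mfd L) (mfd L) f"
  shows "open {x \<in> O0. f (pt x) \<in> U0}" "smooth_on {x \<in> O0. f (pt x) \<in> U0} (\<lambda>x. co (f (pt x)))"
proof -
  note ** = translate_smooth[OF smooth_map_charts[OF assms id_chart(1) id_chart(1) subE atl], of _ a0]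
  have eq: "{x \<in> O0. f (pt x) \<in> U0} = (\<lambda>x. a0 + x) -` {x \<in> cdom E c0. f (cinv E c0 x) \<in> U0}"
    by (auto simp: O0_def pt_def)
  show "open {x \<in> O0. f (pt x) \<in> U0}" by (rule **(1)[OF eq])
  show "smooth_on {x \<in> O0. f (pt x) \<in> U0} (\<lambda>x. co (f (pt x)))"
    by (rule smooth_on_cong[THEN iffD1, OF _ **(2)[OF eq]]) (simp add: co_def pt_def)
qed

lemma mu_0: "y \<in> O0 \<Longrightarrow> mu (0,y) = proj E y" "x \<in> O0 \<Longrightarrow> mu (x,0) = proj E x"
  unfolding mu_def by (simp_all add: pt_0 pt_carrier co_pt)

lemma Om_0: "(0,0) \<in> Om" by (simp add: Om_def O0 pt_0 id_chart)

lemma Om_D: "(x,y) \<in> Om \<Longrightarrow> x \<in> O0" "(x,y) \<in> Om \<Longrightarrow> y \<in> O0" "(x,y) \<in> Om \<Longrightarrow> pt x \<otimes> pt y \<in> U0"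
  "(x,y) \<in> Om \<Longrightarrow> pt (mu (x,y)) = pt x \<otimes> pt y" "(x,y) \<in> Om \<Longrightarrow> mu (x,y) \<in> E"
  by (auto simp: Om_def mu_def pt_co)

text \<open>The bounds are demanded on radius \<open>2 * r\<close> because a power of an element can
  have a coordinate up to twice its linear approximation. The condition
  \<open>C * r \<le> 1 / 2\<close> keeps the quadratic error below half of the linear term, which is
  what justifies that factor 2.\<close>

definition good_radius :: "real \<Rightarrow> real \<Rightarrow> bool" where
  "good_radius r C \<longleftrightarrow> r > 0 \<and> C > 0 \<and> C * r \<le> 1 / 2 \<and> cball 0 (2 * r) \<times> cball 0 (2 * r) \<subseteq> Om \<and>
    cball 0 (2 * r) \<subseteq> {x \<in> O0. inv (pt x) \<in> U0} \<and>
    (\<forall>x y y'. norm x \<le> 2 * r \<longrightarrow> norm y \<le> 2 * r \<longrightarrow> norm y' \<le> 2 * r \<longrightarrow>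
       norm (mu (x,y) - mu (x,y') - proj E (y - y')) \<le> C * norm x * norm (y - y')) \<and>
    (\<forall>x x' y. norm x \<le> 2 * r \<longrightarrow> norm x' \<le> 2 * r \<longrightarrow> norm y \<le> 2 * r \<longrightarrow>
       norm (mu (x,y) - mu (x',y) - proj E (x - x')) \<le> C * norm y * norm (x - x'))"

lemma ex_good_radius: "\<exists>r C. good_radius r C"
proof -
  have m0: "\<And>y. (0,y) \<in> Om \<Longrightarrow> mu (0,y) = proj E y" "\<And>x. (x,0) \<in> Om \<Longrightarrow> mu (x,0) = proj E x"
    using mu_0 Om_D(1,2) by auto
  obtain r C where r: "r > 0" "C > 0" "cball 0 r \<times> cball 0 r \<subseteq> Om"
    "\<And>x y y'. norm x \<le> r \<Longrightarrow> norm y \<le> r \<Longrightarrow> norm y' \<le> r \<Longrightarrow>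
       norm (mu (x,y) - mu (x,y') - proj E (y - y')) \<le> C * norm x * norm (y - y')"
    "\<And>x x' y. norm x \<le> r \<Longrightarrow> norm x' \<le> r \<Longrightarrow> norm y \<le> r \<Longrightarrow>
       norm (mu (x,y) - mu (x',y) - proj E (x - x')) \<le> C * norm y * norm (x - x')"
    by (rule bilinear_estimate[OF Om(1) Om_0 smooth_on_Ck[OF Om(2)] linear_proj m0]; (assumption | rule that; blast)?) 
  have "0 \<in> {x \<in> O0. inv (pt x) \<in> U0}" by (simp add: O0 pt_0 id_chart)
  then obtain r' where r': "r' > 0" "cball 0 r' \<subseteq> {x \<in> O0. inv (pt x) \<in> U0}"
    using map_smooth(1)[OF inv_smooth] unfolding open_contains_cball by blast
  define q where "q = min (min r r') (1 / C) / 2"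
  have q: "q > 0" "2 * q \<le> r" "2 * q \<le> r'" "C * q \<le> 1 / 2"
  proof -
    have m: "2 * q \<le> r" "2 * q \<le> r'" "2 * q \<le> 1 / C" by (auto simp: q_def)
    then show "2 * q \<le> r" "2 * q \<le> r'" by auto
    show "q > 0" using r(1,2) r'(1) by (simp add: q_def)
    have "C * (2 * q) \<le> C * (1 / C)" using m(3) r(2) by (intro mult_left_mono) auto
    then show "C * q \<le> 1 / 2" using r(2) by simp
  qed
  have cb: "cball 0 (2 * q) \<subseteq> (cball 0 r :: 'e set)" "cball 0 (2 * q) \<subseteq> (cball 0 r' :: 'e set)" using q by auto
  have "good_radius q C" unfolding good_radius_def
  proof (intro conjI allI impI)
    show "cball 0 (2 * q) \<times> cball 0 (2 * q) \<subseteq> Om" using cb(1) r(3) by blast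
    show "cball 0 (2 * q) \<subseteq> {x \<in> O0. inv (pt x) \<in> U0}" using cb(2) r'(2) by blast
  qed (use r(1,2,4,5) q in auto)
  then show ?thesis by blast
qed

definition rad where "rad = (SOME r. \<exists>C. good_radius r C)"
definition CC where "CC = (SOME C. good_radius rad C)"

lemma good: "good_radius rad CC"
proof -
  have "\<exists>C. good_radius rad C" unfolding rad_def by (rule someI_ex[OF ex_good_radius])
  then show ?thesis unfolding CC_def by (rule someI_ex)
qed

lemma rad: "rad > 0" "CC > 0" "CC * rad \<le> 1 / 2"
  "norm x \<le> 2 * rad \<Longrightarrow> norm y \<le> 2 * rad \<Longrightarrow> (x,y) \<in> Om"
  "norm x \<le> 2 * rad \<Longrightarrow> x \<in> O0" "norm x \<le> 2 * rad \<Longrightarrow> inv (pt x) \<in> U0"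
  "norm x \<le> 2 * rad \<Longrightarrow> norm y \<le> 2 * rad \<Longrightarrow> norm y' \<le> 2 * rad \<Longrightarrow>
       norm (mu (x,y) - mu (x,y') - proj E (y - y')) \<le> CC * norm x * norm (y - y')"
  "norm x \<le> 2 * rad \<Longrightarrow> norm x' \<le> 2 * rad \<Longrightarrow> norm y \<le> 2 * rad \<Longrightarrow>
       norm (mu (x,y) - mu (x',y) - proj E (x - x')) \<le> CC * norm y * norm (x - x')"
  using good unfolding good_radius_def by (auto simp: subset_iff)

lemma mu_sub_r: assumes "x \<in> E" "y \<in> E" "norm x \<le> 2 * rad" "norm y \<le> 2 * rad"
  shows "norm (mu (x,y) - x - y) \<le> CC * norm x * norm y"
  using rad(7)[of x y 0] assms rad(1,5) by (simp add: mu_0 proj_E)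

text \<open>One more factor adds an error of at most \<open>CC\<close> times the norms of the
  \<open>n\<close>-th power and of \<open>x\<close>, hence \<open>2 CC n\<close> times the squared
  norm of \<open>x\<close>; the quadratic bound closes because
  \<open>n\<^sup>2 + 2 n \<le> (n + 1)\<^sup>2\<close>. The bound by twice the linear size keeps the
  next power inside the good ball.\<close>

lemma power_estimate:
  assumes x: "x \<in> E"
  shows "real n * norm x \<le> rad \<Longrightarrow> pt x [^] n \<in> U0 \<and> norm (co (pt x [^] n) - real n *\<^sub>R x) \<le> CC * (real n * norm x)\<^sup>2
    \<and> norm (co (pt x [^] n)) \<le> 2 * (real n * norm x)"
proof (induction n)
  case 0
  then show ?case by (simp add: id_chart co_one)
next
  case (Suc n)
  let ?p = "co (pt x [^] n)"
  have nx: "real n * norm x \<le> real (Suc n) * norm x" by (intro mult_right_mono) auto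
  then have IH: "pt x [^] n \<in> U0" "norm (?p - real n *\<^sub>R x) \<le> CC * (real n * norm x)\<^sup>2" "norm ?p \<le> 2 * (real n * norm x)"
    using Suc by auto
  have "norm x \<le> real (Suc n) * norm x" using mult_right_mono[of 1 "real (Suc n)" "norm x"] by simp
  then have xr: "norm x \<le> 2 * rad" and pr: "norm ?p \<le> 2 * rad" using Suc.prems IH(3) nx rad(1) by linarith+
  have Om: "(?p, x) \<in> Om" using xr pr rad(4) by blast
  have e: "pt x [^] Suc n = pt ?p \<otimes> pt x" using pt_co[OF IH(1)] by simp
  have "norm (mu (?p,x) - ?p - x) \<le> CC * norm ?p * norm x" using mu_sub_r[OF pt_co(3)[OF IH(1)] x pr xr] .
  also have "\<dots> \<le> CC * (2 * (real n * norm x)) * norm x"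
    using IH(3) rad(2) by (intro mult_right_mono mult_left_mono) auto
  finally have 1: "norm (mu (?p,x) - ?p - x) \<le> 2 * CC * real n * (norm x)\<^sup>2" by (simp add: power2_eq_square algebra_simps)
  have "norm (mu (?p,x) - real (Suc n) *\<^sub>R x) \<le> norm (mu (?p,x) - ?p - x) + norm (?p - real n *\<^sub>R x)"
    using norm_triangle_ineq[of "mu (?p,x) - ?p - x" "?p - real n *\<^sub>R x"] by (simp add: algebra_simps)
  also have "\<dots> \<le> 2 * CC * real n * (norm x)\<^sup>2 + CC * (real n * norm x)\<^sup>2" using 1 IH(2) by linarith
  also have "\<dots> \<le> CC * (real (Suc n) * norm x)\<^sup>2" using rad(2) by (simp add: power2_eq_square algebra_simps)
  finally have 2: "norm (mu (?p,x) - real (Suc n) *\<^sub>R x) \<le> CC * (real (Suc n) * norm x)\<^sup>2" .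
  define s where "s = real (Suc n) * norm x"
  have s: "0 \<le> s" "s \<le> rad" "norm (real (Suc n) *\<^sub>R x) = s" using Suc.prems by (simp_all add: s_def)
  have "CC * s * s \<le> CC * rad * s" using s rad(2) by (intro mult_right_mono mult_left_mono) auto
  moreover have "CC * rad * s \<le> 1 / 2 * s" using rad(3) s(1) by (intro mult_right_mono) auto
  ultimately have "CC * s\<^sup>2 \<le> 1 / 2 * s" by (simp add: power2_eq_square)
  moreover have "norm (mu (?p,x)) \<le> norm (mu (?p,x) - real (Suc n) *\<^sub>R x) + s"
    using norm_triangle_ineq[of "mu (?p,x) - real (Suc n) *\<^sub>R x" "real (Suc n) *\<^sub>R x"] unfolding s(3) by simp
  ultimately have "norm (mu (?p,x)) \<le> 2 * s" using 2 s(1) unfolding s_def[symmetric] by linarith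
  then show ?case using 2 Om_D(3)[OF Om] unfolding e mu_def s_def by simp
qed

lemma one_plus_power_bound: "a \<ge> 0 \<Longrightarrow> real n * a \<le> 1 \<Longrightarrow> (1 + a) ^ n \<le> 3"
  for a :: real
proof -
  assume a: "a \<ge> 0" "real n * a \<le> 1"
  have "(1 + a) ^ n \<le> exp a ^ n" using a(1) by (intro power_mono) (auto simp: add.commute)
  also have "\<dots> = exp (real n * a)" by (simp add: exp_of_nat_mult)
  also have "\<dots> \<le> exp 1" using a by simp
  also have "\<dots> \<le> 3" by (rule exp_le)
  finally show "(1 + a) ^ n \<le> 3" .
qed

text \<open>Each multiplication enlarges the previous difference by a factor of at most
  \<open>?a = 1 + CC * norm x\<close> and adds at most \<open>2 * norm (x - y)\<close>. Since
  \<open>N * CC * norm x \<le> 1\<close>, the accumulated factor \<open>?a ^ N\<close> is at most 3,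
  and 6 is 2 times 3.\<close>

lemma power_diff_estimate:
  assumes x: "x \<in> E" and y: "y \<in> E" and N: "real N * norm x \<le> rad" "real N * norm y \<le> rad"
  shows "norm (co (pt x [^] N) - co (pt y [^] N)) \<le> 6 * real N * norm (x - y)"
proof -
  let ?a = "1 + CC * norm x"
  have "norm (co (pt x [^] n) - co (pt y [^] n)) \<le> 2 * real n * ?a ^ n * norm (x - y)" if "n \<le> N" for n
    using that
  proof (induction n)
    case 0
    then show ?case by (simp add: co_one)
  next
    case (Suc n)
    let ?p = "co (pt x [^] n)" and ?q = "co (pt y [^] n)"
    have n1: "real n * norm z \<le> real N * norm z" "real 1 * norm z \<le> real N * norm z" for z :: 'e
      using Suc.prems by (intro mult_right_mono; simp)+
    have p: "pt x [^] n \<in> U0" "norm ?p \<le> 2 * rad" and q: "pt y [^] n \<in> U0" "norm ?q \<le> 2 * rad"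
      using power_estimate[OF x, of n] power_estimate[OF y, of n] n1[of x] n1[of y] N by auto
    have xr: "norm x \<le> 2 * rad" and yr: "norm y \<le> 2 * rad" using n1(2)[of x] n1(2)[of y] N rad(1) by auto
    have E: "?p \<in> E" "?q \<in> E" using pt_co(3) p q by auto
    have e: "pt x [^] Suc n = pt ?p \<otimes> pt x" "pt y [^] Suc n = pt ?q \<otimes> pt y"
      using pt_co[OF p(1)] pt_co[OF q(1)] by auto
    have "norm (mu (?p,x) - mu (?q,x)) \<le> norm (mu (?p,x) - mu (?q,x) - proj E (?p - ?q)) + norm (proj E (?p - ?q))"
      by norm
    also have "\<dots> \<le> CC * norm x * norm (?p - ?q) + norm (?p - ?q)"
      using rad(8)[OF p(2) q(2) xr] E by (simp add: proj_E subspace_diff[OF subE])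
    finally have 1: "norm (mu (?p,x) - mu (?q,x)) \<le> ?a * norm (?p - ?q)" by (simp add: algebra_simps)
    have "norm (mu (?q,x) - mu (?q,y)) \<le> norm (mu (?q,x) - mu (?q,y) - proj E (x - y)) + norm (proj E (x - y))"
      by norm
    also have "\<dots> \<le> CC * norm ?q * norm (x - y) + norm (x - y)"
      using rad(7)[OF q(2) xr yr] x y by (simp add: proj_E subspace_diff[OF subE])
    also have "CC * norm ?q * norm (x - y) \<le> (CC * (2 * rad)) * norm (x - y)"
      using q(2) rad(2) by (intro mult_right_mono mult_left_mono) auto
    also have "\<dots> \<le> 1 * norm (x - y)" using rad(3) by (intro mult_right_mono) auto
    finally have 2: "norm (mu (?q,x) - mu (?q,y)) \<le> 2 * norm (x - y)" by simp
    have a1: "?a \<ge> 1" using rad(2) by simp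
    have "norm (mu (?p,x) - mu (?q,y)) \<le> norm (mu (?p,x) - mu (?q,x)) + norm (mu (?q,x) - mu (?q,y))" by norm
    also have "\<dots> \<le> ?a * norm (?p - ?q) + 2 * norm (x - y)" using 1 2 by linarith
    also have "\<dots> \<le> ?a * (2 * real n * ?a ^ n * norm (x - y)) + 2 * norm (x - y)"
      using Suc a1 by (intro add_right_mono mult_left_mono) auto
    also have "\<dots> \<le> ?a * (2 * real n * ?a ^ n * norm (x - y)) + 2 * (?a ^ Suc n * norm (x - y))"
      using one_le_power[OF a1, of "Suc n"] mult_right_mono[of 1 "?a ^ Suc n" "norm (x - y)"] by simp
    also have "\<dots> = 2 * real (Suc n) * ?a ^ Suc n * norm (x - y)" by (simp add: algebra_simps)
    finally show ?case unfolding e mu_def by simp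
  qed
  then have "norm (co (pt x [^] N) - co (pt y [^] N)) \<le> 2 * real N * ?a ^ N * norm (x - y)" by blast
  also have "?a ^ N \<le> 3"
  proof (rule one_plus_power_bound)
    have "real N * (CC * norm x) \<le> CC * rad" using N(1) rad(2) by (simp add: mult.left_commute)
    then show "real N * (CC * norm x) \<le> 1" using rad(3) by linarith
  qed (use rad(2) in simp)
  then have "2 * real N * ?a ^ N * norm (x - y) \<le> 2 * real N * 3 * norm (x - y)"
    by (intro mult_right_mono mult_left_mono) auto
  finally show ?thesis by simp
qed

end

section \<open>The exponential map\<close>

context lie_grp begin

text \<open>The group analogue of \<open>(1 + X / k) ^ k\<close>, read in coordinates.\<close>

definition aseq :: "'e \<Rightarrow> nat \<Rightarrow> 'e" where
  "aseq X k = co (pt (X /\<^sub>R real k) [^] k)"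

lemma scale_E: "X \<in> E \<Longrightarrow> c *\<^sub>R X \<in> E" using subspace_scale[OF subE] .

lemma aseq_in:
  assumes "X \<in> E" "norm X \<le> rad"
  shows "pt (X /\<^sub>R real k) [^] k \<in> U0" "aseq X k \<in> E" "k > 0 \<Longrightarrow> norm (aseq X k - X) \<le> CC * (norm X)\<^sup>2"
    "norm (aseq X k) \<le> 2 * norm X"
proof -
  have n: "real k * norm (X /\<^sub>R real k) \<le> norm X" by (cases "k = 0") (simp_all add: field_simps)
  note p = power_estimate[OF scale_E[OF assms(1)], of k "inverse (real k)"]
  show 1: "pt (X /\<^sub>R real k) [^] k \<in> U0" using p n assms(2) by linarith
  show "aseq X k \<in> E" unfolding aseq_def using 1 pt_co(3) by blast
  show "norm (aseq X k) \<le> 2 * norm X" unfolding aseq_def using p n assms(2) by linarith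
  show "norm (aseq X k - X) \<le> CC * (norm X)\<^sup>2" if "k > 0"
  proof -
    have rn: "real k * norm (X /\<^sub>R real k) = norm X" "real k *\<^sub>R (X /\<^sub>R real k) = X" using that by auto
    show ?thesis unfolding aseq_def using p unfolding rn using assms(2) by blast
  qed
qed

text \<open>Grouping the \<open>k * m\<close> factors into \<open>k\<close> blocks compares
  \<open>k\<close>-th powers of two points: \<open>x = X / k\<close> and the coordinate
  \<open>z\<close> of one block. They differ by at most \<open>CC\<close> times the squared norm of
  \<open>x\<close>, and taking \<open>k\<close>-th powers costs a factor \<open>6 k\<close>. The
  radius is halved because \<open>k * norm z\<close> may reach twice the norm of
  \<open>X\<close>.\<close>

lemma aseq_mult_estimate:
  assumes X: "X \<in> E" "norm X \<le> rad / 2" and km: "k > 0" "m > 0"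
  shows "norm (aseq X k - aseq X (k * m)) \<le> 6 * CC * (norm X)\<^sup>2 / real k"
proof -
  define y where "y = X /\<^sub>R real (k * m)"
  define x where "x = X /\<^sub>R real k"
  have yE: "y \<in> E" "x \<in> E" using X(1) scale_E by (auto simp: y_def x_def)
  have my: "real m *\<^sub>R y = x" "real m * norm y = norm x" "real k * norm x = norm X"
    using km by (auto simp: y_def x_def divide_simps)
  have xk: "norm x \<le> norm X" "norm y \<le> norm x"
    using mult_right_mono[of 1 "real k" "norm x"] mult_right_mono[of 1 "real m" "norm y"] my km by auto
  have "real m * norm y \<le> rad" using my xk X(2) rad(1) by simp
  from power_estimate[OF yE(1) this] my
  have p: "pt y [^] m \<in> U0" "norm (co (pt y [^] m) - x) \<le> CC * (norm x)\<^sup>2" "norm (co (pt y [^] m)) \<le> 2 * norm x"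
    by auto
  define z where "z = co (pt y [^] m)"
  have z: "z \<in> E" "pt z = pt y [^] m" using pt_co[OF p(1)] by (auto simp: z_def)
  have kz: "real k * norm z \<le> rad"
  proof -
    have "real k * norm z \<le> real k * (2 * norm x)" using p(3) unfolding z_def by (intro mult_left_mono) auto
    then show ?thesis using my(3) X(2) by simp
  qed
  have ey: "y \<in> O0" using rad(5)[of y] xk X(2) rad(1) by linarith
  have "aseq X (k * m) = co (pt z [^] k)"
    unfolding aseq_def z(2) y_def[symmetric] using nat_pow_pow[OF pt_carrier[OF ey]] by (simp add: mult.commute)
  moreover have "aseq X k = co (pt x [^] k)" by (simp add: aseq_def x_def)
  ultimately have "norm (aseq X k - aseq X (k * m)) \<le> 6 * real k * norm (x - z)"
    using power_diff_estimate[OF yE(2) z(1) _ kz] my(3) X(2) rad(1) by simp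
  also have "\<dots> \<le> 6 * real k * (CC * (norm x)\<^sup>2)"
    using p(2) unfolding z_def by (intro mult_left_mono) (auto simp: norm_minus_commute)
  also have "\<dots> = 6 * CC * (norm X)\<^sup>2 / real k"
    using km unfolding my(3)[symmetric] by (simp add: power2_eq_square divide_simps)
  finally show ?thesis .
qed

text \<open>Neither index need divide the other, so both are compared with the common refinement
  \<open>k * m\<close>.\<close>

lemma aseq_estimate:
  assumes X: "X \<in> E" "norm X \<le> rad / 2" and km: "k > 0" "m > 0"
  shows "norm (aseq X k - aseq X m) \<le> 6 * CC * (norm X)\<^sup>2 / real k + 6 * CC * (norm X)\<^sup>2 / real m"
proof -
  have "norm (aseq X k - aseq X m) \<le> norm (aseq X k - aseq X (k * m)) + norm (aseq X m - aseq X (m * k))"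
    using norm_triangle_ineq4[of "aseq X k - aseq X (k * m)" "aseq X m - aseq X (m * k)"]
    by (simp add: mult.commute)
  then show ?thesis using aseq_mult_estimate[OF X km] aseq_mult_estimate[OF X km(2,1)] by linarith
qed

definition lexp :: "'e \<Rightarrow> 'e" where "lexp X = lim (aseq X)"

lemma aseq_lim:
  assumes X: "X \<in> E" "norm X \<le> rad / 2"
  shows "aseq X \<longlonglongrightarrow> lexp X"
proof -
  let ?M = "6 * CC * (norm X)\<^sup>2"
  have M: "?M \<ge> 0" using rad(2) by simp
  have "Cauchy (aseq X)"
  proof (rule CauchyI)
    fix e :: real assume e: "e > 0"
    obtain n0 :: nat where n0: "real n0 > 2 * ?M / e" using reals_Archimedean2 by blast
    have "norm (aseq X m - aseq X n) < e" if mn: "m \<ge> Suc n0" "n \<ge> Suc n0" for m n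
    proof -
      have lt: "?M / real k < e / 2" if "k \<ge> Suc n0" for k
      proof -
        have "real k > 2 * ?M / e" using n0 that by linarith
        then show ?thesis using e that by (simp add: field_simps)
      qed
      have "m > 0" "n > 0" using mn by auto
      from aseq_estimate[OF X this] show ?thesis using lt[OF mn(1)] lt[OF mn(2)] by linarith
    qed
    then show "\<exists>M. \<forall>m\<ge>M. \<forall>n\<ge>M. norm (aseq X m - aseq X n) < e" by blast
  qed
  then show ?thesis unfolding lexp_def using Cauchy_convergent convergent_LIMSEQ_iff by blast
qed

lemma lexp_props:
  assumes X: "X \<in> E" "norm X \<le> rad / 2"
  shows "lexp X \<in> E" "norm (lexp X - X) \<le> CC * (norm X)\<^sup>2" "norm (lexp X) \<le> 2 * norm X" "lexp X \<in> O0"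
    "k > 0 \<Longrightarrow> norm (aseq X k - lexp X) \<le> 6 * CC * (norm X)\<^sup>2 / real k"
    "norm (lexp X) \<le> rad"
proof -
  note l = aseq_lim[OF X]
  have X': "norm X \<le> rad" using X rad(1) by linarith
  show "lexp X \<in> E"
    by (rule Lim_in_closed_set[OF closed_subspace[OF subE] _ _ l]) (use aseq_in(2)[OF X(1) X'] in auto)
  show "norm (lexp X - X) \<le> CC * (norm X)\<^sup>2"
  proof (rule Lim_norm_ubound[OF _ tendsto_diff[OF l tendsto_const]])
    show "\<forall>\<^sub>F k in sequentially. norm (aseq X k - X) \<le> CC * (norm X)\<^sup>2"
      by (rule eventually_mono[OF eventually_gt_at_top[of 0]]) (rule aseq_in(3)[OF X(1) X'])
  qed simp
  show 2: "norm (lexp X) \<le> 2 * norm X"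
    by (rule Lim_norm_ubound[OF _ l]) (use aseq_in(4)[OF X(1) X'] in auto)
  then show "norm (lexp X) \<le> rad" using X(2) by simp
  then show "lexp X \<in> O0" using rad(5) rad(1) by simp
  show "norm (aseq X k - lexp X) \<le> 6 * CC * (norm X)\<^sup>2 / real k" if k: "k > 0"
  proof (rule LIMSEQ_le)
    show "(\<lambda>m. norm (aseq X k - aseq X m)) \<longlonglongrightarrow> norm (aseq X k - lexp X)" by (intro tendsto_intros l)
    show "(\<lambda>m. 6 * CC * (norm X)\<^sup>2 / real k + 6 * CC * (norm X)\<^sup>2 / real m) \<longlonglongrightarrow> 6 * CC * (norm X)\<^sup>2 / real k"
      using tendsto_add[OF tendsto_const lim_const_over_n] by simp
    show "\<exists>N. \<forall>m\<ge>N. norm (aseq X k - aseq X m) \<le> 6 * CC * (norm X)\<^sup>2 / real k + 6 * CC * (norm X)\<^sup>2 / real m"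
      using aseq_estimate[OF X k] by (intro exI[of _ 1]) auto
  qed
qed

lemma lexp_0: "lexp 0 = 0"
proof -
  have "aseq 0 = (\<lambda>k. 0)" unfolding aseq_def by (auto simp: pt_0 co_one)
  then show ?thesis using aseq_lim[of 0] subspace_0[OF subE] rad(1)
    by (simp add: LIMSEQ_const_iff)
qed

text \<open>The limit theorem behind all that follows: only \<open>n k\<close> times
  \<open>x k\<close> matters, not the way the small elements are chosen. The power of
  \<open>x k\<close> is compared with the power of \<open>X / n k\<close> having the same exponent,
  and that power with its limit.\<close>

lemma powers_tendsto_lexp:
  assumes x: "\<And>k. x k \<in> E" "x \<longlonglongrightarrow> 0" and nx: "(\<lambda>k. real (n k) *\<^sub>R x k) \<longlonglongrightarrow> X"
    and X: "norm X < rad / 2"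
  shows "X \<in> E" "\<forall>\<^sub>F k in sequentially. pt (x k) [^] n k \<in> U0"
    "(\<lambda>k. co (pt (x k) [^] n k)) \<longlonglongrightarrow> lexp X"
proof -
  show XE: "X \<in> E"
    by (rule Lim_in_closed_set[OF closed_subspace[OF subE] _ _ nx]) (use scale_E x in auto)
  have Xr: "norm X \<le> rad / 2" "norm X \<le> rad" using X rad(1) by auto
  have nn: "(\<lambda>k. real (n k) * norm (x k)) \<longlonglongrightarrow> norm X" using tendsto_norm[OF nx] by simp
  have ev1: "\<forall>\<^sub>F k in sequentially. real (n k) * norm (x k) < rad / 2" using order_tendstoD(2)[OF nn X] .
  then show "\<forall>\<^sub>F k in sequentially. pt (x k) [^] n k \<in> U0"
  proof eventually_elim
    case (elim k)
    then show ?case using power_estimate[OF x(1), of "n k" k] rad(1) by linarith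
  qed
  define A where "A = 6 * CC * norm X"
  have A: "A \<ge> 0" using rad(2) by (simp add: A_def)
  \<comment> \<open>This turns the error of order \<open>norm X / n k\<close> into one of order
    \<open>norm (x k)\<close>, which tends to 0 in every case. If \<open>X = 0\<close> the exponents
    may stay bounded or be 0, so divergence of \<open>n k\<close> cannot be used.\<close>
  have ev2: "\<forall>\<^sub>F k in sequentially. norm X / 2 \<le> real (n k) * norm (x k)"
  proof (cases "X = 0")
    case False
    then have "norm X / 2 < norm X" by simp
    from order_tendstoD(1)[OF nn this] show ?thesis by (rule eventually_mono) simp
  qed simp
  from ev1 ev2 have "\<forall>\<^sub>F k in sequentially. norm (co (pt (x k) [^] n k) - lexp X) \<le> 
      6 * norm (real (n k) *\<^sub>R x k - X) + 2 * A * norm (x k)"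
  proof eventually_elim
    case (elim k)
    show ?case
    proof (cases "n k = 0")
      case True
      then have "X = 0" using elim(2) by simp
      then show ?thesis using True lexp_0 A by (simp add: co_one)
    next
      case False
      have rn: "real (n k) * norm (X /\<^sub>R real (n k)) = norm X" using False by simp
      have e: "norm (co (pt (x k) [^] n k) - aseq X (n k)) \<le> 6 * real (n k) * norm (x k - X /\<^sub>R real (n k))"
        unfolding aseq_def
        by (intro power_diff_estimate x scale_E XE) (use elim(1) rad(1) Xr rn in linarith)+
      have "real (n k) * norm (x k - X /\<^sub>R real (n k)) = norm (real (n k) *\<^sub>R (x k - X /\<^sub>R real (n k)))" by simp
      also have "real (n k) *\<^sub>R (x k - X /\<^sub>R real (n k)) = real (n k) *\<^sub>R x k - X" using False by (simp add: scaleR_diff_right)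
      finally have e1: "norm (co (pt (x k) [^] n k) - aseq X (n k)) \<le> 6 * norm (real (n k) *\<^sub>R x k - X)" using e by simp
      have "norm X / real (n k) \<le> 2 * norm (x k)" using elim(2) False by (simp add: field_simps)
      then have "A * (norm X / real (n k)) \<le> A * (2 * norm (x k))" using A by (rule mult_left_mono)
      moreover have "norm (aseq X (n k) - lexp X) \<le> A * (norm X / real (n k))"
        using lexp_props(5)[OF XE Xr(1), of "n k"] False by (simp add: A_def power2_eq_square)
      ultimately have e2: "norm (aseq X (n k) - lexp X) \<le> 2 * A * norm (x k)" by linarith
      show ?thesis using norm_triangle_ineq[of "co (pt (x k) [^] n k) - aseq X (n k)" "aseq X (n k) - lexp X"] e1 e2 by simp
    qed
  qed
  moreover have "(\<lambda>k. 6 * norm (real (n k) *\<^sub>R x k - X) + 2 * A * norm (x k)) \<longlonglongrightarrow> 6 * norm (X - X) + 2 * A * norm (0::'e)"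
    by (intro tendsto_intros nx x(2))
  then have "(\<lambda>k. 6 * norm (real (n k) *\<^sub>R x k - X) + 2 * A * norm (x k)) \<longlonglongrightarrow> 0" by simp
  ultimately have "(\<lambda>k. co (pt (x k) [^] n k) - lexp X) \<longlonglongrightarrow> 0"
    by (rule Lim_null_comparison)
  then show "(\<lambda>k. co (pt (x k) [^] n k)) \<longlonglongrightarrow> lexp X" by (rule LIM_zero_cancel)
qed

text \<open>Rounding the exponent \<open>t * n k\<close> down changes the product by less than one
  copy of \<open>x k\<close>, which tends to 0.\<close>

lemma floor_multiple_tendsto:
  assumes x: "x \<longlonglongrightarrow> (0::'e)" and nx: "(\<lambda>k. real (n k) *\<^sub>R x k) \<longlonglongrightarrow> X" and t: "t \<ge> 0"
  shows "(\<lambda>k. real (nat \<lfloor>t * real (n k)\<rfloor>) *\<^sub>R x k) \<longlonglongrightarrow> t *\<^sub>R X"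
proof -
  have "(\<lambda>k. t *\<^sub>R (real (n k) *\<^sub>R x k) - frac (t * real (n k)) *\<^sub>R x k) \<longlonglongrightarrow> t *\<^sub>R X - 0"
  proof (intro tendsto_diff tendsto_scaleR tendsto_const nx)
    show "(\<lambda>k. frac (t * real (n k)) *\<^sub>R x k) \<longlonglongrightarrow> 0"
    proof (rule Lim_null_comparison[OF always_eventually tendsto_norm_zero[OF x]], intro allI)
      fix k
      have "\<bar>frac (t * real (n k))\<bar> \<le> 1" using frac_lt_1[of "t * real (n k)"] by (simp add: less_imp_le)
      from mult_right_mono[OF this norm_ge_zero[of "x k"]]
      show "norm (frac (t * real (n k)) *\<^sub>R x k) \<le> norm (x k)" by simp
    qed
  qed
  moreover have "real (nat \<lfloor>t * real (n k)\<rfloor>) *\<^sub>R x k = t *\<^sub>R (real (n k) *\<^sub>R x k) - frac (t * real (n k)) *\<^sub>R x k" for k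
    using t by (simp add: frac_def algebra_simps)
  ultimately show ?thesis by simp
qed

lemma mu_continuous: "(x,y) \<in> Om \<Longrightarrow> f \<longlonglongrightarrow> x \<Longrightarrow> g \<longlonglongrightarrow> y \<Longrightarrow> (\<lambda>k. mu (f k, g k)) \<longlonglongrightarrow> mu (x, y)"
proof -
  assume a: "(x,y) \<in> Om" "f \<longlonglongrightarrow> x" "g \<longlonglongrightarrow> y"
  have "isCont mu (x,y)"
    using smooth_on_imp_continuous_on[OF Om(2)] Om(1) a(1) continuous_on_eq_continuous_at by blast
  then show "(\<lambda>k. mu (f k, g k)) \<longlonglongrightarrow> mu (x, y)"
    by (rule isCont_tendsto_compose) (intro tendsto_Pair a)
qed

lemma tendsto_div_nat: "(\<lambda>k. X /\<^sub>R real k) \<longlonglongrightarrow> (0::'e)" "(\<lambda>k. real k *\<^sub>R (X /\<^sub>R real k)) \<longlonglongrightarrow> X"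
proof -
  show "(\<lambda>k. X /\<^sub>R real k) \<longlonglongrightarrow> (0::'e)"
    using tendsto_scaleR[OF lim_inverse_n tendsto_const[of X]] by simp
  have "\<forall>\<^sub>F k in sequentially. real k *\<^sub>R (X /\<^sub>R real k) = X"
    using eventually_gt_at_top[of 0] by eventually_elim simp
  then show "(\<lambda>k. real k *\<^sub>R (X /\<^sub>R real k)) \<longlonglongrightarrow> X" by (rule tendsto_eventually)
qed

text \<open>Powers of the same element \<open>X / k\<close> multiply exactly, so the exponents
  \<open>\<lfloor>s k\<rfloor>\<close> and \<open>\<lfloor>t k\<rfloor>\<close> are added as they
  are. Their sum may differ from \<open>\<lfloor>(s + t) k\<rfloor>\<close>, but times
  \<open>X / k\<close> it still tends to \<open>(s + t) X\<close>.\<close>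

lemma lexp_add_nonneg:
  assumes X: "X \<in> E" "norm X < rad / 2" and st: "s \<ge> 0" "t \<ge> 0" "s + t \<le> 1"
  shows "pt (lexp (s *\<^sub>R X)) \<otimes> pt (lexp (t *\<^sub>R X)) = pt (lexp ((s + t) *\<^sub>R X))"
proof -
  let ?x = "\<lambda>k. X /\<^sub>R real k"
  have xE: "?x k \<in> E" for k using scale_E X(1) by simp
  have sm: "norm (u *\<^sub>R X) < rad / 2" if "u \<ge> 0" "u \<le> 1" for u
    using mult_right_mono[OF that(2) norm_ge_zero[of X]] X(2) that by simp
  note sX = sm[of s] and tX = sm[of t] and stX = sm[of "s + t"]
  let ?n = "\<lambda>t k. nat \<lfloor>t * real k\<rfloor>"
  note fl = floor_multiple_tendsto[OF tendsto_div_nat]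
  note ps = powers_tendsto_lexp[OF xE tendsto_div_nat(1) fl[OF st(1)]]
  note pt' = powers_tendsto_lexp[OF xE tendsto_div_nat(1) fl[OF st(2)]]
  have "(\<lambda>k. real (?n s k) *\<^sub>R ?x k + real (?n t k) *\<^sub>R ?x k) \<longlonglongrightarrow> s *\<^sub>R X + t *\<^sub>R X"
    by (intro tendsto_add fl st)
  then have "(\<lambda>k. real (?n s k + ?n t k) *\<^sub>R ?x k) \<longlonglongrightarrow> (s + t) *\<^sub>R X"
    by (simp only: of_nat_add scaleR_add_left)
  note pst = powers_tendsto_lexp[OF xE tendsto_div_nat(1) this]
  have s1: "norm (s *\<^sub>R X) < rad / 2" "norm (t *\<^sub>R X) < rad / 2" "norm ((s + t) *\<^sub>R X) < rad / 2"
    using sX tX stX st by auto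
  have Om': "(lexp (s *\<^sub>R X), lexp (t *\<^sub>R X)) \<in> Om"
    using lexp_props(6)[OF scale_E[OF X(1)], of s] lexp_props(6)[OF scale_E[OF X(1)], of t] s1 rad(1)
    by (intro rad(4)) auto
  have "(\<lambda>k. mu (co (pt (?x k) [^] ?n s k), co (pt (?x k) [^] ?n t k))) \<longlonglongrightarrow> mu (lexp (s *\<^sub>R X), lexp (t *\<^sub>R X))"
    by (rule mu_continuous[OF Om' ps(3)[OF s1(1)] pt'(3)[OF s1(2)]])
  moreover have "\<forall>\<^sub>F k in sequentially. ?x k \<in> O0"
    using topological_tendstoD[OF tendsto_div_nat(1) O0] .
  then have "\<forall>\<^sub>F k in sequentially. mu (co (pt (?x k) [^] ?n s k), co (pt (?x k) [^] ?n t k)) = co (pt (?x k) [^] (?n s k + ?n t k))"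
    using ps(2)[OF s1(1)] pt'(2)[OF s1(2)]
  proof eventually_elim
    case (elim k)
    then show ?case by (simp add: mu_def pt_co nat_pow_mult pt_carrier)
  qed
  ultimately have "(\<lambda>k. co (pt (?x k) [^] (?n s k + ?n t k))) \<longlonglongrightarrow> mu (lexp (s *\<^sub>R X), lexp (t *\<^sub>R X))"
    by (rule Lim_transform_eventually)
  with pst(3)[OF s1(3)] have "lexp ((s + t) *\<^sub>R X) = mu (lexp (s *\<^sub>R X), lexp (t *\<^sub>R X))"
    using LIMSEQ_unique by blast
  then show ?thesis using Om_D(4)[OF Om'] by simp
qed

text \<open>With \<open>i\<close> the coordinate of the inverse, \<open>mu (x, i) = 0\<close> and
  the product estimate bound \<open>x + i\<close> by \<open>CC\<close> times both norms. The small
  factor \<open>CC * norm x \<le> 1 / 2\<close> then shows that \<open>i\<close> is at most twice as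
  long as \<open>x\<close>.\<close>

lemma inv_coordinate_estimate:
  "\<exists>d>0. \<forall>x\<in>E. norm x < d \<longrightarrow> norm (co (inv (pt x)) + x) \<le> 2 * CC * (norm x)\<^sup>2"
proof -
  let ?W = "{x \<in> O0. inv (pt x) \<in> U0}"
  let ?i = "\<lambda>x. co (inv (pt x))"
  note W = map_smooth[OF inv_smooth]
  have 0: "0 \<in> ?W" "?i 0 = 0" by (simp_all add: O0 pt_0 id_chart co_one)
  have cont0: "isCont ?i 0" using smooth_on_imp_continuous_on[OF W(2)] W(1) 0 continuous_on_eq_continuous_at by blast
  then obtain d where d: "d > 0" "\<And>x. norm x < d \<Longrightarrow> norm (?i x) < rad"
    using cont0[unfolded continuous_at_eps_delta, rule_format, OF rad(1)] 0(2) by (auto simp: dist_norm)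
  have "norm (?i x + x) \<le> 2 * CC * (norm x)\<^sup>2" if x: "x \<in> E" "norm x < min d rad" for x
  proof -
    have xr: "norm x \<le> 2 * rad" using x rad(1) by simp
    have ir: "norm (?i x) \<le> 2 * rad" using d(2)[of x] x rad(1) by simp
    have iU: "inv (pt x) \<in> U0" using rad(6)[OF xr] .
    have xO: "x \<in> O0" using rad(5)[OF xr] .
    have "mu (x, ?i x) = 0" unfolding mu_def using pt_co(2)[OF iU] pt_carrier[OF xO] by (simp add: co_one)
    then have "norm (0 - x - ?i x) \<le> CC * norm x * norm (?i x)"
      using mu_sub_r[OF x(1) pt_co(3)[OF iU] xr ir] by simp
    moreover have "0 - x - ?i x = - (?i x + x)" by simp
    ultimately have "norm (- (?i x + x)) \<le> CC * norm x * norm (?i x)" by (simp only:)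
    then have 1: "norm (?i x + x) \<le> CC * norm x * norm (?i x)" by (simp only: norm_minus_cancel)
    have "CC * norm x \<le> CC * rad" using x rad(2) by (intro mult_left_mono) auto
    then have "CC * norm x * norm (?i x) \<le> 1 / 2 * norm (?i x)" using rad(3) by (intro mult_right_mono) auto
    moreover have "norm (?i x) \<le> norm (?i x + x) + norm x" using norm_triangle_ineq4[of "?i x + x" x] by simp
    ultimately have "norm (?i x) \<le> 2 * norm x" using 1 by linarith
    then have "CC * norm x * norm (?i x) \<le> CC * norm x * (2 * norm x)" using rad(2) by (intro mult_left_mono) auto
    then show ?thesis using 1 by (simp add: power2_eq_square)
  qed
  then show ?thesis using d(1) rad(1) by (intro exI[of _ "min d rad"]) auto
qed

text \<open>The inverses of the elements \<open>X / k\<close> have coordinates \<open>y k\<close>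
  with \<open>k * y k\<close> tending to \<open>- X\<close>, so their \<open>k\<close>-th powers
  tend to the exponential of \<open>- X\<close>. The same powers are the inverses of the
  approximants of the exponential of \<open>X\<close>.\<close>

lemma lexp_minus:
  assumes X: "X \<in> E" "norm X < rad / 2"
  shows "pt (lexp (- X)) = inv (pt (lexp X))"
proof -
  let ?i = "\<lambda>x. co (inv (pt x))"
  let ?x = "\<lambda>k. X /\<^sub>R real k"
  note W = map_smooth[OF inv_smooth]
  obtain d where d: "d > 0" "\<And>x. x \<in> E \<Longrightarrow> norm x < d \<Longrightarrow> norm (?i x + x) \<le> 2 * CC * (norm x)\<^sup>2"
    using inv_coordinate_estimate by blast
  have nx0: "(\<lambda>k. norm (?x k)) \<longlonglongrightarrow> 0" using tendsto_norm_zero[OF tendsto_div_nat(1)] .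
  have small: "\<forall>\<^sub>F k in sequentially. norm (?x k) < min d rad \<and> k > 0"
    by (intro eventually_conj order_tendstoD(2)[OF nx0] eventually_gt_at_top) (use d(1) rad(1) in simp)
  \<comment> \<open>The default 0 keeps every term in \<open>E\<close>, as the limit theorem for
    powers asks for all \<open>k\<close>; for large \<open>k\<close> the first case applies.\<close>
  define y where "y k = (if inv (pt (?x k)) \<in> U0 then ?i (?x k) else 0)" for k
  have yE: "y k \<in> E" for k using pt_co(3) subspace_0[OF subE] by (simp add: y_def)
  have xE: "?x k \<in> E" for k using scale_E X(1) by simp
  have ev: "\<forall>\<^sub>F k in sequentially. norm (y k + ?x k) \<le> 2 * CC * (norm (?x k))\<^sup>2 \<and> norm (real k *\<^sub>R y k - - X) \<le> 2 * CC * norm X * norm (?x k)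
     \<and> pt (y k) = inv (pt (?x k)) \<and> ?x k \<in> O0"
    using small
  proof eventually_elim
    case (elim k)
    have xr: "norm (?x k) \<le> 2 * rad" using elim rad(1) by linarith
    have y: "y k = ?i (?x k)" "pt (y k) = inv (pt (?x k))" using rad(6)[OF xr] pt_co(2) by (auto simp: y_def)
    have 1: "norm (y k + ?x k) \<le> 2 * CC * (norm (?x k))\<^sup>2" unfolding y(1) using d(2)[OF xE] elim by simp
    have "real k *\<^sub>R y k - - X = real k *\<^sub>R (y k + ?x k)" using elim by (simp add: scaleR_add_right)
    then have "norm (real k *\<^sub>R y k - - X) \<le> real k * (2 * CC * (norm (?x k))\<^sup>2)"
      using 1 by (simp add: mult_left_mono)
    also have "\<dots> = 2 * CC * norm X * norm (?x k)" using elim by (simp add: power2_eq_square)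
    finally show ?case using 1 y(2) rad(5)[OF xr] by blast
  qed
  have lin0: "(\<lambda>k. 2 * CC * norm X * norm (?x k)) \<longlonglongrightarrow> 0" using tendsto_mult_right_zero[OF nx0] .
  have "(\<lambda>k. real k *\<^sub>R y k - - X) \<longlonglongrightarrow> 0"
    by (rule Lim_null_comparison[OF eventually_mono[OF ev] lin0]) blast
  then have ky: "(\<lambda>k. real k *\<^sub>R y k) \<longlonglongrightarrow> - X" by (rule LIM_zero_cancel)
  have "(\<lambda>k. 2 * CC * (norm (?x k))\<^sup>2) \<longlonglongrightarrow> 2 * CC * 0\<^sup>2" by (intro tendsto_intros nx0)
  then have sq0: "(\<lambda>k. 2 * CC * (norm (?x k))\<^sup>2) \<longlonglongrightarrow> 0" by simp
  have "(\<lambda>k. y k + ?x k) \<longlonglongrightarrow> 0"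
    by (rule Lim_null_comparison[OF eventually_mono[OF ev] sq0]) blast
  from tendsto_diff[OF this tendsto_div_nat(1)[of X]] have y0: "y \<longlonglongrightarrow> 0" by simp
  have mX: "norm (- X) < rad / 2" using X by simp
  note p = powers_tendsto_lexp[OF yE y0 ky mX]
  have lX: "norm X \<le> rad / 2" using X by simp
  have lW: "lexp X \<in> {x \<in> O0. inv (pt x) \<in> U0}"
    using rad(5,6)[of "lexp X"] lexp_props(6)[OF X(1) lX] rad(1) by simp
  have "isCont ?i (lexp X)" using smooth_on_imp_continuous_on[OF W(2)] W(1) lW continuous_on_eq_continuous_at by blast
  then have "(\<lambda>k. ?i (aseq X k)) \<longlonglongrightarrow> ?i (lexp X)"
    by (rule isCont_tendsto_compose[OF _ aseq_lim[OF X(1) lX]])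
  moreover have "\<forall>\<^sub>F k in sequentially. ?i (aseq X k) = co (pt (y k) [^] k)"
    using ev
  proof eventually_elim
    case (elim k)
    have "pt (aseq X k) = pt (?x k) [^] k" unfolding aseq_def using aseq_in(1)[OF X(1)] lX rad(1) by (intro pt_co) simp
    then show ?case using elim pt_carrier by (simp add: nat_pow_inv)
  qed
  ultimately have "(\<lambda>k. co (pt (y k) [^] k)) \<longlonglongrightarrow> ?i (lexp X)" by (rule Lim_transform_eventually)
  with p(3) have "lexp (- X) = ?i (lexp X)" using LIMSEQ_unique by blast
  then show ?thesis using lW pt_co(2) by simp
qed

end

section \<open>The exponential map on the whole Lie algebra\<close>

context lie_grp begin

lemma subgroup_nat_pow: "subgroup S L \<Longrightarrow> h \<in> S \<Longrightarrow> h [^] (n::nat) \<in> S"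
  by (induction n) (auto intro: subgroup.m_closed subgroup.one_closed)

lemma lexp_carrier: "X \<in> E \<Longrightarrow> norm X < rad / 2 \<Longrightarrow> pt (lexp X) \<in> carrier L"
  using lexp_props(4) pt_carrier by simp

lemma pt_lexp_0: "pt (lexp 0) = \<one>" by (simp add: lexp_0 pt_0)

lemma lexp_add_nonneg':
  assumes X: "X \<in> E" and st: "s \<ge> 0" "t \<ge> 0" "(s + t) * norm X < rad / 2"
  shows "pt (lexp (s *\<^sub>R X)) \<otimes> pt (lexp (t *\<^sub>R X)) = pt (lexp ((s + t) *\<^sub>R X))"
proof (cases "s + t = 0")
  case True
  then have "s = 0" "t = 0" using st by auto
  then show ?thesis by (simp add: pt_lexp_0)
next
  case False
  then have u: "s + t > 0" using st by simp
  have "norm ((s + t) *\<^sub>R X) < rad / 2" using st u by simp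
  moreover have "s / (s + t) + t / (s + t) = 1" using u by (simp add: add_divide_distrib[symmetric])
  ultimately show ?thesis
    using lexp_add_nonneg[of "(s + t) *\<^sub>R X" "s / (s + t)" "t / (s + t)"] scale_E[OF X] u st by simp
qed

text \<open>Every sign pattern of \<open>s\<close>, \<open>t\<close> and \<open>s + t\<close> can be
  rearranged into one addition of nonnegative times, with negative times turned into inverses; the
  claim is that equation solved in the group.\<close>

lemma lexp_add:
  assumes X: "X \<in> E" and st: "\<bar>s\<bar> * norm X < rad / 2" "\<bar>t\<bar> * norm X < rad / 2" "\<bar>s + t\<bar> * norm X < rad / 2"
  shows "pt (lexp (s *\<^sub>R X)) \<otimes> pt (lexp (t *\<^sub>R X)) = pt (lexp ((s + t) *\<^sub>R X))"
proof -
  define A where "A s = pt (lexp (s *\<^sub>R X))" for s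
  have Ac: "A u \<in> carrier L" if "\<bar>u\<bar> * norm X < rad / 2" for u
    unfolding A_def using that X by (intro lexp_carrier scale_E) auto
  have Am: "A (- u) = inv (A u)" if "\<bar>u\<bar> * norm X < rad / 2" for u
    unfolding A_def using lexp_minus[OF scale_E[OF X], of u] that by simp
  have Aa: "A u \<otimes> A v = A (u + v)" if "u \<ge> 0" "v \<ge> 0" "(u + v) * norm X < rad / 2" for u v
    unfolding A_def by (rule lexp_add_nonneg'[OF X that])
  have "A s \<otimes> A t = A (s + t)"
  proof -
    consider "s \<ge> 0" "t \<ge> 0" | "s < 0" "t < 0" | "s \<ge> 0" "t < 0" "s + t \<ge> 0" | "s \<ge> 0" "t < 0" "s + t < 0"
      | "s < 0" "t \<ge> 0" "s + t \<ge> 0" | "s < 0" "t \<ge> 0" "s + t < 0" by linarith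
    then show ?thesis
    proof cases
      case 1
      then show ?thesis using Aa st by simp
    next
      case 2
      then have "A (- t) \<otimes> A (- s) = A (- (s + t))" using Aa[of "- t" "- s"] st by (simp add: add.commute)
      then have "inv (A t) \<otimes> inv (A s) = inv (A (s + t))" by (simp only: Am[OF st(1)] Am[OF st(2)] Am[OF st(3)])
      then show ?thesis using Ac st by (metis inv_inv inv_mult_group m_closed)
    next
      case 3
      then have "A (s + t) \<otimes> A (- t) = A s" using Aa[of "s + t" "- t"] st by simp
      then have "A (s + t) \<otimes> inv (A t) = A s" using Am st by simp
      then show ?thesis using Ac st by (metis inv_solve_right' )
    next
      case 4
      then have "A (- (s + t)) \<otimes> A s = A (- t)" using Aa[of "- (s + t)" s] st by simp
      then have "inv (A (s + t)) \<otimes> A s = inv (A t)" by (simp only: Am[OF st(2)] Am[OF st(3)])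
      then show ?thesis using Ac st by (metis inv_solve_left inv_solve_right inv_closed)
    next
      case 5
      then have "A (- s) \<otimes> A (s + t) = A t" using Aa[of "- s" "s + t"] st by simp
      then have "inv (A s) \<otimes> A (s + t) = A t" using Am st by simp
      then show ?thesis using Ac st by (metis inv_solve_left)
    next
      case 6
      then have "A t \<otimes> A (- (s + t)) = A (- s)" using Aa[of t "- (s + t)"] st by simp
      then have "A t \<otimes> inv (A (s + t)) = inv (A s)" by (simp only: Am[OF st(1)] Am[OF st(3)])
      then show ?thesis using Ac st by (metis inv_solve_left inv_solve_right inv_closed)
    qed
  qed
  then show ?thesis by (simp add: A_def)
qed

lemma lexp_nat_mult:
  assumes X: "X \<in> E" and n: "real n * norm X < rad / 2"
  shows "pt (lexp X) [^] n = pt (lexp (real n *\<^sub>R X))"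
  using n
proof (induction n)
  case 0
  then show ?case by (simp add: pt_lexp_0)
next
  case (Suc n)
  have "real n * norm X \<le> real (Suc n) * norm X" by (intro mult_right_mono) auto
  then have "pt (lexp X) [^] n = pt (lexp (real n *\<^sub>R X))" using Suc by linarith
  moreover have "pt (lexp (real n *\<^sub>R X)) \<otimes> pt (lexp (1 *\<^sub>R X)) = pt (lexp ((real n + 1) *\<^sub>R X))"
    by (rule lexp_add_nonneg'[OF X]) (use Suc.prems in \<open>auto simp: add.commute\<close>)
  ultimately show ?case by (simp add: add.commute)
qed

text \<open>The \<open>N\<close>-th power of the local exponential of \<open>X / N\<close>. Rounding
  \<open>2 * norm X / rad\<close> up and adding 1 brings \<open>X / N\<close> strictly inside the
  radius \<open>rad / 2\<close> where the local exponential is controlled.\<close>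

definition gexp :: "'e \<Rightarrow> 'g" where
  "gexp X = (let N = nat \<lceil>2 * norm X / rad\<rceil> + 1 in pt (lexp (X /\<^sub>R real N)) [^] N)"

text \<open>Two admissible numbers of pieces are both compared with their product, a common
  refinement.\<close>

lemma gexp_eq:
  assumes X: "X \<in> E" and N: "norm X < real N * (rad / 2)"
  shows "gexp X = pt (lexp (X /\<^sub>R real N)) [^] N"
proof -
  have same: "pt (lexp (X /\<^sub>R real N)) [^] N = pt (lexp (X /\<^sub>R real (N * M))) [^] (N * M)"
    if N: "norm X < real N * (rad / 2)" and M: "M > 0" for N M
  proof -
    have N0: "N > 0" using N by (cases N) auto
    let ?Y = "X /\<^sub>R real (N * M)"
    have nY: "real M * norm ?Y < rad / 2" using N N0 M by (simp add: field_simps)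
    have "real M *\<^sub>R ?Y = X /\<^sub>R real N" using M N0 by (simp add: field_simps)
    then have "pt (lexp (X /\<^sub>R real N)) = pt (lexp ?Y) [^] M"
      using lexp_nat_mult[OF scale_E[OF X] nY] by (simp only:)
    moreover have "norm ?Y \<le> real M * norm ?Y" using M mult_right_mono[of 1 "real M" "norm ?Y"] by simp
    then have "pt (lexp ?Y) \<in> carrier L" using nY by (intro lexp_carrier scale_E X) linarith
    ultimately show ?thesis by (simp add: nat_pow_pow mult.commute)
  qed
  define M where "M = nat \<lceil>2 * norm X / rad\<rceil> + 1"
  have "2 * norm X / rad < real M" unfolding M_def by linarith
  then have M: "norm X < real M * (rad / 2)" using rad(1) by (simp add: field_simps)
  have M0: "M > 0" "N > 0" using N by (auto simp: M_def intro!: gr0I)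
  show ?thesis unfolding gexp_def Let_def M_def[symmetric]
    using same[OF M M0(2)] same[OF N M0(1)] by (simp add: mult.commute)
qed

lemma ex_large: "\<exists>N>0. a < real N * (rad / 2)"
proof -
  obtain N :: nat where "2 * \<bar>a\<bar> / rad < real N" using reals_Archimedean2 by blast
  then have "\<bar>a\<bar> < real N * (rad / 2)" using rad(1) by (simp add: field_simps)
  moreover then have "N > 0" by (cases N) auto
  ultimately show ?thesis by (intro exI[of _ N]) auto
qed

lemma gexp_small: "X \<in> E \<Longrightarrow> norm X < rad / 2 \<Longrightarrow> gexp X = pt (lexp X)"
  using gexp_eq[of X 1] lexp_carrier by simp

lemma gexp_0: "gexp 0 = \<one>"
  using gexp_small[OF subspace_0[OF subE]] rad(1) by (simp add: pt_lexp_0)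

lemma gexp_closed: "X \<in> E \<Longrightarrow> gexp X \<in> carrier L"
proof -
  assume X: "X \<in> E"
  obtain N where N: "N > 0" "norm X < real N * (rad / 2)" using ex_large by blast
  have "norm (X /\<^sub>R real N) < rad / 2" using N by (simp add: field_simps)
  then show ?thesis unfolding gexp_eq[OF X N(2)] using lexp_carrier scale_E[OF X] by simp
qed

lemma gexp_add:
  assumes X: "X \<in> E"
  shows "gexp (s *\<^sub>R X) \<otimes> gexp (t *\<^sub>R X) = gexp ((s + t) *\<^sub>R X)"
proof -
  obtain N where N: "N > 0" "(\<bar>s\<bar> + \<bar>t\<bar>) * norm X < real N * (rad / 2)" using ex_large by blast
  have n: "\<bar>u\<bar> * norm X < real N * (rad / 2)" if "\<bar>u\<bar> \<le> \<bar>s\<bar> + \<bar>t\<bar>" for u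
    using mult_right_mono[OF that norm_ge_zero[of X]] N(2) by linarith
  define Y where "Y = X /\<^sub>R real N"
  have YE: "Y \<in> E" using X scale_E by (simp add: Y_def)
  have small: "\<bar>u\<bar> * norm Y < rad / 2" if "\<bar>u\<bar> \<le> \<bar>s\<bar> + \<bar>t\<bar>" for u
    using n[OF that] N(1) by (simp add: Y_def field_simps)
  have e: "gexp (u *\<^sub>R X) = pt (lexp (u *\<^sub>R Y)) [^] N" if "\<bar>u\<bar> \<le> \<bar>s\<bar> + \<bar>t\<bar>" for u
  proof -
    have "norm (u *\<^sub>R X) < real N * (rad / 2)" using n[OF that] by simp
    from gexp_eq[OF scale_E[OF X] this] show ?thesis by (simp add: Y_def mult.commute)
  qed
  have b: "\<bar>s\<bar> \<le> \<bar>s\<bar> + \<bar>t\<bar>" "\<bar>t\<bar> \<le> \<bar>s\<bar> + \<bar>t\<bar>" "\<bar>s + t\<bar> \<le> \<bar>s\<bar> + \<bar>t\<bar>" "\<bar>t + s\<bar> \<le> \<bar>s\<bar> + \<bar>t\<bar>" by auto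
  have st: "pt (lexp (s *\<^sub>R Y)) \<otimes> pt (lexp (t *\<^sub>R Y)) = pt (lexp ((s + t) *\<^sub>R Y))"
    by (rule lexp_add[OF YE small small small]) (use b in auto)
  have ts: "pt (lexp (t *\<^sub>R Y)) \<otimes> pt (lexp (s *\<^sub>R Y)) = pt (lexp ((t + s) *\<^sub>R Y))"
    by (rule lexp_add[OF YE small small small]) (use b in auto)
  have c: "pt (lexp (u *\<^sub>R Y)) \<in> carrier L" if "\<bar>u\<bar> \<le> \<bar>s\<bar> + \<bar>t\<bar>" for u
    using small[OF that] by (intro lexp_carrier scale_E YE) simp
  show ?thesis unfolding e[OF b(1)] e[OF b(2)] e[OF b(3)] st[symmetric]
    using pow_mult_distrib[OF _ c[OF b(1)] c[OF b(2)]] st ts by (simp add: add.commute)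
qed

lemma gexp_minus: "X \<in> E \<Longrightarrow> gexp (- X) = inv (gexp X)"
proof -
  assume X: "X \<in> E"
  have "gexp (- X) \<otimes> gexp X = \<one>" using gexp_add[OF X, of "-1" 1] by (simp add: gexp_0)
  moreover have "gexp (- X) \<in> carrier L" using gexp_closed scale_E[OF X, of "-1"] by simp
  ultimately show ?thesis using gexp_closed[OF X] by (simp add: inv_equality)
qed

lemma gexp_nat_mult: "X \<in> E \<Longrightarrow> gexp (real n *\<^sub>R X) = gexp X [^] n"
proof (induction n)
  case (Suc n)
  then show ?case using gexp_add[OF Suc.prems, of "real n" 1] by (simp add: add.commute)
qed (simp add: gexp_0)

lemma gexp_coordinate:
  assumes "X \<in> E" "norm X < rad / 2"
  shows "gexp X \<in> U0" "co (gexp X) = lexp X" "norm (co (gexp X) - X) \<le> CC * (norm X)\<^sup>2" "norm (co (gexp X)) \<le> 2 * norm X"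
  using lexp_props[of X] assms pt_in co_pt by (simp_all add: gexp_small proj_E)

text \<open>The core of the closed subgroup theorem. The powers of \<open>g k\<close> with exponents
  \<open>\<lfloor>t n k\<rfloor>\<close> stay in \<open>S\<close> and converge to the exponential of
  \<open>t X\<close>, so closedness puts the limit in \<open>S\<close>. Small nonnegative
  \<open>t\<close> suffice: powers and inverses reach the rest.\<close>

lemma gexp_of_sequence:
  assumes g: "\<And>k. g k \<in> U0" and S: "subgroup S L" "\<And>k. g k \<in> S" "closedin (mtop (mfd L)) S"
    and c0: "(\<lambda>k. co (g k)) \<longlonglongrightarrow> 0" and nc: "(\<lambda>k. real (n k) *\<^sub>R co (g k)) \<longlonglongrightarrow> X"
  shows "X \<in> E" "gexp (t *\<^sub>R X) \<in> S"
proof -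
  have cE: "co (g k) \<in> E" for k using pt_co(3)[OF g] .
  show XE: "X \<in> E"
    by (rule Lim_in_closed_set[OF closed_subspace[OF subE] _ _ nc]) (use scale_E cE in auto)
  have small: "gexp Y \<in> S" if Y: "norm Y < rad / 2" and mY: "(\<lambda>k. real (m k) *\<^sub>R co (g k)) \<longlonglongrightarrow> Y" for Y m
  proof -
    note p = powers_tendsto_lexp[OF cE c0 mY Y]
    have lY: "lexp Y \<in> O0" using lexp_props(4)[OF p(1)] Y by simp
    have op: "openin (mtop (mfd L)) (carrier L - S)" using S(3) unfolding closedin_def topspace by blast
    show ?thesis
    proof (rule ccontr)
      assume "gexp Y \<notin> S"
      then have n: "pt (lexp Y) \<in> carrier L - S" using gexp_small[OF p(1) Y] pt_carrier[OF lY] by simp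
      \<comment> \<open>The complement of \<open>S\<close> is seen through the identity chart, where
        it is relatively open in \<open>E\<close>; if the limit lay in it, late approximants would
        leave \<open>S\<close>.\<close>
      let ?W = "snd c0 ` ((carrier L - S) \<inter> U0)"
      have o: "openin (top_of_set E) ?W" using op openin_mtop_charts[OF atl] id_chart(1) by blast
      have lw: "a0 + lexp Y \<in> ?W"
      proof -
        have "co (pt (lexp Y)) = lexp Y" using co_pt[OF lY] lexp_props(1)[OF p(1)] Y by (simp add: proj_E)
        then have "a0 + lexp Y = snd c0 (pt (lexp Y))" unfolding co_def diff_eq_eq by (simp add: add.commute)
        then show ?thesis using n pt_in[OF lY] by blast
      qed
      obtain T where T: "open T" "?W = E \<inter> T" using o openin_open by blast
      have "(\<lambda>k. a0 + co (pt (co (g k)) [^] m k)) \<longlonglongrightarrow> a0 + lexp Y" by (intro tendsto_intros p(3))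
      from topological_tendstoD[OF this T(1)] have ev: "\<forall>\<^sub>F k in sequentially. a0 + co (pt (co (g k)) [^] m k) \<in> T"
        using lw T(2) by blast
      have "\<forall>\<^sub>F k in sequentially. False" using ev p(2)
      proof eventually_elim
        case (elim k)
        let ?h = "pt (co (g k)) [^] m k"
        have "a0 + co ?h \<in> E" using subspace_add[OF subE a0E pt_co(3)[OF elim(2)]] .
        then have "snd c0 ?h \<in> ?W" using elim(1) T(2) by (simp add: co_def)
        then have "?h \<in> (carrier L - S) \<inter> U0"
          using inj_on_image_mem_iff[OF smooth_atlasD(1)[OF atl id_chart(1)] elim(2), of "(carrier L - S) \<inter> U0"] by simp
        moreover have "?h \<in> S" using subgroup_nat_pow[OF S(1,2)] pt_co(2)[OF g] by simp
        ultimately show False by simp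
      qed
      then show False by simp
    qed
  qed
  have pos: "gexp (t *\<^sub>R X) \<in> S" if "t \<ge> 0" for t
  proof -
    obtain N where N: "N > 0" "norm (t *\<^sub>R X) < real N * (rad / 2)" using ex_large by blast
    have "norm ((t / real N) *\<^sub>R X) < rad / 2" using N by (simp add: field_simps)
    moreover have "t / real N \<ge> 0" using that by simp
    ultimately have "gexp ((t / real N) *\<^sub>R X) \<in> S" 
      by (rule small[OF _ floor_multiple_tendsto[OF c0 nc]])
    moreover have "gexp (t *\<^sub>R X) = gexp ((t / real N) *\<^sub>R X) [^] N"
      using gexp_nat_mult[OF scale_E[OF XE], of N "t / real N"] N(1) by simp
    ultimately show ?thesis using subgroup_nat_pow[OF S(1)] by simp
  qed
  show "gexp (t *\<^sub>R X) \<in> S"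
  proof (cases "t \<ge> 0")
    case False
    then have "gexp (- t *\<^sub>R X) \<in> S" using pos[of "- t"] by simp
    moreover have "gexp (t *\<^sub>R X) = inv (gexp (- t *\<^sub>R X))" using gexp_minus[OF scale_E[OF XE], of "- t"] by simp
    ultimately show ?thesis using S(1) subgroup.m_inv_closed by metis
  qed (rule pos)
qed

end

section \<open>One-parameter subgroups and Lie algebras of closed subgroups\<close>

lemma has_vector_derivative_at_0_quotient:
  fixes f :: "real \<Rightarrow> 'a::real_normed_vector"
  assumes "(f has_vector_derivative X) (at 0)" "f 0 = 0"
  shows "((\<lambda>h. f h /\<^sub>R h) \<longlongrightarrow> X) (at 0)"
proof -
  have lim: "((\<lambda>h. norm (f (0 + h) - f 0 - h *\<^sub>R X) / norm h) \<longlongrightarrow> 0) (at 0)"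
    using assms(1) unfolding has_vector_derivative_def has_derivative_at by (rule conjunct2)
  have "\<forall>\<^sub>F h in at 0. norm (f (0 + h) - f 0 - h *\<^sub>R X) / norm h = norm (f h /\<^sub>R h - X)"
  proof (rule eventually_mono[OF eventually_neq_at_within[of 0]])
    fix h :: real assume h: "h \<noteq> 0"
    then have "f h /\<^sub>R h - X = (f h - h *\<^sub>R X) /\<^sub>R h" by (simp add: scaleR_diff_right)
    then have "norm (f h /\<^sub>R h - X) = norm (f h - h *\<^sub>R X) / \<bar>h\<bar>" by (simp add: divide_inverse mult.commute)
    then show "norm (f (0 + h) - f 0 - h *\<^sub>R X) / norm h = norm (f h /\<^sub>R h - X)" using assms(2) by simp
  qed
  from Lim_transform_eventually[OF lim this] show ?thesis
    by (rule LIM_zero_cancel[OF tendsto_norm_zero_cancel])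
qed

lemma has_vector_derivative_at_0_sequence:
  fixes f :: "real \<Rightarrow> 'a::real_normed_vector"
  assumes "(f has_vector_derivative X) (at 0)" "f 0 = 0"
  shows "(\<lambda>k. real (Suc k) *\<^sub>R f (u / real (Suc k))) \<longlonglongrightarrow> u *\<^sub>R X" "(\<lambda>k. f (u / real (Suc k))) \<longlonglongrightarrow> 0"
proof -
  have u0: "(\<lambda>k. u / real (Suc k)) \<longlonglongrightarrow> 0"
    using LIMSEQ_Suc[OF lim_const_over_n[of u]] by simp
  show 1: "(\<lambda>k. real (Suc k) *\<^sub>R f (u / real (Suc k))) \<longlonglongrightarrow> u *\<^sub>R X"
  proof (cases "u = 0")
    case True
    then show ?thesis using assms(2) by simp
  next
    case False
    have "filterlim (\<lambda>k. u / real (Suc k)) (at 0) sequentially"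
      unfolding filterlim_at using u0 False by simp
    from filterlim_compose[OF has_vector_derivative_at_0_quotient[OF assms] this]
    have "(\<lambda>k. u *\<^sub>R (f (u / real (Suc k)) /\<^sub>R (u / real (Suc k)))) \<longlonglongrightarrow> u *\<^sub>R X"
      by (rule tendsto_scaleR[OF tendsto_const])
    moreover have "u *\<^sub>R (f (u / real (Suc k)) /\<^sub>R (u / real (Suc k))) = real (Suc k) *\<^sub>R f (u / real (Suc k))" for k
      using False by simp
    ultimately show ?thesis by (simp only:)
  qed
  have "isCont f 0" using assms(1) has_vector_derivative_continuous by blast
  then show "(\<lambda>k. f (u / real (Suc k))) \<longlonglongrightarrow> 0" using isCont_tendsto_compose[OF _ u0, of f] assms(2) by simp
qed

context lie_grp begin

lemma homomorphism_curve_0: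
  fixes c :: "real \<Rightarrow> 'g"
  assumes "\<And>s t. c (s + t) = c s \<otimes> c t" "\<And>t. c t \<in> carrier L" shows "c 0 = \<one>"
  using assms(1)[of 0 0] assms(2)[of 0] by simp

lemma homomorphism_curve_mult:
  fixes c :: "real \<Rightarrow> 'g"
  assumes "\<And>s t. c (s + t) = c s \<otimes> c t" "\<And>t. c t \<in> carrier L" shows "c (real n * t) = c t [^] n"
proof (induction n)
  case 0
  then show ?case using homomorphism_curve_0[of c] assms by simp
next
  case (Suc n)
  have "c (real (Suc n) * t) = c (real n * t + t)" by (simp add: algebra_simps)
  then show ?case using Suc assms(1) by simp
qed

text \<open>The value at \<open>u\<close> is the \<open>(k + 1)\<close>-st power of the value at
  \<open>u / (k + 1)\<close>, and \<open>k + 1\<close> times the coordinate of the latter tends to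
  \<open>u X\<close>. The limit theorem for powers identifies \<open>c u\<close>; differentiability
  at 0 replaces any differential equation.\<close>

lemma one_parameter_unique:
  fixes c :: "real \<Rightarrow> 'g"
  assumes hom: "\<And>s t. c (s + t) = c s \<otimes> c t" and car: "\<And>t. c t \<in> carrier L"
    and U: "\<forall>\<^sub>F t in at 0. c t \<in> U0"
    and d: "((\<lambda>t. co (c t)) has_vector_derivative X) (at 0)"
  shows "X \<in> E" "c t = gexp (t *\<^sub>R X)"
proof -
  have c00: "c 0 = \<one>" using homomorphism_curve_0 hom car by blast
  have co0: "co (c 0) = 0" using c00 co_one by simp
  have main: "u *\<^sub>R X \<in> E \<and> c u = gexp (u *\<^sub>R X)" if u: "u \<noteq> 0" "norm (u *\<^sub>R X) < rad / 2" for u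
  proof -
    define x where "x k = (if c (u / real (Suc k)) \<in> U0 then co (c (u / real (Suc k))) else 0)" for k
    have xE: "x k \<in> E" for k using pt_co(3) subspace_0[OF subE] by (simp add: x_def)
    have fl: "filterlim (\<lambda>k. u / real (Suc k)) (at 0) sequentially"
      unfolding filterlim_at using LIMSEQ_Suc[OF lim_const_over_n[of u]] u(1) by simp
    have ev: "\<forall>\<^sub>F k in sequentially. c (u / real (Suc k)) \<in> U0"
      using filterlim_iff[THEN iffD1, OF fl, rule_format, OF U] .
    then have ex: "\<forall>\<^sub>F k in sequentially. co (c (u / real (Suc k))) = x k"
      by (rule eventually_mono) (simp add: x_def)
    have x0: "x \<longlonglongrightarrow> 0"
      by (rule Lim_transform_eventually[OF has_vector_derivative_at_0_sequence(2)[OF d co0] ex])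
    have ex': "\<forall>\<^sub>F k in sequentially. real (Suc k) *\<^sub>R co (c (u / real (Suc k))) = real (Suc k) *\<^sub>R x k"
      using ex by (rule eventually_mono) simp
    have nx: "(\<lambda>k. real (Suc k) *\<^sub>R x k) \<longlonglongrightarrow> u *\<^sub>R X"
      by (rule Lim_transform_eventually[OF has_vector_derivative_at_0_sequence(1)[OF d co0] ex'])
    note p = powers_tendsto_lexp[OF xE x0 nx u(2)]
    have cu: "\<forall>\<^sub>F k in sequentially. pt (x k) [^] Suc k = c u"
      using ev
    proof eventually_elim
      case (elim k)
      then have "pt (x k) = c (u / real (Suc k))" using pt_co(2) by (simp add: x_def)
      then show ?case using homomorphism_curve_mult[of c "Suc k" "u / real (Suc k)"] hom car by simp
    qed
    \<comment> \<open>The point \<open>c u\<close> does not depend on \<open>k\<close>, so a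
      property that holds eventually holds outright.\<close>
    have "\<forall>\<^sub>F k::nat in sequentially. c u \<in> U0" using cu p(2) by eventually_elim simp
    then have cU: "c u \<in> U0" by simp
    have "\<forall>\<^sub>F k in sequentially. co (pt (x k) [^] Suc k) = co (c u)" using cu by (rule eventually_mono) simp
    from Lim_transform_eventually[OF p(3) this] have "co (c u) = lexp (u *\<^sub>R X)"
      by (simp add: LIMSEQ_const_iff)
    then have "c u = pt (lexp (u *\<^sub>R X))" using pt_co(2)[OF cU] by simp
    then show ?thesis using p(1) gexp_small u(2) by simp
  qed
  have gen: "X \<in> E \<and> c t = gexp (t *\<^sub>R X)" if "t \<noteq> 0" for t
  proof -
    obtain N where N: "N > 0" "norm (t *\<^sub>R X) < real N * (rad / 2)" using ex_large by blast
    have "t / real N \<noteq> 0" "norm ((t / real N) *\<^sub>R X) < rad / 2" using N that by (auto simp: field_simps)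
    from main[OF this] have m: "(t / real N) *\<^sub>R X \<in> E" "c (t / real N) = gexp ((t / real N) *\<^sub>R X)" by auto
    have "(real N / t) *\<^sub>R ((t / real N) *\<^sub>R X) = X" using N(1) that by simp
    then have XE: "X \<in> E" using scale_E[OF m(1)] by metis
    have "c t = c (t / real N) [^] N"
      using homomorphism_curve_mult[of c N "t / real N"] hom car N(1) by simp
    also have "\<dots> = gexp (real N *\<^sub>R ((t / real N) *\<^sub>R X))" unfolding m(2) gexp_nat_mult[OF m(1)] ..
    also have "real N *\<^sub>R ((t / real N) *\<^sub>R X) = t *\<^sub>R X" using N(1) by simp
    finally show ?thesis using XE by simp
  qed
  show "X \<in> E" using gen[of 1] by simp
  show "c t = gexp (t *\<^sub>R X)" using gen[of t] c00 by (cases "t = 0") (auto simp: gexp_0)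
qed

lemma gexp_curve_derivative:
  assumes X: "X \<in> E" shows "((\<lambda>t. co (gexp (t *\<^sub>R X))) has_vector_derivative X) (at 0)"
  unfolding has_vector_derivative_def
\<comment> \<open>The radius guarantees that \<open>t X\<close> is shorter than
  \<open>rad / 2\<close>; dividing by \<open>norm X + 1\<close> also covers \<open>X = 0\<close>.
  The function \<open>H\<close> is the quadratic coordinate error divided by the absolute value of
  \<open>t\<close>.\<close>
proof (rule has_derivativeI_sandwich[where e = "rad / 2 / (norm X + 1)" and H = "\<lambda>t. CC * \<bar>t\<bar> * (norm X)\<^sup>2"])
  show "0 < rad / 2 / (norm X + 1)" using rad(1) by (simp add: add_nonneg_pos)
  show "bounded_linear (\<lambda>h. h *\<^sub>R X)" by (rule bounded_linear_scaleR_left)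
  have "((\<lambda>t. CC * \<bar>t\<bar> * (norm X)\<^sup>2) \<longlongrightarrow> CC * \<bar>0\<bar> * (norm X)\<^sup>2) (at 0)" by (intro tendsto_intros)
  then show "((\<lambda>t. CC * \<bar>t\<bar> * (norm X)\<^sup>2) \<longlongrightarrow> 0) (at 0)" by simp
  fix t :: real assume t: "t \<noteq> 0" "dist t 0 < rad / 2 / (norm X + 1)"
  have np: "0 < norm X + 1" by (simp add: add_nonneg_pos)
  have "\<bar>t\<bar> < rad / 2 / (norm X + 1)" using t(2) by (simp only: dist_norm diff_zero real_norm_def)
  then have "\<bar>t\<bar> * (norm X + 1) < rad / 2" unfolding pos_less_divide_eq[OF np] .
  then have "norm (t *\<^sub>R X) < rad / 2" by (simp add: distrib_left)
  from gexp_coordinate(3)[OF scale_E[OF X] this]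
  have "norm (co (gexp (t *\<^sub>R X)) - t *\<^sub>R X) \<le> CC * (\<bar>t\<bar> * norm X)\<^sup>2" by simp
  also have "\<dots> = CC * \<bar>t\<bar> * (norm X)\<^sup>2 * \<bar>t\<bar>" by (simp add: power2_eq_square)
  finally show "norm (co (gexp (t *\<^sub>R X)) - co (gexp (0 *\<^sub>R X)) - (t - 0) *\<^sub>R X) / norm (t - 0) \<le> CC * \<bar>t\<bar> * (norm X)\<^sup>2"
    using t by (simp add: gexp_0 co_one divide_le_eq)
qed

lemma translation_smooth:
  assumes g: "g \<in> carrier L" and c: "c \<in> atlas (mfd L)" "d \<in> atlas (mfd L)"
  shows "open {x \<in> cdom E c. g \<otimes> cinv E c x \<in> fst d}"
    "smooth_on {x \<in> cdom E c. g \<otimes> cinv E c x \<in> fst d} (\<lambda>x. snd d (g \<otimes> cinv E c x))"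
proof -
  obtain e where e: "e \<in> atlas (mfd L)" "g \<in> fst e" using chart_at[OF g] .
  note eg = chart_in[OF atl e(1) subE e(2)]
  note s = smooth_map2_charts[OF mult_smooth e(1) c subE atl subE atl, simplified]
  let ?W = "{p. fst p \<in> cdom E e \<and> snd p \<in> cdom E c \<and> cinv E e (fst p) \<otimes> cinv E c (snd p) \<in> fst d}"
  have eq: "{x \<in> cdom E c. g \<otimes> cinv E c x \<in> fst d} = (\<lambda>x. (snd e g, x)) -` ?W" using eg by auto
  show "open {x \<in> cdom E c. g \<otimes> cinv E c x \<in> fst d}" unfolding eq
    by (intro continuous_open_vimage s continuous_intros)
  have "smooth_on {x \<in> cdom E c. g \<otimes> cinv E c x \<in> fst d} (\<lambda>x. snd d (cinv E e (fst (snd e g, x)) \<otimes> cinv E c (snd (snd e g, x))))"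
    by (rule smooth_on_compose[OF smooth_on_Pair[OF smooth_on_const smooth_on_bounded_linear[OF bounded_linear_ident]] s(2)])
      (use eg in auto)
  then show "smooth_on {x \<in> cdom E c. g \<otimes> cinv E c x \<in> fst d} (\<lambda>x. snd d (g \<otimes> cinv E c x))" using eg by simp
qed

text \<open>Near time \<open>t\<close> the curve is \<open>mu (lexp (t X), lexp (s X))\<close> in
  the increment \<open>s\<close>, so its derivative at \<open>t\<close> is that of \<open>mu\<close>
  at \<open>(lexp (t X), 0)\<close> in direction \<open>(0, X)\<close>. This is a smooth function of
  the curve itself, and each order of smoothness yields the next. The bound \<open>rad / 4\<close>
  keeps sums of two times below \<open>rad / 2\<close>.\<close>

lemma lexp_curve_smooth:
  assumes X: "X \<in> E"
  shows "smooth_on {t. \<bar>t\<bar> * norm X < rad / 4} (\<lambda>t. lexp (t *\<^sub>R X))"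
proof -
  let ?I = "{t. \<bar>t\<bar> * norm X < rad / 4}"
  have oI: "open ?I" by (intro open_Collect_less continuous_intros)
  have lE: "(lexp (t *\<^sub>R X), lexp (s *\<^sub>R X)) \<in> Om" if "t \<in> ?I" "s \<in> ?I" for s t
    using lexp_props(6)[OF scale_E[OF X], of t] lexp_props(6)[OF scale_E[OF X], of s] that rad(1)
    by (intro rad(4)) auto
  have add: "lexp ((t + s) *\<^sub>R X) = mu (lexp (t *\<^sub>R X), lexp (s *\<^sub>R X))" if "t \<in> ?I" "s \<in> ?I" for s t
  proof -
    have "\<bar>t + s\<bar> * norm X \<le> \<bar>t\<bar> * norm X + \<bar>s\<bar> * norm X"
      by (metis abs_triangle_ineq distrib_right mult_right_mono norm_ge_zero)
    then have st: "\<bar>t + s\<bar> * norm X < rad / 2" using that by simp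
    have "pt (lexp (t *\<^sub>R X)) \<otimes> pt (lexp (s *\<^sub>R X)) = pt (lexp ((t + s) *\<^sub>R X))"
      by (rule lexp_add[OF X]) (use that st rad(1) in auto)
    moreover have "co (pt (lexp ((t + s) *\<^sub>R X))) = lexp ((t + s) *\<^sub>R X)"
      using lexp_props(1,4)[OF scale_E[OF X], of "t + s"] st by (simp add: co_pt proj_E)
    ultimately show ?thesis by (simp add: mu_def)
  qed
  have lexp_der: "((\<lambda>s. lexp (s *\<^sub>R X)) has_derivative (\<lambda>s. s *\<^sub>R X)) (at 0)"
  proof (rule has_derivative_transform_within_open[OF _ oI])
    show "((\<lambda>t. co (gexp (t *\<^sub>R X))) has_derivative (\<lambda>s. s *\<^sub>R X)) (at 0)"
      using gexp_curve_derivative[OF X] by (simp add: has_vector_derivative_def)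
    show "(0::real) \<in> ?I" using rad(1) by simp
    show "co (gexp (t *\<^sub>R X)) = lexp (t *\<^sub>R X)" if "t \<in> ?I" for t
      using that gexp_coordinate(2)[OF scale_E[OF X], of t] rad(1) by simp
  qed
  have "Ck_on k ?I (\<lambda>t. lexp (t *\<^sub>R X))" for k
  proof (induction k)
    case 0
    have "isCont (\<lambda>t. lexp (t *\<^sub>R X)) t" if t: "t \<in> ?I" for t
    proof -
      have "isCont (\<lambda>s. lexp (s *\<^sub>R X)) 0" using lexp_der has_derivative_continuous by blast
      then have "((\<lambda>s. lexp (s *\<^sub>R X)) \<longlongrightarrow> 0) (at 0)" using isContD lexp_0 by fastforce
      moreover have "isCont mu (lexp (t *\<^sub>R X), 0)"
        using smooth_on_imp_continuous_on[OF Om(2)] Om(1) lE[OF t, of 0] rad(1)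
        by (simp add: lexp_0 continuous_on_eq_continuous_at)
      ultimately have "((\<lambda>s. mu (lexp (t *\<^sub>R X), lexp (s *\<^sub>R X))) \<longlongrightarrow> mu (lexp (t *\<^sub>R X), 0)) (at 0)"
        by (intro isCont_tendsto_compose[of _ mu] tendsto_Pair tendsto_const)
      moreover have "\<forall>\<^sub>F s in at 0. mu (lexp (t *\<^sub>R X), lexp (s *\<^sub>R X)) = lexp ((t + s) *\<^sub>R X)"
        unfolding eventually_at_topological by (rule exI[of _ ?I]) (use add t oI rad(1) in auto)
      ultimately have "((\<lambda>s. lexp ((t + s) *\<^sub>R X)) \<longlongrightarrow> mu (lexp (t *\<^sub>R X), 0)) (at 0)"
        by (rule Lim_transform_eventually)
      moreover have "mu (lexp (t *\<^sub>R X), 0) = lexp (t *\<^sub>R X)" using add[OF t, of 0] rad(1) by (simp add: lexp_0)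
      ultimately show ?thesis by (simp add: isCont_iff)
    qed
    then show ?case using oI by (simp add: continuous_at_imp_continuous_on)
  next
    case (Suc k)
    obtain D where D1: "\<And>p. p \<in> Om \<Longrightarrow> (mu has_derivative D p) (at p within Om)"
      and D2: "\<And>v. Ck_on k Om (\<lambda>p. D p v)"
      by (rule Ck_on_SucE[OF smooth_on_Ck[OF Om(2), of "Suc k"]]) blast
    define F where "F t = D (lexp (t *\<^sub>R X), 0) (0, X)" for t
    have der: "((\<lambda>t. lexp (t *\<^sub>R X)) has_derivative (\<lambda>h. h *\<^sub>R F t)) (at t within ?I)" if t: "t \<in> ?I" for t
    proof -
      let ?p = "(lexp (t *\<^sub>R X), 0::'e)"
      have p: "?p \<in> Om" using lE[OF t, of 0] rad(1) by (simp add: lexp_0)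
      have "((\<lambda>s. (lexp (t *\<^sub>R X), lexp (s *\<^sub>R X))) has_derivative (\<lambda>s. (0, s *\<^sub>R X))) (at 0)"
        by (intro has_derivative_Pair has_derivative_const lexp_der)
      moreover have "(mu has_derivative D ?p) (at ((\<lambda>s. (lexp (t *\<^sub>R X), lexp (s *\<^sub>R X))) 0))"
        using D1[OF p] Om(1) p by (simp add: at_within_open[of _ Om] lexp_0)
      ultimately have "((\<lambda>s. mu (lexp (t *\<^sub>R X), lexp (s *\<^sub>R X))) has_derivative (\<lambda>s. D ?p (0, s *\<^sub>R X))) (at 0)"
        by (rule has_derivative_compose)
      moreover have "D ?p (0, s *\<^sub>R X) = s *\<^sub>R F t" for s
        using linear_scale[OF has_derivative_linear[OF D1[OF p]], of s "(0, X)"] by (simp add: F_def)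
      ultimately have "((\<lambda>s. mu (lexp (t *\<^sub>R X), lexp (s *\<^sub>R X))) has_derivative (\<lambda>s. s *\<^sub>R F t)) (at 0)" by simp
      moreover have sh: "((\<lambda>s. s - t) has_derivative (\<lambda>s. s)) (at t)"
        using has_derivative_diff[OF has_derivative_ident has_derivative_const[of t]] by simp
      ultimately have "((\<lambda>s. lexp ((t + s) *\<^sub>R X)) has_derivative (\<lambda>s. s *\<^sub>R F t)) (at 0)"
        by (elim has_derivative_transform_within_open[OF _ oI]) (use add t rad(1) in auto)
      then have "((\<lambda>s. lexp ((t + (s - t)) *\<^sub>R X)) has_derivative (\<lambda>s. s *\<^sub>R F t)) (at t)"
        using has_derivative_compose[OF sh, of "\<lambda>s. lexp ((t + s) *\<^sub>R X)" "\<lambda>s. s *\<^sub>R F t"] by simp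
      then show ?thesis by (simp add: has_derivative_at_withinI)
    qed
    have F: "Ck_on k ?I F" unfolding F_def
    proof (rule Ck_on_compose[OF _ Ck_on_Pair[OF Suc Ck_on_const] D2])
      show "(\<lambda>t. (lexp (t *\<^sub>R X), 0)) ` ?I \<subseteq> Om" using lE[of _ 0] rad(1) by (auto simp: lexp_0)
    qed
    show ?case
      by (rule Ck_on_SucI, erule der, rule Ck_on_bilinear[OF bounded_bilinear_scaleR Ck_on_const F])
  qed
  then show ?thesis by (simp add: smooth_on_def)
qed

text \<open>Left translation by the value at \<open>t0\<close> carries the curve near time 0, which
  is smooth in the identity chart, to a neighbourhood of \<open>t0\<close> in any chart.\<close>

lemma gexp_translate_local:
  assumes X: "X \<in> E" and d: "d \<in> atlas (mfd L)" and t0: "gexp (t0 *\<^sub>R X) \<in> fst d"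
  shows "\<exists>T. open T \<and> t0 \<in> T \<and> T \<subseteq> {t. gexp (t *\<^sub>R X) \<in> fst d} \<and> smooth_on T (\<lambda>t. snd d (gexp (t *\<^sub>R X)))"
proof -
  let ?g = "gexp (t0 *\<^sub>R X)"
  let ?I = "{t. \<bar>t\<bar> * norm X < rad / 4}"
  let ?J = "(\<lambda>t. t - t0) -` ?I"
  let ?x = "\<lambda>t. a0 + lexp ((t - t0) *\<^sub>R X)"
  let ?W = "{x \<in> cdom E c0. ?g \<otimes> cinv E c0 x \<in> fst d}"
  let ?T = "?J \<inter> ?x -` ?W"
  have gc: "?g \<in> carrier L" by (rule gexp_closed[OF scale_E[OF X]])
  note tr = translation_smooth[OF gc id_chart(1) d]
  have oJ: "open ?J" by (intro open_vimage open_Collect_less continuous_intros)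
  have "smooth_on ?J (\<lambda>t. t + - t0)"
    by (intro smooth_on_add smooth_on_const smooth_on_bounded_linear bounded_linear_ident)
  then have "smooth_on ?J (\<lambda>t. lexp ((t + - t0) *\<^sub>R X))"
    by (rule smooth_on_compose[OF _ lexp_curve_smooth[OF X]]) auto
  then have sx: "smooth_on ?J ?x" using smooth_on_add[OF smooth_on_const[of ?J a0]] by simp
  have oT: "open ?T" using continuous_open_preimage[OF smooth_on_imp_continuous_on[OF sx] oJ tr(1)] .
  have e: "?g \<otimes> cinv E c0 (?x t) = gexp (t *\<^sub>R X)" if "t \<in> ?J" for t
  proof -
    have "cinv E c0 (?x t) = gexp ((t - t0) *\<^sub>R X)"
      using gexp_small[OF scale_E[OF X], of "t - t0"] that rad(1) by (simp add: pt_def)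
    then show ?thesis using gexp_add[OF X, of t0 "t - t0"] by simp
  qed
  have s: "smooth_on ?T (\<lambda>t. snd d (?g \<otimes> cinv E c0 (?x t)))"
    by (rule smooth_on_compose[OF smooth_on_subset[OF sx] tr(2)]) auto
  have "smooth_on ?T (\<lambda>t. snd d (gexp (t *\<^sub>R X)))"
    by (rule smooth_on_cong[THEN iffD1, OF _ s]) (use e in auto)
  moreover have tJ: "t0 \<in> ?J" using rad(1) by simp
  have "a0 \<in> cdom E c0" using O0(2) by (simp add: O0_def)
  then have "t0 \<in> ?T" using tJ e[OF tJ] t0 by (simp add: lexp_0)
  moreover have "?T \<subseteq> {t. gexp (t *\<^sub>R X) \<in> fst d}" using e by auto
  ultimately show ?thesis using oT by blast
qed

lemma smooth_curve_iff:
  "smooth_curve L c \<longleftrightarrow> range c \<subseteq> carrier L \<and>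
    (\<forall>d\<in>atlas (mfd L). open {t. c t \<in> fst d} \<and> smooth_on {t. c t \<in> fst d} (\<lambda>t. snd d (c t)))"
proof -
  have p: "points (vec_mfd (UNIV :: real set)) = UNIV" by (simp add: points_def vec_mfd_def)
  have i: "inv_into UNIV (\<lambda>x::real. x) = (\<lambda>x. x)"
    using inv_into_f_f[of "\<lambda>x::real. x" UNIV] by (simp add: fun_eq_iff)
  show ?thesis
    unfolding smooth_curve_def smooth_map_def p pts by (simp add: vec_mfd_def i o_def vimage_def case_prod_beta)
qed

lemma gexp_smooth_curve:
  assumes X: "X \<in> E" shows "smooth_curve L (\<lambda>t. gexp (t *\<^sub>R X))"
proof -
  have "open {t. gexp (t *\<^sub>R X) \<in> fst d} \<and> smooth_on {t. gexp (t *\<^sub>R X) \<in> fst d} (\<lambda>t. snd d (gexp (t *\<^sub>R X)))"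
    if d: "d \<in> atlas (mfd L)" for d
  proof -
    define W where "W = {t. gexp (t *\<^sub>R X) \<in> fst d}"
    have *: "\<exists>T. open T \<and> t \<in> T \<and> T \<subseteq> W \<and> smooth_on T (\<lambda>t. snd d (gexp (t *\<^sub>R X)))" if "t \<in> W" for t
      using gexp_translate_local[OF X d, of t] that unfolding W_def by (simp only: mem_Collect_eq)
    then have "open W" by (subst open_subopen) blast
    moreover have "smooth_on W (\<lambda>t. snd d (gexp (t *\<^sub>R X)))" by (rule smooth_on_local_open) (rule *)
    ultimately show ?thesis by (simp add: W_def)
  qed
  then show ?thesis unfolding smooth_curve_iff using gexp_closed scale_E[OF X] by blast
qed

lemma smooth_curve_velocity:
  assumes c: "smooth_curve L c" "c 0 = \<one>"
  shows "open {t. c t \<in> U0}" "\<forall>\<^sub>F t in at 0. c t \<in> U0"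
    "((\<lambda>t. co (c t)) has_vector_derivative velocity L c) (at 0)" "c t \<in> carrier L"
proof -
  let ?T = "{t. c t \<in> U0}"
  have T: "open ?T" "smooth_on ?T (\<lambda>t. snd c0 (c t))" using c(1) id_chart(1) unfolding smooth_curve_iff by auto
  show "open ?T" by (rule T)
  have 0: "0 \<in> ?T" using c(2) id_chart(2) by simp
  show "\<forall>\<^sub>F t in at 0. c t \<in> U0" unfolding eventually_at_topological using T(1) 0 by (intro exI[of _ ?T]) auto
  show "c t \<in> carrier L" using c(1) unfolding smooth_curve_iff by auto
  obtain D where "\<And>t. t \<in> ?T \<Longrightarrow> ((\<lambda>t. snd c0 (c t)) has_derivative D t) (at t within ?T)"
    by (rule Ck_on_SucE[OF smooth_on_Ck[OF T(2), of "Suc 0"]]) blast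
  then have "((\<lambda>t. snd c0 (c t)) has_derivative D 0) (at 0)" using 0 T(1) by (metis at_within_open)
  then have "(\<lambda>t. snd c0 (c t)) differentiable (at 0)" by (auto simp: differentiable_def)
  then have "((\<lambda>t. snd c0 (c t)) has_vector_derivative velocity L c) (at 0)"
    unfolding velocity_def by (simp add: vector_derivative_works)
  from has_vector_derivative_diff[OF this has_vector_derivative_const[of a0]]
  show "((\<lambda>t. co (c t)) has_vector_derivative velocity L c) (at 0)" by (simp add: co_def)
qed

lemma velocity_eqI:
  assumes "((\<lambda>t. co (c t)) has_vector_derivative X) (at 0)" shows "velocity L c = X"
proof -
  have "((\<lambda>t. co (c t) + a0) has_vector_derivative X + 0) (at 0)"
    by (intro has_vector_derivative_add has_vector_derivative_const assms)
  then show ?thesis unfolding velocity_def by (simp add: co_def vector_derivative_at)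
qed

lemma lie_exp_eq:
  assumes X: "X \<in> E" shows "lie_exp L X = gexp X"
proof -
  have "(THE c. smooth_curve L c \<and> (\<forall>s t. c (s + t) = c s \<otimes> c t) \<and> velocity L c = X) = (\<lambda>t. gexp (t *\<^sub>R X))"
  proof (rule the_equality)
    show "smooth_curve L (\<lambda>t. gexp (t *\<^sub>R X)) \<and> (\<forall>s t. gexp ((s + t) *\<^sub>R X) = gexp (s *\<^sub>R X) \<otimes> gexp (t *\<^sub>R X))
       \<and> velocity L (\<lambda>t. gexp (t *\<^sub>R X)) = X"
      using gexp_smooth_curve[OF X] gexp_add[OF X] velocity_eqI[OF gexp_curve_derivative[OF X]] by simp
    fix c assume c: "smooth_curve L c \<and> (\<forall>s t. c (s + t) = c s \<otimes> c t) \<and> velocity L c = X"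
    then have h: "\<And>s t. c (s + t) = c s \<otimes> c t" "\<And>t. c t \<in> carrier L"
      unfolding smooth_curve_iff by auto
    note v = smooth_curve_velocity[of c, OF _ homomorphism_curve_0[of c, OF h]]
    show "c = (\<lambda>t. gexp (t *\<^sub>R X))"
      using one_parameter_unique(2)[OF h v(2) v(3)] c by auto
  qed
  then show ?thesis unfolding lie_exp_def by simp
qed

text \<open>The curve need not be a homomorphism: its samples at \<open>1 / (k + 1)\<close>,
  rescaled by \<open>k + 1\<close>, tend to the velocity, and the limit argument for sequences in a
  closed subgroup produces the whole ray.\<close>

lemma curve_in_closed_subgroup:
  assumes S: "subgroup S L" "closedin (mtop (mfd L)) S"
    and c: "c 0 = \<one>" "\<And>t::real. c t \<in> S" "\<forall>\<^sub>F t in at 0. c t \<in> U0" "((\<lambda>t. co (c t)) has_vector_derivative X) (at 0)"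
  shows "X \<in> E" "gexp (t *\<^sub>R X) \<in> S"
proof -
  have co0: "co (c 0) = 0" using c(1) co_one by simp
  \<comment> \<open>The default \<open>\<one>\<close> lies both in the identity chart and in
    \<open>S\<close>, so both memberships hold for every \<open>k\<close>.\<close>
  define g where "g k = (if c (1 / real (Suc k)) \<in> U0 then c (1 / real (Suc k)) else \<one>)" for k
  have fl: "filterlim (\<lambda>k. 1 / real (Suc k)) (at 0) sequentially"
    unfolding filterlim_at using LIMSEQ_Suc[OF lim_const_over_n[of "1::real"]] by simp
  have ev: "\<forall>\<^sub>F k in sequentially. c (1 / real (Suc k)) \<in> U0"
    using filterlim_iff[THEN iffD1, OF fl, rule_format, OF c(3)] .
  have g: "g k \<in> U0" "g k \<in> S" for k
    using id_chart(2) subgroup.one_closed[OF S(1)] c(2) by (auto simp: g_def)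
  have e1: "\<forall>\<^sub>F k in sequentially. co (c (1 / real (Suc k))) = co (g k)"
    using ev by (rule eventually_mono) (simp add: g_def)
  have e2: "\<forall>\<^sub>F k in sequentially. real (Suc k) *\<^sub>R co (c (1 / real (Suc k))) = real (Suc k) *\<^sub>R co (g k)"
    using ev by (rule eventually_mono) (simp add: g_def)
  have c0: "(\<lambda>k. co (g k)) \<longlonglongrightarrow> 0"
    by (rule Lim_transform_eventually[OF has_vector_derivative_at_0_sequence(2)[OF c(4) co0] e1])
  have nc: "(\<lambda>k. real (Suc k) *\<^sub>R co (g k)) \<longlonglongrightarrow> 1 *\<^sub>R X"
    by (rule Lim_transform_eventually[OF has_vector_derivative_at_0_sequence(1)[OF c(4) co0] e2])
  show "X \<in> E" "gexp (t *\<^sub>R X) \<in> S"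
    using gexp_of_sequence[OF g(1) S(1) g(2) S(2) c0 nc] by simp_all
qed

text \<open>Replaces velocities of smooth curves by rays in \<open>S\<close>; membership in a Lie
  algebra is tested in this form from here on.\<close>

lemma Lie_closed_subgroup:
  assumes S: "subgroup S L" "closedin (mtop (mfd L)) S"
  shows "Lie L S = {X \<in> E. \<forall>t. gexp (t *\<^sub>R X) \<in> S}"
proof (intro equalityI subsetI)
  fix X assume "X \<in> {X \<in> E. \<forall>t. gexp (t *\<^sub>R X) \<in> S}"
  then have X: "X \<in> E" "\<And>t. gexp (t *\<^sub>R X) \<in> S" by auto
  have "X = velocity L (\<lambda>t. gexp (t *\<^sub>R X))" using velocity_eqI[OF gexp_curve_derivative[OF X(1)]] by simp
  moreover have "smooth_curve L (\<lambda>t. gexp (t *\<^sub>R X)) \<and> gexp (0 *\<^sub>R X) = \<one> \<and> range (\<lambda>t. gexp (t *\<^sub>R X)) \<subseteq> S"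
    using gexp_smooth_curve[OF X(1)] X(2) by (auto simp: gexp_0)
  ultimately show "X \<in> Lie L S" unfolding Lie_def by blast
next
  fix X assume "X \<in> Lie L S"
  then obtain c where c: "X = velocity L c" "smooth_curve L c" "c 0 = \<one>" "range c \<subseteq> S" unfolding Lie_def by blast
  have cS: "c t \<in> S" for t using c(4) by blast
  show "X \<in> {X \<in> E. \<forall>t. gexp (t *\<^sub>R X) \<in> S}"
    using curve_in_closed_subgroup[OF S c(3) cS smooth_curve_velocity(2,3)[OF c(2,3)]] c(1) by simp
qed

lemma Lie_carrier: "Lie L (carrier L) = E"
proof -
  have "closedin (mtop (mfd L)) (carrier L)" using closedin_topspace topspace by metis
  then show ?thesis using Lie_closed_subgroup[OF subgroup_self] gexp_closed scale_E by auto
qed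

end

section \<open>Differentials, the adjoint representation and the bracket\<close>

lemma has_derivative_within_openin:
  assumes "openin (top_of_set E) S" "x \<in> S"
  shows "at x within S = at x within E"
proof -
  obtain T where T: "open T" "S = E \<inter> T" using assms(1) openin_open by blast
  then show ?thesis using assms(2) by (intro at_within_nhd[of x T]) auto
qed

text \<open>Projecting onto \<open>S\<close> does not change \<open>f\<close> near the point, so by
  uniqueness the derivative equals its own projection.\<close>

lemma has_derivative_in_subspace:
  fixes f :: "'a::real_normed_vector \<Rightarrow> 'b::euclidean_space"
  assumes f: "(f has_derivative D) (at x)" and S: "subspace S" "\<forall>\<^sub>F y in nhds x. f y \<in> S"
  shows "D v \<in> S"
proof -
  have "((\<lambda>y. proj S (f y)) has_derivative (\<lambda>v. proj S (D v))) (at x)"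
    by (rule bounded_linear.has_derivative[OF bounded_linear_proj f])
  moreover have e: "\<forall>\<^sub>F y in nhds x. proj S (f y) = f y" using S(2) by (rule eventually_mono) (rule proj_id[OF S(1)])
  then have "\<forall>\<^sub>F y in at x. proj S (f y) = f y" by (auto simp: eventually_at_filter elim: eventually_mono)
  moreover have "proj S (f x) = f x" using e by (rule eventually_nhds_x_imp_x)
  ultimately have "(f has_derivative (\<lambda>v. proj S (D v))) (at x)"
    by (rule has_derivative_transform_eventually) simp
  from has_derivative_unique[OF f this] have "D v = proj S (D v)" by metis
  then show ?thesis using proj_in[OF S(1)] by metis
qed

context lie_grp begin

text \<open>The differential at the identity as a relation. Because \<open>pt\<close> is defined
  around 0 in the full type and not only on \<open>E\<close>, the map \<open>D\<close> is determined
  everywhere, which gives \<open>tder_unique\<close>.\<close>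

definition tder :: "('g \<Rightarrow> 'g) \<Rightarrow> ('e \<Rightarrow> 'e) \<Rightarrow> bool" where
  "tder f D \<longleftrightarrow> f \<one> = \<one> \<and> (\<forall>\<^sub>F x in nhds 0. f (pt x) \<in> U0) \<and>
     ((\<lambda>x. co (f (pt x))) has_derivative D) (at 0)"

lemma tder_linear: "tder f D \<Longrightarrow> linear D" "tder f D \<Longrightarrow> bounded_linear D"
  unfolding tder_def using has_derivative_linear has_derivative_bounded_linear by blast+

lemma tder_unique: "tder f D \<Longrightarrow> tder f D' \<Longrightarrow> D = D'"
  using has_derivative_unique[of "\<lambda>x. co (f (pt x))" D 0 D'] unfolding tder_def by simp

lemma tder_smooth:
  assumes "smooth_map (mfd L) (mfd L) f" "f \<one> = \<one>" shows "\<exists>D. tder f D"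
proof -
  let ?W = "{x \<in> O0. f (pt x) \<in> U0}"
  note W = map_smooth[OF assms(1)]
  have 0: "0 \<in> ?W" using assms(2) O0 id_chart by (simp add: pt_0)
  obtain D where "\<And>x. x \<in> ?W \<Longrightarrow> ((\<lambda>x. co (f (pt x))) has_derivative D x) (at x within ?W)"
    by (rule Ck_on_SucE[OF smooth_on_Ck[OF W(2), of "Suc 0"]]) blast
  from this[OF 0] have "((\<lambda>x. co (f (pt x))) has_derivative D 0) (at 0)"
    unfolding at_within_open[OF 0 W(1)] .
  moreover have "\<forall>\<^sub>F x in nhds 0. x \<in> ?W" using W(1) 0 eventually_nhds by blast
  then have "\<forall>\<^sub>F x in nhds 0. f (pt x) \<in> U0" by (rule eventually_mono) simp
  ultimately show ?thesis unfolding tder_def using assms(2) by blast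
qed

lemma tder_curve:
  assumes f: "tder f D" and c: "((\<lambda>t. co (c t)) has_vector_derivative X) (at (0::real))" "c 0 = \<one>" "\<forall>\<^sub>F t in at 0. c t \<in> U0"
  shows "((\<lambda>t. co (f (c t))) has_vector_derivative D X) (at 0)" "\<forall>\<^sub>F t in at 0. f (c t) \<in> U0"
proof -
  have co0: "co (c 0) = 0" using c(2) co_one by simp
  have cd: "((\<lambda>t. co (c t)) has_derivative (\<lambda>h. h *\<^sub>R X)) (at 0)" using c(1) by (simp add: has_vector_derivative_def)
  have fd: "((\<lambda>x. co (f (pt x))) has_derivative D) (at (co (c 0)))" using f co0 by (simp add: tder_def)
  have "((\<lambda>t. co (f (pt (co (c t))))) has_derivative (\<lambda>h. D (h *\<^sub>R X))) (at 0)"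
    by (rule has_derivative_compose[OF cd fd])
  then have "((\<lambda>t. co (f (pt (co (c t))))) has_derivative (\<lambda>h. h *\<^sub>R D X)) (at 0)"
    using linear_scale[OF tder_linear(1)[OF f]] by simp
  moreover have "\<forall>\<^sub>F t in at 0. co (f (pt (co (c t)))) = co (f (c t))"
    using c(3) by (rule eventually_mono) (simp add: pt_co)
  moreover have "co (f (pt (co (c 0)))) = co (f (c 0))" using c(2) by (simp add: co_one pt_0)
  ultimately have "((\<lambda>t. co (f (c t))) has_derivative (\<lambda>h. h *\<^sub>R D X)) (at 0)"
    by (rule has_derivative_transform_eventually) simp
  then show "((\<lambda>t. co (f (c t))) has_vector_derivative D X) (at 0)" by (simp add: has_vector_derivative_def)
  have "isCont (\<lambda>t. co (c t)) 0" using c(1) has_vector_derivative_continuous by blast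
  then have "((\<lambda>t. co (c t)) \<longlongrightarrow> 0) (at 0)" using co0 isContD by metis
  then have "\<forall>\<^sub>F t in at 0. f (pt (co (c t))) \<in> U0"
    using f unfolding tder_def filterlim_iff by blast
  with c(3) show "\<forall>\<^sub>F t in at 0. f (c t) \<in> U0" by eventually_elim (simp add: pt_co)
qed

lemma tder_E: assumes f: "tder f D" shows "D x \<in> E"
proof -
  have "((\<lambda>x. co (f (pt x))) has_derivative D) (at 0)" "\<forall>\<^sub>F x in nhds 0. f (pt x) \<in> U0"
    using f unfolding tder_def by auto
  then show ?thesis by (elim has_derivative_in_subspace[OF _ subE] eventually_mono) (rule pt_co(3))
qed

lemma chart_line_eq: "X \<in> E \<Longrightarrow> chart_line L X t = pt (t *\<^sub>R X)"
  unfolding chart_line_def pt_def cinv_def a0_def[symmetric]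
  using proj_E[OF subspace_add[OF subE a0E scale_E]] by (simp add: case_prod_beta Let_def a0_def)

lemma tangent_map_eq:
  assumes f: "tder f D" and X: "X \<in> E" shows "tangent_map L f X = D X"
proof -
  have fd: "((\<lambda>x. co (f (pt x))) has_derivative D) (at (0 *\<^sub>R X))" using f by (simp add: tder_def)
  have "((\<lambda>t::real. t *\<^sub>R X) has_derivative (\<lambda>t. t *\<^sub>R X)) (at 0)"
    by (rule bounded_linear_imp_has_derivative[OF bounded_linear_scaleR_left])
  from has_derivative_compose[OF this fd]
  have "((\<lambda>t::real. co (f (pt (t *\<^sub>R X)))) has_vector_derivative D X) (at 0)"
    using linear_scale[OF tder_linear(1)[OF f]] by (simp add: has_vector_derivative_def)
  then show ?thesis unfolding tangent_map_def chart_line_eq[OF X] by (rule velocity_eqI)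
qed

lemma gexp_curve:
  assumes X: "X \<in> E"
  shows "((\<lambda>t. co (gexp (t *\<^sub>R X))) has_vector_derivative X) (at 0)" "gexp (0 *\<^sub>R X) = \<one>"
    "\<forall>\<^sub>F t in at 0. gexp (t *\<^sub>R X) \<in> U0"
proof -
  show "((\<lambda>t. co (gexp (t *\<^sub>R X))) has_vector_derivative X) (at 0)" by (rule gexp_curve_derivative[OF X])
  show 0: "gexp (0 *\<^sub>R X) = \<one>" by (simp add: gexp_0)
  show "\<forall>\<^sub>F t in at 0. gexp (t *\<^sub>R X) \<in> U0" by (rule smooth_curve_velocity(2)[OF gexp_smooth_curve[OF X] 0])
qed

text \<open>The main device for identities between tangent vectors: both sides are exponentiated,
  the group identity is checked, and the velocities are compared.\<close>

lemma gexp_ray_inj: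
  assumes "X \<in> E" "Y \<in> E" "\<And>t. gexp (t *\<^sub>R X) = gexp (t *\<^sub>R Y)" shows "X = Y"
proof -
  have "X = velocity L (\<lambda>t. gexp (t *\<^sub>R X))" by (rule velocity_eqI[OF gexp_curve(1)[OF assms(1)], symmetric])
  also have "(\<lambda>t. gexp (t *\<^sub>R X)) = (\<lambda>t. gexp (t *\<^sub>R Y))" by (rule ext) (rule assms(3))
  also have "velocity L (\<lambda>t. gexp (t *\<^sub>R Y)) = Y" by (rule velocity_eqI[OF gexp_curve(1)[OF assms(2)]])
  finally show ?thesis .
qed

lemma tder_hom:
  assumes f: "tder f D" and h: "f \<in> hom L L" and X: "X \<in> E"
  shows "f (gexp (t *\<^sub>R X)) = gexp (t *\<^sub>R D X)"
proof (rule one_parameter_unique(2))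
  note c = gexp_curve[OF X]
  show "f (gexp ((s + t) *\<^sub>R X)) = f (gexp (s *\<^sub>R X)) \<otimes> f (gexp (t *\<^sub>R X))" for s t
    unfolding gexp_add[OF X, symmetric] by (rule hom_mult[OF h]) (rule gexp_closed[OF scale_E[OF X]])+
  show "f (gexp (t *\<^sub>R X)) \<in> carrier L" for t using h gexp_closed[OF scale_E[OF X]] by (rule hom_in_carrier)
  show "\<forall>\<^sub>F t in at 0. f (gexp (t *\<^sub>R X)) \<in> U0" "((\<lambda>t. co (f (gexp (t *\<^sub>R X)))) has_vector_derivative D X) (at 0)"
    using tder_curve[OF f c] by auto
qed

text \<open>With the identity in place of multiplication by the imaginary unit, holomorphy reduces
  to smoothness. A lemma about an arbitrary \<open>J\<close> thus serves real groups as well as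
  complex ones.\<close>

lemma holomorphic_map_id:
  "holomorphic_map (map_prod (\<lambda>v. v) (\<lambda>v. v)) (\<lambda>v. v) (prod_mfd (mfd L) (mfd L)) (mfd L) (\<lambda>(g, h). g \<otimes> h)"
  unfolding holomorphic_map_def
proof (intro conjI mult_smooth)
  let ?f = "\<lambda>(g, h). g \<otimes> h"
  have H: "\<exists>D. ((snd d \<circ> ?f \<circ> inv_into (fst c) (snd c)) has_derivative D) (at x within snd c ` (fst c \<inter> ?f -` fst d)) \<and>
      (\<forall>v\<in>model (prod_mfd (mfd L) (mfd L)). D (map_prod (\<lambda>v. v) (\<lambda>v. v) v) = D v)"
    if cdx: "c \<in> atlas (prod_mfd (mfd L) (mfd L))" "d \<in> atlas (mfd L)" "x \<in> snd c ` (fst c \<inter> ?f -` fst d)" for c d x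
  proof -
    obtain D where "\<And>x. x \<in> snd c ` (fst c \<inter> ?f -` fst d) \<Longrightarrow>
       ((snd d \<circ> ?f \<circ> inv_into (fst c) (snd c)) has_derivative D x) (at x within snd c ` (fst c \<inter> ?f -` fst d))"
      by (rule Ck_on_SucE[OF smooth_on_Ck[OF smooth_mapD(2)[OF mult_smooth cdx(1,2)], of "Suc 0"]]) blast
    from this[OF cdx(3)] show ?thesis by (intro exI[of _ "D x"]) (simp add: map_prod_def)
  qed
  show "\<forall>(U, \<phi>)\<in>atlas (prod_mfd (mfd L) (mfd L)). \<forall>(V, \<psi>)\<in>atlas (mfd L). \<forall>x\<in>\<phi> ` (U \<inter> ?f -` V). \<exists>D.
        ((\<psi> \<circ> ?f \<circ> inv_into U \<phi>) has_derivative D) (at x within \<phi> ` (U \<inter> ?f -` V)) \<and>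
        (\<forall>v\<in>model (prod_mfd (mfd L) (mfd L)). D (map_prod (\<lambda>v. v) (\<lambda>v. v) v) = D v)"
    unfolding case_prod_beta by (intro ballI) (rule H[unfolded case_prod_beta])
qed

lemma holomorphic_mapD:
  assumes "holomorphic_map J K M N f" "c \<in> atlas M" "d \<in> atlas N" "p \<in> fst c" "f p \<in> fst d"
  obtains D where "((snd d \<circ> f \<circ> inv_into (fst c) (snd c)) has_derivative D) (at (snd c p) within snd c ` (fst c \<inter> f -` fst d))"
    "\<And>v. v \<in> model M \<Longrightarrow> D (J v) = K (D v)"
proof -
  have "snd c p \<in> snd c ` (fst c \<inter> f -` fst d)" using assms(4,5) by blast
  then have "\<exists>D. ((snd d \<circ> f \<circ> inv_into (fst c) (snd c)) has_derivative D) (at (snd c p) within snd c ` (fst c \<inter> f -` fst d)) \<and>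
        (\<forall>v\<in>model M. D (J v) = K (D v))"
    using assms(1-3) unfolding holomorphic_map_def case_prod_beta by blast
  then show thesis using that by blast
qed

text \<open>Charts are extended to the whole space by projection.\<close>

lemma mult_partial_derivatives:
  assumes hol: "holomorphic_map (map_prod J J) J (prod_mfd (mfd L) (mfd L)) (mfd L) (\<lambda>(g, h). g \<otimes> h)"
    and J: "J 0 = 0" "\<And>v. v \<in> E \<Longrightarrow> J v \<in> E" and g: "c \<in> atlas (mfd L)" "g \<in> fst c" and h: "d \<in> atlas (mfd L)" "h \<in> fst d"
    and k: "k \<in> atlas (mfd L)" "g \<otimes> h \<in> fst k"
  shows "\<exists>D. ((\<lambda>x. snd k (cinv E c x \<otimes> h)) has_derivative D) (at (snd c g)) \<and> (\<forall>v\<in>E. D (J v) = J (D v))"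
    "\<exists>D. ((\<lambda>x. snd k (g \<otimes> cinv E d x)) has_derivative D) (at (snd d h)) \<and> (\<forall>v\<in>E. D (J v) = J (D v))"
proof -
  let ?f = "\<lambda>(g, h). g \<otimes> h"
  define cd where "cd = (fst c \<times> fst d, map_prod (snd c) (snd d))"
  have cd: "cd \<in> atlas (prod_mfd (mfd L) (mfd L))" unfolding prod_mfd_def cd_def using g h by (cases c; cases d; auto)
  have m: "model (prod_mfd (mfd L) (mfd L)) = E \<times> E" by (simp add: prod_mfd_def)
  have p: "(g, h) \<in> fst cd" "?f (g, h) \<in> fst k" using g h k by (auto simp: cd_def)
  have sp: "snd cd (g, h) = (snd c g, snd d h)" by (simp add: cd_def)
  let ?S = "snd cd ` (fst cd \<inter> ?f -` fst k)"
  obtain D where D: "((snd k \<circ> ?f \<circ> inv_into (fst cd) (snd cd)) has_derivative D) (at (snd c g, snd d h) within ?S)"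
    "\<And>v. v \<in> E \<times> E \<Longrightarrow> D (map_prod J J v) = J (D v)"
    by (rule holomorphic_mapD[OF hol cd k(1) p, unfolded m sp]) blast
  have o: "openin (top_of_set (E \<times> E)) ?S" using smooth_mapD(1)[OF mult_smooth cd k(1)] unfolding m .
  have "(snd c g, snd d h) \<in> ?S"
  proof -
    have "snd cd (g, h) \<in> ?S" using p by (intro imageI) auto
    then show ?thesis by (simp add: sp)
  qed
  note D1 = D(1)[unfolded has_derivative_within_openin[OF o this]]
  note cg = chart_in[OF atl g(1) subE g(2)] and dh = chart_in[OF atl h(1) subE h(2)]
  have Dlin: "linear D" using D1 by (rule has_derivative_linear)
  have inv1: "(snd k \<circ> ?f \<circ> inv_into (fst cd) (snd cd)) (proj E x, snd d h) = snd k (cinv E c x \<otimes> h)" if "x \<in> cdom E c" for x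
    using inv_into_map_prod[OF smooth_atlasD(1)[OF atl g(1)] smooth_atlasD(1)[OF atl h(1)], of "proj E x" "snd d h"] that dh(2) h(2)
    by (simp add: cd_def cdom_def cinv_def dh(3))
  have inv2: "(snd k \<circ> ?f \<circ> inv_into (fst cd) (snd cd)) (snd c g, proj E x) = snd k (g \<otimes> cinv E d x)" if "x \<in> cdom E d" for x
    using inv_into_map_prod[OF smooth_atlasD(1)[OF atl g(1)] smooth_atlasD(1)[OF atl h(1)], of "snd c g" "proj E x"] that cg(2) g(2)
    by (simp add: cd_def cdom_def cinv_def cg(3))
  have q1: "((\<lambda>x. (proj E x, snd d h)) has_derivative (\<lambda>v. (proj E v, 0))) (at (snd c g))"
    and q2: "((\<lambda>x. (snd c g, proj E x)) has_derivative (\<lambda>v. (0, proj E v))) (at (snd d h))"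
    by (intro has_derivative_Pair has_derivative_const bounded_linear_imp_has_derivative bounded_linear_proj)+
  have r1: "((snd k \<circ> ?f \<circ> inv_into (fst cd) (snd cd)) has_derivative D) (at (proj E (snd c g), snd d h) within range (\<lambda>x. (proj E x, snd d h)))"
    unfolding cg(3) by (rule has_derivative_subset[OF D1]) (use proj_in[OF subE] dh(4) in auto)
  have r2: "((snd k \<circ> ?f \<circ> inv_into (fst cd) (snd cd)) has_derivative D) (at (snd c g, proj E (snd d h)) within range (\<lambda>x. (snd c g, proj E x)))"
    unfolding dh(3) by (rule has_derivative_subset[OF D1]) (use proj_in[OF subE] cg(4) in auto)
  have 1: "((\<lambda>x. snd k (cinv E c x \<otimes> h)) has_derivative (\<lambda>v. D (proj E v, 0))) (at (snd c g))"
    by (rule has_derivative_transform_within_open[OF has_derivative_in_compose[OF q1 r1] open_cdom[OF subE atl g(1)] cg(1) inv1])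
  have 2: "((\<lambda>x. snd k (g \<otimes> cinv E d x)) has_derivative (\<lambda>v. D (0, proj E v))) (at (snd d h))"
    by (rule has_derivative_transform_within_open[OF has_derivative_in_compose[OF q2 r2] open_cdom[OF subE atl h(1)] dh(1) inv2])
  have JE: "D (proj E (J v), 0) = J (D (proj E v, 0))" "D (0, proj E (J v)) = J (D (0, proj E v))"
    if "v \<in> E" for v
    using D(2)[of "(v, 0)"] D(2)[of "(0, v)"] that J subspace_0[OF subE] by (simp_all add: proj_E)
  show "\<exists>D. ((\<lambda>x. snd k (cinv E c x \<otimes> h)) has_derivative D) (at (snd c g)) \<and> (\<forall>v\<in>E. D (J v) = J (D v))"
    by (intro exI[of _ "\<lambda>v. D (proj E v, 0)"] conjI ballI 1 JE(1))
  show "\<exists>D. ((\<lambda>x. snd k (g \<otimes> cinv E d x)) has_derivative D) (at (snd d h)) \<and> (\<forall>v\<in>E. D (J v) = J (D v))"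
    by (intro exI[of _ "\<lambda>v. D (0, proj E v)"] conjI ballI 2 JE(2))
qed

section \<open>Conjugation, the adjoint representation and the bracket\<close>

definition cj :: "'g \<Rightarrow> 'g \<Rightarrow> 'g" where "cj g h = g \<otimes> h \<otimes> inv g"

text \<open>Conjugation is left translation by \<open>g\<close> into a chart around
  \<open>g\<close>, followed by right translation by the inverse back to the identity chart. Both
  are partial derivatives of multiplication and commute with \<open>J\<close>, hence so does their
  composite.\<close>

lemma tder_conj:
  assumes hol: "holomorphic_map (map_prod J J) J (prod_mfd (mfd L) (mfd L)) (mfd L) (\<lambda>(g, h). g \<otimes> h)"
    and J: "J 0 = 0" "\<And>v. v \<in> E \<Longrightarrow> J v \<in> E" and g: "g \<in> carrier L"
  shows "\<exists>D. tder (cj g) D \<and> (\<forall>v\<in>E. D (J v) = J (D v))"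
proof -
  have gi: "inv g \<in> carrier L" using g by simp
  obtain c where c: "c \<in> atlas (mfd L)" "g \<in> fst c" using chart_at[OF g] .
  obtain d where d: "d \<in> atlas (mfd L)" "inv g \<in> fst d" using chart_at[OF gi] .
  note cg = chart_in[OF atl c(1) subE c(2)]
  have k1: "g \<otimes> \<one> \<in> fst c" and k2: "g \<otimes> inv g \<in> U0" using g c id_chart by auto
  obtain D1 where D1: "((\<lambda>x. snd c (g \<otimes> cinv E c0 x)) has_derivative D1) (at (snd c0 \<one>))" "\<And>v. v \<in> E \<Longrightarrow> D1 (J v) = J (D1 v)"
    using mult_partial_derivatives(2)[OF hol J c id_chart c(1) k1] by blast
  obtain D2 where D2: "((\<lambda>x. snd c0 (cinv E c x \<otimes> inv g)) has_derivative D2) (at (snd c g))" "\<And>v. v \<in> E \<Longrightarrow> D2 (J v) = J (D2 v)"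
    using mult_partial_derivatives(1)[OF hol J c d id_chart(1) k2] by blast
  let ?W = "{x \<in> cdom E c0. g \<otimes> cinv E c0 x \<in> fst c}"
  note tr = translation_smooth[OF g id_chart(1) c(1)]
  have sh: "((\<lambda>x. a0 + x) has_derivative (\<lambda>v. v)) (at (0::'e))"
    using has_derivative_add[OF has_derivative_const[of a0] has_derivative_ident] by simp
  have D1': "((\<lambda>x. snd c (g \<otimes> cinv E c0 x)) has_derivative D1) (at (a0 + 0))" using D1(1) by (simp add: a0_def)
  from has_derivative_compose[OF sh D1']
  have T: "((\<lambda>x. snd c (g \<otimes> pt x)) has_derivative D1) (at 0)" by (simp add: pt_def)
  have 0: "a0 \<in> ?W" using g c(2) pt_0 O0(2) by (simp add: O0_def pt_def)
  have T0: "snd c (g \<otimes> pt 0) = snd c g" using g by (simp add: pt_0)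
  have "((\<lambda>x. snd c0 (cinv E c (snd c (g \<otimes> pt x)) \<otimes> inv g)) has_derivative (\<lambda>v. D2 (D1 v))) (at 0)"
    by (rule has_derivative_compose[OF T]) (simp only: T0 D2(1))
  from has_derivative_diff[OF this has_derivative_const[of a0]]
  have d1: "((\<lambda>x. snd c0 (cinv E c (snd c (g \<otimes> pt x)) \<otimes> inv g) - a0) has_derivative (\<lambda>v. D2 (D1 v))) (at 0)" by simp
  let ?V = "(\<lambda>x. a0 + x) -` ?W"
  have V: "open ?V" by (intro continuous_open_vimage tr(1) continuous_intros)
  have V0: "0 \<in> ?V" using 0 by simp
  have e: "snd c0 (cinv E c (snd c (g \<otimes> pt x)) \<otimes> inv g) - a0 = co (cj g (pt x))" if "x \<in> ?V" for x
    using that chart_in(2)[OF atl c(1) subE, of "g \<otimes> pt x"] by (simp add: pt_def cj_def co_def)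
  have d2: "((\<lambda>x. co (cj g (pt x))) has_derivative (\<lambda>v. D2 (D1 v))) (at 0)"
    by (rule has_derivative_transform_within_open[OF d1 V V0 e])
  \<comment> \<open>That conjugates of points near the identity stay in the identity chart comes
    from continuity of conjugation, transported to an open set of coordinates by the
    projection.\<close>
  have op: "openin (mtop (mfd L)) {h \<in> topspace (mtop (mfd L)). cj g h \<in> U0}"
  proof (rule openin_continuous_map_preimage[OF _ openin_mtop_chart[OF atl id_chart(1)]])
    have "continuous_map (mtop (mfd L)) (mtop (mfd L)) (\<lambda>h. (\<lambda>(a,b). a \<otimes> b) ((\<lambda>(a,b). a \<otimes> b) (g, h), inv g))"
      using g gi topspace by (intro smooth_map2_continuous[OF mult_smooth atl atl atl] continuous_map_const[THEN iffD2] continuous_map_id[unfolded id_def]) auto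
    then show "continuous_map (mtop (mfd L)) (mtop (mfd L)) (cj g)" by (simp add: cj_def[abs_def])
  qed
  let ?Q = "{h \<in> topspace (mtop (mfd L)). cj g h \<in> U0}"
  have oQ: "openin (top_of_set E) (snd c0 ` (?Q \<inter> U0))" using op openin_mtop_charts[OF atl] id_chart(1) by blast
  have "open (proj E -` (snd c0 ` (?Q \<inter> U0)))"
    by (rule openin_subspace_vimage[OF oQ continuous_on_proj range_proj[OF subE]])
  then have "open ((\<lambda>x. a0 + x) -` (proj E -` (snd c0 ` (?Q \<inter> U0))))"
    by (auto intro!: continuous_open_vimage continuous_intros)
  moreover have "0 \<in> (\<lambda>x. a0 + x) -` (proj E -` (snd c0 ` (?Q \<inter> U0)))"
  proof -
    have "\<one> \<in> ?Q \<inter> U0" using g id_chart topspace by (simp add: cj_def)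
    then show ?thesis using proj_a0 by (auto simp: a0_def)
  qed
  ultimately have "\<forall>\<^sub>F x in nhds 0. x \<in> (\<lambda>x. a0 + x) -` (proj E -` (snd c0 ` (?Q \<inter> U0)))"
    using eventually_nhds by blast
  then have "\<forall>\<^sub>F x in nhds 0. cj g (pt x) \<in> U0"
  proof (rule eventually_mono)
    fix x assume "x \<in> (\<lambda>x. a0 + x) -` (proj E -` (snd c0 ` (?Q \<inter> U0)))"
    then obtain h where h: "proj E (a0 + x) = snd c0 h" "h \<in> ?Q" "h \<in> U0" by auto
    then have "pt x = h" unfolding pt_def cinv_def using inv_into_f_f[OF smooth_atlasD(1)[OF atl id_chart(1)]] by simp
    then show "cj g (pt x) \<in> U0" using h by simp
  qed
  moreover have "cj g \<one> = \<one>" using g by (simp add: cj_def)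
  ultimately have "tder (cj g) (\<lambda>v. D2 (D1 v))" using d2 by (simp add: tder_def)
  moreover have "D2 (D1 (J v)) = J (D2 (D1 v))" if v: "v \<in> E" for v
  proof -
    have "D1 v \<in> E"
    proof (rule has_derivative_in_subspace[OF D1' subE])
      have "\<forall>\<^sub>F x in nhds (a0 + 0). x \<in> ?W" using eventually_nhds_in_open[OF tr(1)] 0 by simp
      then show "\<forall>\<^sub>F x in nhds (a0 + 0). snd c (g \<otimes> cinv E c0 x) \<in> E"
        by (rule eventually_mono) (use chart_in(4)[OF atl c(1) subE] in simp)
    qed
    then show ?thesis using D1(2)[OF v] D2(2) by simp
  qed
  ultimately show ?thesis by blast
qed

lemma Ad_tder:
  assumes "g \<in> carrier L" shows "\<exists>D. tder (cj g) D \<and> (\<forall>X\<in>E. Ad L g X = D X)"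
proof -
  obtain D where "tder (cj g) D" using tder_conj[OF holomorphic_map_id _ _ assms] by auto
  moreover then have "\<forall>X\<in>E. Ad L g X = D X" using tangent_map_eq unfolding Ad_def cj_def[abs_def] by blast
  ultimately show ?thesis by blast
qed

lemma conj_hom: "g \<in> carrier L \<Longrightarrow> cj g \<in> hom L L"
  by (auto simp: hom_def cj_def m_assoc) (metis inv_closed inv_solve_left m_closed)

lemma gexp_Ad:
  assumes g: "g \<in> carrier L" and X: "X \<in> E"
  shows "cj g (gexp (t *\<^sub>R X)) = gexp (t *\<^sub>R Ad L g X)" "cj g (gexp X) = gexp (Ad L g X)" "Ad L g X \<in> E"
proof -
  obtain D where D: "tder (cj g) D" "\<forall>X\<in>E. Ad L g X = D X" using Ad_tder[OF g] by blast
  show 1: "cj g (gexp (t *\<^sub>R X)) = gexp (t *\<^sub>R Ad L g X)" for t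
    using tder_hom[OF D(1) conj_hom[OF g] X] D(2) X by simp
  show "cj g (gexp X) = gexp (Ad L g X)" using 1[of 1] by simp
  show "Ad L g X \<in> E" using D X tder_E by metis
qed

lemma Ad_linear:
  assumes g: "g \<in> carrier L"
  shows "X \<in> E \<Longrightarrow> Y \<in> E \<Longrightarrow> Ad L g (X + Y) = Ad L g X + Ad L g Y" "X \<in> E \<Longrightarrow> Ad L g (r *\<^sub>R X) = r *\<^sub>R Ad L g X"
    "Ad L g 0 = 0" "\<exists>A. bounded_linear A \<and> (\<forall>X\<in>E. Ad L g X = A X)"
proof -
  obtain D where D: "tder (cj g) D" "\<forall>X\<in>E. Ad L g X = D X" using Ad_tder[OF g] by blast
  note l = tder_linear[OF D(1)]
  show "X \<in> E \<Longrightarrow> Y \<in> E \<Longrightarrow> Ad L g (X + Y) = Ad L g X + Ad L g Y"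
    using D(2) subspace_add[OF subE] by (simp add: linear_add[OF l(1)])
  show "X \<in> E \<Longrightarrow> Ad L g (r *\<^sub>R X) = r *\<^sub>R Ad L g X" using D(2) scale_E by (simp add: linear_scale[OF l(1)])
  show "Ad L g 0 = 0" using D(2) subspace_0[OF subE] by (simp add: linear_0[OF l(1)])
  show "\<exists>A. bounded_linear A \<and> (\<forall>X\<in>E. Ad L g X = A X)" using D(2) l(2) by blast
qed

lemma conj_conj: "g \<in> carrier L \<Longrightarrow> h \<in> carrier L \<Longrightarrow> x \<in> carrier L \<Longrightarrow> cj (g \<otimes> h) x = cj g (cj h x)"
  by (simp add: cj_def m_assoc inv_mult_group)

lemma Ad_mult:
  assumes g: "g \<in> carrier L" and h: "h \<in> carrier L" and X: "X \<in> E" shows "Ad L (g \<otimes> h) X = Ad L g (Ad L h X)"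
proof (rule gexp_ray_inj)
  show "Ad L (g \<otimes> h) X \<in> E" "Ad L g (Ad L h X) \<in> E" using gexp_Ad(3) g h X by auto
  show "gexp (t *\<^sub>R Ad L (g \<otimes> h) X) = gexp (t *\<^sub>R Ad L g (Ad L h X))" for t
    using gexp_Ad(1)[OF m_closed[OF g h] X, of t] gexp_Ad(1)[OF h X, of t] gexp_Ad(1)[OF g gexp_Ad(3)[OF h X], of t]
      conj_conj[OF g h gexp_closed[OF scale_E[OF X]], of t] by simp
qed

lemma Ad_one: assumes X: "X \<in> E" shows "Ad L \<one> X = X"
proof (rule gexp_ray_inj)
  show "gexp (t *\<^sub>R Ad L \<one> X) = gexp (t *\<^sub>R X)" for t
    using gexp_Ad(1)[OF one_closed X, of t] gexp_closed[OF scale_E[OF X], of t] by (simp add: cj_def)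
qed (use gexp_Ad(3) X in auto)

lemma hom_Ad:
  assumes f: "tder f D" "f \<in> hom L L" and g: "g \<in> carrier L" and X: "X \<in> E"
  shows "D (Ad L g X) = Ad L (f g) (D X)"
proof (rule gexp_ray_inj)
  have fg: "f g \<in> carrier L" using f(2) g by (rule hom_in_carrier)
  show "D (Ad L g X) \<in> E" "Ad L (f g) (D X) \<in> E" using tder_E[OF f(1)] gexp_Ad(3)[OF fg] by auto
  fix t
  have ig: "f (inv g) = inv (f g)"
    using hom_mult[OF f(2) g inv_closed[OF g]] f(1) g fg hom_in_carrier[OF f(2) inv_closed[OF g]]
    by (simp add: tder_def) (metis inv_equality inv_comm)
  have gX: "gexp (t *\<^sub>R X) \<in> carrier L" using gexp_closed[OF scale_E[OF X]] .
  have "gexp (t *\<^sub>R D (Ad L g X)) = f (cj g (gexp (t *\<^sub>R X)))"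
    using tder_hom[OF f gexp_Ad(3)[OF g X]] gexp_Ad(1)[OF g X] by simp
  also have "\<dots> = cj (f g) (f (gexp (t *\<^sub>R X)))"
    using g gX by (simp add: cj_def hom_mult[OF f(2)] ig)
  also have "\<dots> = gexp (t *\<^sub>R Ad L (f g) (D X))"
    using tder_hom[OF f X] gexp_Ad(1)[OF fg tder_E[OF f(1)]] by simp
  finally show "gexp (t *\<^sub>R D (Ad L g X)) = gexp (t *\<^sub>R Ad L (f g) (D X))" .
qed

definition ka :: "'e \<times> 'e \<Rightarrow> 'e" where "ka p = co (cj (pt (fst p)) (pt (snd p)))"

text \<open>In coordinates \<open>Ad (pt x) Y\<close> is the derivative of the conjugation map
  \<open>ka\<close> at \<open>(x, 0)\<close> in direction \<open>(0, Y)\<close>. Since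
  \<open>ka\<close> is built from \<open>mu\<close> and inversion near such points, it is smooth
  there, and this derivative is itself differentiable in \<open>x\<close>.\<close>

lemma Ad_coordinate_derivative:
  assumes Y: "Y \<in> E"
  shows "\<exists>A. ((\<lambda>x. Ad L (pt x) Y) has_derivative A) (at 0)"
proof -
  let ?i = "\<lambda>x. co (inv (pt x))"
  let ?V = "{x \<in> O0. inv (pt x) \<in> U0}"
  note V = map_smooth[OF inv_smooth]
  let ?h = "\<lambda>p. (mu p, ?i (fst p))"
  let ?W1 = "Om \<inter> fst -` ?V"
  let ?W = "?W1 \<inter> ?h -` Om"
  have oW1: "open ?W1" using V(1) Om(1) by (intro open_Int open_vimage continuous_intros)
  have "smooth_on ?W1 (\<lambda>p. ?i (fst p))"
    by (rule smooth_on_compose[OF smooth_on_bounded_linear[OF bounded_linear_fst] V(2)]) auto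
  then have sh: "smooth_on ?W1 ?h" by (intro smooth_on_Pair smooth_on_subset[OF Om(2)]) auto
  have oW: "open ?W" using continuous_open_preimage[OF smooth_on_imp_continuous_on[OF sh] oW1 Om(1)] .
  have sW: "smooth_on ?W (\<lambda>p. mu (?h p))"
    by (rule smooth_on_compose[OF smooth_on_subset[OF sh] Om(2)]) auto
  have kW: "ka p = mu (?h p)" if "p \<in> ?W" for p
    using that pt_co(2) Om_D(3,4)[of "fst p" "snd p"] by (simp add: ka_def cj_def mu_def)
  have s: "smooth_on ?W ka" by (rule smooth_on_cong[THEN iffD1, OF _ sW]) (use kW in auto)
  have xW: "(x, 0) \<in> ?W" if "x \<in> ?V" for x
  proof -
    have c: "pt x \<in> carrier L" "inv (pt x) \<in> U0" "pt x \<in> U0" using that pt_carrier pt_in by auto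
    have "mu (x, 0) = co (pt x)" using c by (simp add: mu_def pt_0)
    then show ?thesis using that c pt_co[OF c(3)] pt_co[OF c(2)] O0(2) id_chart(2) by (simp add: Om_def pt_0)
  qed
  obtain D where D1: "\<And>p. p \<in> ?W \<Longrightarrow> (ka has_derivative D p) (at p within ?W)"
    and D2: "\<And>v. Ck_on (Suc 0) ?W (\<lambda>p. D p v)"
    by (rule Ck_on_SucE[OF smooth_on_Ck[OF s, of "Suc (Suc 0)"]]) blast
  have AdD: "Ad L (pt x) Y = D (x, 0) (0, Y)" if x: "x \<in> ?V" for x
  proof -
    have g: "pt x \<in> carrier L" using x pt_carrier by auto
    obtain D' where D': "tder (cj (pt x)) D'" "\<forall>X\<in>E. Ad L (pt x) X = D' X" using Ad_tder[OF g] by blast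
    have "((\<lambda>y. (x, y)) has_derivative (\<lambda>v. (0, v))) (at (0::'e))"
      by (intro has_derivative_Pair has_derivative_const has_derivative_ident)
    moreover have "(ka has_derivative D (x, 0)) (at (x, 0))" using D1[OF xW[OF x]] unfolding at_within_open[OF xW[OF x] oW] .
    ultimately have "((\<lambda>y. ka (x, y)) has_derivative (\<lambda>v. D (x, 0) (0, v))) (at 0)" by (rule has_derivative_compose)
    moreover have "((\<lambda>y. ka (x, y)) has_derivative D') (at 0)" using D'(1) by (simp add: tder_def ka_def)
    ultimately have "(\<lambda>v. D (x, 0) (0, v)) = D'" by (rule has_derivative_unique)
    then show ?thesis using D'(2) Y by (metis (no_types))
  qed
  have 0: "0 \<in> ?V" using O0 id_chart by (simp add: pt_0)
  obtain D3 where D3: "\<And>p. p \<in> ?W \<Longrightarrow> ((\<lambda>p. D p (0, Y)) has_derivative D3 p) (at p within ?W)"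
    by (rule Ck_on_SucE[OF D2]) blast
  have "((\<lambda>x. (x, 0)) has_derivative (\<lambda>v. (v, 0))) (at (0::'e))"
    by (intro has_derivative_Pair has_derivative_const has_derivative_ident)
  moreover have "((\<lambda>p. D p (0, Y)) has_derivative D3 (0, 0)) (at (0, 0))"
    using D3[OF xW[OF 0]] unfolding at_within_open[OF xW[OF 0] oW] .
  ultimately have "((\<lambda>x. D (x, 0) (0, Y)) has_derivative (\<lambda>v. D3 (0, 0) (v, 0))) (at 0)" by (rule has_derivative_compose)
  then have "((\<lambda>x. Ad L (pt x) Y) has_derivative (\<lambda>v. D3 (0, 0) (v, 0))) (at 0)"
    by (rule has_derivative_transform_within_open[OF _ V(1) 0]) (simp add: AdD)
  then show ?thesis by blast
qed

text \<open>The bracket is defined along a straight line in the chart. By the chain rule only the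
  velocity of the curve matters, so the line may be replaced by the one-parameter subgroup, along
  which \<open>Ad\<close> is multiplicative.\<close>

lemma Ad_curve_derivative:
  assumes X: "X \<in> E" and Y: "Y \<in> E"
  shows "((\<lambda>t. Ad L (gexp (t *\<^sub>R X)) Y) has_vector_derivative lie_bracket L X Y) (at 0)"
    and "lie_bracket L X Y \<in> E"
proof -
  obtain A where A: "((\<lambda>x. Ad L (pt x) Y) has_derivative A) (at 0)" using Ad_coordinate_derivative[OF Y] by blast
  have lA: "linear A" using A has_derivative_linear by blast
  have "((\<lambda>t::real. t *\<^sub>R X) has_derivative (\<lambda>t. t *\<^sub>R X)) (at 0)"
    by (rule bounded_linear_imp_has_derivative[OF bounded_linear_scaleR_left])
  moreover have "((\<lambda>x. Ad L (pt x) Y) has_derivative A) (at (0 *\<^sub>R X))" using A by simp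
  ultimately have "((\<lambda>t. Ad L (pt (t *\<^sub>R X)) Y) has_derivative (\<lambda>h. A (h *\<^sub>R X))) (at 0)" by (rule has_derivative_compose)
  then have "((\<lambda>t. Ad L (pt (t *\<^sub>R X)) Y) has_vector_derivative A X) (at 0)"
    by (simp add: has_vector_derivative_def linear_scale[OF lA])
  then have br: "lie_bracket L X Y = A X"
    unfolding lie_bracket_def by (simp add: chart_line_eq[OF X] vector_derivative_at)
  have cd: "((\<lambda>t. co (gexp (t *\<^sub>R X))) has_derivative (\<lambda>h. h *\<^sub>R X)) (at 0)"
    using gexp_curve_derivative[OF X] by (simp add: has_vector_derivative_def)
  have A': "((\<lambda>x. Ad L (pt x) Y) has_derivative A) (at (co (gexp (0 *\<^sub>R X))))" using A by (simp add: gexp_0 co_one)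
  have "((\<lambda>t. Ad L (pt (co (gexp (t *\<^sub>R X)))) Y) has_derivative (\<lambda>h. A (h *\<^sub>R X))) (at 0)"
    by (rule has_derivative_compose[OF cd A'])
  then have "((\<lambda>t. Ad L (pt (co (gexp (t *\<^sub>R X)))) Y) has_derivative (\<lambda>h. h *\<^sub>R A X)) (at 0)"
    by (simp add: linear_scale[OF lA])
  moreover have "\<forall>\<^sub>F t in at 0. Ad L (pt (co (gexp (t *\<^sub>R X)))) Y = Ad L (gexp (t *\<^sub>R X)) Y"
    using gexp_curve(3)[OF X] by (rule eventually_mono) (simp add: pt_co)
  moreover have "Ad L (pt (co (gexp (0 *\<^sub>R X)))) Y = Ad L (gexp (0 *\<^sub>R X)) Y" by (simp add: gexp_0 co_one pt_0)
  ultimately have "((\<lambda>t. Ad L (gexp (t *\<^sub>R X)) Y) has_derivative (\<lambda>h. h *\<^sub>R A X)) (at 0)"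
    by (rule has_derivative_transform_eventually) simp
  then show d: "((\<lambda>t. Ad L (gexp (t *\<^sub>R X)) Y) has_vector_derivative lie_bracket L X Y) (at 0)"
    by (simp add: has_vector_derivative_def br)
  let ?f = "\<lambda>t. Ad L (gexp (t *\<^sub>R X)) Y - Y"
  have "(?f has_vector_derivative lie_bracket L X Y) (at 0)"
    using has_vector_derivative_diff[OF d has_vector_derivative_const[of Y]] by simp
  moreover have "?f 0 = 0" by (simp add: gexp_0 Ad_one[OF Y])
  ultimately have lim: "(\<lambda>k. real (Suc k) *\<^sub>R ?f (1 / real (Suc k))) \<longlonglongrightarrow> 1 *\<^sub>R lie_bracket L X Y"
    by (rule has_vector_derivative_at_0_sequence)
  have "real (Suc k) *\<^sub>R ?f (1 / real (Suc k)) \<in> E" for k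
    by (intro scale_E subspace_diff[OF subE] gexp_Ad(3) gexp_closed X Y)
  then show "lie_bracket L X Y \<in> E" using Lim_in_closed_set[OF closed_subspace[OF subE] _ _ lim] by simp
qed

text \<open>Splitting the exponential at time \<open>s\<close> with the increment
  \<open>s - t\<close> on the left gives the first form, with the increment on the right the second.
  Comparing them shows that \<open>ad X\<close> commutes with \<open>Ad\<close> along its own
  one-parameter subgroup.\<close>

lemma Ad_curve_derivative_at:
  assumes X: "X \<in> E" and Y: "Y \<in> E"
  shows "((\<lambda>t. Ad L (gexp (t *\<^sub>R X)) Y) has_vector_derivative lie_bracket L X (Ad L (gexp (t *\<^sub>R X)) Y)) (at t)"
    "((\<lambda>t. Ad L (gexp (t *\<^sub>R X)) Y) has_vector_derivative Ad L (gexp (t *\<^sub>R X)) (lie_bracket L X Y)) (at t)"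
proof -
  have gt: "gexp (t *\<^sub>R X) \<in> carrier L" for t using gexp_closed[OF scale_E[OF X]] .
  have sh: "((\<lambda>s. s - t) has_vector_derivative 1) (at t)"
    using has_vector_derivative_diff[OF has_vector_derivative_id[unfolded id_def] has_vector_derivative_const[of t]] by (simp add: id_def)
  have shift: "((\<lambda>s. f (s - t)) has_vector_derivative V) (at t)" if "(f has_vector_derivative V) (at 0)" for f :: "real \<Rightarrow> 'e" and V
    using vector_diff_chain_at[OF sh, of f V] that by (simp add: o_def)
  have "Ad L (gexp ((s - t) *\<^sub>R X)) (Ad L (gexp (t *\<^sub>R X)) Y) = Ad L (gexp (s *\<^sub>R X)) Y" for s
    using Ad_mult[OF gt gt Y, of "s - t" t] gexp_add[OF X, of "s - t" t] by simp
  then show "((\<lambda>t. Ad L (gexp (t *\<^sub>R X)) Y) has_vector_derivative lie_bracket L X (Ad L (gexp (t *\<^sub>R X)) Y)) (at t)"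
    using shift[OF Ad_curve_derivative(1)[OF X gexp_Ad(3)[OF gt Y], of t]] by simp
  obtain A where A: "bounded_linear A" "\<forall>Z\<in>E. Ad L (gexp (t *\<^sub>R X)) Z = A Z" using Ad_linear(4)[OF gt, of t] by blast
  show "((\<lambda>t. Ad L (gexp (t *\<^sub>R X)) Y) has_vector_derivative Ad L (gexp (t *\<^sub>R X)) (lie_bracket L X Y)) (at t)"
  proof -
    have "((\<lambda>s. A (Ad L (gexp (s *\<^sub>R X)) Y)) has_vector_derivative A (lie_bracket L X Y)) (at 0)"
      by (rule bounded_linear.has_vector_derivative[OF A(1) Ad_curve_derivative(1)[OF X Y]])
    moreover have "A (Ad L (gexp (s *\<^sub>R X)) Y) = Ad L (gexp ((t + s) *\<^sub>R X)) Y" for s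
      using A(2) gexp_Ad(3)[OF gt Y] Ad_mult[OF gt gt Y, of t s] gexp_add[OF X, of t s] by simp
    ultimately have "((\<lambda>s. Ad L (gexp ((t + s) *\<^sub>R X)) Y) has_vector_derivative A (lie_bracket L X Y)) (at 0)" by simp
    from shift[OF this] show ?thesis using A(2) Ad_curve_derivative(2)[OF X Y] by simp
  qed
qed

end

section \<open>Closed subgroups are embedded\<close>

lemma smooth_atlas_insert:
  assumes A: "smooth_atlas E A" and "inj_on \<phi> W" "openin (top_of_set E) (\<phi> ` W)" "smooth_on (\<phi> ` W) (\<phi> \<circ> inv_into W \<phi>)"
    and "\<And>d. d \<in> A \<Longrightarrow> openin (top_of_set E) (\<phi> ` (W \<inter> fst d))"
    and "\<And>d. d \<in> A \<Longrightarrow> smooth_on (\<phi> ` (W \<inter> fst d)) (snd d \<circ> inv_into W \<phi>)"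
    and "\<And>d. d \<in> A \<Longrightarrow> openin (top_of_set E) (snd d ` (fst d \<inter> W))"
    and "\<And>d. d \<in> A \<Longrightarrow> smooth_on (snd d ` (fst d \<inter> W)) (\<phi> \<circ> inv_into (fst d) (snd d))"
  shows "smooth_atlas E (insert (W, \<phi>) A)"
proof -
  have 1: "inj_on (snd d) (fst d)" "openin (top_of_set E) (snd d ` fst d)" if "d \<in> A" for d
    using smooth_atlasD[OF A that] by auto
  have 2: "openin (top_of_set E) (snd c ` (fst c \<inter> fst d))" "smooth_on (snd c ` (fst c \<inter> fst d)) (snd d \<circ> inv_into (fst c) (snd c))"
    if "c \<in> A" "d \<in> A" for c d
    using A that unfolding smooth_atlas_def case_prod_beta by blast+
  show ?thesis unfolding smooth_atlas_def case_prod_beta using assms(2-) 1 2 by (simp add: Int_absorb)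
qed

context lie_grp begin

abbreviation "T \<equiv> mtop (mfd L)"

lemma cm_mult: "continuous_map X T a \<Longrightarrow> continuous_map X T b \<Longrightarrow> continuous_map X T (\<lambda>x. a x \<otimes> b x)"
  using smooth_map2_continuous[OF mult_smooth atl atl atl, of X a b] by simp

lemma cm_inv: "continuous_map X T a \<Longrightarrow> continuous_map X T (\<lambda>x. inv (a x))"
  using continuous_map_compose[OF _ smooth_map_continuous[OF inv_smooth atl atl], of X a] by (simp add: o_def)

lemma cm_const: "g \<in> carrier L \<Longrightarrow> continuous_map X T (\<lambda>x. g)"
  by (simp add: topspace)

lemma cm_id: "continuous_map T T (\<lambda>x. x)"
  using continuous_map_id[of T] by (simp add: id_def)

lemma closedin_equalizer: "continuous_map T T a \<Longrightarrow> continuous_map T T b \<Longrightarrow> closedin T {x \<in> carrier L. a x = b x}"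
  using closedin_continuous_maps_eq[OF Hausdorff, of T a b] by (simp add: topspace)

lemma closedin_centralizer:
  assumes "S \<subseteq> carrier L" shows "closedin T (centralizer L S)"
proof (cases "S = {}")
  case True
  then show ?thesis using closedin_topspace[of T] by (simp add: centralizer_def topspace)
next
  case False
  have "closedin T (\<Inter>h\<in>S. {g \<in> carrier L. g \<otimes> h = h \<otimes> g})"
    by (rule closedin_Inter) (use False assms in \<open>auto intro!: closedin_equalizer cm_mult cm_id cm_const\<close>)
  moreover have "centralizer L S = (\<Inter>h\<in>S. {g \<in> carrier L. g \<otimes> h = h \<otimes> g})" using False by (auto simp: centralizer_def)
  ultimately show ?thesis by simp
qed

lemma mu_derivative_0: "(mu has_derivative (\<lambda>p. proj E (fst p) + proj E (snd p))) (at (0,0))"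
proof -
  obtain D where D: "\<And>p. p \<in> Om \<Longrightarrow> (mu has_derivative D p) (at p within Om)"
    by (rule Ck_on_SucE[OF smooth_on_Ck[OF Om(2), of "Suc 0"]]) blast
  have d: "(mu has_derivative D (0,0)) (at (0,0))" using D[OF Om_0] unfolding at_within_open[OF Om_0 Om(1)] .
  have pd: "(proj E has_derivative proj E) (at 0)" by (rule bounded_linear_imp_has_derivative[OF bounded_linear_proj])
  have "((\<lambda>x. (x, 0)) has_derivative (\<lambda>v. (v, 0))) (at (0::'e))"
    by (intro has_derivative_Pair has_derivative_const has_derivative_ident)
  from has_derivative_compose[OF this d]
  have "((\<lambda>x. mu (x, 0)) has_derivative (\<lambda>v. D (0,0) (v, 0))) (at 0)" .
  moreover have "((\<lambda>x. mu (x, 0)) has_derivative proj E) (at 0)"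
    by (rule has_derivative_transform_within_open[OF pd O0]) (simp add: mu_0)
  ultimately have 1: "(\<lambda>v. D (0,0) (v, 0)) = proj E" by (rule has_derivative_unique)
  have "((\<lambda>x. (0, x)) has_derivative (\<lambda>v. (0, v))) (at (0::'e))"
    by (intro has_derivative_Pair has_derivative_const has_derivative_ident)
  from has_derivative_compose[OF this d]
  have "((\<lambda>x. mu (0, x)) has_derivative (\<lambda>v. D (0,0) (0, v))) (at 0)" .
  moreover have "((\<lambda>x. mu (0, x)) has_derivative proj E) (at 0)"
    by (rule has_derivative_transform_within_open[OF pd O0]) (simp add: mu_0)
  ultimately have 2: "(\<lambda>v. D (0,0) (0, v)) = proj E" by (rule has_derivative_unique)
  have "D (0,0) p = proj E (fst p) + proj E (snd p)" for p
  proof -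
    have "D (0,0) p = D (0,0) ((fst p, 0) + (0, snd p))" by simp
    also have "\<dots> = D (0,0) (fst p, 0) + D (0,0) (0, snd p)" by (rule linear_add[OF has_derivative_linear[OF d]])
    finally show ?thesis using fun_cong[OF 1, of "fst p"] fun_cong[OF 2, of "snd p"] by simp
  qed
  then have "D (0,0) = (\<lambda>p. proj E (fst p) + proj E (snd p))" by (rule ext)
  then show ?thesis using d by simp
qed

text \<open>Maps from a vector space to the group with value \<open>\<one>\<close> at 0, smooth near
  0 in the identity chart, with differential \<open>D\<close>. The notion is closed under pointwise
  products and covers real curves as well as maps in several variables.\<close>

definition smooth_germ :: "('a::euclidean_space \<Rightarrow> 'g) \<Rightarrow> ('a \<Rightarrow> 'e) \<Rightarrow> bool" where
  "smooth_germ F D \<longleftrightarrow> F 0 = \<one> \<and> (\<exists>W. open W \<and> 0 \<in> W \<and> (\<forall>x\<in>W. F x \<in> U0) \<and> smooth_on W (\<lambda>x. co (F x))) \<and>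
     ((\<lambda>x. co (F x)) has_derivative D) (at 0)"

lemma smooth_germ_in_E: assumes "smooth_germ F D" shows "D v \<in> E"
proof -
  obtain W where W: "open W" "0 \<in> W" "\<forall>x\<in>W. F x \<in> U0" using assms unfolding smooth_germ_def by blast
  have "\<forall>\<^sub>F x in nhds 0. co (F x) \<in> E"
    using eventually_nhds_in_open[OF W(1,2)] by (rule eventually_mono) (use W(3) pt_co(3) in blast)
  moreover have "((\<lambda>x. co (F x)) has_derivative D) (at 0)" using assms by (simp add: smooth_germ_def)
  ultimately show ?thesis by (intro has_derivative_in_subspace[OF _ subE])
qed

lemma smooth_germ_mult:
  assumes F: "smooth_germ F D" and G: "smooth_germ G D'"
  shows "smooth_germ (\<lambda>x. F x \<otimes> G x) (\<lambda>v. D v + D' v)"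
proof -
  obtain W where W: "open W" "0 \<in> W" "\<forall>x\<in>W. F x \<in> U0" "smooth_on W (\<lambda>x. co (F x))" using F unfolding smooth_germ_def by blast
  obtain V where V: "open V" "0 \<in> V" "\<forall>x\<in>V. G x \<in> U0" "smooth_on V (\<lambda>x. co (G x))" using G unfolding smooth_germ_def by blast
  let ?h = "\<lambda>x. (co (F x), co (G x))"
  have s: "smooth_on (W \<inter> V) ?h" by (intro smooth_on_Pair smooth_on_subset[OF W(4)] smooth_on_subset[OF V(4)]) auto
  let ?Z = "(W \<inter> V) \<inter> ?h -` Om"
  have oZ: "open ?Z" by (rule continuous_open_preimage[OF smooth_on_imp_continuous_on[OF s] open_Int[OF W(1) V(1)] Om(1)])
  have h0: "?h 0 = (0,0)" using F G by (simp add: smooth_germ_def co_one)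
  have 0: "0 \<in> ?Z" using W V h0 Om_0 by simp
  have e: "mu (?h x) = co (F x \<otimes> G x)" if "x \<in> ?Z" for x using that W(3) V(3) by (simp add: mu_def pt_co)
  have in0: "F x \<otimes> G x \<in> U0" if "x \<in> ?Z" for x using that W(3) V(3) Om_D(3)[of "co (F x)" "co (G x)"] by (simp add: pt_co)
  have s2: "smooth_on ?Z (\<lambda>x. mu (?h x))" by (rule smooth_on_compose[OF smooth_on_subset[OF s] Om(2)]) auto
  have s3: "smooth_on ?Z (\<lambda>x. co (F x \<otimes> G x))" by (rule smooth_on_cong[THEN iffD1, OF _ s2]) (rule e)
  have "(?h has_derivative (\<lambda>v. (D v, D' v))) (at 0)" using F G by (intro has_derivative_Pair) (simp_all add: smooth_germ_def)
  moreover have "(mu has_derivative (\<lambda>p. proj E (fst p) + proj E (snd p))) (at (?h 0))" unfolding h0 by (rule mu_derivative_0)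
  ultimately have "((\<lambda>x. mu (?h x)) has_derivative (\<lambda>v. proj E (fst (D v, D' v)) + proj E (snd (D v, D' v)))) (at 0)"
    by (rule has_derivative_compose)
  then have "((\<lambda>x. mu (?h x)) has_derivative (\<lambda>v. D v + D' v)) (at 0)"
    by (simp add: proj_E[OF smooth_germ_in_E[OF F]] proj_E[OF smooth_germ_in_E[OF G]])
  then have d: "((\<lambda>x. co (F x \<otimes> G x)) has_derivative (\<lambda>v. D v + D' v)) (at 0)"
    by (rule has_derivative_transform_within_open[OF _ oZ 0 e])
  have "F 0 \<otimes> G 0 = \<one>" using F G by (simp add: smooth_germ_def)
  then show ?thesis unfolding smooth_germ_def using d oZ 0 in0 s3 by blast
qed

lemma smooth_germ_gexp:
  assumes b: "b \<in> E" shows "smooth_germ (\<lambda>x. gexp ((x \<bullet> b) *\<^sub>R b)) (\<lambda>v. (v \<bullet> b) *\<^sub>R b)"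
proof -
  let ?I = "{t. \<bar>t\<bar> * norm b < rad / 4}"
  let ?W = "(\<lambda>x. x \<bullet> b) -` ?I"
  have oW: "open ?W" by (intro open_vimage open_Collect_less continuous_intros)
  have 0: "0 \<in> ?W" using rad(1) by simp
  have g: "gexp ((x \<bullet> b) *\<^sub>R b) \<in> U0" "co (gexp ((x \<bullet> b) *\<^sub>R b)) = lexp ((x \<bullet> b) *\<^sub>R b)" if "x \<in> ?W" for x
    using gexp_coordinate(1,2)[OF scale_E[OF b], of "x \<bullet> b"] that rad(1) by auto
  have "smooth_on ?W (\<lambda>x. lexp ((x \<bullet> b) *\<^sub>R b))"
    by (rule smooth_on_compose[OF smooth_on_bounded_linear[OF bounded_linear_inner_left] lexp_curve_smooth[OF b]]) auto
  then have s: "smooth_on ?W (\<lambda>x. co (gexp ((x \<bullet> b) *\<^sub>R b)))"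
    by (rule smooth_on_cong[THEN iffD1, rotated]) (simp add: g(2)[symmetric])
  have "((\<lambda>t. co (gexp (t *\<^sub>R b))) has_derivative (\<lambda>h. h *\<^sub>R b)) (at (0 \<bullet> b))"
    using gexp_curve_derivative[OF b] by (simp add: has_vector_derivative_def)
  from has_derivative_compose[OF bounded_linear_imp_has_derivative[OF bounded_linear_inner_left[of b]] this]
  have d: "((\<lambda>x. co (gexp ((x \<bullet> b) *\<^sub>R b))) has_derivative (\<lambda>v. (v \<bullet> b) *\<^sub>R b)) (at 0)" .
  show ?thesis unfolding smooth_germ_def using oW 0 g(1) s d gexp_0 by (intro conjI exI[of _ ?W]) auto
qed

lemma smooth_germ_pt:
  assumes Q: "bounded_linear Q" shows "smooth_germ (\<lambda>x. pt (Q x)) (\<lambda>v. proj E (Q v))"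
proof -
  have Q0: "Q 0 = 0" using Q by (simp add: linear_simps)
  have o: "open (Q -` O0)" by (intro open_vimage O0 linear_continuous_on Q)
  have bl: "bounded_linear (\<lambda>x. proj E (Q x))" by (rule bounded_linear_compose[OF bounded_linear_proj Q])
  have e: "proj E (Q x) = co (pt (Q x))" if "x \<in> Q -` O0" for x using that co_pt by simp
  have s: "smooth_on (Q -` O0) (\<lambda>x. co (pt (Q x)))"
    by (rule smooth_on_cong[THEN iffD1, OF e smooth_on_bounded_linear[OF bl]])
  have 0: "0 \<in> Q -` O0" using Q0 O0 by simp
  have d: "((\<lambda>x. co (pt (Q x))) has_derivative (\<lambda>v. proj E (Q v))) (at 0)"
    by (rule has_derivative_transform_within_open[OF bounded_linear_imp_has_derivative[OF bl] o 0 e])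
  show ?thesis unfolding smooth_germ_def using o 0 s d pt_in Q0 pt_0 by (intro conjI exI[of _ "Q -` O0"]) auto
qed

lemma smooth_germ_curve:
  fixes c :: "real \<Rightarrow> 'g"
  assumes "smooth_germ c D"
  shows "c 0 = \<one>" "\<forall>\<^sub>F t in at 0. c t \<in> U0" "((\<lambda>t. co (c t)) has_vector_derivative D 1) (at 0)"
proof -
  obtain W where W: "open W" "0 \<in> W" "\<forall>x\<in>W. c x \<in> U0" using assms unfolding smooth_germ_def by blast
  show "c 0 = \<one>" using assms by (simp add: smooth_germ_def)
  show "\<forall>\<^sub>F t in at 0. c t \<in> U0" unfolding eventually_at_topological using W by blast
  have d: "((\<lambda>t. co (c t)) has_derivative D) (at 0)" using assms by (simp add: smooth_germ_def)
  have "D h = h *\<^sub>R D 1" for h using linear_scale[OF has_derivative_linear[OF d], of h 1] by simp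
  then have "D = (\<lambda>h. h *\<^sub>R D 1)" by (rule ext)
  then show "((\<lambda>t. co (c t)) has_vector_derivative D 1) (at 0)" using d unfolding has_vector_derivative_def by metis
qed

lemma gexp_smooth_germ: assumes X: "X \<in> E" shows "smooth_germ (\<lambda>t::real. gexp (t *\<^sub>R X)) (\<lambda>t. t *\<^sub>R X)"
proof -
  let ?I = "{t. \<bar>t\<bar> * norm X < rad / 4}"
  have o: "open ?I" by (intro open_Collect_less continuous_intros)
  have g: "gexp (t *\<^sub>R X) \<in> U0" "co (gexp (t *\<^sub>R X)) = lexp (t *\<^sub>R X)" if "t \<in> ?I" for t
    using gexp_coordinate(1,2)[OF scale_E[OF X], of t] that rad(1) by auto
  have s: "smooth_on ?I (\<lambda>t. co (gexp (t *\<^sub>R X)))"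
    by (rule smooth_on_cong[THEN iffD1, OF _ lexp_curve_smooth[OF X]]) (simp add: g(2)[symmetric])
  show ?thesis unfolding smooth_germ_def using o g(1) s rad(1) gexp_0 gexp_curve_derivative[OF X]
    by (intro conjI exI[of _ ?I]) (auto simp: has_vector_derivative_def)
qed

text \<open>Only sums need an argument: the product of the two rays is a curve in \<open>S\<close>
  with velocity \<open>X + Y\<close>, though in general not a homomorphism.\<close>

lemma Lie_subspace:
  assumes S: "subgroup S L" "closedin T S" shows "subspace (Lie L S)"
  unfolding Lie_closed_subgroup[OF S]
proof (rule subspaceI)
  show "0 \<in> {X \<in> E. \<forall>t. gexp (t *\<^sub>R X) \<in> S}" using subspace_0[OF subE] subgroup.one_closed[OF S(1)] by (simp add: gexp_0)
  show "r *\<^sub>R X \<in> {X \<in> E. \<forall>t. gexp (t *\<^sub>R X) \<in> S}" if "X \<in> {X \<in> E. \<forall>t. gexp (t *\<^sub>R X) \<in> S}" for r X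
    using that scale_E by simp
  fix X Y assume X: "X \<in> {X \<in> E. \<forall>t. gexp (t *\<^sub>R X) \<in> S}" and Y: "Y \<in> {X \<in> E. \<forall>t. gexp (t *\<^sub>R X) \<in> S}"
  let ?c = "\<lambda>t::real. gexp (t *\<^sub>R X) \<otimes> gexp (t *\<^sub>R Y)"
  have "smooth_germ ?c (\<lambda>t. t *\<^sub>R X + t *\<^sub>R Y)" using X Y by (intro smooth_germ_mult gexp_smooth_germ) auto
  note c = smooth_germ_curve[OF this]
  have "?c t \<in> S" for t using X Y subgroup.m_closed[OF S(1)] by simp
  from curve_in_closed_subgroup[OF S c(1) this c(2,3)]
  show "X + Y \<in> {X \<in> E. \<forall>t. gexp (t *\<^sub>R X) \<in> S}" by simp
qed

text \<open>Otherwise nonzero transversal coordinates \<open>y k\<close> of elements of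
  \<open>S\<close> would tend to 0. A limit direction \<open>v\<close> of them would be tangent to
  \<open>S\<close> by the limit argument for closed subgroups, yet orthogonal to the Lie algebra and
  of norm 1.\<close>

lemma transversal_isolated:
  assumes S: "subgroup S L" "closedin T S"
  shows "\<exists>e>0. \<forall>y\<in>E. (\<forall>z\<in>Lie L S. y \<bullet> z = 0) \<longrightarrow> norm y < e \<longrightarrow> pt y \<in> S \<longrightarrow> y = 0"
proof (rule ccontr)
  assume "\<not> ?thesis"
  then have H: "\<exists>y\<in>E. (\<forall>z\<in>Lie L S. y \<bullet> z = 0) \<and> norm y < e \<and> pt y \<in> S \<and> y \<noteq> 0" if "e > 0" for e
    using that by blast
  have "\<exists>y\<in>E. (\<forall>z\<in>Lie L S. y \<bullet> z = 0) \<and> norm y < min rad (1 / real (Suc k)) \<and> pt y \<in> S \<and> y \<noteq> 0" for k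
    by (rule H) (use rad(1) in simp)
  then obtain y where y: "\<And>k. y k \<in> E" "\<And>k z. z \<in> Lie L S \<Longrightarrow> y k \<bullet> z = 0" "\<And>k. norm (y k) < min rad (1 / real (Suc k))"
    "\<And>k. pt (y k) \<in> S" "\<And>k. y k \<noteq> 0" by metis
  define u where "u k = y k /\<^sub>R norm (y k)" for k
  have un: "u k \<in> sphere 0 1" for k using y(5) by (simp add: u_def)
  obtain v r where v: "v \<in> sphere 0 1" "strict_mono r" "(u \<circ> r) \<longlonglongrightarrow> v"
    using compact_sphere[of 0 1] un unfolding compact_def by metis
  have y0: "y \<longlonglongrightarrow> 0"
  proof (rule Lim_null_comparison)
    show "\<forall>\<^sub>F k in sequentially. norm (y k) \<le> 1 / real (Suc k)" using y(3) by (intro always_eventually allI) (simp add: less_imp_le)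
    show "(\<lambda>k. 1 / real (Suc k)) \<longlonglongrightarrow> 0" using LIMSEQ_Suc[OF lim_const_over_n[of "1::real"]] by simp
  qed
  then have yr: "(\<lambda>k. y (r k)) \<longlonglongrightarrow> 0" using LIMSEQ_subseq_LIMSEQ[OF y0 v(2)] by (simp add: o_def)
  \<comment> \<open>This exponent rescales \<open>y k\<close> to its unit vector up to an error of
    at most \<open>norm (y k)\<close>.\<close>
  define n where "n k = nat \<lfloor>1 / norm (y k)\<rfloor>" for k
  have "norm (real (n k) *\<^sub>R y k - u k) \<le> norm (y k)" for k
  proof -
    have "real (n k) = of_int \<lfloor>1 / norm (y k)\<rfloor>" by (simp add: n_def)
    then have "\<bar>real (n k) - 1 / norm (y k)\<bar> \<le> 1" by linarith
    from mult_right_mono[OF this norm_ge_zero[of "y k"]]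
    have "norm ((real (n k) - 1 / norm (y k)) *\<^sub>R y k) \<le> norm (y k)" by simp
    then show ?thesis by (simp add: scaleR_diff_left u_def divide_inverse)
  qed
  then have "(\<lambda>k. real (n (r k)) *\<^sub>R y (r k) - u (r k)) \<longlonglongrightarrow> 0"
    by (intro Lim_null_comparison[OF always_eventually tendsto_norm_zero[OF yr]]) blast
  from tendsto_add[OF this v(3)] have nv: "(\<lambda>k. real (n (r k)) *\<^sub>R y (r k)) \<longlonglongrightarrow> v" by (simp add: o_def)
  have yO: "y k \<in> O0" for k using rad(5)[of "y k"] y(3)[of k] rad(1) by simp
  have cy: "co (pt (y k)) = y k" for k using co_pt[OF yO] y(1) proj_E by simp
  have "v \<in> E" "\<And>t. gexp (t *\<^sub>R v) \<in> S"
    using gexp_of_sequence[of "\<lambda>k. pt (y (r k))" S "\<lambda>k. n (r k)" v, unfolded cy, OF pt_in[OF yO] S(1) y(4) S(2) yr nv] by auto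
  then have vL: "v \<in> Lie L S" unfolding Lie_closed_subgroup[OF S] by simp
  have "(\<lambda>k. (u \<circ> r) k \<bullet> v) \<longlonglongrightarrow> v \<bullet> v" by (intro tendsto_intros v(3))
  moreover have "(u \<circ> r) k \<bullet> v = 0" for k using y(2)[OF vL] by (simp add: u_def)
  ultimately have "v \<bullet> v = 0" by (simp add: LIMSEQ_const_iff)
  then show False using v(1) by simp
qed

text \<open>The order of the list matters, as the factors need not commute; to first order at 0 the
  map is the sum of the components.\<close>

primrec prodexp :: "'e list \<Rightarrow> 'e \<Rightarrow> 'g" where
  "prodexp [] x = \<one>"
| "prodexp (b # bs) x = gexp ((x \<bullet> b) *\<^sub>R b) \<otimes> prodexp bs x"

lemma smooth_germ_prodexp:
  "set bs \<subseteq> E \<Longrightarrow> smooth_germ (prodexp bs) (\<lambda>v. \<Sum>b\<leftarrow>bs. (v \<bullet> b) *\<^sub>R b)"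
proof (induction bs)
  case Nil
  have "smooth_germ (\<lambda>x::'e. \<one>) (\<lambda>v. 0)" unfolding smooth_germ_def
    using id_chart by (intro conjI exI[of _ UNIV]) (auto simp: co_one intro: smooth_on_const)
  then show ?case by simp
next
  case (Cons b bs)
  then show ?case using smooth_germ_mult[OF smooth_germ_gexp[of b] Cons.IH] by simp
qed

lemma prodexp_in_subgroup:
  "subgroup S L \<Longrightarrow> (\<And>b t. b \<in> set bs \<Longrightarrow> gexp (t *\<^sub>R b) \<in> S) \<Longrightarrow> prodexp bs x \<in> S"
  by (induction bs) (auto intro: subgroup.one_closed subgroup.m_closed)


lemma sum_list_onb:
  assumes "finite B" "set bs = B" "distinct bs"
  shows "(\<Sum>b\<leftarrow>bs. (v \<bullet> b) *\<^sub>R b) = (\<Sum>b\<in>B. (v \<bullet> b) *\<^sub>R (b::'e))"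
  using assms sum_list_distinct_conv_sum_set by blast

text \<open>Slice coordinates: products of one-parameter subgroups of \<open>S\<close> followed by a transversal chart line.\<close>

lemma slice_coordinates:
  assumes S: "subgroup S L" "closedin T S"
  obtains N V \<Phi> g where "open N" "0 \<in> N" "open V" "smooth_on N (\<lambda>x. co (\<Phi> x))" "smooth_on V g"
    "\<And>x. x \<in> N \<Longrightarrow> x \<in> E \<Longrightarrow> \<Phi> x \<in> U0" "\<And>x. x \<in> N \<Longrightarrow> x \<in> E \<Longrightarrow> co (\<Phi> x) \<in> V" "\<Phi> 0 = \<one>"
    "\<And>x. x \<in> N \<Longrightarrow> x \<in> E \<Longrightarrow> g (co (\<Phi> x)) = x"
    "\<And>y. y \<in> V \<Longrightarrow> y \<in> E \<Longrightarrow> g y \<in> N \<and> g y \<in> E \<and> co (\<Phi> (g y)) = y"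
    "\<And>x. x \<in> N \<Longrightarrow> x \<in> E \<Longrightarrow> \<Phi> x \<in> S \<longleftrightarrow> x \<in> Lie L S"
proof -
  let ?s = "Lie L S"
  have ss: "subspace ?s" by (rule Lie_subspace[OF S])
  have sE: "?s \<subseteq> E" unfolding Lie_closed_subgroup[OF S] by blast
  obtain bs where bs: "set bs = onb ?s" "distinct bs" using finite_distinct_list[OF onb(1)[OF ss]] by blast
  have bsE: "set bs \<subseteq> E" using bs onb(2)[OF ss] sE by blast
  let ?Q = "\<lambda>x. x - proj ?s x"
  have blQ: "bounded_linear ?Q" by (intro bounded_linear_sub bounded_linear_ident bounded_linear_proj)
  define \<Phi> where "\<Phi> x = prodexp bs x \<otimes> pt (?Q x)" for x
  have germ: "smooth_germ \<Phi> (\<lambda>v. (\<Sum>b\<leftarrow>bs. (v \<bullet> b) *\<^sub>R b) + proj E (?Q v))"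
    unfolding \<Phi>_def by (rule smooth_germ_mult[OF smooth_germ_prodexp[OF bsE] smooth_germ_pt[OF blQ]])
  have "(\<Sum>b\<leftarrow>bs. (v \<bullet> b) *\<^sub>R b) + proj E (?Q v) = proj E v" for v
  proof -
    have "(\<Sum>b\<leftarrow>bs. (v \<bullet> b) *\<^sub>R b) = proj ?s v" unfolding sum_list_onb[OF onb(1)[OF ss] bs] proj_def ..
    moreover have "proj E (proj ?s v) = proj ?s v" using proj_in[OF ss] sE by (intro proj_E) blast
    ultimately show ?thesis by (simp add: linear_diff[OF linear_proj])
  qed
  with germ have germ: "smooth_germ \<Phi> (\<lambda>v. proj E v)" by simp
  obtain W where W: "open W" "0 \<in> W" "\<forall>x\<in>W. \<Phi> x \<in> U0" "smooth_on W (\<lambda>x. co (\<Phi> x))"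
    using germ unfolding smooth_germ_def by blast
  have \<Phi>0: "\<Phi> 0 = \<one>" using germ by (simp add: smooth_germ_def)
  \<comment> \<open>Adding the component orthogonal to \<open>E\<close> makes the differential at 0
    the identity of the full type, as the inverse function theorem requires; on \<open>E\<close>
    nothing changes.\<close>
  define f where "f x = co (\<Phi> x) + (x - proj E x)" for x
  have fE: "f x = co (\<Phi> x)" if "x \<in> E" for x using that by (simp add: f_def proj_E)
  have blP: "bounded_linear (\<lambda>x. x - proj E x)" by (intro bounded_linear_sub bounded_linear_ident bounded_linear_proj)
  have sf: "smooth_on W f" unfolding f_def by (intro smooth_on_add W(4) smooth_on_bounded_linear[OF blP])
  have "((\<lambda>x. co (\<Phi> x)) has_derivative (\<lambda>v. proj E v)) (at 0)" using germ by (simp add: smooth_germ_def)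
  from has_derivative_add[OF this bounded_linear_imp_has_derivative[OF blP]]
  have df: "(f has_derivative (\<lambda>v. v)) (at 0)" by (simp add: f_def[abs_def])
  obtain U V g where UV: "open U" "U \<subseteq> W" "0 \<in> U" "open V" "homeomorphism U V f g" "smooth_on V g"
    using smooth_local_inverse[OF W(1,2) sf df] by blast
  have fg: "\<And>x. x \<in> U \<Longrightarrow> g (f x) = x" "\<And>y. y \<in> V \<Longrightarrow> f (g y) = y" "\<And>x. x \<in> U \<Longrightarrow> f x \<in> V" "\<And>y. y \<in> V \<Longrightarrow> g y \<in> U"
    using UV(5) unfolding homeomorphism_def by auto
  \<comment> \<open>The inverse respects \<open>E\<close>, since \<open>f\<close> differs from a
    point of \<open>E\<close> exactly by the component of its argument orthogonal to
    \<open>E\<close>.\<close>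
  have gE: "g y \<in> E" if y: "y \<in> V" "y \<in> E" for y
  proof -
    let ?x = "g y"
    have "\<Phi> ?x \<in> U0" using fg(4)[OF y(1)] UV(2) W(3) by blast
    then have "f ?x - co (\<Phi> ?x) \<in> E" using fg(2)[OF y(1)] y(2) pt_co(3) subspace_diff[OF subE] by metis
    then have "?x - proj E ?x \<in> E" by (simp add: f_def)
    from subspace_add[OF subE this proj_in[OF subE, of ?x]] show ?thesis by simp
  qed
  obtain e where e: "e > 0" "\<And>y. y \<in> E \<Longrightarrow> (\<And>z. z \<in> ?s \<Longrightarrow> y \<bullet> z = 0) \<Longrightarrow> norm y < e \<Longrightarrow> pt y \<in> S \<Longrightarrow> y = 0"
    using transversal_isolated[OF S] by blast
  \<comment> \<open>On this neighbourhood the transversal part is too short to meet \<open>S\<close>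
    except at 0 and stays in the chart domain, so membership in \<open>S\<close> is decided by the
    vanishing of \<open>?Q x\<close>.\<close>
  let ?B = "{x. norm (?Q x) < e} \<inter> {x. ?Q x \<in> O0}"
  have oB: "open ?B"
  proof (rule open_Int)
    have c: "continuous_on UNIV ?Q" by (rule linear_continuous_on[OF blQ])
    show "open {x. norm (?Q x) < e}" by (intro open_Collect_less continuous_on_norm c continuous_intros)
    show "open {x. ?Q x \<in> O0}" using open_vimage[OF O0(1) c] by (simp add: vimage_def)
  qed
  have Q0: "?Q 0 = 0" by (simp add: linear_0[OF linear_proj])
  let ?N = "U \<inter> ?B" and ?V = "V \<inter> g -` ?B"
  show thesis
  proof (rule that)
    show "open ?N" using UV(1) oB by blast
    show "0 \<in> ?N" using UV(3) Q0 e(1) O0(2) by simp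
    show "open ?V" by (rule continuous_open_preimage[OF smooth_on_imp_continuous_on[OF UV(6)] UV(4) oB])
    show "smooth_on ?N (\<lambda>x. co (\<Phi> x))" by (rule smooth_on_subset[OF W(4)]) (use UV(2) in blast)
    show "smooth_on ?V g" by (rule smooth_on_subset[OF UV(6)]) blast
    show "\<Phi> 0 = \<one>" by (rule \<Phi>0)
    show "\<Phi> x \<in> U0" if "x \<in> ?N" "x \<in> E" for x using that UV(2) W(3) by blast
    show "co (\<Phi> x) \<in> ?V" if "x \<in> ?N" "x \<in> E" for x
    proof -
      have "f x \<in> V" "g (f x) \<in> ?B" using that fg(1,3) by auto
      then show ?thesis using fE[OF that(2)] by simp
    qed
    show "g (co (\<Phi> x)) = x" if "x \<in> ?N" "x \<in> E" for x
      using fg(1)[of x] that(1) unfolding fE[OF that(2)] by blast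
    show "g y \<in> ?N \<and> g y \<in> E \<and> co (\<Phi> (g y)) = y" if "y \<in> ?V" "y \<in> E" for y
      using that fg(2,4) gE[of y] fE[of "g y"] by simp
    show "\<Phi> x \<in> S \<longleftrightarrow> x \<in> ?s" if x: "x \<in> ?N" "x \<in> E" for x
    proof -
      have pS: "prodexp bs x \<in> S"
        by (rule prodexp_in_subgroup[OF S(1)]) (use bs onb(2)[OF ss] in \<open>auto simp: Lie_closed_subgroup[OF S]\<close>)
      have QE: "?Q x \<in> E" using x(2) proj_in[OF ss] sE subspace_diff[OF subE] by blast
      have pc: "pt (?Q x) \<in> carrier L" using x(1) pt_carrier by blast
      have "\<Phi> x \<in> S \<longleftrightarrow> pt (?Q x) \<in> S"
      proof
        assume "\<Phi> x \<in> S"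
        then have "inv (prodexp bs x) \<otimes> \<Phi> x \<in> S" using pS S(1) subgroup.m_closed subgroup.m_inv_closed by metis
        moreover have "prodexp bs x \<in> carrier L" using pS subgroup.subset[OF S(1)] by blast
        ultimately show "pt (?Q x) \<in> S" using pc by (simp add: \<Phi>_def m_assoc[symmetric])
      qed (use pS S(1) in \<open>simp add: \<Phi>_def subgroup.m_closed\<close>)
      also have "\<dots> \<longleftrightarrow> ?Q x = 0"
      proof
        assume "pt (?Q x) \<in> S"
        then show "?Q x = 0" using e(2)[OF QE] proj_orthogonal[OF ss] x(1) by blast
      next
        assume "?Q x = 0"
        then show "pt (?Q x) \<in> S" using subgroup.one_closed[OF S(1)] pt_0 by simp
      qed
      also have "\<dots> \<longleftrightarrow> x \<in> ?s" using proj_in[OF ss, of x] proj_id[OF ss, of x] by auto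
      finally show ?thesis .
    qed
  qed
qed

text \<open>The slice at the identity is moved to \<open>p\<close> by left translation. The labour
  lies in compatibility with the atlas in both directions, which rests on smoothness of left
  translation and of the inverse slice map \<open>g\<close>.\<close>

lemma closed_subgroup_embedded:
  assumes S: "subgroup S L" "closedin T S"
  shows "lie_subgroup L S"
  unfolding lie_subgroup_def embedded_submanifold_def
proof (intro conjI ballI S(1))
  have SC: "S \<subseteq> carrier L" using subgroup.subset[OF S(1)] .
  then show "S \<subseteq> points (mfd L)" by (simp add: pts)
  fix p assume p: "p \<in> S"
  then have pc: "p \<in> carrier L" using SC by blast
  obtain N V \<Phi> g where N: "open N" "0 \<in> N" "open V" "smooth_on N (\<lambda>x. co (\<Phi> x))" "smooth_on V g"
    and \<Phi>: "\<And>x. x \<in> N \<Longrightarrow> x \<in> E \<Longrightarrow> \<Phi> x \<in> U0" "\<And>x. x \<in> N \<Longrightarrow> x \<in> E \<Longrightarrow> co (\<Phi> x) \<in> V" "\<Phi> 0 = \<one>"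
      "\<And>x. x \<in> N \<Longrightarrow> x \<in> E \<Longrightarrow> g (co (\<Phi> x)) = x"
      "\<And>y. y \<in> V \<Longrightarrow> y \<in> E \<Longrightarrow> g y \<in> N \<and> g y \<in> E \<and> co (\<Phi> (g y)) = y"
      "\<And>x. x \<in> N \<Longrightarrow> x \<in> E \<Longrightarrow> \<Phi> x \<in> S \<longleftrightarrow> x \<in> Lie L S"
    by (rule slice_coordinates[OF S]) blast
  define W where "W = (\<lambda>x. p \<otimes> \<Phi> x) ` (E \<inter> N)"
  define \<phi> where "\<phi> h = g (co (inv p \<otimes> h))" for h
  have \<Phi>c: "\<Phi> x \<in> carrier L" if "x \<in> E \<inter> N" for x using that \<Phi>(1) U0_carrier by blast
  have \<phi>: "\<phi> (p \<otimes> \<Phi> x) = x" if "x \<in> E \<inter> N" for x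
    unfolding \<phi>_def using that \<Phi>(4)[of x] \<Phi>c[OF that] pc by (simp add: m_assoc[symmetric])
  have inj: "inj_on \<phi> W" unfolding W_def by (rule inj_onI) (auto simp: \<phi>)
  have im: "\<phi> ` (W \<inter> A) = {x \<in> E \<inter> N. p \<otimes> \<Phi> x \<in> A}" for A
  proof (intro equalityI subsetI)
    fix z assume "z \<in> \<phi> ` (W \<inter> A)"
    then obtain x where "x \<in> E \<inter> N" "p \<otimes> \<Phi> x \<in> A" "z = \<phi> (p \<otimes> \<Phi> x)" unfolding W_def by blast
    then show "z \<in> {x \<in> E \<inter> N. p \<otimes> \<Phi> x \<in> A}" using \<phi> by simp
  next
    fix z assume z: "z \<in> {x \<in> E \<inter> N. p \<otimes> \<Phi> x \<in> A}"
    then have "p \<otimes> \<Phi> z \<in> W \<inter> A" unfolding W_def by blast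
    then have "\<phi> (p \<otimes> \<Phi> z) \<in> \<phi> ` (W \<inter> A)" by (rule imageI)
    then show "z \<in> \<phi> ` (W \<inter> A)" using \<phi>[of z] z by simp
  qed
  have imW: "\<phi> ` W = E \<inter> N" using im[of UNIV] by auto
  have inv\<phi>: "inv_into W \<phi> x = p \<otimes> \<Phi> x" if "x \<in> E \<inter> N" for x
    using inv_into_f_f[OF inj, of "p \<otimes> \<Phi> x"] that \<phi>[OF that] unfolding W_def by auto
  have cN: "continuous_on N (\<lambda>x. a0 + co (\<Phi> x))"
    by (intro continuous_intros smooth_on_imp_continuous_on[OF N(4)])
  have sN: "smooth_on N (\<lambda>x. a0 + co (\<Phi> x))" by (intro smooth_on_add smooth_on_const N(4))
  have pt\<Phi>: "cinv E c0 (a0 + co (\<Phi> x)) = \<Phi> x" "a0 + co (\<Phi> x) \<in> cdom E c0" if "x \<in> E \<inter> N" for x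
    using pt_co[OF \<Phi>(1)] that by (auto simp: pt_def O0_def)
  have fwd: "openin (top_of_set E) (\<phi> ` (W \<inter> fst d))" "smooth_on (\<phi> ` (W \<inter> fst d)) (snd d \<circ> inv_into W \<phi>)"
    if d: "d \<in> atlas (mfd L)" for d
  proof -
    let ?Z = "{z \<in> cdom E c0. p \<otimes> cinv E c0 z \<in> fst d}"
    note tr = translation_smooth[OF pc id_chart(1) d]
    have eq: "\<phi> ` (W \<inter> fst d) = E \<inter> (N \<inter> (\<lambda>x. a0 + co (\<Phi> x)) -` ?Z)" unfolding im using pt\<Phi> by auto
    have "open (N \<inter> (\<lambda>x. a0 + co (\<Phi> x)) -` ?Z)" by (rule continuous_open_preimage[OF cN N(1) tr(1)])
    then show "openin (top_of_set E) (\<phi> ` (W \<inter> fst d))" unfolding eq by (rule openin_open_Int)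
    have s: "smooth_on (\<phi> ` (W \<inter> fst d)) (\<lambda>x. snd d (p \<otimes> cinv E c0 (a0 + co (\<Phi> x))))"
      unfolding eq by (rule smooth_on_compose[OF smooth_on_subset[OF sN] tr(2)]) auto
    show "smooth_on (\<phi> ` (W \<inter> fst d)) (snd d \<circ> inv_into W \<phi>)"
      by (rule smooth_on_cong[THEN iffD1, OF _ s]) (use pt\<Phi> inv\<phi> in \<open>auto simp: im\<close>)
  qed
  have bwd: "openin (top_of_set E) (snd d ` (fst d \<inter> W))" "smooth_on (snd d ` (fst d \<inter> W)) (\<phi> \<circ> inv_into (fst d) (snd d))"
    if d: "d \<in> atlas (mfd L)" for d
  proof -
    let ?Z = "{z \<in> cdom E d. inv p \<otimes> cinv E d z \<in> U0}"
    let ?F = "\<lambda>z. snd c0 (inv p \<otimes> cinv E d z) + - a0"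
    note tr = translation_smooth[OF inv_closed[OF pc] d id_chart(1)]
    have sF: "smooth_on ?Z ?F" by (intro smooth_on_add smooth_on_const tr(2))
    have F: "?F z = co (inv p \<otimes> cinv E d z)" for z by (simp add: co_def)
    have eq: "snd d ` (fst d \<inter> W) = E \<inter> (?Z \<inter> ?F -` V)"
    proof (intro equalityI subsetI)
      fix z assume "z \<in> snd d ` (fst d \<inter> W)"
      then obtain x where x: "x \<in> E \<inter> N" "p \<otimes> \<Phi> x \<in> fst d" "z = snd d (p \<otimes> \<Phi> x)" unfolding W_def by blast
      note c = chart_in[OF atl d subE x(2), folded x(3)]
      have "inv p \<otimes> (p \<otimes> \<Phi> x) = \<Phi> x" using \<Phi>c[OF x(1)] pc by (simp add: m_assoc[symmetric])
      then show "z \<in> E \<inter> (?Z \<inter> ?F -` V)" using c \<Phi>(1,2)[of x] x(1) unfolding vimage_def F by auto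
    next
      fix z assume z: "z \<in> E \<inter> (?Z \<inter> ?F -` V)"
      let ?h = "cinv E d z" and ?y = "co (inv p \<otimes> cinv E d z)"
      have hd: "?h \<in> fst d" "snd d ?h = z" using z cinv_in[of z E d] chart_cinv[of z E d] proj_E by auto
      have hU: "inv p \<otimes> ?h \<in> U0" using z by simp
      have y: "?y \<in> V" "?y \<in> E" using z pt_co(3)[OF hU] unfolding vimage_def F by auto
      have gy: "g ?y \<in> E \<inter> N" "co (\<Phi> (g ?y)) = ?y" using \<Phi>(5)[OF y] by auto
      have "\<Phi> (g ?y) \<in> U0" using \<Phi>(1) gy(1) by blast
      then have "\<Phi> (g ?y) = inv p \<otimes> ?h" using pt_co(2)[OF hU] pt_co(2)[of "\<Phi> (g ?y)"] gy(2) by simp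
      then have "p \<otimes> \<Phi> (g ?y) = ?h" using pc chart_carrier[OF d hd(1)] by (simp add: m_assoc[symmetric])
      then have "?h \<in> W" unfolding W_def using gy(1) by (metis imageI)
      then have "snd d ?h \<in> snd d ` (fst d \<inter> W)" using hd(1) by blast
      then show "z \<in> snd d ` (fst d \<inter> W)" using hd(2) by simp
    qed
    have "open (?Z \<inter> ?F -` V)" by (rule continuous_open_preimage[OF smooth_on_imp_continuous_on[OF sF] tr(1) N(3)])
    then show "openin (top_of_set E) (snd d ` (fst d \<inter> W))" unfolding eq by (rule openin_open_Int)
    have s: "smooth_on (E \<inter> (?Z \<inter> ?F -` V)) (\<lambda>z. g (?F z))"
      by (rule smooth_on_compose[OF smooth_on_subset[OF sF] N(5)]) auto
    have e: "g (?F z) = (\<phi> \<circ> inv_into (fst d) (snd d)) z" if "z \<in> E \<inter> (?Z \<inter> ?F -` V)" for z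
      unfolding F using that by (simp add: \<phi>_def cinv_def proj_E)
    show "smooth_on (snd d ` (fst d \<inter> W)) (\<phi> \<circ> inv_into (fst d) (snd d))"
      unfolding eq by (rule smooth_on_cong[THEN iffD1, OF e s])
  qed
  have self: "smooth_on (\<phi> ` W) (\<phi> \<circ> inv_into W \<phi>)"
    by (rule smooth_on_cong[THEN iffD1, OF _ smooth_on_bounded_linear[OF bounded_linear_ident]])
      (use \<phi> inv\<phi> in \<open>auto simp: imW\<close>)
  have oW: "openin (top_of_set E) (\<phi> ` W)" unfolding imW by (rule openin_open_Int[OF N(1)])
  have "smooth_atlas E (insert (W, \<phi>) (atlas (mfd L)))"
    by (rule smooth_atlas_insert[OF atl inj oW self fwd bwd])
  moreover have "p \<in> W"
  proof -
    have "p \<otimes> \<Phi> 0 \<in> W" unfolding W_def using N(2) subspace_0[OF subE] by blast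
    then show ?thesis using \<Phi>(3) pc by simp
  qed
  moreover have "W \<subseteq> points (mfd L)" unfolding W_def pts using \<Phi>c pc by auto
  moreover have "\<phi> ` (W \<inter> S) = \<phi> ` W \<inter> Lie L S"
  proof -
    have "p \<otimes> \<Phi> x \<in> S \<longleftrightarrow> x \<in> Lie L S" if x: "x \<in> E \<inter> N" for x
    proof -
      have "p \<otimes> \<Phi> x \<in> S \<longleftrightarrow> \<Phi> x \<in> S"
      proof
        assume "p \<otimes> \<Phi> x \<in> S"
        then have "inv p \<otimes> (p \<otimes> \<Phi> x) \<in> S" using p S(1) subgroup.m_closed subgroup.m_inv_closed by metis
        then show "\<Phi> x \<in> S" using \<Phi>c[OF x] pc by (simp add: m_assoc[symmetric])
      qed (use p S(1) subgroup.m_closed in metis)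
      then show ?thesis using \<Phi>(6) x by blast
    qed
    then show ?thesis unfolding im imW by blast
  qed
  moreover have "subspace (Lie L S)" "Lie L S \<subseteq> E" using Lie_subspace[OF S] Lie_closed_subgroup[OF S] by auto
  ultimately show "\<exists>W \<phi> V. p \<in> W \<and> W \<subseteq> points (mfd L) \<and> smooth_atlas E (insert (W, \<phi>) (atlas (mfd L))) \<and>
        subspace V \<and> V \<subseteq> E \<and> \<phi> ` (W \<inter> S) = \<phi> ` W \<inter> V"
    by (intro exI[of _ W] exI[of _ \<phi>] exI[of _ "Lie L S"] conjI)
qed

end

section \<open>Complex reductive groups\<close>

context lie_grp begin

text \<open>The derivative provided by holomorphy lives within the model space; composed with the
  projection it becomes the differential of \<open>tder\<close>, and uniqueness transfers the
  commutation rule.\<close>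

lemma tder_holomorphic:
  assumes hol: "holomorphic_map J K (mfd L) (mfd L) f" and f1: "f \<one> = \<one>" and J: "\<And>v. v \<in> E \<Longrightarrow> J v \<in> E"
  shows "\<exists>D. tder f D \<and> (\<forall>v\<in>E. D (J v) = K (D v))"
proof -
  have sm: "smooth_map (mfd L) (mfd L) f" using hol by (simp add: holomorphic_map_def)
  obtain D where D: "tder f D" using tder_smooth[OF sm f1] by blast
  have fU: "f \<one> \<in> U0" using f1 id_chart by simp
  let ?F = "snd c0 \<circ> f \<circ> inv_into U0 (snd c0)"
  let ?S = "snd c0 ` (U0 \<inter> f -` U0)"
  obtain D' where D': "(?F has_derivative D') (at a0 within ?S)" "\<And>v. v \<in> E \<Longrightarrow> D' (J v) = K (D' v)"
    by (rule holomorphic_mapD[OF hol id_chart(1) id_chart(1) id_chart(2) fU]) (use that a0_def in auto)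
  have o: "openin (top_of_set E) ?S" by (rule smooth_mapD(1)[OF sm id_chart(1) id_chart(1)])
  have "a0 \<in> ?S" unfolding a0_def using id_chart(2) fU by blast
  note D1 = D'(1)[unfolded has_derivative_within_openin[OF o this]]
  have q: "((\<lambda>x. a0 + proj E x) has_derivative (\<lambda>v. proj E v)) (at 0)"
    using has_derivative_add[OF has_derivative_const[of a0] bounded_linear_imp_has_derivative[OF bounded_linear_proj]] by simp
  have a00: "a0 + proj E 0 = a0" by (simp add: linear_0[OF linear_proj])
  have r: "(?F has_derivative D') (at (a0 + proj E 0) within range (\<lambda>x. a0 + proj E x))"
    unfolding a00 by (rule has_derivative_subset[OF D1]) (use proj_in[OF subE] subspace_add[OF subE a0E] in auto)
  have "((\<lambda>x. ?F (a0 + proj E x) - a0) has_derivative (\<lambda>v. D' (proj E v))) (at 0)"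
    using has_derivative_diff[OF has_derivative_in_compose[OF q r] has_derivative_const[of a0]] by simp
  moreover have "?F (a0 + proj E x) - a0 = co (f (pt x))" for x
    by (simp add: co_def pt_def cinv_def proj_add proj_a0)
  ultimately have "((\<lambda>x. co (f (pt x))) has_derivative (\<lambda>v. D' (proj E v))) (at 0)" by simp
  moreover have "((\<lambda>x. co (f (pt x))) has_derivative D) (at 0)" using D by (simp add: tder_def)
  ultimately have "D = (\<lambda>v. D' (proj E v))" using has_derivative_unique by blast
  then have "\<forall>v\<in>E. D (J v) = K (D v)" using D'(2) J proj_E by simp
  then show ?thesis using D by blast
qed

text \<open>The derivative of the orbit is \<open>Ad\<close> applied to the bracket of
  \<open>X\<close> and \<open>Y\<close>, which is 0 at every time, so the orbit is constant.\<close>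

lemma Ad_gexp_fixed:
  assumes X: "X \<in> E" and Y: "Y \<in> E" and XY: "lie_bracket L X Y = 0"
  shows "Ad L (gexp (t *\<^sub>R X)) Y = Y"
proof -
  have "((\<lambda>t. Ad L (gexp (t *\<^sub>R X)) Y) has_vector_derivative 0) (at t within UNIV)" for t
    using Ad_curve_derivative_at(2)[OF X Y, of t] XY Ad_linear(3)[OF gexp_closed[OF scale_E[OF X]]] by simp
  then obtain c where "\<And>t. t \<in> UNIV \<Longrightarrow> Ad L (gexp (t *\<^sub>R X)) Y = c"
    using has_vector_derivative_zero_constant[of UNIV "\<lambda>t. Ad L (gexp (t *\<^sub>R X)) Y"] by auto
  from this[of t] this[of 0] show ?thesis using Ad_one[OF Y] by (simp add: gexp_0)
qed

lemma bracket_of_fixed: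
  assumes X: "X \<in> E" and Y: "Y \<in> E" and f: "\<And>t. Ad L (gexp (t *\<^sub>R X)) Y = Y"
  shows "lie_bracket L X Y = 0"
proof -
  have "((\<lambda>t. Y) has_vector_derivative lie_bracket L X Y) (at 0)" using Ad_curve_derivative(1)[OF X Y] f by simp
  then show ?thesis using has_vector_derivative_const vector_derivative_at by metis
qed

lemma hom_bracket:
  assumes f: "tder f D" "f \<in> hom L L" and X: "X \<in> E" and Y: "Y \<in> E"
  shows "D (lie_bracket L X Y) = lie_bracket L (D X) (D Y)"
proof -
  have "((\<lambda>t. D (Ad L (gexp (t *\<^sub>R X)) Y)) has_vector_derivative D (lie_bracket L X Y)) (at 0)"
    by (rule bounded_linear.has_vector_derivative[OF tder_linear(2)[OF f(1)] Ad_curve_derivative(1)[OF X Y]])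
  moreover have "D (Ad L (gexp (t *\<^sub>R X)) Y) = Ad L (gexp (t *\<^sub>R D X)) (D Y)" for t
    using hom_Ad[OF f gexp_closed[OF scale_E[OF X]] Y] tder_hom[OF f X] by simp
  ultimately have "((\<lambda>t. Ad L (gexp (t *\<^sub>R D X)) (D Y)) has_vector_derivative D (lie_bracket L X Y)) (at 0)" by simp
  moreover have "((\<lambda>t. Ad L (gexp (t *\<^sub>R D X)) (D Y)) has_vector_derivative lie_bracket L (D X) (D Y)) (at 0)"
    by (rule Ad_curve_derivative(1)) (rule tder_E[OF f(1)])+
  ultimately show ?thesis by (metis vector_derivative_at)
qed

lemma gexp_commute_Ad:
  assumes g: "g \<in> carrier L" and X: "X \<in> E" and f: "Ad L g X = X"
  shows "g \<otimes> gexp (t *\<^sub>R X) = gexp (t *\<^sub>R X) \<otimes> g"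
proof -
  have c: "gexp (t *\<^sub>R X) \<in> carrier L" using gexp_closed[OF scale_E[OF X]] .
  have "g \<otimes> gexp (t *\<^sub>R X) \<otimes> inv g = gexp (t *\<^sub>R X)" using gexp_Ad(1)[OF g X, of t] f by (simp add: cj_def)
  then have "g \<otimes> gexp (t *\<^sub>R X) \<otimes> inv g \<otimes> g = gexp (t *\<^sub>R X) \<otimes> g" by simp
  then show ?thesis using g c by (simp add: m_assoc)
qed

lemma Ad_of_commute:
  assumes g: "g \<in> carrier L" and X: "X \<in> E" and f: "\<And>t. g \<otimes> gexp (t *\<^sub>R X) = gexp (t *\<^sub>R X) \<otimes> g"
  shows "Ad L g X = X"
proof (rule gexp_ray_inj[OF gexp_Ad(3)[OF g X] X])
  fix t
  have c: "gexp (t *\<^sub>R X) \<in> carrier L" using gexp_closed[OF scale_E[OF X]] .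
  have "gexp (t *\<^sub>R Ad L g X) = g \<otimes> gexp (t *\<^sub>R X) \<otimes> inv g" using gexp_Ad(1)[OF g X, of t] by (simp add: cj_def)
  also have "\<dots> = gexp (t *\<^sub>R X)" unfolding f using g c by (simp add: m_assoc)
  finally show "gexp (t *\<^sub>R Ad L g X) = gexp (t *\<^sub>R X)" .
qed

text \<open>Commutation at all times makes the product of the two rays a homomorphism with velocity
  \<open>X + Y\<close>, and such a curve is unique.\<close>

lemma gexp_add_commuting:
  assumes X: "X \<in> E" and Y: "Y \<in> E" and f: "\<And>s t. gexp (s *\<^sub>R Y) \<otimes> gexp (t *\<^sub>R X) = gexp (t *\<^sub>R X) \<otimes> gexp (s *\<^sub>R Y)"
  shows "gexp (t *\<^sub>R (X + Y)) = gexp (t *\<^sub>R X) \<otimes> gexp (t *\<^sub>R Y)"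
proof -
  let ?c = "\<lambda>t::real. gexp (t *\<^sub>R X) \<otimes> gexp (t *\<^sub>R Y)"
  have cX: "gexp (t *\<^sub>R X) \<in> carrier L" for t using gexp_closed[OF scale_E[OF X]] .
  have cY: "gexp (t *\<^sub>R Y) \<in> carrier L" for t using gexp_closed[OF scale_E[OF Y]] .
  have "smooth_germ ?c (\<lambda>t. t *\<^sub>R X + t *\<^sub>R Y)" using X Y by (intro smooth_germ_mult gexp_smooth_germ) auto
  note g = smooth_germ_curve[OF this]
  have "?c (s + t) = ?c s \<otimes> ?c t" for s t
  proof -
    have "?c (s + t) = gexp (s *\<^sub>R X) \<otimes> (gexp (t *\<^sub>R X) \<otimes> gexp (s *\<^sub>R Y)) \<otimes> gexp (t *\<^sub>R Y)"
      unfolding gexp_add[OF X, symmetric] gexp_add[OF Y, symmetric] using cX cY by (simp add: m_assoc)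
    also have "gexp (t *\<^sub>R X) \<otimes> gexp (s *\<^sub>R Y) = gexp (s *\<^sub>R Y) \<otimes> gexp (t *\<^sub>R X)" by (rule f[symmetric])
    finally show ?thesis using cX cY by (simp add: m_assoc)
  qed
  from one_parameter_unique(2)[of ?c, OF this _ g(2,3), of t] cX cY show ?thesis by simp
qed

text \<open>Invariance under the whole group, not just vanishing of brackets: this is the Lie
  algebra of the group centre, which for a disconnected group can be smaller than the centre of the
  Lie algebra.\<close>

definition zz :: "'e set" where "zz = {Y \<in> E. \<forall>g\<in>carrier L. Ad L g Y = Y}"

lemma group_center_subgroup: "subgroup (group_center L) L"
proof (rule subgroupI)
  show "group_center L \<subseteq> carrier L" "group_center L \<noteq> {}" by (auto simp: group_center_def centralizer_def intro!: exI[of _ \<one>])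
  fix a assume a: "a \<in> group_center L"
  then have ac: "a \<in> carrier L" "\<And>h. h \<in> carrier L \<Longrightarrow> a \<otimes> h = h \<otimes> a" by (auto simp: group_center_def centralizer_def)
  have "inv a \<otimes> h = h \<otimes> inv a" if h: "h \<in> carrier L" for h
  proof -
    have "inv a \<otimes> h = inv a \<otimes> (h \<otimes> a) \<otimes> inv a" using ac(1) h by (simp add: m_assoc)
    also have "h \<otimes> a = a \<otimes> h" using ac(2)[OF h] by simp
    finally show ?thesis using ac(1) h by (simp add: m_assoc[symmetric])
  qed
  then show "inv a \<in> group_center L" using ac(1) by (simp add: group_center_def centralizer_def)
  fix b assume b: "b \<in> group_center L"
  then have bc: "b \<in> carrier L" "\<And>h. h \<in> carrier L \<Longrightarrow> b \<otimes> h = h \<otimes> b" by (auto simp: group_center_def centralizer_def)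
  have "a \<otimes> b \<otimes> h = h \<otimes> (a \<otimes> b)" if h: "h \<in> carrier L" for h
    using ac bc h by (metis m_assoc m_closed)
  then show "a \<otimes> b \<in> group_center L" using ac(1) bc(1) by (simp add: group_center_def centralizer_def)
qed

lemma group_center_closed: "closedin T (group_center L)"
  unfolding group_center_def by (rule closedin_centralizer) simp

lemma group_centerD: "z \<in> group_center L \<Longrightarrow> z \<in> carrier L" "z \<in> group_center L \<Longrightarrow> h \<in> carrier L \<Longrightarrow> z \<otimes> h = h \<otimes> z"
  by (auto simp: group_center_def centralizer_def)

lemma Lie_center: "Lie L (group_center L) = zz"
proof -
  have "(\<forall>t. gexp (t *\<^sub>R Y) \<in> group_center L) \<longleftrightarrow> (\<forall>g\<in>carrier L. Ad L g Y = Y)" if Y: "Y \<in> E" for Y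
  proof
    assume "\<forall>t. gexp (t *\<^sub>R Y) \<in> group_center L"
    then show "\<forall>g\<in>carrier L. Ad L g Y = Y" using group_centerD(2) by (intro ballI Ad_of_commute Y) auto
  next
    assume "\<forall>g\<in>carrier L. Ad L g Y = Y"
    then have "g \<otimes> gexp (t *\<^sub>R Y) = gexp (t *\<^sub>R Y) \<otimes> g" if "g \<in> carrier L" for g t using gexp_commute_Ad[OF that Y] that by blast
    then show "\<forall>t. gexp (t *\<^sub>R Y) \<in> group_center L" using gexp_closed[OF scale_E[OF Y]] by (auto simp: group_center_def centralizer_def)
  qed
  then show ?thesis unfolding Lie_closed_subgroup[OF group_center_subgroup group_center_closed] zz_def by blast
qed

lemma zz_gexp: "Y \<in> zz \<Longrightarrow> gexp (t *\<^sub>R Y) \<in> group_center L"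
  using Lie_center Lie_closed_subgroup[OF group_center_subgroup group_center_closed] by blast

lemma zz_E: "Y \<in> zz \<Longrightarrow> Y \<in> E" by (simp add: zz_def)

lemma subspace_zz: "subspace zz"
  using Lie_subspace[OF group_center_subgroup group_center_closed] Lie_center by simp

lemma gexp_add_zz:
  assumes X: "X \<in> E" and Y: "Y \<in> zz" shows "gexp (t *\<^sub>R (X + Y)) = gexp (t *\<^sub>R X) \<otimes> gexp (t *\<^sub>R Y)"
  by (rule gexp_add_commuting[OF X zz_E[OF Y]]) (rule group_centerD(2)[OF zz_gexp[OF Y] gexp_closed[OF scale_E[OF X]]])

lemma zz_bracket: "Y \<in> zz \<Longrightarrow> X \<in> E \<Longrightarrow> lie_bracket L X Y = 0"
  by (rule bracket_of_fixed) (auto simp: zz_def gexp_closed scale_E)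

end

lemma imag_simps: "imag (v + w) = imag v + imag w" "imag (r *\<^sub>R v) = r *\<^sub>R imag v" "imag (imag v) = - v" "imag (- v) = - imag v" "imag 0 = 0"
  "imag (v - w) = imag v - imag w"
  unfolding imag_def by (simp_all add: vec_eq_iff algebra_simps)

lemma bounded_linear_imag: "bounded_linear (imag :: complex ^ 'n \<Rightarrow> complex ^ 'n)"
  unfolding linear_conv_bounded_linear[symmetric] by (simp add: linear_iff imag_simps)

locale complex_red = lie_grp L for L :: "('g, complex ^ 'n) lie_group_data" (structure) +
  fixes U :: "'g set" and \<tau> :: "complex ^ 'n \<Rightarrow> complex ^ 'n" and BC :: "complex ^ 'n \<Rightarrow> complex ^ 'n \<Rightarrow> real"
  assumes CR: "complex_reductive L U \<tau> BC"
begin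

abbreviation "br \<equiv> lie_bracket L"
abbreviation "mm \<equiv> minus_part L (carrier L) \<tau>"
abbreviation "uu \<equiv> Lie L U"

lemma imag_E: "v \<in> E \<Longrightarrow> imag v \<in> E"
  and holo_mult: "holomorphic_map (map_prod imag imag) imag (prod_mfd (mfd L) (mfd L)) (mfd L) (\<lambda>(g, h). g \<otimes> h)"
  using CR unfolding complex_reductive_def complex_lie_group_def by auto

lemma RR: "real_reductive L (carrier L) U \<tau> BC" using CR by (simp add: complex_reductive_def)

lemma lspace_L: "lspace (lie_alg_of L S) = Lie L S" "lbracket (lie_alg_of L S) = br" by (simp_all add: lie_alg_of_def)

lemma LA: "lie_algebra (lie_alg_of L (carrier L))"
  using RR unfolding real_reductive_def reductive_lie_algebra_def by blast

lemma br_props: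
  "x \<in> E \<Longrightarrow> y \<in> E \<Longrightarrow> br x y \<in> E"
  "x \<in> E \<Longrightarrow> y \<in> E \<Longrightarrow> z \<in> E \<Longrightarrow> br (x + y) z = br x z + br y z"
  "x \<in> E \<Longrightarrow> y \<in> E \<Longrightarrow> z \<in> E \<Longrightarrow> br z (x + y) = br z x + br z y"
  "x \<in> E \<Longrightarrow> y \<in> E \<Longrightarrow> br (c *\<^sub>R x) y = c *\<^sub>R br x y"
  "x \<in> E \<Longrightarrow> y \<in> E \<Longrightarrow> br x (c *\<^sub>R y) = c *\<^sub>R br x y"
  "x \<in> E \<Longrightarrow> br x x = 0"
  "x \<in> E \<Longrightarrow> y \<in> E \<Longrightarrow> z \<in> E \<Longrightarrow> br x (br y z) + br y (br z x) + br z (br x y) = 0"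
  using LA unfolding lie_algebra_def lspace_L Lie_carrier by blast+

lemma br_anti: assumes "x \<in> E" "y \<in> E" shows "br x y = - br y x"
proof -
  have "br (x + y) (x + y) = 0" using br_props(6) subspace_add[OF subE] assms by blast
  moreover have "br (x + y) (x + y) = br x (x + y) + br y (x + y)"
    by (rule br_props(2)[OF assms subspace_add[OF subE assms]])
  moreover have "br x (x + y) = br x x + br x y" "br y (x + y) = br y x + br y y"
    using br_props(3)[OF assms assms(1)] br_props(3)[OF assms assms(2)] .
  ultimately have "br x y + br y x = 0" using br_props(6) assms by simp
  then show ?thesis by (simp add: eq_neg_iff_add_eq_0)
qed

lemma tau: "x \<in> E \<Longrightarrow> \<tau> x \<in> E" "x \<in> E \<Longrightarrow> \<tau> (\<tau> x) = x"
  "x \<in> E \<Longrightarrow> y \<in> E \<Longrightarrow> \<tau> (x + y) = \<tau> x + \<tau> y" "x \<in> E \<Longrightarrow> \<tau> (c *\<^sub>R x) = c *\<^sub>R \<tau> x"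
  "x \<in> E \<Longrightarrow> y \<in> E \<Longrightarrow> \<tau> (br x y) = br (\<tau> x) (\<tau> y)" "x \<in> E \<Longrightarrow> \<tau> (imag x) = - imag (\<tau> x)"
proof -
  have l: "lie_involution (lie_alg_of L (carrier L)) \<tau>" using RR unfolding real_reductive_def by blast
  then show "x \<in> E \<Longrightarrow> \<tau> x \<in> E" "x \<in> E \<Longrightarrow> \<tau> (\<tau> x) = x"
    "x \<in> E \<Longrightarrow> y \<in> E \<Longrightarrow> \<tau> (x + y) = \<tau> x + \<tau> y" "x \<in> E \<Longrightarrow> \<tau> (c *\<^sub>R x) = c *\<^sub>R \<tau> x"
    "x \<in> E \<Longrightarrow> y \<in> E \<Longrightarrow> \<tau> (br x y) = br (\<tau> x) (\<tau> y)"
    unfolding lie_involution_def lspace_L Lie_carrier by blast+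
  show "x \<in> E \<Longrightarrow> \<tau> (imag x) = - imag (\<tau> x)" using CR unfolding complex_reductive_def Lie_carrier by blast
qed

lemma tau_minus: "x \<in> E \<Longrightarrow> \<tau> (- x) = - \<tau> x" using tau(4)[of x "-1"] by simp
lemma minus_E: "x \<in> E \<Longrightarrow> - x \<in> E" using scale_E[of x "-1"] by simp
lemma add_E: "x \<in> E \<Longrightarrow> y \<in> E \<Longrightarrow> x + y \<in> E" using subspace_add[OF subE] .
lemma diff_E: "x \<in> E \<Longrightarrow> y \<in> E \<Longrightarrow> x - y \<in> E" using subspace_diff[OF subE] .
lemma tau_diff: "x \<in> E \<Longrightarrow> y \<in> E \<Longrightarrow> \<tau> (x - y) = \<tau> x - \<tau> y" using tau(3)[of x "- y"] minus_E tau_minus by simp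

lemma uu: "uu = {X \<in> E. \<tau> X = X}" and mm: "mm = {X \<in> E. \<tau> X = - X}"
proof -
  show "uu = {X \<in> E. \<tau> X = X}" using RR unfolding real_reductive_def Lie_carrier by blast
  show "mm = {X \<in> E. \<tau> X = - X}" by (simp add: minus_part_def Lie_carrier)
qed

lemma BC_bilinear:
  "x \<in> E \<Longrightarrow> y \<in> E \<Longrightarrow> z \<in> E \<Longrightarrow> BC (x + y) z = BC x z + BC y z"
  "x \<in> E \<Longrightarrow> y \<in> E \<Longrightarrow> z \<in> E \<Longrightarrow> BC z (x + y) = BC z x + BC z y"
  "x \<in> E \<Longrightarrow> y \<in> E \<Longrightarrow> BC (c *\<^sub>R x) y = c * BC x y"
  "x \<in> E \<Longrightarrow> y \<in> E \<Longrightarrow> BC x (c *\<^sub>R y) = c * BC x y"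
proof -
  have b: "bilinear_form_on E BC" using RR unfolding real_reductive_def Lie_carrier by blast
  then show "x \<in> E \<Longrightarrow> y \<in> E \<Longrightarrow> z \<in> E \<Longrightarrow> BC (x + y) z = BC x z + BC y z"
  "x \<in> E \<Longrightarrow> y \<in> E \<Longrightarrow> z \<in> E \<Longrightarrow> BC z (x + y) = BC z x + BC z y"
  "x \<in> E \<Longrightarrow> y \<in> E \<Longrightarrow> BC (c *\<^sub>R x) y = c * BC x y"
  "x \<in> E \<Longrightarrow> y \<in> E \<Longrightarrow> BC x (c *\<^sub>R y) = c * BC x y"
    unfolding bilinear_form_on_def by blast+
qed

lemma BC_inv:
  "x \<in> E \<Longrightarrow> y \<in> E \<Longrightarrow> BC (\<tau> x) (\<tau> y) = BC x y"
  "g \<in> carrier L \<Longrightarrow> x \<in> E \<Longrightarrow> y \<in> E \<Longrightarrow> BC (Ad L g x) (Ad L g y) = BC x y"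
  "x \<in> uu \<Longrightarrow> y \<in> mm \<Longrightarrow> BC x y = 0" "x \<in> uu \<Longrightarrow> y \<in> mm \<Longrightarrow> BC y x = 0"
  "x \<in> uu \<Longrightarrow> x \<noteq> 0 \<Longrightarrow> BC x x < 0" "x \<in> mm \<Longrightarrow> x \<noteq> 0 \<Longrightarrow> BC x x > 0"
  using RR unfolding real_reductive_def Lie_carrier by blast+

lemma U_sub: "subgroup U L" "compactin T U" and U_closed: "closedin T U" and U_carrier: "u \<in> U \<Longrightarrow> u \<in> carrier L"
proof -
  show s: "subgroup U L" and c: "compactin T U" using RR unfolding real_reductive_def maximal_compact_def by blast+
  show "closedin T U" by (rule compactin_imp_closedin[OF Hausdorff c])
  show "u \<in> U \<Longrightarrow> u \<in> carrier L" using subgroup.subset[OF s] by blast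
qed

lemma uu_gexp: "X \<in> E \<Longrightarrow> X \<in> uu \<longleftrightarrow> (\<forall>t. gexp (t *\<^sub>R X) \<in> U)"
  unfolding Lie_closed_subgroup[OF U_sub(1) U_closed] by simp

lemma polar_bij: "bij_betw (polar L) (U \<times> mm) (carrier L)"
  using RR unfolding real_reductive_def by blast

lemma mm_E: "X \<in> mm \<Longrightarrow> X \<in> E" by (simp add: mm)
lemma uu_E: "X \<in> uu \<Longrightarrow> X \<in> E" by (simp add: uu)

lemma polar_gexp: "X \<in> E \<Longrightarrow> polar L (u, X) = u \<otimes> gexp X" by (simp add: polar_def lie_exp_eq)

lemma polar_ex: assumes "g \<in> carrier L" obtains u X where "u \<in> U" "X \<in> mm" "g = u \<otimes> gexp X"
proof -
  have "g \<in> polar L ` (U \<times> mm)" using assms bij_betw_imp_surj_on[OF polar_bij] by simp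
  then obtain p where p: "g = polar L p" "p \<in> U \<times> mm" by (rule imageE)
  obtain u X where uX: "p = (u, X)" by (cases p)
  have "u \<in> U" "X \<in> mm" using p(2) uX by simp_all
  moreover have "g = u \<otimes> gexp X" unfolding p(1) uX by (rule polar_gexp[OF mm_E[OF \<open>X \<in> mm\<close>]])
  ultimately show thesis by (rule that)
qed

lemma polar_unique:
  assumes "u \<in> U" "X \<in> mm" "v \<in> U" "Y \<in> mm" "u \<otimes> gexp X = v \<otimes> gexp Y" shows "u = v" "X = Y"
proof -
  have "polar L (u, X) = polar L (v, Y)" using assms polar_gexp mm_E by simp
  then have "(u, X) = (v, Y)" by (rule inj_onD[OF bij_betw_imp_inj_on[OF polar_bij]]) (use assms in simp_all)
  then show "u = v" "X = Y" by auto
qed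

lemma split:
  assumes X: "X \<in> E" obtains A B where "A \<in> uu" "B \<in> mm" "X = A + B" "\<tau> X = A - B"
proof -
  let ?A = "(1/2) *\<^sub>R (X + \<tau> X)" and ?B = "(1/2) *\<^sub>R (X - \<tau> X)"
  have A: "?A \<in> uu" using X tau scale_E add_E by (simp add: uu add.commute)
  have B: "?B \<in> mm" using X tau scale_E diff_E tau_diff by (simp add: mm scaleR_diff_right)
  have h: "(1/2) *\<^sub>R v + (1/2) *\<^sub>R v = v" for v :: "complex ^ 'n"
    by (simp add: scaleR_left_distrib[symmetric])
  have "?A + ?B = ((1/2) *\<^sub>R X + (1/2) *\<^sub>R X) + ((1/2) *\<^sub>R \<tau> X - (1/2) *\<^sub>R \<tau> X)"
    unfolding scaleR_right_distrib scaleR_right_diff_distrib by (simp only: add_diff_eq diff_add_eq add_ac)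
  then have X1: "X = ?A + ?B" unfolding h by simp
  have "?A - ?B = ((1/2) *\<^sub>R \<tau> X + (1/2) *\<^sub>R \<tau> X) + ((1/2) *\<^sub>R X - (1/2) *\<^sub>R X)"
    unfolding scaleR_right_distrib scaleR_right_diff_distrib by (simp only: add_diff_eq diff_add_eq diff_diff_eq2 add_ac)
  then have X2: "\<tau> X = ?A - ?B" unfolding h by simp
  show thesis by (rule that[OF A B X1 X2])
qed

lemma Ad_imag: assumes g: "g \<in> carrier L" and X: "X \<in> E" shows "Ad L g (imag X) = imag (Ad L g X)"
proof -
  obtain D where D: "tder (cj g) D" "\<forall>v\<in>E. D (imag v) = imag (D v)"
    using tder_conj[OF holo_mult imag_simps(5) imag_E g] by blast
  obtain D' where D': "tder (cj g) D'" "\<forall>X\<in>E. Ad L g X = D' X" using Ad_tder[OF g] by blast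
  show ?thesis using D D' tder_unique[OF D(1) D'(1)] X imag_E by simp
qed

text \<open>Complex linearity of \<open>Ad\<close>, differentiated along a one-parameter subgroup;
  antisymmetry moves it to the other slot.\<close>

lemma br_imag: assumes X: "X \<in> E" and Y: "Y \<in> E"
  shows "br X (imag Y) = imag (br X Y)" "br (imag X) Y = imag (br X Y)"
proof -
  have r: "br X (imag Y) = imag (br X Y)" if X: "X \<in> E" and Y: "Y \<in> E" for X Y
  proof -
    have "((\<lambda>t. imag (Ad L (gexp (t *\<^sub>R X)) Y)) has_vector_derivative imag (br X Y)) (at 0)"
      by (rule bounded_linear.has_vector_derivative[OF bounded_linear_imag Ad_curve_derivative(1)[OF X Y]])
    then have "((\<lambda>t. Ad L (gexp (t *\<^sub>R X)) (imag Y)) has_vector_derivative imag (br X Y)) (at 0)"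
      using Ad_imag[OF gexp_closed[OF scale_E[OF X]] Y] by simp
    then show ?thesis using Ad_curve_derivative(1)[OF X imag_E[OF Y]] by (metis vector_derivative_at)
  qed
  show "br X (imag Y) = imag (br X Y)" by (rule r[OF X Y])
  show "br (imag X) Y = imag (br X Y)"
    using br_anti[OF imag_E[OF X] Y] r[OF Y X] br_anti[OF Y X] by (simp add: imag_simps)
qed

lemma imag_uu_mm: "X \<in> uu \<Longrightarrow> imag X \<in> mm" "X \<in> mm \<Longrightarrow> imag X \<in> uu"
  using imag_E tau by (auto simp: uu mm imag_simps)

text \<open>Conjugation by \<open>w\<close> preserves \<open>U\<close>, hence \<open>Ad w\<close>
  preserves \<open>uu\<close>. Invariance of \<open>BC\<close> then makes the
  \<open>uu\<close>-component of \<open>Ad w Z\<close>, for \<open>Z\<close> in \<open>mm\<close>,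
  orthogonal to itself, and definiteness on \<open>uu\<close> kills it. Preserving both eigenspaces
  means commuting with \<open>\<tau>\<close>.\<close>

lemma Ad_U_tau:
  assumes w: "w \<in> U" and X: "X \<in> E" shows "Ad L w (\<tau> X) = \<tau> (Ad L w X)"
proof -
  have wc: "w \<in> carrier L" "inv w \<in> U" "inv w \<in> carrier L" using w U_carrier subgroup.m_inv_closed[OF U_sub(1)] by auto
  have Au: "Ad L v A \<in> uu" if v: "v \<in> U" and A: "A \<in> uu" for v A
  proof -
    have vc: "v \<in> carrier L" using v U_carrier by blast
    have "gexp (t *\<^sub>R Ad L v A) \<in> U" for t
      unfolding gexp_Ad(1)[OF vc uu_E[OF A], symmetric] cj_def
      using A uu_gexp[OF uu_E[OF A]] v by (intro subgroup.m_closed[OF U_sub(1)] subgroup.m_inv_closed[OF U_sub(1)]) auto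
    then show ?thesis using uu_gexp[OF gexp_Ad(3)[OF vc uu_E[OF A]]] by blast
  qed
  have Am: "Ad L w Z \<in> mm" if Z: "Z \<in> mm" for Z
  proof -
    have ZE: "Z \<in> E" using Z mm_E by blast
    obtain A B where AB: "A \<in> uu" "B \<in> mm" "Ad L w Z = A + B" using split[OF gexp_Ad(3)[OF wc(1) ZE]] by metis
    have AE: "A \<in> E" "B \<in> E" using AB uu_E mm_E by auto
    have "BC (Ad L w Z) A = BC (Ad L w Z) (Ad L w (Ad L (inv w) A))"
      using Ad_mult[OF wc(1,3) AE(1)] Ad_one[OF AE(1)] wc by simp
    also have "\<dots> = BC Z (Ad L (inv w) A)" by (rule BC_inv(2)[OF wc(1) ZE gexp_Ad(3)[OF wc(3) AE(1)]])
    also have "\<dots> = 0" by (rule BC_inv(4)[OF Au[OF wc(2) AB(1)] Z])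
    finally have "BC A A = 0" using AB AE BC_bilinear(1) BC_inv(4) by simp
    then have "A = 0" using BC_inv(5)[OF AB(1)] by force
    then show ?thesis using AB by simp
  qed
  obtain A B where AB: "A \<in> uu" "B \<in> mm" "X = A + B" "\<tau> X = A - B" using split[OF X] .
  have AE: "A \<in> E" "B \<in> E" using AB uu_E mm_E by auto
  have "Ad L w (\<tau> X) = Ad L w A - Ad L w B"
    using Ad_linear(1)[OF wc(1) AE(1) minus_E[OF AE(2)]] Ad_linear(2)[OF wc(1) AE(2), of "-1"] AB(4) by simp
  moreover have "\<tau> (Ad L w X) = Ad L w A - Ad L w B"
    using Ad_linear(1)[OF wc(1) AE] AB(3) Au[OF w AB(1)] Am[OF AB(2)] gexp_Ad(3)[OF wc(1)] AE tau(3) by (simp add: uu mm)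
  ultimately show ?thesis by simp
qed

text \<open>By the polar decomposition the group is generated by \<open>U\<close> and the
  exponentials of \<open>mm\<close>; for the latter, invariance follows from a vanishing
  bracket.\<close>

lemma zz_test:
  assumes Y: "Y \<in> E" and "\<And>w. w \<in> U \<Longrightarrow> Ad L w Y = Y" "\<And>X. X \<in> mm \<Longrightarrow> br X Y = 0"
  shows "Y \<in> zz"
proof -
  have "Ad L g Y = Y" if g: "g \<in> carrier L" for g
  proof -
    obtain u X where uX: "u \<in> U" "X \<in> mm" "g = u \<otimes> gexp X" using polar_ex[OF g] .
    have "Ad L (gexp X) Y = Y" using Ad_gexp_fixed[OF mm_E[OF uX(2)] Y assms(3)[OF uX(2)], of 1] by simp
    then show ?thesis using Ad_mult[OF U_carrier[OF uX(1)] gexp_closed[OF mm_E[OF uX(2)]] Y] assms(2)[OF uX(1)] uX(3) by simp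
  qed
  then show ?thesis using Y by (simp add: zz_def)
qed

lemma tau_zz: assumes Y: "Y \<in> zz" shows "\<tau> Y \<in> zz"
proof (rule zz_test)
  have YE: "Y \<in> E" using Y zz_E by blast
  show "\<tau> Y \<in> E" using tau(1)[OF YE] .
  show "Ad L w (\<tau> Y) = \<tau> Y" if "w \<in> U" for w using Ad_U_tau[OF that YE] Y U_carrier[OF that] by (simp add: zz_def)
  show "br X (\<tau> Y) = 0" if "X \<in> mm" for X
  proof -
    have XE: "X \<in> E" using that mm_E by blast
    have "br X (\<tau> Y) = \<tau> (br (\<tau> X) Y)" using tau(5)[OF tau(1)[OF XE] YE] tau(2)[OF XE] by simp
    also have "\<dots> = \<tau> 0" using zz_bracket[OF Y tau(1)[OF XE]] by simp
    also have "\<dots> = 0" using tau(4)[OF YE, of 0] by simp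
    finally show ?thesis .
  qed
qed

lemma imag_zz: "Y \<in> zz \<Longrightarrow> imag Y \<in> zz"
  using Ad_imag imag_E by (simp add: zz_def)

section \<open>The inner product attached to the invariant form\<close>

lemma BC_ad: assumes X: "X \<in> E" and Y: "Y \<in> E" and Z: "Z \<in> E" shows "BC (br X Y) Z + BC Y (br X Z) = 0"
proof -
  \<comment> \<open>\<open>BC\<close> is bilinear only on \<open>E\<close>; composed with the
    projection it is a bounded bilinear form on the full type, to which the product rule
    applies.\<close>
  let ?P = "proj E"
  let ?B = "\<lambda>x y. BC (?P x) (?P y)"
  have PE: "?P x \<in> E" for x by (rule proj_in[OF subE])
  have "bilinear ?B" unfolding bilinear_def linear_iff
    using PE BC_bilinear by (simp add: proj_add linear_scale[OF linear_proj])
  then have bb: "bounded_bilinear ?B" by (simp add: bilinear_conv_bounded_bilinear)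
  let ?A = "\<lambda>W t. Ad L (gexp (t *\<^sub>R X)) W"
  have g: "gexp (t *\<^sub>R X) \<in> carrier L" for t using gexp_closed[OF scale_E[OF X]] .
  have "((\<lambda>t. ?B (?A Y t) (?A Z t)) has_vector_derivative (?B (?A Y 0) (br X Z) + ?B (br X Y) (?A Z 0))) (at 0)"
    by (rule bounded_bilinear.has_vector_derivative[OF bb Ad_curve_derivative(1)[OF X Y] Ad_curve_derivative(1)[OF X Z]])
  moreover have "?B (?A Y t) (?A Z t) = BC Y Z" for t
    using gexp_Ad(3)[OF g] Y Z BC_inv(2)[OF g Y Z] by (simp add: proj_E)
  moreover have "?A Y 0 = Y" "?A Z 0 = Z" using Ad_one Y Z by (simp_all add: gexp_0)
  ultimately have "((\<lambda>t::real. BC Y Z) has_vector_derivative (BC Y (br X Z) + BC (br X Y) Z)) (at 0)"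
    using X Y Z br_props(1) by (simp add: proj_E)
  then show ?thesis using has_vector_derivative_const vector_derivative_at by (metis add.commute)
qed

text \<open>The sign makes the form positive: \<open>BC\<close> is negative on \<open>uu\<close>,
  where \<open>\<tau>\<close> is 1, and positive on \<open>mm\<close>, where \<open>\<tau>\<close>
  is -1. The two summands symmetrize a form whose symmetry is not given.\<close>

definition ip :: "complex ^ 'n \<Rightarrow> complex ^ 'n \<Rightarrow> real" where "ip X Y = - (BC X (\<tau> Y) + BC Y (\<tau> X))"

lemma ip_bilinear:
  "x \<in> E \<Longrightarrow> y \<in> E \<Longrightarrow> z \<in> E \<Longrightarrow> ip (x + y) z = ip x z + ip y z"
  "x \<in> E \<Longrightarrow> y \<in> E \<Longrightarrow> z \<in> E \<Longrightarrow> ip z (x + y) = ip z x + ip z y"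
  "x \<in> E \<Longrightarrow> y \<in> E \<Longrightarrow> ip (c *\<^sub>R x) y = c * ip x y"
  "x \<in> E \<Longrightarrow> y \<in> E \<Longrightarrow> ip x (c *\<^sub>R y) = c * ip x y"
  by (simp_all add: ip_def BC_bilinear tau algebra_simps)

lemma BC_tau_neg: assumes X: "X \<in> E" "X \<noteq> 0" shows "BC X (\<tau> X) < 0" "BC (\<tau> X) X < 0"
proof -
  obtain A B where AB: "A \<in> uu" "B \<in> mm" "X = A + B" "\<tau> X = A - B" using split[OF X(1)] .
  have AE: "A \<in> E" "B \<in> E" "- B \<in> E" using AB uu_E mm_E minus_E by auto
  have m: "BC a (- B) = - BC a B" "BC (- B) a = - BC B a" if "a \<in> E" for a
    using BC_bilinear(3)[OF AE(2) that, of "-1"] BC_bilinear(4)[OF that AE(2), of "-1"] by auto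
  have "BC X (\<tau> X) = BC (A + B) (A + - B)" "BC (\<tau> X) X = BC (A + - B) (A + B)" using AB by auto
  moreover have "BC (A + B) (A + - B) = (BC A A + BC A (- B)) + (BC B A + BC B (- B))"
    by (simp only: BC_bilinear(1)[OF AE(1,2) add_E[OF AE(1,3)]] BC_bilinear(2)[OF AE(1,3,1)] BC_bilinear(2)[OF AE(1,3,2)])
  moreover have "BC (A + - B) (A + B) = (BC A A + BC A B) + (BC (- B) A + BC (- B) B)"
    by (simp only: BC_bilinear(1)[OF AE(1,3) add_E[OF AE(1,2)]] BC_bilinear(2)[OF AE(1,2,1)] BC_bilinear(2)[OF AE(1,2,3)])
  ultimately have e: "BC X (\<tau> X) = BC A A - BC B B" "BC (\<tau> X) X = BC A A - BC B B"
    using m[OF AE(1)] m[OF AE(2)] BC_inv(3,4)[OF AB(1,2)] by simp_all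
  have "BC A A < 0 \<or> A = 0" "BC B B > 0 \<or> B = 0" using BC_inv(5,6) AB by auto
  moreover have "A \<noteq> 0 \<or> B \<noteq> 0" using X(2) AB(3) by auto
  moreover have "BC 0 0 = 0" using BC_bilinear(3)[OF X(1) X(1), of 0] BC_bilinear(4)[OF subspace_0[OF subE] X(1), of 0] by simp
  ultimately have "BC A A - BC B B < 0" by auto
  then show "BC X (\<tau> X) < 0" "BC (\<tau> X) X < 0" using e by auto
qed

lemma ip_pos: "X \<in> E \<Longrightarrow> X \<noteq> 0 \<Longrightarrow> ip X X > 0"
  using BC_tau_neg(1) by (simp add: ip_def)

text \<open>The adjoint of \<open>ad X\<close> is \<open>- ad (\<tau> X)\<close>. It is used twice:
  for \<open>X\<close> in \<open>mm\<close> it makes \<open>ad X\<close> symmetric, and in a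
  \<open>\<tau>\<close>-stable subalgebra it turns the orthogonal complement of an ideal into an
  ideal.\<close>

lemma ip_ad: assumes X: "X \<in> E" and P: "P \<in> E" and Q: "Q \<in> E" shows "ip (br X P) Q = - ip P (br (\<tau> X) Q)"
proof -
  have "BC (br X P) (\<tau> Q) = - BC P (br X (\<tau> Q))" using BC_ad[OF X P tau(1)[OF Q]] by simp
  moreover have "BC Q (\<tau> (br X P)) = - BC (br (\<tau> X) Q) (\<tau> P)"
    using BC_ad[OF tau(1)[OF X] Q tau(1)[OF P]] tau(5)[OF X P] by simp
  moreover have "\<tau> (br (\<tau> X) Q) = br X (\<tau> Q)" using tau(5)[OF tau(1)[OF X] Q] tau(2)[OF X] by simp
  ultimately show ?thesis by (simp add: ip_def)
qed

text \<open>\<open>ad Y\<close> is symmetric for \<open>Y \<in> mm\<close>, so \<open>t \<mapsto> ip [Y, Z(t)] Z(t)\<close> is nondecreasing along \<open>Z(t) = Ad (exp tY) Z\<close>; it is periodic when \<open>Ad (exp Y) = 1\<close>.\<close>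

lemma bracket_zero_of_Ad_trivial:
  assumes Y: "Y \<in> mm" and tr: "\<And>Z. Z \<in> E \<Longrightarrow> Ad L (gexp Y) Z = Z" and Z: "Z \<in> E"
  shows "br Y Z = 0"
proof -
  have YE: "Y \<in> E" and tY: "\<tau> Y = - Y" using Y by (auto simp: mm)
  have g: "gexp (t *\<^sub>R Y) \<in> carrier L" for t using gexp_closed[OF scale_E[OF YE]] .
  define W where "W t = Ad L (gexp (t *\<^sub>R Y)) Z" for t
  have WE: "W t \<in> E" for t unfolding W_def by (rule gexp_Ad(3)[OF g Z])
  have W': "(W has_vector_derivative br Y (W t)) (at t)" for t
    unfolding W_def by (rule Ad_curve_derivative_at(1)[OF YE Z])
  have brW: "br Y (W t) = Ad L (gexp (t *\<^sub>R Y)) (br Y Z)" for t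
    using Ad_curve_derivative_at[OF YE Z, of t] unfolding W_def by (metis vector_derivative_at)
  have V': "((\<lambda>t. br Y (W t)) has_vector_derivative br Y (br Y (W t))) (at t)" for t
    unfolding brW by (rule Ad_curve_derivative_at(1)[OF YE br_props(1)[OF YE Z]])
  have bE: "br Y V \<in> E" if "V \<in> E" for V using br_props(1)[OF YE that] .
  let ?P = "proj E"
  have PE: "?P x \<in> E" for x by (rule proj_in[OF subE])
  have "bilinear (\<lambda>x y. ip (?P x) (?P y))" unfolding bilinear_def linear_iff
    using PE ip_bilinear by (simp add: proj_add linear_scale[OF linear_proj])
  then have bb: "bounded_bilinear (\<lambda>x y. ip (?P x) (?P y))" by (simp add: bilinear_conv_bounded_bilinear)
  define k where "k t = ip (br Y (W t)) (W t)" for t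
  have k': "(k has_real_derivative 2 * ip (br Y (W t)) (br Y (W t))) (at t)" for t
  proof -
    have "((\<lambda>t. ip (?P (br Y (W t))) (?P (W t))) has_vector_derivative
       (ip (?P (br Y (W t))) (?P (br Y (W t))) + ip (?P (br Y (br Y (W t)))) (?P (W t)))) (at t)"
      by (rule bounded_bilinear.has_vector_derivative[OF bb V' W'])
    moreover have "br (- Y) (W t) = - br Y (W t)" using br_props(4)[OF YE WE, of "-1"] by simp
    then have "ip (br Y (br Y (W t))) (W t) = ip (br Y (W t)) (br Y (W t))"
      using ip_ad[OF YE bE[OF WE] WE, of t t] tY ip_bilinear(4)[OF bE[OF WE] bE[OF WE], of t "-1" t] by simp
    ultimately show ?thesis using bE WE
      by (simp add: proj_E k_def[abs_def] has_real_derivative_iff_has_vector_derivative)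
  qed
  \<comment> \<open>The function \<open>k\<close> takes equal values at 0 and 1, so the mean value
    theorem yields one time \<open>z\<close> at which the bracket of \<open>Y\<close> with
    \<open>W z\<close> has length 0. Transport back along the one-parameter subgroup gives the claim
    at time 0.\<close>
  have "\<exists>z::real. z > 0 \<and> z < 1 \<and> k 1 - k 0 = (1 - 0) * (2 * ip (br Y (W z)) (br Y (W z)))"
    by (rule MVT2) (use k' in auto)
  then obtain z where z: "k 1 - k 0 = 2 * ip (br Y (W z)) (br Y (W z))" by auto
  have "W 1 = Z" "W 0 = Z" using tr[OF Z] Ad_one[OF Z] by (simp_all add: W_def gexp_0)
  then have "k 1 = k 0" by (simp add: k_def)
  then have "br Y (W z) = 0" using z ip_pos[OF bE[OF WE], of z] by force
  then have "Ad L (gexp (z *\<^sub>R Y)) (br Y Z) = 0" using brW by simp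
  moreover have "Ad L (gexp ((- z) *\<^sub>R Y)) (Ad L (gexp (z *\<^sub>R Y)) (br Y Z)) = br Y Z"
    unfolding Ad_mult[OF g g bE[OF Z], symmetric] gexp_add[OF YE] using Ad_one[OF bE[OF Z]] by (simp add: gexp_0)
  ultimately show ?thesis using Ad_linear(3)[OF g, of "- z"] by (simp only:)
qed

end

section \<open>Connected groups and centralizers\<close>

context lie_grp begin

text \<open>A closed subgroup with full Lie algebra is open.\<close>

lemma connected_closed_subgroup:
  assumes S: "subgroup S L" "closedin T S" and ex: "\<And>X. X \<in> E \<Longrightarrow> gexp X \<in> S" and conn: "connected_space T"
  shows "S = carrier L"
proof -
  have LS: "Lie L S = E" unfolding Lie_closed_subgroup[OF S] using ex scale_E by blast
  obtain N V \<Phi> g where N: "open N" "0 \<in> N" "open V" "smooth_on N (\<lambda>x. co (\<Phi> x))" "smooth_on V g"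
    and \<Phi>: "\<And>x. x \<in> N \<Longrightarrow> x \<in> E \<Longrightarrow> \<Phi> x \<in> U0" "\<And>x. x \<in> N \<Longrightarrow> x \<in> E \<Longrightarrow> co (\<Phi> x) \<in> V" "\<Phi> 0 = \<one>"
      "\<And>x. x \<in> N \<Longrightarrow> x \<in> E \<Longrightarrow> g (co (\<Phi> x)) = x"
      "\<And>y. y \<in> V \<Longrightarrow> y \<in> E \<Longrightarrow> g y \<in> N \<and> g y \<in> E \<and> co (\<Phi> (g y)) = y"
      "\<And>x. x \<in> N \<Longrightarrow> x \<in> E \<Longrightarrow> \<Phi> x \<in> S \<longleftrightarrow> x \<in> Lie L S"
    by (rule slice_coordinates[OF S]) blast
  let ?A = "E \<inter> (\<lambda>x. x - a0) -` V"
  \<comment> \<open>The range of the slice chart. Each \<open>h\<close> in it has a slice coordinate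
    in \<open>E\<close>, and since the Lie algebra of \<open>S\<close> is all of \<open>E\<close>,
    this places \<open>h\<close> in \<open>S\<close>.\<close>
  let ?O = "U0 \<inter> snd c0 -` ?A"
  have "open ((\<lambda>x. x - a0) -` V)" by (intro open_vimage N(3) continuous_intros)
  then have oO: "openin T ?O" by (intro openin_mtop_chart_vimage[OF atl id_chart(1)] openin_open_Int)
  have OS: "h \<in> S" if h: "h \<in> ?O" for h
  proof -
    have hU: "h \<in> U0" and hV: "co h \<in> V" using h by (auto simp: co_def)
    have gh: "g (co h) \<in> N" "g (co h) \<in> E" "co (\<Phi> (g (co h))) = co h" using \<Phi>(5)[OF hV pt_co(3)[OF hU]] by auto
    have "\<Phi> (g (co h)) = h" using pt_co(2)[OF \<Phi>(1)[OF gh(1,2)]] pt_co(2)[OF hU] gh(3) by simp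
    then show ?thesis using \<Phi>(6)[OF gh(1,2)] LS gh(2) by simp
  qed
  have one: "\<one> \<in> ?O"
    using \<Phi>(2)[OF N(2) subspace_0[OF subE]] \<Phi>(3) id_chart(2) a0E by (simp add: co_def a0_def)
  have SC: "S \<subseteq> carrier L" using subgroup.subset[OF S(1)] .
  have "openin T S"
  proof (subst openin_subopen, intro ballI)
    fix s assume s: "s \<in> S"
    then have sc: "s \<in> carrier L" using SC by blast
    let ?W = "{h \<in> topspace T. inv s \<otimes> h \<in> ?O}"
    have "openin T ?W"
      by (rule openin_continuous_map_preimage[OF cm_mult[OF cm_const[OF inv_closed[OF sc]] cm_id] oO])
    moreover have "s \<in> ?W" using sc one by (simp add: topspace)
    moreover have "?W \<subseteq> S"
    proof
      fix h assume h: "h \<in> ?W"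
      then have hc: "h \<in> carrier L" by (simp add: topspace)
      have "inv s \<otimes> h \<in> ?O" using h by blast
      from OS[OF this] have "s \<otimes> (inv s \<otimes> h) \<in> S" using s S(1) subgroup.m_closed by metis
      then show "h \<in> S" using sc hc by (simp add: m_assoc[symmetric])
    qed
    ultimately show "\<exists>T'. openin T T' \<and> s \<in> T' \<and> T' \<subseteq> S" by (intro exI[of _ ?W] conjI)
  qed
  then have "S = {} \<or> S = topspace T" using conn S(2) unfolding connected_space_clopen_in by blast
  then show ?thesis using subgroup.one_closed[OF S(1)] topspace by auto
qed

lemma subgroup_centralizer:
  assumes "S \<subseteq> carrier L" shows "subgroup (centralizer L S) L"
proof (rule subgroupI)
  show "centralizer L S \<subseteq> carrier L" by (auto simp: centralizer_def)
  have "\<one> \<in> centralizer L S" using assms by (auto simp: centralizer_def)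
  then show "centralizer L S \<noteq> {}" by blast
  fix a assume a: "a \<in> centralizer L S"
  then have ac: "a \<in> carrier L" "\<And>h. h \<in> S \<Longrightarrow> a \<otimes> h = h \<otimes> a" by (auto simp: centralizer_def)
  have "inv a \<otimes> h = h \<otimes> inv a" if h: "h \<in> S" for h
  proof -
    have hc: "h \<in> carrier L" using h assms by blast
    have "inv a \<otimes> h = inv a \<otimes> (h \<otimes> a) \<otimes> inv a" using ac(1) hc by (simp add: m_assoc)
    also have "h \<otimes> a = a \<otimes> h" using ac(2)[OF h] by simp
    finally show ?thesis using ac(1) hc by (simp add: m_assoc[symmetric])
  qed
  then show "inv a \<in> centralizer L S" using ac(1) by (simp add: centralizer_def)
  fix b assume b: "b \<in> centralizer L S"
  then have bc: "b \<in> carrier L" "\<And>h. h \<in> S \<Longrightarrow> b \<otimes> h = h \<otimes> b" by (auto simp: centralizer_def)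
  have "a \<otimes> b \<otimes> h = h \<otimes> (a \<otimes> b)" if h: "h \<in> S" for h
  proof -
    have hc: "h \<in> carrier L" using h assms by blast
    have "a \<otimes> b \<otimes> h = a \<otimes> (h \<otimes> b)" using ac(1) bc hc h by (simp add: m_assoc)
    also have "\<dots> = (h \<otimes> a) \<otimes> b" using ac(1) bc(1) hc ac(2)[OF h] by (simp add: m_assoc[symmetric])
    finally show ?thesis using ac(1) bc(1) hc by (simp add: m_assoc)
  qed
  then show "a \<otimes> b \<in> centralizer L S" using ac(1) bc(1) by (simp add: centralizer_def)
qed

end

lemma smooth_map_on_subset:
  assumes "smooth_map_on M S N f" "S' \<subseteq> S" "\<And>x. x \<in> S' \<Longrightarrow> f' x = f x"
  shows "smooth_map_on M S' N f'"
  unfolding smooth_map_on_def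
proof (intro conjI ballI)
  show "S' \<subseteq> points M" using assms unfolding smooth_map_on_def by blast
  fix p assume p: "p \<in> S'"
  then have "p \<in> S" using assms(2) by blast
  then obtain W g where W: "openin (mtop M) W" "p \<in> W" "smooth_map (open_submfd M W) N g" "\<forall>x\<in>S \<inter> W. g x = f x"
    using assms(1) unfolding smooth_map_on_def by blast
  have "\<forall>x\<in>S' \<inter> W. g x = f' x" using W(4) assms(2,3) by auto
  then show "\<exists>W g. openin (mtop M) W \<and> p \<in> W \<and> smooth_map (open_submfd M W) N g \<and> (\<forall>x\<in>S' \<inter> W. g x = f' x)"
    using W(1-3) by blast
qed

section \<open>Orthogonal complements and reductive subalgebras\<close>

context complex_red begin

text \<open>Gram-Schmidt for \<open>ip\<close>, which is positive only on \<open>E\<close>: each new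
  vector is first replaced by its component \<open>b'\<close> orthogonal to the earlier span, and
  the approximation is corrected along \<open>b'\<close>.\<close>

lemma ip_complement:
  assumes "finite Bs" "Bs \<subseteq> E"
  shows "\<forall>x\<in>E. \<exists>y\<in>span Bs. \<forall>w\<in>span Bs. ip (x - y) w = 0"
  using assms
proof (induction Bs rule: finite_induct)
  case empty
  have "ip x 0 = 0" if "x \<in> E" for x using ip_bilinear(4)[OF that that, of 0] by simp
  then show ?case by simp
next
  case (insert b Bs)
  have BE: "Bs \<subseteq> E" "b \<in> E" using insert.prems by auto
  have sE: "span Bs \<subseteq> E" using span_minimal[OF BE(1) subE] .
  note IH = insert.IH[OF BE(1)]
  obtain yb where yb: "yb \<in> span Bs" "\<forall>w\<in>span Bs. ip (b - yb) w = 0" using IH BE(2) by blast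
  define b' where "b' = b - yb"
  have b'E: "b' \<in> E" using BE(2) yb(1) sE diff_E by (auto simp: b'_def)
  have spm: "span Bs \<subseteq> span (insert b Bs)" by (rule span_mono) blast
  have "b \<in> span (insert b Bs)" by (rule span_base) simp
  then have spb: "b' \<in> span (insert b Bs)" unfolding b'_def using yb(1) spm by (intro span_diff) auto
  show ?case
  proof
    fix x assume x: "x \<in> E"
    obtain y where y: "y \<in> span Bs" "\<forall>w\<in>span Bs. ip (x - y) w = 0" using bspec[OF IH x] by blast
    \<comment> \<open>If \<open>b' = 0\<close> the span does not grow and no correction is made;
      otherwise this is the usual projection coefficient.\<close>
    define c where "c = (if b' = 0 then 0 else ip (x - y) b' / ip b' b')"
    let ?y = "y + c *\<^sub>R b'"
    have yE: "y \<in> E" using y(1) sE by blast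
    have xyE: "x - y \<in> E" using x yE diff_E by blast
    have "?y \<in> span (insert b Bs)" using y(1) spm spb by (intro span_add span_scale) auto
    moreover have "ip (x - ?y) w = 0" if w: "w \<in> span (insert b Bs)" for w
    proof -
      obtain k where k: "w - k *\<^sub>R b \<in> span Bs" using span_breakdown_eq[THEN iffD1, OF w] by blast
      define w0 where "w0 = w - k *\<^sub>R b + k *\<^sub>R yb"
      have w0: "w0 \<in> span Bs" using k yb(1) unfolding w0_def by (intro span_add span_scale)
      have w0E: "w0 \<in> E" using w0 sE by blast
      have wd: "w = w0 + k *\<^sub>R b'" by (simp add: w0_def b'_def algebra_simps)
      have cb: "c *\<^sub>R b' \<in> E" "(- c) *\<^sub>R b' \<in> E" using scale_E[OF b'E] by blast+
      have e: "x - ?y = (x - y) + (- c) *\<^sub>R b'" by simp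
      have l: "ip (x - ?y) v = ip (x - y) v - c * ip b' v" if "v \<in> E" for v
        unfolding e using ip_bilinear(1)[OF xyE cb(2) that] ip_bilinear(3)[OF b'E that, of "- c"] by simp
      have 1: "ip (x - ?y) w0 = 0" using l[OF w0E] y(2) yb(2) w0 by (simp add: b'_def)
      have 2: "ip (x - ?y) b' = 0"
      proof (cases "b' = 0")
        case True
        have "ip v 0 = 0" if "v \<in> E" for v using ip_bilinear(4)[OF that that, of 0] by simp
        then show ?thesis using True diff_E[OF x add_E[OF yE cb(1)]] by simp
      next
        case False
        then have "ip b' b' \<noteq> 0" using ip_pos[OF b'E] by simp
        then show ?thesis using l[OF b'E] False by (simp add: c_def)
      qed
      have "x - ?y \<in> E" using diff_E[OF x add_E[OF yE cb(1)]] .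
      then show ?thesis unfolding wd using ip_bilinear(2)[OF w0E scale_E[OF b'E]] ip_bilinear(4)[OF _ b'E] 1 2 by simp
    qed
    ultimately show "\<exists>y\<in>span (insert b Bs). \<forall>w\<in>span (insert b Bs). ip (x - y) w = 0" by blast
  qed
qed

text \<open>The \<open>ip\<close>-orthogonal complement of an ideal in \<open>V\<close> is the
  required complementary ideal: moving \<open>br x\<close> to the other side produces
  \<open>br (\<tau> x)\<close>, and \<open>\<tau> x\<close> is again in \<open>V\<close>, so the
  ideal absorbs it. Positivity gives trivial intersection.\<close>

lemma tau_stable_subalgebra_reductive:
  assumes V: "subspace V" "V \<subseteq> E" and br: "\<And>x y. x \<in> V \<Longrightarrow> y \<in> V \<Longrightarrow> br x y \<in> V" and tV: "\<And>x. x \<in> V \<Longrightarrow> \<tau> x \<in> V"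
    and A: "lspace A = V" "lbracket A = br"
  shows "reductive_lie_algebra A" "lie_algebra A"
proof -
  have vE: "x \<in> E" if "x \<in> V" for x using V(2) that by blast
  show la: "lie_algebra A" unfolding lie_algebra_def A
    by (intro conjI ballI allI V(1)) (simp_all add: br br_props vE)
  show "reductive_lie_algebra A" unfolding reductive_lie_algebra_def
  proof (intro conjI la allI impI)
    fix I assume I: "lie_ideal A I"
    then have I1: "subspace I" "I \<subseteq> V" "\<And>x y. x \<in> V \<Longrightarrow> y \<in> I \<Longrightarrow> br x y \<in> I" unfolding lie_ideal_def A by auto
    have iE: "x \<in> E" if "x \<in> I" for x using I1(2) vE that by blast
    obtain Bs where Bs: "Bs \<subseteq> I" "independent Bs" "I \<subseteq> span Bs" by (rule basis_exists[of I])
    have spI: "span Bs = I" using Bs(1,3) span_minimal[OF Bs(1) I1(1)] by blast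
    have fin: "finite Bs" using Bs(2) independent_bound by blast
    have BsE: "Bs \<subseteq> E" using Bs(1) iE by blast
    define K where "K = {x \<in> V. \<forall>y\<in>I. ip x y = 0}"
    have kE: "x \<in> E" if "x \<in> K" for x using that vE by (simp add: K_def)
    have "subspace K"
    proof (rule subspaceI)
      have "ip 0 y = 0" if "y \<in> E" for y using ip_bilinear(3)[OF that that, of 0] by simp
      then show "0 \<in> K" using subspace_0[OF V(1)] iE by (simp add: K_def)
      show "x + y \<in> K" if "x \<in> K" "y \<in> K" for x y
        using that subspace_add[OF V(1)] ip_bilinear(1)[OF kE[OF that(1)] kE[OF that(2)]] iE by (simp add: K_def)
      show "c *\<^sub>R x \<in> K" if "x \<in> K" for c x
        using that subspace_scale[OF V(1)] ip_bilinear(3)[OF kE[OF that]] iE by (simp add: K_def)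
    qed
    moreover have "br x y \<in> K" if x: "x \<in> V" and y: "y \<in> K" for x y
    proof -
      have "ip (br x y) w = 0" if w: "w \<in> I" for w
      proof -
        have "ip (br x y) w = - ip y (br (\<tau> x) w)" by (rule ip_ad[OF vE[OF x] kE[OF y] iE[OF w]])
        also have "\<dots> = 0" using I1(3)[OF tV[OF x] w] y by (simp add: K_def)
        finally show ?thesis .
      qed
      then show ?thesis using br[OF x] y by (simp add: K_def)
    qed
    ultimately have "lie_ideal A K" unfolding lie_ideal_def A by (auto simp: K_def)
    moreover have "I \<inter> K = {0}"
    proof
      show "I \<inter> K \<subseteq> {0}"
      proof
        fix x assume x: "x \<in> I \<inter> K"
        then have "ip x x = 0" by (simp add: K_def)
        then show "x \<in> {0}" using ip_pos[OF iE[of x]] x by force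
      qed
      show "{0} \<subseteq> I \<inter> K" using subspace_0[OF I1(1)] subspace_0[OF \<open>subspace K\<close>] by simp
    qed
    moreover have "{x + y | x y. x \<in> I \<and> y \<in> K} = V"
    proof
      show "{x + y | x y. x \<in> I \<and> y \<in> K} \<subseteq> V" using I1(2) subspace_add[OF V(1)] by (auto simp: K_def)
      show "V \<subseteq> {x + y | x y. x \<in> I \<and> y \<in> K}"
      proof
        fix x assume x: "x \<in> V"
        obtain y where y: "y \<in> I" "\<forall>w\<in>I. ip (x - y) w = 0" using ip_complement[OF fin BsE] vE[OF x] unfolding spI by blast
        have "x - y \<in> K" using y I1(2) subspace_diff[OF V(1) x] by (auto simp: K_def)
        moreover have "x = y + (x - y)" by simp
        ultimately show "x \<in> {x + y | x y. x \<in> I \<and> y \<in> K}" using y(1) by blast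
      qed
    qed
    ultimately show "\<exists>K. lie_ideal A K \<and> I \<inter> K = {0} \<and> {x + y | x y. x \<in> I \<and> y \<in> K} = lspace A" unfolding A by blast
  qed
qed

section \<open>Polar parts, compactness and the centre\<close>

lemma polar_inverse:
  assumes "u \<in> U" "X \<in> mm" shows "inv_into (U \<times> mm) (polar L) (u \<otimes> gexp X) = (u, X)"
proof -
  have "inv_into (U \<times> mm) (polar L) (polar L (u, X)) = (u, X)"
    by (rule inv_into_f_f[OF bij_betw_imp_inj_on[OF polar_bij]]) (use assms in simp)
  then show ?thesis using polar_gexp[OF mm_E[OF assms(2)]] by simp
qed

definition polar_part :: "'g \<Rightarrow> complex ^ 'n" where "polar_part g = snd (inv_into (U \<times> mm) (polar L) g)"

text \<open>Smoothness of the inverse polar map gives, near \<open>p\<close>, a smooth extension;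
  its vector component is continuous in charts and hence bounded near \<open>p\<close>. Local
  boundedness is enough for compact sets, through a finite subcover.\<close>

lemma polar_part_locally_bounded:
  assumes p: "p \<in> carrier L"
  shows "\<exists>W. openin T W \<and> p \<in> W \<and> bounded (polar_part ` W)"
proof -
  let ?f = "inv_into (U \<times> mm) (polar L)"
  let ?M = "prod_mfd (mfd L) (vec_mfd E)"
  have "smooth_map_on (mfd L) (carrier L) ?M ?f" using RR unfolding real_reductive_def by blast
  then obtain W0 g where W0: "openin T W0" "p \<in> W0" "smooth_map (open_submfd (mfd L) W0) ?M g" "\<forall>x\<in>carrier L \<inter> W0. g x = ?f x"
    unfolding smooth_map_on_def using p by blast
  have W0c: "W0 \<subseteq> carrier L" using openin_subset[OF W0(1)] topspace by simp
  obtain c where c: "c \<in> atlas (mfd L)" "p \<in> fst c" using chart_at[OF p] .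
  let ?c = "(fst c \<inter> W0, snd c)"
  have c': "?c \<in> atlas (open_submfd (mfd L) W0)" using c(1) unfolding open_submfd_def by (cases c) auto
  have m': "model (open_submfd (mfd L) W0) = E" by (simp add: open_submfd_def)
  have "p \<in> points (open_submfd (mfd L) W0)" unfolding points_chart using c' c(2) W0(2) by (intro bexI[OF _ c']) simp
  then have "g p \<in> points ?M" using W0(3) unfolding smooth_map_def by blast
  then obtain e where e: "e \<in> atlas ?M" "g p \<in> fst e" unfolding points_chart by blast
  \<comment> \<open>A chart of the product is the identity on the vector factor, so the second
    coordinate in the chart is the polar part itself.\<close>
  then obtain d where d: "d \<in> atlas (mfd L)" "e = (fst d \<times> E, map_prod (snd d) (\<lambda>x. x))"
    unfolding prod_mfd_def vec_mfd_def by force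
  let ?A = "snd ?c ` (fst ?c \<inter> g -` fst e)"
  note A = smooth_mapD[OF W0(3) c' e(1), unfolded m']
  define F where "F = snd e \<circ> g \<circ> inv_into (fst ?c) (snd ?c)"
  have inj: "inj_on (snd ?c) (fst ?c)" using smooth_atlasD(1)[OF atl c(1)] by (auto intro: inj_on_subset)
  have F: "snd (F (snd c h)) = snd (g h)" if "h \<in> fst c \<inter> W0" for h
    using inv_into_f_f[OF inj, of h] that by (simp add: F_def d(2))
  have cF: "continuous_on ?A (\<lambda>x. snd (F x))"
    using smooth_on_imp_continuous_on[OF A(2), folded F_def] by (intro continuous_on_snd)
  let ?b = "norm (snd (g p)) + 1"
  have "openin (top_of_set ?A) (?A \<inter> (\<lambda>x. snd (F x)) -` ball 0 ?b)"
    by (rule continuous_openin_preimage_gen[OF cF open_ball])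
  then have oA: "openin (top_of_set E) (?A \<inter> (\<lambda>x. snd (F x)) -` ball 0 ?b)" using A(1) openin_trans by blast
  let ?W = "(fst c \<inter> snd c -` (?A \<inter> (\<lambda>x. snd (F x)) -` ball 0 ?b)) \<inter> W0"
  have "openin T ?W" by (intro openin_Int openin_mtop_chart_vimage[OF atl c(1) oA] W0(1))
  moreover have "p \<in> ?W"
  proof -
    have "snd ?c p \<in> ?A" using c(2) W0(2) e(2) by (intro imageI) simp
    then show ?thesis using c(2) W0(2) F[of p] by simp
  qed
  moreover have "bounded (polar_part ` ?W)"
  proof (rule boundedI)
    fix x assume "x \<in> polar_part ` ?W"
    then obtain h where h: "x = polar_part h" "h \<in> ?W" by (rule imageE)
    then have hc: "h \<in> fst c \<inter> W0" "snd (F (snd c h)) \<in> ball 0 ?b" by simp_all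
    have "x = snd (g h)" using W0(4) W0c hc(1) h(1) by (auto simp: polar_part_def)
    then show "norm x \<le> ?b" using hc(2) F[OF hc(1)] by simp
  qed
  ultimately show ?thesis by blast
qed

lemma polar_part_bounded:
  assumes K: "compactin T K" shows "bounded (polar_part ` K)"
proof -
  let ?\<U> = "{W. openin T W \<and> bounded (polar_part ` W)}"
  have Kc: "K \<subseteq> carrier L" using compactin_subset_topspace[OF K] topspace by simp
  have "K \<subseteq> \<Union>?\<U>" using polar_part_locally_bounded Kc by blast
  then obtain \<F> where \<F>: "finite \<F>" "\<F> \<subseteq> ?\<U>" "K \<subseteq> \<Union>\<F>" using K unfolding compactin_def by (metis (no_types, lifting) mem_Collect_eq)
  have "bounded (\<Union>W\<in>\<F>. polar_part ` W)" using \<F> by (intro bounded_UN) auto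
  then show ?thesis by (rule bounded_subset) (use \<F>(3) in blast)
qed

text \<open>Commuting with \<open>U\<close> makes \<open>Ad v\<close> trivial on \<open>uu\<close>,
  and complex linearity extends this to \<open>mm\<close>, since \<open>imag\<close> carries
  \<open>mm\<close> into \<open>uu\<close>. Then \<open>v\<close> commutes with both factors of
  every polar decomposition.\<close>

lemma center_of_U:
  assumes v: "v \<in> U" "\<And>w. w \<in> U \<Longrightarrow> v \<otimes> w = w \<otimes> v" shows "v \<in> group_center L"
proof -
  have vc: "v \<in> carrier L" using v(1) U_carrier by blast
  have fu: "Ad L v X = X" if X: "X \<in> uu" for X
    by (rule Ad_of_commute[OF vc uu_E[OF X] v(2)]) (use X uu_gexp[OF uu_E[OF X]] in blast)
  have fm: "Ad L v X = X" if X: "X \<in> mm" for X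
  proof -
    have "imag (Ad L v X) = imag X" using fu[OF imag_uu_mm(2)[OF X]] Ad_imag[OF vc mm_E[OF X]] by simp
    then have "imag (imag (Ad L v X)) = imag (imag X)" by simp
    then show ?thesis by (simp add: imag_simps)
  qed
  have "v \<otimes> g = g \<otimes> v" if g: "g \<in> carrier L" for g
  proof -
    obtain u X where uX: "u \<in> U" "X \<in> mm" "g = u \<otimes> gexp X" using polar_ex[OF g] .
    have c: "u \<in> carrier L" "gexp X \<in> carrier L" using U_carrier[OF uX(1)] gexp_closed[OF mm_E[OF uX(2)]] .
    have vX: "v \<otimes> gexp X = gexp X \<otimes> v" using gexp_commute_Ad[OF vc mm_E[OF uX(2)] fm[OF uX(2)], of 1] by simp
    have "v \<otimes> g = (v \<otimes> u) \<otimes> gexp X" unfolding uX(3) using vc c by (simp add: m_assoc)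
    also have "\<dots> = u \<otimes> (v \<otimes> gexp X)" unfolding v(2)[OF uX(1)] using vc c by (simp add: m_assoc)
    also have "\<dots> = g \<otimes> v" unfolding vX uX(3) using vc c by (simp add: m_assoc)
    finally show ?thesis .
  qed
  then show ?thesis using vc by (simp add: group_center_def centralizer_def)
qed

text \<open>For \<open>w\<close> in \<open>U\<close>, conjugation fixes the central
  \<open>z\<close>, but rewrites its polar form with \<open>w v w\<inverse>\<close> and
  \<open>Ad w Y\<close>; uniqueness shows that neither factor moves. Thus \<open>v\<close> is
  central by \<open>center_of_U\<close>, so the exponential of \<open>Y\<close> is central too, and
  the convexity argument removes all brackets with \<open>Y\<close>.\<close>

lemma center_polar:
  assumes z: "z \<in> group_center L"
  obtains v Y where "v \<in> U" "v \<in> group_center L" "Y \<in> zz" "Y \<in> mm" "z = v \<otimes> gexp Y"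
proof -
  obtain v Y where vY: "v \<in> U" "Y \<in> mm" "z = v \<otimes> gexp Y" using polar_ex[OF group_centerD(1)[OF z]] .
  have YE: "Y \<in> E" using mm_E[OF vY(2)] .
  have vc: "v \<in> carrier L" "gexp Y \<in> carrier L" using U_carrier[OF vY(1)] gexp_closed[OF YE] .
  have comm: "w \<otimes> v = v \<otimes> w" "Ad L w Y = Y" if w: "w \<in> U" for w
  proof -
    have wc: "w \<in> carrier L" using U_carrier[OF w] .
    have AY: "Ad L w Y \<in> mm" using Ad_U_tau[OF w YE] vY(2) gexp_Ad(3)[OF wc YE] Ad_linear(2)[OF wc YE, of "-1"] by (simp add: mm)
    have cv: "w \<otimes> v \<otimes> inv w \<in> U" using w vY(1) subgroup.m_closed[OF U_sub(1)] subgroup.m_inv_closed[OF U_sub(1)] by simp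
    have "(w \<otimes> v \<otimes> inv w) \<otimes> (w \<otimes> gexp Y \<otimes> inv w) = w \<otimes> v \<otimes> (inv w \<otimes> w) \<otimes> gexp Y \<otimes> inv w"
      using wc vc by (simp only: m_assoc m_closed inv_closed)
    also have "\<dots> = w \<otimes> z \<otimes> inv w" using wc vc by (simp add: vY(3) m_assoc)
    also have "\<dots> = z \<otimes> w \<otimes> inv w" using group_centerD(2)[OF z wc] by simp
    also have "\<dots> = v \<otimes> gexp Y" using wc group_centerD(1)[OF z] vY(3) by (simp add: m_assoc)
    finally have "(w \<otimes> v \<otimes> inv w) \<otimes> gexp (Ad L w Y) = v \<otimes> gexp Y" using gexp_Ad(2)[OF wc YE] by (simp add: cj_def)
    from polar_unique[OF cv AY vY(1,2) this] have e: "w \<otimes> v \<otimes> inv w = v" "Ad L w Y = Y" by auto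
    show "Ad L w Y = Y" by (rule e(2))
    have "w \<otimes> v \<otimes> inv w \<otimes> w = v \<otimes> w" unfolding e(1) ..
    then show "w \<otimes> v = v \<otimes> w" using wc vc by (simp add: m_assoc)
  qed
  have vZ: "v \<in> group_center L" by (rule center_of_U[OF vY(1)]) (rule comm(1)[symmetric])
  have "gexp Y = inv v \<otimes> z" using vc vY(3) by (simp add: m_assoc[symmetric])
  then have eZ: "gexp Y \<in> group_center L"
    using z vZ subgroup.m_closed[OF group_center_subgroup] subgroup.m_inv_closed[OF group_center_subgroup] by simp
  have tr: "Ad L (gexp Y) Z = Z" if Z: "Z \<in> E" for Z
    by (rule Ad_of_commute[OF vc(2) Z]) (rule group_centerD(2)[OF eZ gexp_closed[OF scale_E[OF Z]]])
  have b0: "br Y Z = 0" if "Z \<in> E" for Z by (rule bracket_zero_of_Ad_trivial[OF vY(2) tr that])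
  have "Y \<in> zz"
  proof (rule zz_test[OF YE comm(2)])
    show "br X Y = 0" if "X \<in> mm" for X using br_anti[OF mm_E[OF that] YE] b0[OF mm_E[OF that]] by simp
  qed
  then show thesis using that vY vZ by blast
qed

end

section \<open>Real forms\<close>

locale complex_real_form = complex_red L U \<tau> BC
  for L :: "('g, complex ^ 'n) lie_group_data" (structure) and U \<tau> BC +
  fixes \<sigma> :: "'g \<Rightarrow> 'g" and G H :: "'g set" and \<theta> :: "complex ^ 'n \<Rightarrow> complex ^ 'n"
    and B :: "complex ^ 'n \<Rightarrow> complex ^ 'n \<Rightarrow> real"
  assumes RF: "real_form_group L U \<tau> BC \<sigma> G H \<theta> B"
begin

abbreviation "ZL \<equiv> group_center L"

lemma sig: "\<sigma> \<in> hom L L" "g \<in> carrier L \<Longrightarrow> \<sigma> (\<sigma> g) = g"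
  "holomorphic_map imag (\<lambda>v. - imag v) (mfd L) (mfd L) \<sigma>"
  "g \<in> carrier L \<Longrightarrow> \<sigma> (group_cartan_involution L U \<tau> g) = group_cartan_involution L U \<tau> (\<sigma> g)"
  and G_def': "G = {g \<in> carrier L. \<sigma> g = g}"
  using RF unfolding real_form_group_def antiholomorphic_involution_def by blast+

lemma sig_closed: "g \<in> carrier L \<Longrightarrow> \<sigma> g \<in> carrier L"
  and sig_mult: "g \<in> carrier L \<Longrightarrow> h \<in> carrier L \<Longrightarrow> \<sigma> (g \<otimes> h) = \<sigma> g \<otimes> \<sigma> h"
  using sig(1) by (auto simp: hom_def)

lemma sig_one: "\<sigma> \<one> = \<one>" using hom_one[OF sig(1) is_group is_group] .

lemma sig_inv: assumes "g \<in> carrier L" shows "\<sigma> (inv g) = inv (\<sigma> g)"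
proof -
  have "\<sigma> (inv g) \<otimes> \<sigma> g = \<one>" using sig_mult[of "inv g" g] assms sig_one by simp
  then show ?thesis using sig_closed assms by (simp add: inv_equality)
qed

definition S where "S = (SOME D. tder \<sigma> D \<and> (\<forall>v\<in>E. D (imag v) = - imag (D v)))"

lemma S: "tder \<sigma> S" "v \<in> E \<Longrightarrow> S (imag v) = - imag (S v)"
proof -
  have "\<exists>D. tder \<sigma> D \<and> (\<forall>v\<in>E. D (imag v) = - imag (D v))"
    by (rule tder_holomorphic[OF sig(3) sig_one imag_E])
  from someI_ex[OF this] show "tder \<sigma> S" "v \<in> E \<Longrightarrow> S (imag v) = - imag (S v)" unfolding S_def by auto
qed

lemma S_E: "S X \<in> E" by (rule tder_E[OF S(1)])

lemma S_linear: "linear S" by (rule tder_linear(1)[OF S(1)])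
lemmas S_simps = linear_add[OF S_linear] linear_diff[OF S_linear] linear_scale[OF S_linear] linear_neg[OF S_linear] linear_0[OF S_linear]

lemma sig_gexp: "X \<in> E \<Longrightarrow> \<sigma> (gexp (t *\<^sub>R X)) = gexp (t *\<^sub>R S X)"
  by (rule tder_hom[OF S(1) sig(1)])

lemma sig_gexp1: "X \<in> E \<Longrightarrow> \<sigma> (gexp X) = gexp (S X)"
  using sig_gexp[of X 1] by simp

lemma S_S: assumes X: "X \<in> E" shows "S (S X) = X"
proof (rule gexp_ray_inj[OF S_E X])
  show "gexp (t *\<^sub>R S (S X)) = gexp (t *\<^sub>R X)" for t
    using sig_gexp[OF S_E, of t X] sig_gexp[OF X, of t] sig(2)[OF gexp_closed[OF scale_E[OF X]], of t] by simp
qed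

lemma S_br: "X \<in> E \<Longrightarrow> Y \<in> E \<Longrightarrow> S (br X Y) = br (S X) (S Y)"
  by (rule hom_bracket[OF S(1) sig(1)])

lemma cartan_involution: assumes "u \<in> U" "X \<in> mm" shows "group_cartan_involution L U \<tau> (u \<otimes> gexp X) = u \<otimes> gexp (- X)"
  unfolding group_cartan_involution_def polar_inverse[OF assms] using polar_gexp[OF minus_E[OF mm_E[OF assms(2)]]] by simp

lemma minus_mm: "X \<in> mm \<Longrightarrow> - X \<in> mm" using minus_E tau_minus by (auto simp: mm)

lemma zero_mm: "0 \<in> mm" using subspace_0[OF subE] tau(4)[of 0 0] by (simp add: mm)

text \<open>An element of \<open>U\<close> is fixed by the Cartan involution, hence so is its image
  under \<open>\<sigma>\<close>. For a polar form with vector part \<open>Z\<close> this forces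
  \<open>- Z = Z\<close> by uniqueness, so \<open>Z = 0\<close>.\<close>

lemma sig_U: assumes u: "u \<in> U" shows "\<sigma> u \<in> U"
proof -
  have uc: "u \<in> carrier L" using U_carrier[OF u] .
  obtain w Z where w: "w \<in> U" "Z \<in> mm" "\<sigma> u = w \<otimes> gexp Z" using polar_ex[OF sig_closed[OF uc]] .
  have "group_cartan_involution L U \<tau> u = u" using cartan_involution[OF u zero_mm] uc by (simp add: gexp_0)
  then have "w \<otimes> gexp (- Z) = w \<otimes> gexp Z" using sig(4)[OF uc] cartan_involution[OF w(1,2)] w(3) by simp
  from polar_unique(2)[OF w(1) minus_mm[OF w(2)] w(1,2) this] have "(2::real) *\<^sub>R Z = 0" by (simp add: scaleR_2 neg_eq_iff_add_eq_0)
  then have "Z = 0" by simp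
  then show ?thesis using w(1,3) U_carrier[OF w(1)] by (simp add: gexp_0)
qed

lemma S_uu: assumes X: "X \<in> uu" shows "S X \<in> uu"
proof -
  have "gexp (t *\<^sub>R S X) \<in> U" for t using sig_gexp[OF uu_E[OF X], of t] sig_U uu_gexp[OF uu_E[OF X]] X by metis
  then show ?thesis using uu_gexp[OF S_E] by blast
qed

text \<open>Conjugate linearity gives \<open>S X = imag (S (imag X))\<close>, which leads from
  \<open>mm\<close> to \<open>uu\<close>, where \<open>S\<close> is already understood, and
  back.\<close>

lemma S_mm: assumes X: "X \<in> mm" shows "S X \<in> mm"
proof -
  have XE: "X \<in> E" using mm_E[OF X] .
  have "S (imag (imag X)) = - imag (S (imag X))" by (rule S(2)[OF imag_E[OF XE]])
  then have "S X = imag (S (imag X))" by (simp add: imag_simps S_simps)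
  then show ?thesis using imag_uu_mm(1)[OF S_uu[OF imag_uu_mm(2)[OF X]]] by simp
qed

text \<open>Infinitesimal form of the commutation assumed on the group: \<open>S\<close> preserves
  both eigenspaces of \<open>\<tau>\<close>.\<close>

lemma S_tau: assumes X: "X \<in> E" shows "S (\<tau> X) = \<tau> (S X)"
proof -
  obtain A C where AB: "A \<in> uu" "C \<in> mm" "X = A + C" "\<tau> X = A - C" using split[OF X] .
  have "\<tau> (S X) = S A - S C" unfolding AB(3) S_simps using S_uu[OF AB(1)] S_mm[OF AB(2)] tau(3)[OF S_E S_E] by (simp add: uu mm)
  then show ?thesis using AB(4) by (simp add: S_simps)
qed

lemma S_zz: assumes Y: "Y \<in> zz" shows "S Y \<in> zz"
proof -
  have "Ad L g (S Y) = S Y" if g: "g \<in> carrier L" for g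
    using hom_Ad[OF S(1) sig(1) sig_closed[OF g] zz_E[OF Y]] sig(2)[OF g] sig_closed[OF g] Y by (simp add: zz_def)
  then show ?thesis using S_E by (simp add: zz_def)
qed

section \<open>The groups of almost fixed elements\<close>

definition Gs where "Gs = almost_fixed L \<sigma>"
definition Us where "Us = almost_fixed (L\<lparr>carrier := U\<rparr>) \<sigma>"
definition gs where "gs = {X \<in> E. S X - X \<in> zz}"

lemma Gs_iff: "g \<in> Gs \<longleftrightarrow> g \<in> carrier L \<and> inv g \<otimes> \<sigma> g \<in> ZL"
  by (simp add: Gs_def almost_fixed_def)

lemma Gs_E: assumes "g \<in> Gs" obtains z where "z \<in> ZL" "\<sigma> g = g \<otimes> z"
proof -
  have g: "g \<in> carrier L" "inv g \<otimes> \<sigma> g \<in> ZL" using assms by (auto simp: Gs_iff)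
  have "\<sigma> g = g \<otimes> (inv g \<otimes> \<sigma> g)" using g(1) sig_closed by (simp add: m_assoc[symmetric])
  then show thesis using that g(2) by blast
qed

lemma Gs_I: assumes "g \<in> carrier L" "z \<in> ZL" "\<sigma> g = g \<otimes> z" shows "g \<in> Gs"
  using assms group_centerD(1)[OF assms(2)] by (simp add: Gs_iff m_assoc[symmetric])

lemma Gs_subgroup: "subgroup Gs L"
proof (rule subgroupI)
  show "Gs \<subseteq> carrier L" by (auto simp: Gs_iff)
  have "\<one> \<in> Gs" by (rule Gs_I[of _ \<one>]) (use subgroup.one_closed[OF group_center_subgroup] sig_one in auto)
  then show "Gs \<noteq> {}" by blast
  fix a assume a: "a \<in> Gs"
  then have ac: "a \<in> carrier L" by (simp add: Gs_iff)
  obtain z where z: "z \<in> ZL" "\<sigma> a = a \<otimes> z" using Gs_E[OF a] .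
  have zc: "z \<in> carrier L" "inv z \<in> ZL" using group_centerD(1)[OF z(1)] subgroup.m_inv_closed[OF group_center_subgroup z(1)] by auto
  have "\<sigma> (inv a) = inv z \<otimes> inv a" using sig_inv[OF ac] z(2) ac zc by (simp add: inv_mult_group)
  also have "\<dots> = inv a \<otimes> inv z" by (rule group_centerD(2)[OF zc(2) inv_closed[OF ac]])
  finally show "inv a \<in> Gs" by (rule Gs_I[OF inv_closed[OF ac] zc(2)])
  fix b assume b: "b \<in> Gs"
  then have bc: "b \<in> carrier L" by (simp add: Gs_iff)
  obtain y where y: "y \<in> ZL" "\<sigma> b = b \<otimes> y" using Gs_E[OF b] .
  have yc: "y \<in> carrier L" using group_centerD(1)[OF y(1)] .
  have "\<sigma> (a \<otimes> b) = a \<otimes> (z \<otimes> b) \<otimes> y" using sig_mult[OF ac bc] z y ac bc zc yc by (simp add: m_assoc)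
  also have "z \<otimes> b = b \<otimes> z" by (rule group_centerD(2)[OF z(1) bc])
  finally have "\<sigma> (a \<otimes> b) = (a \<otimes> b) \<otimes> (z \<otimes> y)" using ac bc zc yc by (simp add: m_assoc)
  then show "a \<otimes> b \<in> Gs" using ac bc subgroup.m_closed[OF group_center_subgroup z(1) y(1)] by (intro Gs_I[of _ "z \<otimes> y"]) auto
qed

lemma sig_continuous: "continuous_map T T \<sigma>"
  using sig(3) smooth_map_continuous[OF _ atl atl] by (simp add: holomorphic_map_def)

lemma Gs_closed: "closedin T Gs"
proof -
  have "closedin T {g \<in> topspace T. inv g \<otimes> \<sigma> g \<in> ZL}"
    by (rule closedin_continuous_map_preimage[OF _ group_center_closed]) (intro cm_mult cm_inv cm_id sig_continuous)
  then show ?thesis by (simp add: topspace Gs_iff[abs_def] Gs_def almost_fixed_def)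
qed

text \<open>The two conditions differ only in the centre they refer to. As \<open>\<sigma>\<close>
  preserves \<open>U\<close>, it suffices that the centre of \<open>U\<close> is the part of
  \<open>ZL\<close> inside \<open>U\<close>, and \<open>center_of_U\<close> gives the nontrivial
  inclusion.\<close>

lemma Us: "Us = U \<inter> Gs"
proof -
  have c: "group_center (L\<lparr>carrier := U\<rparr>) = U \<inter> ZL"
  proof (intro equalityI subsetI)
    fix v assume "v \<in> group_center (L\<lparr>carrier := U\<rparr>)"
    then have v: "v \<in> U" "\<And>w. w \<in> U \<Longrightarrow> v \<otimes> w = w \<otimes> v" by (auto simp: group_center_def centralizer_def)
    show "v \<in> U \<inter> ZL" using v center_of_U[OF v] by blast
  next
    fix v assume "v \<in> U \<inter> ZL"
    then have v: "v \<in> U" "v \<in> ZL" by auto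
    have "v \<otimes> w = w \<otimes> v" if "w \<in> U" for w by (rule group_centerD(2)[OF v(2) U_carrier[OF that]])
    then show "v \<in> group_center (L\<lparr>carrier := U\<rparr>)" unfolding group_center_def centralizer_def using v(1) by simp
  qed
  have "u \<in> Us \<longleftrightarrow> u \<in> U \<inter> Gs" for u
  proof (cases "u \<in> U")
    case u: True
    have m: "inv\<^bsub>L\<lparr>carrier := U\<rparr>\<^esub> u = inv u" by (rule m_inv_consistent[OF U_sub(1) u])
    have "inv u \<otimes> \<sigma> u \<in> U"
      by (rule subgroup.m_closed[OF U_sub(1) subgroup.m_inv_closed[OF U_sub(1) u] sig_U[OF u]])
    then show ?thesis unfolding Us_def almost_fixed_def c using u m U_carrier[OF u] by (simp add: Gs_iff)
  next
    case False
    then show ?thesis by (simp add: Us_def almost_fixed_def)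
  qed
  then show ?thesis by (rule Set.set_eqI)
qed

lemma gs_E: "X \<in> gs \<Longrightarrow> X \<in> E" by (simp add: gs_def)

lemma gs_gexp: assumes X: "X \<in> gs" shows "gexp (t *\<^sub>R X) \<in> Gs"
proof -
  have XE: "X \<in> E" and Y: "S X - X \<in> zz" using X by (auto simp: gs_def)
  have "\<sigma> (gexp (t *\<^sub>R X)) = gexp (t *\<^sub>R (X + (S X - X)))" using sig_gexp[OF XE] by simp
  also have "\<dots> = gexp (t *\<^sub>R X) \<otimes> gexp (t *\<^sub>R (S X - X))" by (rule gexp_add_zz[OF XE Y])
  finally show ?thesis by (rule Gs_I[OF gexp_closed[OF scale_E[OF XE]] zz_gexp[OF Y]])
qed

text \<open>For a ray in \<open>Gs\<close> the curve \<open>exp (- t X) exp (t S X)\<close> runs in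
  the centre and has velocity \<open>S X - X\<close>; so this vector lies in the Lie algebra of the
  centre. Conversely, a central summand splits off from the exponential.\<close>

lemma Lie_Gs: "Lie L Gs = gs"
proof (intro equalityI subsetI)
  fix X assume "X \<in> Lie L Gs"
  then have X: "X \<in> E" "\<And>t. gexp (t *\<^sub>R X) \<in> Gs" unfolding Lie_closed_subgroup[OF Gs_subgroup Gs_closed] by auto
  let ?c = "\<lambda>t::real. gexp (t *\<^sub>R (- X)) \<otimes> gexp (t *\<^sub>R S X)"
  have "smooth_germ ?c (\<lambda>t. t *\<^sub>R (- X) + t *\<^sub>R S X)"
    using X(1) S_E minus_E by (intro smooth_germ_mult gexp_smooth_germ) auto
  note c = smooth_germ_curve[OF this]
  have "?c t \<in> ZL" for t
    using X(2)[of t] gexp_minus[OF scale_E[OF X(1)], of t] sig_gexp[OF X(1), of t] by (simp add: Gs_iff)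
  from curve_in_closed_subgroup[OF group_center_subgroup group_center_closed c(1) this c(2,3)]
  have "- X + S X \<in> Lie L ZL" unfolding Lie_closed_subgroup[OF group_center_subgroup group_center_closed] by simp
  then show "X \<in> gs" using X(1) Lie_center by (simp add: gs_def)
next
  fix X assume X: "X \<in> gs"
  then show "X \<in> Lie L Gs" unfolding Lie_closed_subgroup[OF Gs_subgroup Gs_closed] using gs_gexp gs_E by blast
qed

lemma Us_subgroup: "subgroup Us L" and Us_closed: "closedin T Us"
  unfolding Us using subgroups_Inter_pair[OF U_sub(1) Gs_subgroup] closedin_Int[OF U_closed Gs_closed] by auto

lemma Lie_Us: "Lie L Us = {X \<in> gs. \<tau> X = X}"
proof -
  have "Lie L Us = Lie L U \<inter> Lie L Gs"
  proof (rule Set.set_eqI)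
    fix X
    show "X \<in> Lie L Us \<longleftrightarrow> X \<in> Lie L U \<inter> Lie L Gs"
      unfolding Lie_closed_subgroup[OF Us_subgroup Us_closed] Lie_closed_subgroup[OF Gs_subgroup Gs_closed]
        Lie_closed_subgroup[OF U_sub(1) U_closed] using Us by blast
  qed
  then show ?thesis unfolding Lie_Gs uu using gs_E by blast
qed

lemma minus_Gs: "minus_part L Gs \<tau> = gs \<inter> mm"
  unfolding minus_part_def Lie_Gs Lie_carrier using gs_E by blast

lemma gs_subspace: "subspace gs" using Lie_subspace[OF Gs_subgroup Gs_closed] Lie_Gs by simp

lemma gs_tau: "X \<in> gs \<Longrightarrow> \<tau> X \<in> gs"
proof -
  assume X: "X \<in> gs"
  then have XE: "X \<in> E" and Y: "S X - X \<in> zz" by (auto simp: gs_def)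
  have "\<tau> (S X - X) \<in> zz" by (rule tau_zz[OF Y])
  then show "\<tau> X \<in> gs" using S_tau[OF XE] tau_diff[OF S_E XE] tau(1)[OF XE] by (simp add: gs_def)
qed

lemma br_zz: "Y \<in> zz \<Longrightarrow> X \<in> E \<Longrightarrow> br Y X = 0" "Y \<in> zz \<Longrightarrow> X \<in> E \<Longrightarrow> br X Y = 0"
  using zz_bracket[of Y X] br_anti[OF zz_E, of Y X] by auto

lemma br_mod_zz: assumes "X \<in> E" "X' \<in> E" "Y \<in> zz" "Y' \<in> zz" shows "br (X + Y) (X' + Y') = br X X'"
proof -
  have "br (X + Y) (X' + Y') = br X (X' + Y') + br Y (X' + Y')"
    by (rule br_props(2)[OF assms(1) zz_E[OF assms(3)] add_E[OF assms(2) zz_E[OF assms(4)]]])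
  also have "br Y (X' + Y') = 0" by (rule br_zz(1)[OF assms(3) add_E[OF assms(2) zz_E[OF assms(4)]]])
  also have "br X (X' + Y') = br X X' + br X Y'" by (rule br_props(3)[OF assms(2) zz_E[OF assms(4)] assms(1)])
  also have "br X Y' = 0" by (rule br_zz(2)[OF assms(4,1)])
  finally show ?thesis by simp
qed

text \<open>Brackets do not see central summands, so the bracket of two elements of
  \<open>gs\<close> is even fixed by \<open>S\<close>.\<close>

lemma gs_br: assumes X: "X \<in> gs" and Y: "Y \<in> gs" shows "br X Y \<in> gs"
proof -
  have XE: "X \<in> E" "Y \<in> E" using X Y gs_E by auto
  have z: "S X - X \<in> zz" "S Y - Y \<in> zz" using X Y by (auto simp: gs_def)
  have "S (br X Y) = br (X + (S X - X)) (Y + (S Y - Y))" using S_br[OF XE] by simp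
  also have "\<dots> = br X Y" by (rule br_mod_zz[OF XE z])
  finally show ?thesis using br_props(1)[OF XE] subspace_0[OF subspace_zz] by (simp add: gs_def)
qed

lemma Gs_polar:
  assumes u: "u \<in> U" and X: "X \<in> mm" shows "u \<otimes> gexp X \<in> Gs \<longleftrightarrow> u \<in> Gs \<and> X \<in> gs"
proof
  assume "u \<in> Gs \<and> X \<in> gs"
  then show "u \<otimes> gexp X \<in> Gs" using gs_gexp[of X 1] subgroup.m_closed[OF Gs_subgroup] by simp
next
  assume g: "u \<otimes> gexp X \<in> Gs"
  have XE: "X \<in> E" using mm_E[OF X] .
  have c: "u \<in> carrier L" "gexp X \<in> carrier L" using U_carrier[OF u] gexp_closed[OF XE] .
  obtain z where z: "z \<in> ZL" "\<sigma> (u \<otimes> gexp X) = u \<otimes> gexp X \<otimes> z" using Gs_E[OF g] .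
  obtain v Y where vY: "v \<in> U" "v \<in> ZL" "Y \<in> zz" "Y \<in> mm" "z = v \<otimes> gexp Y" using center_polar[OF z(1)] .
  have YE: "Y \<in> E" using zz_E[OF vY(3)] .
  have vc: "v \<in> carrier L" "gexp Y \<in> carrier L" using U_carrier[OF vY(1)] gexp_closed[OF YE] .
  have XY: "X + Y \<in> mm" using X vY(4) add_E tau(3) by (simp add: mm)
  have "\<sigma> u \<otimes> gexp (S X) = u \<otimes> (gexp X \<otimes> v) \<otimes> gexp Y"
    using z(2) sig_mult[OF c] sig_gexp1[OF XE] c vc by (simp add: vY(5) m_assoc)
  also have "gexp X \<otimes> v = v \<otimes> gexp X" using group_centerD(2)[OF vY(2) c(2)] by simp
  also have "u \<otimes> (v \<otimes> gexp X) \<otimes> gexp Y = (u \<otimes> v) \<otimes> (gexp X \<otimes> gexp Y)" using c vc by (simp add: m_assoc)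
  \<comment> \<open>Centrality of \<open>Y\<close> merges the exponents, and the right side becomes
    a polar form with factors \<open>u v\<close> and \<open>X + Y\<close>, to which uniqueness
    applies.\<close>
  also have "gexp X \<otimes> gexp Y = gexp (X + Y)" using gexp_add_zz[OF XE vY(3), of 1] by simp
  finally have e: "\<sigma> u \<otimes> gexp (S X) = (u \<otimes> v) \<otimes> gexp (X + Y)" .
  have uv: "u \<otimes> v \<in> U" using u vY(1) subgroup.m_closed[OF U_sub(1)] by blast
  from polar_unique[OF sig_U[OF u] S_mm[OF X] uv XY e] have "\<sigma> u = u \<otimes> v" "S X = X + Y" by auto
  then show "u \<in> Gs \<and> X \<in> gs" using Gs_I[OF c(1) vY(2)] XE vY(3) by (simp add: gs_def)
qed

lemma polar_bij_Gs: "bij_betw (polar L) (Us \<times> (gs \<inter> mm)) Gs"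
  unfolding bij_betw_def
proof
  show "inj_on (polar L) (Us \<times> (gs \<inter> mm))"
    by (rule inj_on_subset[OF bij_betw_imp_inj_on[OF polar_bij]]) (auto simp: Us)
  show "polar L ` (Us \<times> (gs \<inter> mm)) = Gs"
  proof (intro equalityI subsetI)
    fix g assume "g \<in> polar L ` (Us \<times> (gs \<inter> mm))"
    then obtain p where p: "g = polar L p" "p \<in> Us \<times> (gs \<inter> mm)" by (rule imageE)
    then have q: "fst p \<in> U" "fst p \<in> Gs" "snd p \<in> gs" "snd p \<in> mm" by (auto simp: Us)
    have "g = fst p \<otimes> gexp (snd p)" using polar_gexp[OF mm_E[OF q(4)], of "fst p"] p(1) by simp
    then show "g \<in> Gs" using Gs_polar[OF q(1,4)] q(2,3) by simp
  next
    fix g assume g: "g \<in> Gs"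
    then have "g \<in> carrier L" by (simp add: Gs_iff)
    then obtain u X where uX: "u \<in> U" "X \<in> mm" "g = u \<otimes> gexp X" using polar_ex by blast
    have "g = polar L (u, X)" using polar_gexp[OF mm_E[OF uX(2)]] uX(3) by simp
    moreover have "(u, X) \<in> Us \<times> (gs \<inter> mm)" using Gs_polar[OF uX(1,2)] g uX by (simp add: Us)
    ultimately show "g \<in> polar L ` (Us \<times> (gs \<inter> mm))" by (rule image_eqI)
  qed
qed

lemma maximal_Us: "maximal_compact L Gs Us"
  unfolding maximal_compact_def
proof (intro conjI allI impI)
  show "subgroup Us L" by (rule Us_subgroup)
  show "Us \<subseteq> Gs" by (simp add: Us)
  show "compactin T Us" by (rule closed_compactin[OF U_sub(2) _ Us_closed]) (simp add: Us)
  fix K assume K: "subgroup K L \<and> K \<subseteq> Gs \<and> compactin T K \<and> Us \<subseteq> K"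
  show "K = Us"
  proof
    show "Us \<subseteq> K" using K by blast
    show "K \<subseteq> Us"
    proof
      fix k assume k: "k \<in> K"
      then have kG: "k \<in> Gs" "k \<in> carrier L" using K by (auto simp: Gs_iff)
      obtain u X where uX: "u \<in> U" "X \<in> mm" "k = u \<otimes> gexp X" using polar_ex[OF kG(2)] .
      have XE: "X \<in> E" using mm_E[OF uX(2)] .
      have c: "u \<in> carrier L" "gexp X \<in> carrier L" using U_carrier[OF uX(1)] gexp_closed[OF XE] .
      have "u \<in> Gs" using Gs_polar[OF uX(1,2)] kG(1) uX(3) by simp
      then have uK: "u \<in> Us" "u \<in> K" using uX(1) K by (auto simp: Us)
      have "inv u \<otimes> k \<in> K" using uK(2) k K subgroup.m_closed subgroup.m_inv_closed by metis
      then have eK: "gexp X \<in> K" using c uX(3) by (simp add: m_assoc[symmetric])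
      \<comment> \<open>The exponential of \<open>n X\<close> is its own polar form with trivial
        factor in \<open>U\<close>, so its polar part grows linearly in \<open>n\<close>, against
        boundedness of polar parts on compact sets.\<close>
      have "real n *\<^sub>R X \<in> polar_part ` K" for n
      proof -
        have nm: "real n *\<^sub>R X \<in> mm" using uX(2) scale_E tau(4) by (simp add: mm)
        have "gexp (real n *\<^sub>R X) \<in> K" using gexp_nat_mult[OF XE] subgroup_nat_pow[OF _ eK] K by simp
        moreover have "polar_part (gexp (real n *\<^sub>R X)) = real n *\<^sub>R X"
          using polar_inverse[OF subgroup.one_closed[OF U_sub(1)] nm] gexp_closed[OF scale_E[OF XE]]
          by (simp add: polar_part_def)
        ultimately show ?thesis by (metis imageI)
      qed
      moreover obtain M where M: "\<And>x. x \<in> polar_part ` K \<Longrightarrow> norm x \<le> M" using polar_part_bounded K unfolding bounded_iff by blast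
      ultimately have nM: "real n * norm X \<le> M" for n using M[of "real n *\<^sub>R X"] by simp
      have "X = 0"
      proof (rule ccontr)
        assume "X \<noteq> 0"
        then obtain n :: nat where "M < real n * norm X" using reals_Archimedean3[of "norm X"] by auto
        then show False using nM[of n] by simp
      qed
      then show "k \<in> Us" using uX(3) c(1) uK(1) by (simp add: gexp_0)
    qed
  qed
qed

lemma reductive_Gs: "real_reductive L Gs Us \<tau> BC"
proof -
  have sub: "gs \<subseteq> E" using gs_E by blast
  have lsp: "lspace (lie_alg_of L Gs) = gs" by (simp add: lie_alg_of_def Lie_Gs)
  note red = tau_stable_subalgebra_reductive[OF gs_subspace sub gs_br gs_tau lsp lspace_L(2)]
  \<comment> \<open>The term \<open>inv_into\<close> depends on the domain; agreement with the
    inverse on the full group is what lets its smoothness be inherited by restriction.\<close>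
  have inv: "inv_into (Us \<times> (gs \<inter> mm)) (polar L) g = inv_into (U \<times> mm) (polar L) g" if g: "g \<in> Gs" for g
  proof -
    obtain p where p: "g = polar L p" "p \<in> Us \<times> (gs \<inter> mm)"
      using g unfolding bij_betw_imp_surj_on[OF polar_bij_Gs, symmetric] by (rule imageE)
    then have "p \<in> U \<times> mm" by (auto simp: Us)
    then show ?thesis unfolding p(1)
      using inv_into_f_f[OF bij_betw_imp_inj_on[OF polar_bij]] inv_into_f_f[OF bij_betw_imp_inj_on[OF polar_bij_Gs] p(2)] by simp
  qed
  have sm: "smooth_map_on (prod_mfd (mfd L) (vec_mfd E)) (U \<times> mm) (mfd L) (polar L)"
    "smooth_map_on (mfd L) (carrier L) (prod_mfd (mfd L) (vec_mfd E)) (inv_into (U \<times> mm) (polar L))"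
    using RR unfolding real_reductive_def by blast+
  show ?thesis unfolding real_reductive_def minus_Gs Lie_Us Lie_Gs
  proof (intro conjI)
    show "lie_group L" by (rule lie)
    show "lie_subgroup L Gs" by (rule closed_subgroup_embedded[OF Gs_subgroup Gs_closed])
    show "reductive_lie_algebra (lie_alg_of L Gs)" by (rule red(1))
    show "maximal_compact L Gs Us" by (rule maximal_Us)
    show "lie_involution (lie_alg_of L Gs) \<tau>"
      unfolding lie_involution_def lsp lspace_L(2) using gs_tau tau gs_E by simp
    show "{X \<in> gs. \<tau> X = X} = {X \<in> gs. \<tau> X = X}" ..
    show "bilinear_form_on gs BC" unfolding bilinear_form_on_def using BC_bilinear gs_E by simp
    \<comment> \<open>The test vector is \<open>\<tau> x\<close>, which stays in \<open>gs\<close>;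
      pairing it with a nonzero \<open>x\<close> gives a negative value in either order.\<close>
    show "nondegenerate_on gs BC" unfolding nondegenerate_on_def
    proof (intro conjI ballI impI)
      fix x assume x: "x \<in> gs" "\<forall>y\<in>gs. BC x y = 0"
      then show "x = 0" using BC_tau_neg(1)[OF gs_E[OF x(1)]] gs_tau[OF x(1)] by force
    next
      fix x assume x: "x \<in> gs" "\<forall>y\<in>gs. BC y x = 0"
      then show "x = 0" using BC_tau_neg(2)[OF gs_E[OF x(1)]] gs_tau[OF x(1)] by force
    qed
    show "\<forall>X\<in>gs. \<forall>Y\<in>gs. BC (\<tau> X) (\<tau> Y) = BC X Y" using BC_inv(1) gs_E by blast
    show "\<forall>g\<in>Gs. \<forall>X\<in>gs. \<forall>Y\<in>gs. BC (Ad L g X) (Ad L g Y) = BC X Y" using BC_inv(2) gs_E Gs_iff by blast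
    show "\<forall>X\<in>{X \<in> gs. \<tau> X = X}. \<forall>Y\<in>gs \<inter> mm. BC X Y = 0 \<and> BC Y X = 0" using BC_inv(3,4) gs_E uu by blast
    show "\<forall>X\<in>{X \<in> gs. \<tau> X = X}. X \<noteq> 0 \<longrightarrow> BC X X < 0" using BC_inv(5) gs_E uu by blast
    show "\<forall>X\<in>gs \<inter> mm. X \<noteq> 0 \<longrightarrow> 0 < BC X X" using BC_inv(6) by blast
    show "bij_betw (polar L) (Us \<times> (gs \<inter> mm)) Gs" by (rule polar_bij_Gs)
    show "smooth_map_on (prod_mfd (mfd L) (vec_mfd E)) (Us \<times> (gs \<inter> mm)) (mfd L) (polar L)"
      by (rule smooth_map_on_subset[OF sm(1)]) (auto simp: Us)
    show "smooth_map_on (mfd L) Gs (prod_mfd (mfd L) (vec_mfd E)) (inv_into (Us \<times> (gs \<inter> mm)) (polar L))"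
      by (rule smooth_map_on_subset[OF sm(2) _ inv]) (auto simp: Gs_iff)
  qed
qed

section \<open>The normalizer of the real form\<close>

lemma G_carrier: "G \<subseteq> carrier L" by (auto simp: G_def')

text \<open>The conjugation action on sets is a function restricted to subsets of the carrier, so it
  can be evaluated at \<open>G\<close> only after \<open>G_carrier\<close>.\<close>

lemma normalizer_iff:
  "g \<in> normalizer L G \<longleftrightarrow> g \<in> carrier L \<and> cj g ` G = G"
proof -
  have "g <# G #> inv g = cj g ` G" by (auto simp: l_coset_def r_coset_def cj_def)
  then show ?thesis unfolding normalizer_def stabilizer_def using G_carrier by simp
qed

text \<open>For \<open>h\<close> fixed by \<open>\<sigma>\<close>, the conjugate of \<open>h\<close>
  by \<open>g\<close> is again fixed exactly when \<open>inv g \<otimes> \<sigma> g\<close> commutes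
  with \<open>h\<close>. Ranging over \<open>G\<close> puts this element in the centralizer, which
  \<open>cz\<close> identifies with the centre.\<close>

lemma Gs_normalizer: assumes cz: "centralizer L G = ZL" shows "Gs = normalizer L G"
proof (intro equalityI subsetI)
  have sub: "cj g h \<in> G" if g: "g \<in> Gs" and h: "h \<in> G" for g h
  proof -
    have gc: "g \<in> carrier L" using g by (simp add: Gs_iff)
    have hc: "h \<in> carrier L" "\<sigma> h = h" using h by (auto simp: G_def')
    obtain z where z: "z \<in> ZL" "\<sigma> g = g \<otimes> z" using Gs_E[OF g] .
    have zc: "z \<in> carrier L" using group_centerD(1)[OF z(1)] .
    have "\<sigma> (cj g h) = g \<otimes> (z \<otimes> h) \<otimes> inv (g \<otimes> z)"
      using sig_mult sig_inv[OF gc] gc hc zc z(2) by (simp add: cj_def m_assoc)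
    also have "z \<otimes> h = h \<otimes> z" by (rule group_centerD(2)[OF z(1) hc(1)])
    also have "g \<otimes> (h \<otimes> z) \<otimes> inv (g \<otimes> z) = g \<otimes> h \<otimes> (z \<otimes> inv z) \<otimes> inv g"
      using gc hc zc by (simp only: inv_mult_group m_assoc m_closed inv_closed)
    also have "\<dots> = cj g h" using gc hc zc by (simp add: cj_def)
    finally show ?thesis using gc hc by (simp add: G_def' cj_def)
  qed
  fix g assume g: "g \<in> Gs"
  \<comment> \<open>Applying the inclusion to \<open>inv g\<close> as well upgrades
    \<open>cj g\<close> maps \<open>G\<close> into \<open>G\<close> to equality.\<close>
  then have gc: "g \<in> carrier L" and ig: "inv g \<in> Gs" using subgroup.m_inv_closed[OF Gs_subgroup] by (auto simp: Gs_iff)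
  have "cj g ` G = G"
  proof
    show "cj g ` G \<subseteq> G" using sub[OF g] by blast
    show "G \<subseteq> cj g ` G"
    proof
      fix h assume h: "h \<in> G"
      then have hc: "h \<in> carrier L" using G_carrier by blast
      have "cj g (cj (inv g) h) = h" using gc hc by (simp add: cj_def m_assoc[symmetric]) (simp add: m_assoc)
      then show "h \<in> cj g ` G" using sub[OF ig h] by (metis imageI)
    qed
  qed
  then show "g \<in> normalizer L G" using normalizer_iff gc by simp
next
  fix g assume "g \<in> normalizer L G"
  then have gc: "g \<in> carrier L" and gG: "cj g ` G = G" using normalizer_iff by auto
  have sc: "\<sigma> g \<in> carrier L" using sig_closed[OF gc] .
  have "inv g \<otimes> \<sigma> g \<otimes> h = h \<otimes> (inv g \<otimes> \<sigma> g)" if h: "h \<in> G" for h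
  proof -
    have hc: "h \<in> carrier L" "\<sigma> h = h" using h by (auto simp: G_def')
    have "cj g h \<in> G" using gG h by blast
    then have "\<sigma> (cj g h) = cj g h" by (simp add: G_def')
    then have e: "\<sigma> g \<otimes> h \<otimes> inv (\<sigma> g) = g \<otimes> h \<otimes> inv g"
      using sig_mult sig_inv[OF gc] gc hc by (simp add: cj_def)
    have "inv g \<otimes> \<sigma> g \<otimes> h = inv g \<otimes> (\<sigma> g \<otimes> h \<otimes> inv (\<sigma> g)) \<otimes> \<sigma> g" using gc sc hc by (simp add: m_assoc)
    also have "\<dots> = (inv g \<otimes> g) \<otimes> h \<otimes> (inv g \<otimes> \<sigma> g)" unfolding e using gc sc hc by (simp only: m_assoc m_closed inv_closed)
    finally show ?thesis using gc sc hc by simp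
  qed
  then have "inv g \<otimes> \<sigma> g \<in> centralizer L G" using gc sc by (simp add: centralizer_def)
  then show "g \<in> Gs" using gc cz by (simp add: Gs_iff)
qed

section \<open>Eigenspaces of the differential of \<open>\<sigma>\<close> and connectedness\<close>

definition pp where "pp X = (1/2) *\<^sub>R (X + S X)"
text \<open>With \<open>pp\<close> the real and imaginary parts for the real structure
  \<open>S\<close>: on \<open>E\<close>, multiplication by \<open>imag\<close> interchanges the
  eigenspaces 1 and -1, since \<open>S\<close> is conjugate linear.\<close>

definition qq where "qq X = (1/2) *\<^sub>R (X - S X)"

lemma half_double: "(1/2) *\<^sub>R (v::complex^'n) + (1/2) *\<^sub>R v = v" by (simp add: scaleR_left_distrib[symmetric])

lemma ppqq:
  assumes X: "X \<in> E"
  shows "pp X \<in> E" "qq X \<in> E" "pp X + qq X = X" "S (pp X) = pp X" "S (qq X) = - qq X"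
proof -
  show "pp X \<in> E" "qq X \<in> E" unfolding pp_def qq_def using X S_E by (auto intro!: scale_E add_E diff_E)
  have "pp X + qq X = ((1/2) *\<^sub>R X + (1/2) *\<^sub>R X) + ((1/2) *\<^sub>R S X - (1/2) *\<^sub>R S X)"
    unfolding pp_def qq_def scaleR_right_distrib scaleR_right_diff_distrib by (simp only: add_diff_eq diff_add_eq add_ac)
  then show "pp X + qq X = X" unfolding half_double by simp
  show "S (pp X) = pp X" using S_S[OF X] by (simp add: pp_def S_simps add.commute)
  show "S (qq X) = - qq X" using S_S[OF X] by (simp add: qq_def S_simps scaleR_right_diff_distrib)
qed

lemma pp_unique:
  assumes "A \<in> E" "C \<in> E" "S A = A" "S C = - C" shows "pp (A + C) = A" "qq (A + C) = C"
proof -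
  have "A + C + S (A + C) = A + A" "A + C - S (A + C) = C + C" using assms by (simp_all add: S_simps)
  then show "pp (A + C) = A" "qq (A + C) = C" using half_double[of A] half_double[of C]
    unfolding pp_def qq_def by (simp_all only: scaleR_right_distrib)
qed

lemma imag_S: "A \<in> E \<Longrightarrow> S A = A \<Longrightarrow> S (imag A) = - imag A" "A \<in> E \<Longrightarrow> S A = - A \<Longrightarrow> S (imag A) = imag A"
  using S(2) by (simp_all add: imag_simps)

lemma qq_zz: "X \<in> gs \<longleftrightarrow> X \<in> E \<and> qq X \<in> zz"
proof -
  have 1: "qq X = (-(1/2)) *\<^sub>R (S X - X)" by (simp add: qq_def scaleR_right_diff_distrib)
  have 2: "S X - X = (-2) *\<^sub>R qq X" by (simp add: qq_def scaleR_right_diff_distrib)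
  show ?thesis unfolding gs_def using subspace_scale[OF subspace_zz] 1 2 by (metis (no_types, lifting) mem_Collect_eq)
qed

lemma centralizer_of_G:
  assumes conn: "connected_space T" shows "centralizer L G = ZL"
proof
  show "ZL \<subseteq> centralizer L G" using G_carrier by (auto simp: group_center_def centralizer_def)
  show "centralizer L G \<subseteq> ZL"
  proof
    fix g assume "g \<in> centralizer L G"
    then have g: "g \<in> carrier L" "\<And>h. h \<in> G \<Longrightarrow> g \<otimes> h = h \<otimes> g" by (auto simp: centralizer_def)
    have 1: "Ad L g A = A" if A: "A \<in> E" "S A = A" for A
    proof (rule Ad_of_commute[OF g(1) A(1)], rule g(2))
      fix t show "gexp (t *\<^sub>R A) \<in> G" using sig_gexp[OF A(1)] A(2) gexp_closed[OF scale_E[OF A(1)]] by (simp add: G_def')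
    qed
    have 2: "Ad L g C = C" if C: "C \<in> E" "S C = - C" for C
    proof -
      have "imag (Ad L g C) = imag C" using 1[OF imag_E[OF C(1)] imag_S(2)[OF C]] Ad_imag[OF g(1) C(1)] by simp
      then have "imag (imag (Ad L g C)) = imag (imag C)" by simp
      then show ?thesis by (simp add: imag_simps)
    qed
    have Adg: "Ad L g X = X" if X: "X \<in> E" for X
      using Ad_linear(1)[OF g(1) ppqq(1,2)[OF X]] 1[OF ppqq(1,4)[OF X]] 2[OF ppqq(2,5)[OF X]] ppqq(3)[OF X] by simp
    have sg: "{g} \<subseteq> carrier L" using g(1) by simp
    \<comment> \<open>Triviality of \<open>Ad g\<close> puts all exponentials into this closed
      subgroup, and connectedness then makes it the whole group.\<close>
    have "centralizer L {g} = carrier L"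
    proof (rule connected_closed_subgroup[OF subgroup_centralizer[OF sg] closedin_centralizer[OF sg] _ conn])
      show "gexp X \<in> centralizer L {g}" if "X \<in> E" for X
        using gexp_commute_Ad[OF g(1) that Adg[OF that], of 1] gexp_closed[OF that] by (simp add: centralizer_def)
    qed
    then have "h \<otimes> g = g \<otimes> h" if "h \<in> carrier L" for h using that unfolding centralizer_def by blast
    then show "g \<in> ZL" using g(1) by (simp add: group_center_def centralizer_def)
  qed
qed

text \<open>If all brackets with \<open>Y\<close> vanish, the ray of \<open>Y\<close> acts trivially
  through \<open>Ad\<close> and commutes with all exponentials; by connectedness it is central. This
  is the step from the centre of the Lie algebra to the Lie algebra of the group centre.\<close>

lemma lie_center_connected:
  assumes conn: "connected_space T" shows "lie_center (lie_alg_of L (carrier L)) = zz"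
proof -
  have "lie_center (lie_alg_of L (carrier L)) = {x \<in> E. \<forall>y\<in>E. br x y = 0}"
    by (simp add: lie_center_def lspace_L Lie_carrier)
  also have "\<dots> = zz"
  proof (intro equalityI subsetI)
    fix Y assume "Y \<in> {x \<in> E. \<forall>y\<in>E. br x y = 0}"
    then have Y: "Y \<in> E" "\<And>X. X \<in> E \<Longrightarrow> br Y X = 0" by auto
    have AX: "Ad L (gexp (t *\<^sub>R Y)) X = X" if "X \<in> E" for t X by (rule Ad_gexp_fixed[OF Y(1) that Y(2)[OF that]])
    have "gexp (t *\<^sub>R Y) \<in> ZL" for t
    proof -
      let ?g = "gexp (t *\<^sub>R Y)"
      have g: "?g \<in> carrier L" using gexp_closed[OF scale_E[OF Y(1)]] .
      then have sg: "{?g} \<subseteq> carrier L" by simp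
      have "centralizer L {?g} = carrier L"
      proof (rule connected_closed_subgroup[OF subgroup_centralizer[OF sg] closedin_centralizer[OF sg] _ conn])
        show "gexp X \<in> centralizer L {?g}" if "X \<in> E" for X
          using gexp_commute_Ad[OF g that AX[OF that], of 1] gexp_closed[OF that] by (simp add: centralizer_def)
      qed
      then have "h \<otimes> ?g = ?g \<otimes> h" if "h \<in> carrier L" for h using that unfolding centralizer_def by blast
      then show ?thesis using g by (simp add: group_center_def centralizer_def)
    qed
    then have "Y \<in> Lie L ZL" unfolding Lie_closed_subgroup[OF group_center_subgroup group_center_closed] using Y(1) by blast
    then show "Y \<in> zz" using Lie_center by simp
  next
    fix Y assume "Y \<in> zz"
    then show "Y \<in> {x \<in> E. \<forall>y\<in>E. br x y = 0}" using br_zz(1) zz_E by blast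
  qed
  finally show ?thesis .
qed

section \<open>The isomorphism of complex Lie algebras\<close>

lemma pp_linear: "pp (x + y) = pp x + pp y" "pp (c *\<^sub>R x) = c *\<^sub>R pp x" "pp (- x) = - pp x" "pp (x - y) = pp x - pp y"
  and qq_linear: "qq (x + y) = qq x + qq y" "qq (c *\<^sub>R x) = c *\<^sub>R qq x" "qq (- x) = - qq x" "qq (x - y) = qq x - qq y"
  by (simp_all add: pp_def qq_def S_simps algebra_simps)

text \<open>For elements of \<open>gs\<close> the parts \<open>qq x\<close> and \<open>qq y\<close>
  are central, so the bracket is that of the real parts and is itself real.\<close>

lemma pq_br: assumes x: "x \<in> gs" and y: "y \<in> gs" shows "pp (br x y) = br (pp x) (pp y)" "qq (br x y) = 0"
proof -
  have xE: "x \<in> E" "y \<in> E" using x y gs_E by auto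
  have z: "qq x \<in> zz" "qq y \<in> zz" using x y qq_zz by auto
  have "br x y = br (pp x + qq x) (pp y + qq y)" using ppqq(3) xE by simp
  also have "\<dots> = br (pp x) (pp y)" by (rule br_mod_zz[OF ppqq(1)[OF xE(1)] ppqq(1)[OF xE(2)] z])
  finally have e: "br x y = br (pp x) (pp y) + 0" by simp
  have bE: "br (pp x) (pp y) \<in> E" using br_props(1) ppqq(1) xE by blast
  have "S (br (pp x) (pp y)) = br (pp x) (pp y)" using S_br[OF ppqq(1)[OF xE(1)] ppqq(1)[OF xE(2)]] ppqq(4) xE by simp
  from pp_unique[OF bE subspace_0[OF subE] this] show "pp (br x y) = br (pp x) (pp y)" "qq (br x y) = 0"
    unfolding e by (simp_all add: S_simps)
qed

text \<open>By \<open>qq_zz\<close>, \<open>gs\<close> is the sum of the fixed space of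
  \<open>S\<close> and the -1 eigenspace inside \<open>zz\<close>. The complexification of the first
  summand is \<open>E\<close>; that of the second is \<open>zz\<close>, which is stable under
  \<open>S\<close> and \<open>imag\<close>. Brackets in the second component are 0 on both
  sides.\<close>

lemma real_form_Gs:
  "real_form_lie_alg (lie_alg_of L Gs) (clie_dsum (clie_alg_of L (carrier L)) (clie_alg_of L ZL))"
proof -
  have lsp: "lspace (lie_alg_of L Gs) = gs" by (simp add: lie_alg_of_def Lie_Gs)
  have sub: "gs \<subseteq> E" using gs_E by blast
  note red = tau_stable_subalgebra_reductive[OF gs_subspace sub gs_br gs_tau lsp lspace_L(2)]
  let ?C = "complexification (lie_alg_of L Gs)" and ?D = "clie_dsum (clie_alg_of L (carrier L)) (clie_alg_of L ZL)"
  define f where "f p = (pp (fst p) + imag (pp (snd p)), qq (fst p) + imag (qq (snd p)))" for p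
  have C: "lspace ?C = gs \<times> gs" "limul ?C p = (- snd p, fst p)"
    "lbracket ?C p r = (br (fst p) (fst r) - br (snd p) (snd r), br (fst p) (snd r) + br (snd p) (fst r))" for p r
    by (simp_all add: complexification_def lsp lspace_L(2) case_prod_beta)
  have D: "lspace ?D = E \<times> zz" "limul ?D p = (imag (fst p), imag (snd p))"
    "lbracket ?D p r = (br (fst p) (fst r), br (snd p) (snd r))" for p r
    by (simp_all add: clie_dsum_def clie_alg_of_def Lie_carrier Lie_center case_prod_beta map_prod_def)
  have zzadd: "a + b \<in> zz" if "a \<in> zz" "b \<in> zz" for a b using subspace_add[OF subspace_zz that] .
  have fin: "f p \<in> E \<times> zz" if "p \<in> gs \<times> gs" for p
  proof -
    have g: "fst p \<in> gs" "snd p \<in> gs" using that by auto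
    then have e: "fst p \<in> E" "snd p \<in> E" "qq (fst p) \<in> zz" "qq (snd p) \<in> zz" using qq_zz by auto
    show ?thesis unfolding f_def using ppqq(1) e imag_E imag_zz add_E zzadd by simp
  qed
  \<comment> \<open>As \<open>imag\<close> exchanges the eigenspaces of \<open>S\<close>, the two
    terms in each component of \<open>f\<close> lie in different eigenspaces and can be read off
    again; this gives injectivity.\<close>
  have decomp: "pp (pp a + imag (pp b)) = pp a" "qq (pp a + imag (pp b)) = imag (pp b)"
    "pp (qq a + imag (qq b)) = imag (qq b)" "qq (qq a + imag (qq b)) = qq a" if "a \<in> E" "b \<in> E" for a b
    using pp_unique[OF ppqq(1)[OF that(1)] imag_E[OF ppqq(1)[OF that(2)]] ppqq(4)[OF that(1)] imag_S(1)[OF ppqq(1)[OF that(2)] ppqq(4)[OF that(2)]]]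
      pp_unique[OF imag_E[OF ppqq(2)[OF that(2)]] ppqq(2)[OF that(1)] imag_S(2)[OF ppqq(2)[OF that(2)] ppqq(5)[OF that(2)]] ppqq(5)[OF that(1)]]
    by (simp_all add: add.commute)
  have imag_inj: "imag v = imag w \<Longrightarrow> v = w" for v w :: "complex ^ 'n"
  proof -
    assume "imag v = imag w"
    then have "imag (imag v) = imag (imag w)" by simp
    then show "v = w" by (simp add: imag_simps)
  qed
  have bij: "bij_betw f (gs \<times> gs) (E \<times> zz)"
  proof (rule bij_betwI')
    fix p r assume p: "p \<in> gs \<times> gs" and r: "r \<in> gs \<times> gs"
    have e: "fst p \<in> E" "snd p \<in> E" "fst r \<in> E" "snd r \<in> E" using p r gs_E by auto
    show "(f p = f r) = (p = r)"
    proof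
      assume fe: "f p = f r"
      then have a: "pp (fst p) + imag (pp (snd p)) = pp (fst r) + imag (pp (snd r))"
        and b: "qq (fst p) + imag (qq (snd p)) = qq (fst r) + imag (qq (snd r))" by (simp_all add: f_def)
      have "pp (fst p) = pp (fst r)" "imag (pp (snd p)) = imag (pp (snd r))"
        using decomp(1,2)[OF e(1,2)] decomp(1,2)[OF e(3,4)] a by simp_all
      moreover have "qq (fst p) = qq (fst r)" "imag (qq (snd p)) = imag (qq (snd r))"
        using decomp(3,4)[OF e(1,2)] decomp(3,4)[OF e(3,4)] b by simp_all
      ultimately have "fst p = fst r" "snd p = snd r" using ppqq(3)[OF e(1)] ppqq(3)[OF e(2)] ppqq(3)[OF e(3)] ppqq(3)[OF e(4)] imag_inj by metis+
      then show "p = r" by (simp add: prod_eq_iff)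
    qed simp
  next
    fix p assume "p \<in> gs \<times> gs" then show "f p \<in> E \<times> zz" by (rule fin)
  next
    fix y assume y: "y \<in> E \<times> zz"
    define e c where "e = fst y" and "c = snd y"
    have e: "e \<in> E" and c: "c \<in> zz" "c \<in> E" using y zz_E by (auto simp: e_def c_def)
    have "S c - c \<in> zz" using subspace_diff[OF subspace_zz S_zz[OF c(1)] c(1)] .
    then have "c \<in> gs" unfolding gs_def using c(2) by simp
    then have qc: "qq c \<in> zz" by (simp only: qq_zz)
    have pc: "pp c \<in> zz" using subspace_diff[OF subspace_zz c(1) qc] ppqq(3)[OF c(2)] by (metis add_diff_cancel_right')
    \<comment> \<open>The preimage is found one eigenspace at a time: \<open>pp a = pp e\<close>,
      \<open>imag (pp b) = qq e\<close>, \<open>qq a = qq c\<close> and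
      \<open>imag (qq b) = pp c\<close>. The signs in \<open>b\<close> come from
      \<open>imag (imag v) = - v\<close>.\<close>
    define a where "a = pp e + qq c"
    define b where "b = - imag (qq e) + - imag (pp c)"
    have A: "pp a = pp e" "qq a = qq c" "a \<in> E" unfolding a_def
      using pp_unique[OF ppqq(1)[OF e] ppqq(2)[OF c(2)] ppqq(4)[OF e] ppqq(5)[OF c(2)]] ppqq(1)[OF e] ppqq(2)[OF c(2)] add_E by auto
    have s: "S (- imag (qq e)) = - imag (qq e)" "S (- imag (pp c)) = - (- imag (pp c))"
      using imag_S(2)[OF ppqq(2,5)[OF e]] imag_S(1)[OF ppqq(1,4)[OF c(2)]] by (simp_all add: S_simps)
    have m: "- imag (qq e) \<in> E" "- imag (pp c) \<in> E" by (rule minus_E[OF imag_E[OF ppqq(2)[OF e]]], rule minus_E[OF imag_E[OF ppqq(1)[OF c(2)]]])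
    have Bb: "pp b = - imag (qq e)" "qq b = - imag (pp c)" "b \<in> E" unfolding b_def using pp_unique[OF m s] add_E[OF m] by auto
    have "qq b \<in> zz" using Bb(2) imag_zz[OF pc] subspace_scale[OF subspace_zz, of "imag (pp c)" "-1"] by simp
    then have ab: "(a, b) \<in> gs \<times> gs" using A Bb qc qq_zz by simp
    have "f (a, b) = (pp e + qq e, qq c + pp c)" unfolding f_def using A Bb by (simp add: imag_simps)
    also have "\<dots> = y" using ppqq(3)[OF e] ppqq(3)[OF c(2)] by (simp add: e_def c_def add.commute)
    finally show "\<exists>x\<in>gs \<times> gs. y = f x" using ab by metis
  qed
  have "clie_iso f ?C ?D" unfolding clie_iso_def C D
  proof (intro conjI ballI allI bij)
    show "f (x + y) = f x + f y" for x y
      by (simp only: f_def pp_linear qq_linear imag_simps fst_add snd_add add_Pair add.assoc add.left_commute)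
    show "f (c *\<^sub>R x) = c *\<^sub>R f x" for c x
      by (simp only: f_def pp_linear qq_linear imag_simps scaleR_add_right fst_scaleR snd_scaleR scaleR_Pair)
    show "f (- snd x, fst x) = (imag (fst (f x)), imag (snd (f x)))" for x
      by (simp add: f_def pp_linear qq_linear imag_simps)
    fix x y assume x: "x \<in> gs \<times> gs" and y: "y \<in> gs \<times> gs"
    then have g: "fst x \<in> gs" "snd x \<in> gs" "fst y \<in> gs" "snd y \<in> gs" by auto
    then have e: "pp (fst x) \<in> E" "pp (snd x) \<in> E" "pp (fst y) \<in> E" "pp (snd y) \<in> E" using gs_E ppqq(1) by auto
    note i = imag_E[OF e(2)] imag_E[OF e(4)]
    have fz: "snd (f x) \<in> zz" "snd (f y) \<in> zz" using fin[OF x] fin[OF y] by auto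
    have "br (pp (fst x) + imag (pp (snd x))) (pp (fst y) + imag (pp (snd y)))
       = (br (pp (fst x)) (pp (fst y)) + br (pp (fst x)) (imag (pp (snd y)))) + (br (imag (pp (snd x))) (pp (fst y)) + br (imag (pp (snd x))) (imag (pp (snd y))))"
      by (simp only: br_props(2)[OF e(1) i(1) add_E[OF e(3) i(2)]] br_props(3)[OF e(3) i(2) e(1)] br_props(3)[OF e(3) i(2) i(1)])
    also have "\<dots> = br (pp (fst x)) (pp (fst y)) - br (pp (snd x)) (pp (snd y)) + imag (br (pp (fst x)) (pp (snd y)) + br (pp (snd x)) (pp (fst y)))"
      unfolding br_imag(1)[OF e(1) e(4)] br_imag(2)[OF e(2) e(3)] br_imag(2)[OF e(2) i(2)] br_imag(1)[OF e(2) e(4)] by (simp add: imag_simps)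
    finally have 1: "br (fst (f x)) (fst (f y)) = pp (br (fst x) (fst y) - br (snd x) (snd y)) + imag (pp (br (fst x) (snd y) + br (snd x) (fst y)))"
      unfolding f_def using pq_br(1) g by (simp add: pp_linear)
    have 2: "br (snd (f x)) (snd (f y)) = 0" by (rule br_zz(1)[OF fz(1) zz_E[OF fz(2)]])
    show "f (br (fst x) (fst y) - br (snd x) (snd y), br (fst x) (snd y) + br (snd x) (fst y)) = (br (fst (f x)) (fst (f y)), br (snd (f x)) (snd (f y)))"
      unfolding 1 2 unfolding f_def using pq_br(2) g by (simp add: qq_linear imag_simps)
  qed
  then show ?thesis unfolding real_form_lie_alg_def using red(2) by blast
qed

lemma almost_fixed_group:
  "real_reductive L (almost_fixed L \<sigma>) (almost_fixed (L\<lparr>carrier := U\<rparr>) \<sigma>) \<tau> BC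
    \<and> (centralizer L G = group_center L \<longrightarrow> almost_fixed L \<sigma> = normalizer L G)
    \<and> (semisimple_group L \<longrightarrow> centralizer L G = group_center L)
    \<and> (connected_space (mtop (mfd L)) \<longrightarrow>
         real_form_lie_alg (lie_alg_of L (almost_fixed L \<sigma>))
           (clie_dsum (clie_alg_of L (carrier L))
              \<lparr>lspace = lie_center (lie_alg_of L (carrier L)),
               lbracket = lie_bracket L, limul = imag\<rparr>))
    \<and> real_form_lie_alg (lie_alg_of L (almost_fixed L \<sigma>))
         (clie_dsum (clie_alg_of L (carrier L)) (clie_alg_of L (group_center L)))"
proof -
  note rf = real_form_Gs
  show ?thesis unfolding Gs_def[symmetric] Us_def[symmetric]
  proof (intro conjI impI)
    show "real_reductive L Gs Us \<tau> BC" by (rule reductive_Gs)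
    show "Gs = normalizer L G" if "centralizer L G = ZL" by (rule Gs_normalizer[OF that])
    show "real_form_lie_alg (lie_alg_of L Gs) (clie_dsum (clie_alg_of L (carrier L)) (clie_alg_of L ZL))"
      by (rule rf)
    show "centralizer L G = ZL" if "semisimple_group L"
      using that by (intro centralizer_of_G) (simp add: semisimple_group_def)
    show "real_form_lie_alg (lie_alg_of L Gs) (clie_dsum (clie_alg_of L (carrier L))
        \<lparr>lspace = lie_center (lie_alg_of L (carrier L)), lbracket = lie_bracket L, limul = imag\<rparr>)"
      if "connected_space T"
    proof -
      have "\<lparr>lspace = lie_center (lie_alg_of L (carrier L)), lbracket = lie_bracket L, limul = imag\<rparr> = clie_alg_of L ZL"
        unfolding clie_alg_of_def lie_center_connected[OF that] Lie_center ..
      then show ?thesis using rf by (simp only:)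
    qed
  qed
qed

end

theorem corollary3p18:
  fixes L :: "('g, complex ^ 'n) lie_group_data"
    and U G H :: "'g set"
    and \<tau> \<theta> :: "complex ^ 'n \<Rightarrow> complex ^ 'n"
    and BC B :: "complex ^ 'n \<Rightarrow> complex ^ 'n \<Rightarrow> real"
    and \<sigma> :: "'g \<Rightarrow> 'g"
  assumes "complex_reductive L U \<tau> BC"
    and "real_form_group L U \<tau> BC \<sigma> G H \<theta> B"
  defines "G\<^sub>\<sigma> \<equiv> almost_fixed L \<sigma>"
    and "U\<^sub>\<sigma> \<equiv> almost_fixed (L\<lparr>carrier := U\<rparr>) \<sigma>"
  shows "real_reductive L G\<^sub>\<sigma> U\<^sub>\<sigma> \<tau> BC
    \<and> (centralizer L G = group_center L \<longrightarrow> G\<^sub>\<sigma> = normalizer L G)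
    \<and> (semisimple_group L \<longrightarrow> centralizer L G = group_center L)
    \<and> (connected_space (mtop (mfd L)) \<longrightarrow>
         real_form_lie_alg (lie_alg_of L G\<^sub>\<sigma>)
           (clie_dsum (clie_alg_of L (carrier L))
              \<lparr>lspace = lie_center (lie_alg_of L (carrier L)),
               lbracket = lie_bracket L, limul = imag\<rparr>))
    \<and> real_form_lie_alg (lie_alg_of L G\<^sub>\<sigma>)
         (clie_dsum (clie_alg_of L (carrier L)) (clie_alg_of L (group_center L)))"
proof -
  have lg: "lie_group L"
    using assms(1)[unfolded complex_reductive_def complex_lie_group_def, THEN conjunct1, THEN conjunct1] .
  have g: "lie_grp L"
    by (rule lie_grp.intro[OF _ lie_grp_axioms.intro[OF lg]]) (rule lg[unfolded lie_group_def, THEN conjunct1])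
  have r: "complex_red L U \<tau> BC"
    by (rule complex_red.intro[OF g complex_red_axioms.intro[OF assms(1)]])
  have "complex_real_form L U \<tau> BC \<sigma> G H \<theta> B"
    by (rule complex_real_form.intro[OF r complex_real_form_axioms.intro[OF assms(2)]])
  from complex_real_form.almost_fixed_group[OF this] show ?thesis unfolding G\<^sub>\<sigma>_def U\<^sub>\<sigma>_def .
qed

end
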